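(* There exists an absolute constant $C>0$ such that for every $n$, every centered convex body $K\subseteq\mathbb{R}^n$ and every uniform cover $\mathcal{S}=(S_1,\dots,S_m)$ of $[n]$ with weights $(p_1,\dots,p_m)$, $$\tilde{\Lambda}_{\mathcal{S}}(K)\leqslant (CL_K)^n.$$ Furthermore, there exist absolute constants $c,C>0$ such that, for every $n$ and every uniform cover $\mathcal{S}=(S_1,\dots,S_m)$ of $[n]$ with weights $(p_1,\dots,p_m)$, writing $d_j=|S_j|$ for the cardinality of $S_j$, $$\frac{(cL_n)^n}{\prod_{j=1}^mL_{d_j}^{p_jd_j}}\leqslant \tilde{\Lambda}_{\mathcal{S}}(n)\leqslant (CL_n)^n,$$ where $L_d=\max_{K\in\mathcal{K}^d}L_K$ is the maximal isotropic constant in $\mathbb{R}^d$.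
   Context: A convex body in $\mathbb{R}^n$ is a compact convex set with non-empty interior; $\mathcal{K}^n$ is the set of all convex bodies in $\mathbb{R}^n$. $|\cdot|$ applied to convex sets denotes volume (Lebesgue measure) in the corresponding subspace (with $|\{0\}|=1$ in dimension $0$). $K$ is centered if its barycentre $\frac{1}{|K|}\int_K x\,dx$ equals $0$; $\mathcal{K}_c^n$ is the set of centered convex bodies in $\mathbb{R}^n$. Uniform cover: let $[n]=\{1,\dots,n\}$ and $m\geqslant 1$. $\mathcal{S}=(S_1,\dots,S_m)$ is a uniform cover of $[n]$ with (nonnegative real) weights $(p_1,\dots,p_m)$ if $S_j\subseteq[n]$ for every $1\leqslant j\leqslant m$ and $\sum_{j=1}^m p_j\chi_{S_j}(i)=1$ for every $1\leqslant i\leqslant n$, where $\chi_{S_j}$ is the indicator function of $S_j$. Put $p=\sum_{j=1}^m p_j$. For a basis $\{w_i\}_{i=1}^n$ of $\mathbb{R}^n$ let $H_j=\mathrm{span}\{w_k : k\in S_j\}$, so $d_j=\dim H_j=|S_j|$. (If $d_j=0$ the factor $L_{d_j}^{p_jd_j}$ is read as $1$.) For a centered convex body $K\subseteq\mathbb{R}^n$, $$\tilde{\Lambda}_{\mathcal{S}}(K)=\min\frac{|K|^{p-1}}{\prod_{j=1}^m|K\cap H_j^\perp|^{p_j}},$$ where the minimum is taken over all orthogonal bases $\{w_i\}_{i=1}^n$ of $\mathbb{R}^n$, and $\tilde{\Lambda}_{\mathcal{S}}(n)=\sup_{K\in\mathcal{K}_c^n}\tilde{\Lambda}_{\mathcal{S}}(K)$.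 Isotropic constant: a convex body $K\subseteq\mathbb{R}^n$ is isotropic if $|K|=1$, $K$ is centered, and there is a constant $L_K>0$ such that $\int_K\langle x,\theta\rangle^2dx=L_K^2$ for every $\theta\in S^{n-1}$. Every convex body $K$ has an isotropic image $a+TK$ with $a\in\mathbb{R}^n$, $T\in GL(n)$ (with $T$ unique up to orthogonal transformations), and the isotropic constant $L_K$ of $K$ is defined as the isotropic constant of any of its isotropic images. "Absolute constant" means a constant independent of all parameters (the dimension, the body and the cover). *)

theory Defs
  imports "HOL-Analysis.Analysis"
begin

text \<open>
  The dimension is quantified inside the statement, so the space of dimension \<open>n\<close> is the
  carrier \<open>Rn n\<close> of extensional functions on \<open>{..<n}\<close>.  It is both the
  topspace of \<open>powertop_real {..<n}\<close> and the space of the product Lebesgue measure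
  \<open>leb n\<close>.  The index set \<open>{1, \<dots>, n}\<close> is rendered as \<open>{..<n}\<close>.
\<close>

definition Rn :: "nat \<Rightarrow> (nat \<Rightarrow> real) set"
  where "Rn n = {..<n} \<rightarrow>\<^sub>E UNIV"

definition leb :: "nat \<Rightarrow> (nat \<Rightarrow> real) measure"
  where "leb n = Pi\<^sub>M {..<n} (\<lambda>_. lborel)"

definition vol :: "nat \<Rightarrow> (nat \<Rightarrow> real) set \<Rightarrow> real"
  where "vol n A = measure (leb n) A"

definition dot :: "nat \<Rightarrow> (nat \<Rightarrow> real) \<Rightarrow> (nat \<Rightarrow> real) \<Rightarrow> real"
  where "dot n x y = (\<Sum>i<n. x i * y i)"

definition lincomb :: "nat \<Rightarrow> nat set \<Rightarrow> (nat \<Rightarrow> nat \<Rightarrow> real) \<Rightarrow> (nat \<Rightarrow> real) \<Rightarrow> (nat \<Rightarrow> real)"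
  where "lincomb n S w c = (\<lambda>i\<in>{..<n}. \<Sum>k\<in>S. c k * w k i)"

text \<open>Here \<open>w k\<close> is the \<open>k\<close>-th vector of the family \<open>w\<close>; the index set \<open>S\<close> is always finite.\<close>

definition lin_span :: "nat \<Rightarrow> nat set \<Rightarrow> (nat \<Rightarrow> nat \<Rightarrow> real) \<Rightarrow> (nat \<Rightarrow> real) set"
  where "lin_span n S w = range (lincomb n S w)"

definition basis :: "nat \<Rightarrow> (nat \<Rightarrow> nat \<Rightarrow> real) \<Rightarrow> bool"
  where "basis n w \<longleftrightarrow>
    (\<forall>k<n. w k \<in> Rn n) \<and>
    lin_span n {..<n} w = Rn n \<and>
    (\<forall>c. lincomb n {..<n} w c = (\<lambda>i\<in>{..<n}. 0) \<longrightarrow> (\<forall>k<n. c k = 0))"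

definition orthogonal_basis :: "nat \<Rightarrow> (nat \<Rightarrow> nat \<Rightarrow> real) \<Rightarrow> bool"
  where "orthogonal_basis n w \<longleftrightarrow>
    basis n w \<and> (\<forall>j<n. \<forall>k<n. j \<noteq> k \<longrightarrow> dot n (w j) (w k) = 0)"

definition orth_compl :: "nat \<Rightarrow> (nat \<Rightarrow> real) set \<Rightarrow> (nat \<Rightarrow> real) set"
  where "orth_compl n H = {x \<in> Rn n. \<forall>y\<in>H. dot n x y = 0}"

definition orthonormal_basis_of ::
    "nat \<Rightarrow> (nat \<Rightarrow> real) set \<Rightarrow> nat \<Rightarrow> (nat \<Rightarrow> nat \<Rightarrow> real) \<Rightarrow> bool"
  where "orthonormal_basis_of n E k u \<longleftrightarrow>
    (\<forall>j<k. u j \<in> Rn n) \<and>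
    (\<forall>i<k. \<forall>j<k. dot n (u i) (u j) = (if i = j then 1 else 0)) \<and>
    lin_span n {..<k} u = E"

text \<open>
  Volume of \<open>A\<close> in the linear subspace \<open>E\<close>: the Lebesgue measure of \<open>A\<close> in the coordinates of an
  orthonormal basis of \<open>E\<close>.  The value does not depend on the basis (orthogonal invariance of
  Lebesgue measure), whence the definite description.  For \<open>E = {0}\<close> the measure
  \<open>leb 0\<close> is a point mass, so \<open>{0}\<close> has volume 1.
\<close>

definition subspace_vol :: "nat \<Rightarrow> (nat \<Rightarrow> real) set \<Rightarrow> (nat \<Rightarrow> real) set \<Rightarrow> real"
  where "subspace_vol n E A =
    (THE v. \<exists>k u. orthonormal_basis_of n E k u \<and>
                  v = vol k {y \<in> Rn k. lincomb n {..<k} u y \<in> A})"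

definition convex_body :: "nat \<Rightarrow> (nat \<Rightarrow> real) set \<Rightarrow> bool"
  where "convex_body n K \<longleftrightarrow>
    compactin (powertop_real {..<n}) K \<and>
    (\<forall>x\<in>K. \<forall>y\<in>K. \<forall>t\<in>{0..1}. (\<lambda>i\<in>{..<n}. (1 - t) * x i + t * y i) \<in> K) \<and>
    powertop_real {..<n} interior_of K \<noteq> {}"

definition barycentre :: "nat \<Rightarrow> (nat \<Rightarrow> real) set \<Rightarrow> (nat \<Rightarrow> real)"
  where "barycentre n K = (\<lambda>i\<in>{..<n}. 1 / vol n K * (LINT x:K|leb n. x i))"

definition centered :: "nat \<Rightarrow> (nat \<Rightarrow> real) set \<Rightarrow> bool"
  where "centered n K \<longleftrightarrow> barycentre n K = (\<lambda>i\<in>{..<n}. 0)"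

definition isotropic_with :: "nat \<Rightarrow> (nat \<Rightarrow> real) set \<Rightarrow> real \<Rightarrow> bool"
  where "isotropic_with n K L \<longleftrightarrow>
    convex_body n K \<and> vol n K = 1 \<and> centered n K \<and> L > 0 \<and>
    (\<forall>\<theta>\<in>Rn n. dot n \<theta> \<theta> = 1 \<longrightarrow> (LINT x:K|leb n. (dot n x \<theta>)\<^sup>2) = L\<^sup>2)"

text \<open>Linear maps are given by their matrices.\<close>

definition GL :: "nat \<Rightarrow> (nat \<Rightarrow> nat \<Rightarrow> real) \<Rightarrow> bool"
  where "GL n T \<longleftrightarrow> (\<exists>R. \<forall>i<n. \<forall>k<n.
    (\<Sum>j<n. T i j * R j k) = (if i = k then 1 else 0) \<and>
    (\<Sum>j<n. R i j * T j k) = (if i = k then 1 else 0))"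

definition affine_image ::
    "nat \<Rightarrow> (nat \<Rightarrow> real) \<Rightarrow> (nat \<Rightarrow> nat \<Rightarrow> real) \<Rightarrow> (nat \<Rightarrow> real) set \<Rightarrow> (nat \<Rightarrow> real) set"
  where "affine_image n a T K = (\<lambda>x. \<lambda>i\<in>{..<n}. a i + (\<Sum>j<n. T i j * x j)) ` K"

definition isotropic_constant :: "nat \<Rightarrow> (nat \<Rightarrow> real) set \<Rightarrow> real"
  where "isotropic_constant n K =
    (THE L. \<exists>a\<in>Rn n. \<exists>T. GL n T \<and> isotropic_with n (affine_image n a T K) L)"

text \<open>The maximum of the isotropic constants in dimension \<open>d\<close>, written as a supremum.\<close>

definition max_isotropic_constant :: "nat \<Rightarrow> real"
  where "max_isotropic_constant d = (SUP K\<in>{K. convex_body d K}. isotropic_constant d K)"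

definition uniform_cover ::
    "nat \<Rightarrow> nat \<Rightarrow> (nat \<Rightarrow> nat set) \<Rightarrow> (nat \<Rightarrow> real) \<Rightarrow> bool"
  where "uniform_cover n m S p \<longleftrightarrow>
    m \<ge> 1 \<and> (\<forall>j<m. S j \<subseteq> {..<n}) \<and> (\<forall>j<m. 0 \<le> p j) \<and>
    (\<forall>i<n. (\<Sum>j<m. p j * indicator (S j) i) = 1)"

text \<open>The minimum over all orthogonal bases, written as an infimum (the set of values is
  bounded below by 0).\<close>

definition Lambda_body ::
    "nat \<Rightarrow> nat \<Rightarrow> (nat \<Rightarrow> nat set) \<Rightarrow> (nat \<Rightarrow> real) \<Rightarrow> (nat \<Rightarrow> real) set \<Rightarrow> real"
  where "Lambda_body n m S p K =
    (INF w\<in>{w. orthogonal_basis n w}.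
       vol n K powr ((\<Sum>j<m. p j) - 1) /
       (\<Prod>j<m. let E = orth_compl n (lin_span n (S j) w)
               in subspace_vol n E (K \<inter> E) powr p j))"

text \<open>Extended-real-valued, so that an upper bound on it includes the finiteness of the supremum.\<close>

definition Lambda_dim ::
    "nat \<Rightarrow> nat \<Rightarrow> (nat \<Rightarrow> nat set) \<Rightarrow> (nat \<Rightarrow> real) \<Rightarrow> ereal"
  where "Lambda_dim n m S p =
    (SUP K\<in>{K. convex_body n K \<and> centered n K}. ereal (Lambda_body n m S p K))"

text \<open>The factor \<open>L_d\<close> to the power \<open>q d\<close>, read as 1 when \<open>d = 0\<close>.\<close>

definition L_factor :: "nat \<Rightarrow> real \<Rightarrow> real"
  where "L_factor d q = (if d = 0 then 1 else max_isotropic_constant d powr (q * real d))"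

end

theory Submission
  imports Defs "HOL-Probability.Distributions"
begin

text \<open>
  After a rotation, \<open>|K \<inter> H\<^sup>\<bottom>|\<close> with \<open>dim H = d\<close> is the value at the origin of the log-concave function
  \<open>f(y) = |{z. (y, z) \<in> K}|\<close> on a \<open>d\<close>-dimensional space, and \<open>f\<close> has barycentre \<open>0\<close>.

  From below: Jensen's inequality for \<open>ln f\<close> together with Gibbs' inequality against a product of double
  exponentials gives \<open>f(0) \<ge> |K| \<Prod> 1 / (2 e s_k)\<close>, where \<open>s_k\<^sup>2\<close> are the normalised second moments of \<open>K\<close>.
  Taking for \<open>w\<close> the principal axes of \<open>K\<close> and multiplying over the cover, the product of all \<open>s_k\<close> is
  \<open>L_K^n |K|\<close>, whence both upper bounds.

  From above, for isotropic \<open>K\<close>: Ball's body \<open>T\<close> of \<open>f\<close> with exponent \<open>d + 2\<close> is convex, has second moments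
  \<open>L_K\<^sup>2 / f(0)\<close> in every direction and volume at most \<open>e\<^sup>2 / f(0)\<close>.  It need not be centered, but recentring
  changes the second moment in one direction only, and there by a factor at most \<open>4 2^d\<close>.  Hence
  \<open>f(0) \<le> (C L_d / L_K)^d\<close>, and multiplying over the cover gives the lower bound.
\<close>

section \<open>Product Lebesgue measure\<close>

text \<open>The dimension varies inside the statement, so space is the set \<open>Rn n\<close> and
  not a type. A linear map scales \<open>leb n\<close> by some positive constant, found by Fubini;
  its value is computed only for triangular maps, dilations and rotations. Fubini and dilations also
  replace polar coordinates. The exponent \<open>d + 2\<close> is what makes the second moments of T
  exact: a superlevel set of the integral of r^(d+1) f(rx) over r turns integrals against f of
  functions homogeneous of degree 2 into integrals over T. Exponent d + 1 would do this for degree 1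
  and give a centered body, but its second moments would match those of f only up to constants. With
  exact moments the second moments of T about its barycentre are a multiple of the identity minus a
  rank-one form, which is why recentring disturbs one direction only. The loss 4 * 2^d then occurs
  once and is absorbed into C^d. The real supremum L_d bounds its members only if they are bounded.
  An exponential bound in d serves for this, as it does not enter the final constants.\<close>

interpretation lb: product_sigma_finite "\<lambda>_::nat. lborel :: real measure"
  by standard

lemma space_leb [simp]: "space (leb n) = Rn n"
  by (simp add: leb_def space_PiM Rn_def)

lemma sets_leb [measurable_cong]: "sets (leb n) = sets (Pi\<^sub>M {..<n} (\<lambda>_. borel))"
  unfolding leb_def by (rule sets_PiM_cong) auto

lemma sigma_finite_leb: "sigma_finite_measure (leb n)"
  unfolding leb_def by (rule lb.sigma_finite) auto

interpretation leb: sigma_finite_measure "leb n" for n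
  by (rule sigma_finite_leb)

interpretation leb2: pair_sigma_finite "leb m" "leb n" for m n
  by standard

interpretation leb_lborel: pair_sigma_finite "leb m" "lborel :: real measure" for m
  by standard

lemma Rn_eqI: "x \<in> Rn n \<Longrightarrow> y \<in> Rn n \<Longrightarrow> (\<And>i. i < n \<Longrightarrow> x i = y i) \<Longrightarrow> x = y"
  unfolding Rn_def by (rule PiE_ext) auto

lemma restrict_in_Rn [simp]: "(\<lambda>i\<in>{..<n}. f i) \<in> Rn n"
  by (simp add: Rn_def)

lemma Rn_upd [simp]: "x \<in> Rn n \<Longrightarrow> k < n \<Longrightarrow> x(k := s) \<in> Rn n"
  by (auto simp: Rn_def PiE_def extensional_def)

lemma Rn_upd_Suc [simp]: "x \<in> Rn n \<Longrightarrow> x(n := s) \<in> Rn (Suc n)"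
  by (auto simp: Rn_def PiE_def extensional_def)

lemma Rn_restrict_id: "x \<in> Rn n \<Longrightarrow> (\<lambda>i\<in>{..<n}. x i) = x"
  by (rule Rn_eqI) auto

lemma measurable_leb_component [measurable]:
  "i < n \<Longrightarrow> (\<lambda>x. x i) \<in> borel_measurable (leb n)"
  unfolding measurable_cong_sets[OF sets_leb refl] by measurable

lemma measurable_lebI:
  assumes "\<And>i. i < n \<Longrightarrow> (\<lambda>\<omega>. f \<omega> i) \<in> borel_measurable M"
    and "\<And>\<omega>. \<omega> \<in> space M \<Longrightarrow> f \<omega> \<in> Rn n"
  shows "f \<in> M \<rightarrow>\<^sub>M leb n"
  unfolding measurable_cong_sets[OF refl sets_leb]
  by (rule measurable_PiM_single') (use assms in \<open>auto simp: Rn_def\<close>)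

lemma measurable_leb_dest:
  assumes "f \<in> M \<rightarrow>\<^sub>M leb n" "i < n"
  shows "(\<lambda>\<omega>. f \<omega> i) \<in> borel_measurable M"
  using measurable_compose[OF assms(1) measurable_leb_component[OF assms(2)]] .

lemma measurable_leb_upd:
  assumes "k < n" "h \<in> borel_measurable M" "g \<in> M \<rightarrow>\<^sub>M leb n"
  shows "(\<lambda>x. (g x)(k := h x)) \<in> M \<rightarrow>\<^sub>M leb n"
proof (rule measurable_lebI)
  fix i assume "i < n"
  then show "(\<lambda>x. ((g x)(k := h x)) i) \<in> borel_measurable M"
    by (cases "i = k") (use assms measurable_leb_dest in auto)
next
  fix \<omega> assume "\<omega> \<in> space M"
  then have "g \<omega> \<in> Rn n" using measurable_space[OF assms(3)] by simp
  then show "(g \<omega>)(k := h \<omega>) \<in> Rn n" using assms(1) by (rule Rn_upd)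
qed

lemma nn_integral_leb_split:
  assumes "k < n" "f \<in> borel_measurable (leb n)"
  shows "(\<integral>\<^sup>+x. f x \<partial>leb n) =
    (\<integral>\<^sup>+x. \<integral>\<^sup>+y. f (x(k := y)) \<partial>lborel \<partial>Pi\<^sub>M ({..<n} - {k}) (\<lambda>_. lborel))"
proof -
  have ins: "insert k ({..<n} - {k}) = {..<n}" using assms(1) by blast
  have "f \<in> borel_measurable (Pi\<^sub>M (insert k ({..<n} - {k})) (\<lambda>_. lborel))"
    unfolding ins using assms(2) by (simp only: leb_def)
  from lb.product_nn_integral_insert[OF _ _ this] show ?thesis
    by (simp only: ins leb_def) simp
qed

text \<open>Fubini isolates coordinate \<open>k\<close>. As \<open>\<beta>\<close> does not see that
  coordinate, the inner integral undergoes a one-dimensional affine substitution.\<close>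

lemma nn_integral_leb_upd:
  assumes k: "k < n" and \<alpha>: "\<alpha> \<noteq> 0"
    and [measurable]: "f \<in> borel_measurable (leb n)" "\<beta> \<in> borel_measurable (leb n)"
    and \<beta>: "\<And>x s. x \<in> Rn n \<Longrightarrow> \<beta> (x(k := s)) = \<beta> x"
  shows "(\<integral>\<^sup>+x. f (x(k := \<alpha> * x k + \<beta> x)) \<partial>leb n) = ennreal (1 / \<bar>\<alpha>\<bar>) * (\<integral>\<^sup>+x. f x \<partial>leb n)"
proof -
  let ?I = "{..<n} - {k}"
  have upd [measurable]: "(\<lambda>x. x(k := \<alpha> * x k + \<beta> x)) \<in> leb n \<rightarrow>\<^sub>M leb n"
    by (rule measurable_leb_upd) (use k in auto)
  have "(\<integral>\<^sup>+x. f (x(k := \<alpha> * x k + \<beta> x)) \<partial>leb n) =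
      (\<integral>\<^sup>+x. \<integral>\<^sup>+y. f (x(k := \<alpha> * y + \<beta> (x(k := y)))) \<partial>lborel \<partial>Pi\<^sub>M ?I (\<lambda>_. lborel))"
    using nn_integral_leb_split[OF k, of "\<lambda>x. f (x(k := \<alpha> * x k + \<beta> x))"] by simp
  also have "\<dots> = (\<integral>\<^sup>+x. ennreal (1 / \<bar>\<alpha>\<bar>) * \<integral>\<^sup>+y. f (x(k := y)) \<partial>lborel \<partial>Pi\<^sub>M ?I (\<lambda>_. lborel))"
  proof (rule nn_integral_cong)
    fix x :: "nat \<Rightarrow> real" assume "x \<in> space (Pi\<^sub>M ?I (\<lambda>_. lborel))"
    then have x: "x(k := y) \<in> Rn n" for y
      using k by (auto simp: Rn_def space_PiM PiE_def extensional_def)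
    define b where "b = \<beta> (x(k := 0))"
    have b: "\<beta> (x(k := y)) = b" for y
      using \<beta>[OF x, of 0 y] by (simp add: b_def)
    have [measurable]: "(\<lambda>y. f (x(k := y))) \<in> borel_measurable borel"
    proof (rule measurable_compose[of _ borel "leb n"])
      show "(\<lambda>y. x(k := y)) \<in> borel \<rightarrow>\<^sub>M leb n"
      proof (rule measurable_lebI)
        show "(\<lambda>y. (x(k := y)) i) \<in> borel_measurable borel" for i
          by (cases "i = k") auto
      qed (rule x)
    qed measurable
    have "(\<integral>\<^sup>+y. f (x(k := y)) \<partial>lborel) = \<bar>\<alpha>\<bar> * (\<integral>\<^sup>+y. f (x(k := b + \<alpha> * y)) \<partial>lborel)"
      by (rule nn_integral_real_affine) (use \<alpha> in auto)
    then show "(\<integral>\<^sup>+y. f (x(k := \<alpha> * y + \<beta> (x(k := y)))) \<partial>lborel) =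
        ennreal (1 / \<bar>\<alpha>\<bar>) * \<integral>\<^sup>+y. f (x(k := y)) \<partial>lborel"
      using \<alpha> by (simp add: b add.commute mult.assoc[symmetric] ennreal_mult'[symmetric] del: fun_upd_apply)
  qed
  also have "\<dots> = ennreal (1 / \<bar>\<alpha>\<bar>) * (\<integral>\<^sup>+x. \<integral>\<^sup>+y. f (x(k := y)) \<partial>lborel \<partial>Pi\<^sub>M ?I (\<lambda>_. lborel))"
  proof (rule nn_integral_cmult)
    have "(\<lambda>p. (fst p)(k := snd p)) \<in> Pi\<^sub>M ?I (\<lambda>_. lborel) \<Otimes>\<^sub>M lborel \<rightarrow>\<^sub>M leb n"
      unfolding leb_def by (rule measurable_fun_upd[of _ ?I]) (use k in auto)
    then have [measurable]: "(\<lambda>p. f ((fst p)(k := snd p))) \<in> borel_measurable (Pi\<^sub>M ?I (\<lambda>_. lborel) \<Otimes>\<^sub>M lborel)"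
      by measurable
    show "(\<lambda>x. \<integral>\<^sup>+y. f (x(k := y)) \<partial>lborel) \<in> borel_measurable (Pi\<^sub>M ?I (\<lambda>_. lborel))"
      by (rule lborel.borel_measurable_nn_integral) (simp add: split_beta')
  qed
  also have "(\<integral>\<^sup>+x. \<integral>\<^sup>+y. f (x(k := y)) \<partial>lborel \<partial>Pi\<^sub>M ?I (\<lambda>_. lborel)) = (\<integral>\<^sup>+x. f x \<partial>leb n)"
    by (rule nn_integral_leb_split[symmetric]) (use k in auto)
  finally show ?thesis .
qed

text \<open>The coordinates are replaced one at a time in increasing order. \<open>\<beta> i\<close>
  reads only coordinates above \<open>i\<close>, which still have their old values when coordinate
  \<open>i\<close> is replaced, so each stage is an update of a single coordinate.\<close>

lemma nn_integral_leb_triangular: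
  fixes \<beta> :: "nat \<Rightarrow> (nat \<Rightarrow> real) \<Rightarrow> real"
  assumes f [measurable]: "f \<in> borel_measurable (leb n)"
    and \<alpha>: "\<And>i. i < n \<Longrightarrow> \<alpha> i \<noteq> 0"
    and \<beta>m: "\<And>i. i < n \<Longrightarrow> \<beta> i \<in> borel_measurable (leb n)"
    and \<beta>: "\<And>i x y. i < n \<Longrightarrow> x \<in> Rn n \<Longrightarrow> y \<in> Rn n \<Longrightarrow> (\<And>j. i < j \<Longrightarrow> j < n \<Longrightarrow> x j = y j) \<Longrightarrow> \<beta> i x = \<beta> i y"
  shows "(\<integral>\<^sup>+x. f (\<lambda>i\<in>{..<n}. \<alpha> i * x i + \<beta> i x) \<partial>leb n) =
    ennreal (\<Prod>i<n. 1 / \<bar>\<alpha> i\<bar>) * (\<integral>\<^sup>+x. f x \<partial>leb n)"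
proof -
  define T where "T k x = (\<lambda>i\<in>{..<n}. if i < k then \<alpha> i * x i + \<beta> i x else x i)" for k x
  have "(\<integral>\<^sup>+x. g (T k x) \<partial>leb n) = ennreal (\<Prod>i<k. 1 / \<bar>\<alpha> i\<bar>) * (\<integral>\<^sup>+x. g x \<partial>leb n)"
    if "k \<le> n" "g \<in> borel_measurable (leb n)" for k g
    using that
  proof (induction k arbitrary: g)
    case 0
    have "(\<integral>\<^sup>+x. g (T 0 x) \<partial>leb n) = (\<integral>\<^sup>+x. g x \<partial>leb n)"
      by (rule nn_integral_cong) (simp add: T_def Rn_restrict_id)
    then show ?case by simp
  next
    case (Suc k)
    then have k: "k < n" by simp
    note [measurable] = \<beta>m[OF k] Suc.prems(2)
    define U where "U x = x(k := \<alpha> k * x k + \<beta> k x)" for x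
    have U: "U \<in> leb n \<rightarrow>\<^sub>M leb n"
      unfolding U_def by (rule measurable_leb_upd) (use k in auto)
    have "T (Suc k) x = U (T k x)" if "x \<in> Rn n" for x
    proof -
      have "\<beta> k x = \<beta> k (T k x)"
        by (rule \<beta>[OF k that]) (auto simp: T_def)
      then show ?thesis
        using k by (intro Rn_eqI[of _ n]) (auto simp: T_def U_def less_Suc_eq)
    qed
    then have "(\<integral>\<^sup>+x. g (T (Suc k) x) \<partial>leb n) = (\<integral>\<^sup>+x. g (U (T k x)) \<partial>leb n)"
      by (intro nn_integral_cong) auto
    also have "\<dots> = ennreal (\<Prod>i<k. 1 / \<bar>\<alpha> i\<bar>) * (\<integral>\<^sup>+x. g (U x) \<partial>leb n)"
      using Suc.IH[of "\<lambda>x. g (U x)"] k measurable_compose[OF U Suc.prems(2)] by simp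
    also have "(\<integral>\<^sup>+x. g (U x) \<partial>leb n) = ennreal (1 / \<bar>\<alpha> k\<bar>) * (\<integral>\<^sup>+x. g x \<partial>leb n)"
      unfolding U_def by (rule nn_integral_leb_upd) (use k \<alpha> in \<open>auto intro!: \<beta> simp del: fun_upd_apply, auto\<close>)
    finally show ?case
      by (simp add: mult.assoc[symmetric] ennreal_mult'[symmetric] prod_nonneg)
  qed
  note * = this[OF order_refl f]
  have "T n = (\<lambda>x. \<lambda>i\<in>{..<n}. \<alpha> i * x i + \<beta> i x)"
    by (auto simp: T_def fun_eq_iff)
  with * show ?thesis by (simp only:)
qed

lemma nn_integral_leb_translate:
  assumes "f \<in> borel_measurable (leb n)"
  shows "(\<integral>\<^sup>+x. f (\<lambda>i\<in>{..<n}. x i + a i) \<partial>leb n) = (\<integral>\<^sup>+x. f x \<partial>leb n)"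
proof -
  have "(\<integral>\<^sup>+x. f (\<lambda>i\<in>{..<n}. 1 * x i + a i) \<partial>leb n) = ennreal (\<Prod>i<n. 1 / \<bar>1\<bar>) * (\<integral>\<^sup>+x. f x \<partial>leb n)"
    by (rule nn_integral_leb_triangular[OF assms]) auto
  then show ?thesis by (simp only: mult_1 abs_one div_by_1 prod.neutral_const ennreal_1)
qed

lemma nn_integral_leb_scale:
  assumes "f \<in> borel_measurable (leb n)" "\<And>i. i < n \<Longrightarrow> s i \<noteq> 0"
  shows "(\<integral>\<^sup>+x. f (\<lambda>i\<in>{..<n}. s i * x i) \<partial>leb n) = ennreal (\<Prod>i<n. 1 / \<bar>s i\<bar>) * (\<integral>\<^sup>+x. f x \<partial>leb n)"
proof -
  have "(\<integral>\<^sup>+x. f (\<lambda>i\<in>{..<n}. s i * x i + 0) \<partial>leb n) = ennreal (\<Prod>i<n. 1 / \<bar>s i\<bar>) * (\<integral>\<^sup>+x. f x \<partial>leb n)"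
    by (rule nn_integral_leb_triangular[OF assms(1)]) (use assms(2) in auto)
  then show ?thesis by (simp only: add_0_right)
qed

lemma nn_integral_leb_Suc:
  assumes "f \<in> borel_measurable (leb (Suc n))"
  shows "(\<integral>\<^sup>+x. f x \<partial>leb (Suc n)) = (\<integral>\<^sup>+x. \<integral>\<^sup>+s. f (x(n := s)) \<partial>lborel \<partial>leb n)"
  using assms unfolding leb_def lessThan_Suc by (subst lb.product_nn_integral_insert) auto

lemma measurable_upd_Suc [measurable]:
  "(\<lambda>p. (fst p)(n := snd p)) \<in> leb n \<Otimes>\<^sub>M borel \<rightarrow>\<^sub>M leb (Suc n)"
proof (rule measurable_lebI)
  fix i assume "i < Suc n"
  then consider "i = n" | "i < n" by linarith
  then show "(\<lambda>\<omega>. ((fst \<omega>)(n := snd \<omega>)) i) \<in> borel_measurable (leb n \<Otimes>\<^sub>M borel)"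
    by cases auto
qed (auto simp: space_pair_measure)

section \<open>Concatenated coordinate blocks\<close>

definition app :: "nat \<Rightarrow> nat \<Rightarrow> (nat \<Rightarrow> real) \<Rightarrow> (nat \<Rightarrow> real) \<Rightarrow> (nat \<Rightarrow> real)"
  where "app d e y z = (\<lambda>i\<in>{..<d + e}. if i < d then y i else z (i - d))"

lemma app_in_Rn [simp]: "app d e y z \<in> Rn (d + e)"
  by (simp add: app_def)

lemma measurable_app [measurable]:
  "(\<lambda>p. app d e (fst p) (snd p)) \<in> leb d \<Otimes>\<^sub>M leb e \<rightarrow>\<^sub>M leb (d + e)"
proof (rule measurable_lebI)
  fix i assume "i < d + e"
  then consider "i < d" | "\<not> i < d" "i - d < e" by linarith
  then show "(\<lambda>\<omega>. app d e (fst \<omega>) (snd \<omega>) i) \<in> borel_measurable (leb d \<Otimes>\<^sub>M leb e)"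
  proof cases
    case 1
    then show ?thesis by (simp add: app_def)
  next
    case 2
    have "(\<lambda>\<omega>. snd \<omega> (i - d)) \<in> borel_measurable (leb d \<Otimes>\<^sub>M leb e)"
      using 2 by measurable
    then show ?thesis using 2 \<open>i < d + e\<close> by (simp add: app_def)
  qed
qed auto

lemma measurable_app_right:
  assumes "y \<in> Rn d" shows "app d e y \<in> leb e \<rightarrow>\<^sub>M leb (d + e)"
  using measurable_compose[OF measurable_Pair1' measurable_app, of y d e] assms by simp

text \<open>\<open>Rn 0\<close> is a single point, the everywhere \<open>undefined\<close> function,
  and carries mass 1.\<close>

lemma nn_integral_leb_0: "(\<integral>\<^sup>+x. f x \<partial>leb 0) = f (\<lambda>_. undefined)"
  by (simp add: leb_def PiM_empty nn_integral_count_space_finite)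

lemma nn_integral_leb_app:
  assumes "f \<in> borel_measurable (leb (d + e))"
  shows "(\<integral>\<^sup>+x. f x \<partial>leb (d + e)) = (\<integral>\<^sup>+y. \<integral>\<^sup>+z. f (app d e y z) \<partial>leb e \<partial>leb d)"
  using assms
proof (induction e arbitrary: f)
  case 0
  have "app d 0 y (\<lambda>_. undefined) = y" if "y \<in> Rn d" for y
    by (rule Rn_eqI[of _ d]) (use that in \<open>auto simp: app_def Rn_def\<close>)
  then show ?case
    by (auto simp: nn_integral_leb_0 intro!: nn_integral_cong)
next
  case (Suc e)
  note [measurable] = Suc.prems
  have m [measurable]: "(\<lambda>p. f ((fst p)(d + e := snd p))) \<in> borel_measurable (leb (d + e) \<Otimes>\<^sub>M borel)"
    using measurable_compose[OF measurable_upd_Suc, of f "d + e" borel] Suc.prems by simp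
  have 1: "(\<lambda>x. \<integral>\<^sup>+s. f (x(d + e := s)) \<partial>lborel) \<in> borel_measurable (leb (d + e))"
    by (rule lborel.borel_measurable_nn_integral) (simp add: split_beta')
  have app_upd: "app d (Suc e) y (z(e := s)) = (app d e y z)(d + e := s)" for y z s
    by (auto simp: app_def fun_eq_iff)
  have "(\<integral>\<^sup>+x. f x \<partial>leb (d + Suc e)) = (\<integral>\<^sup>+x. \<integral>\<^sup>+s. f (x(d + e := s)) \<partial>lborel \<partial>leb (d + e))"
    using nn_integral_leb_Suc[of f "d + e"] Suc.prems by simp
  also have "\<dots> = (\<integral>\<^sup>+y. \<integral>\<^sup>+z. \<integral>\<^sup>+s. f ((app d e y z)(d + e := s)) \<partial>lborel \<partial>leb e \<partial>leb d)"
    by (rule Suc.IH[OF 1])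
  also have "\<dots> = (\<integral>\<^sup>+y. \<integral>\<^sup>+z. f (app d (Suc e) y z) \<partial>leb (Suc e) \<partial>leb d)"
  proof (rule nn_integral_cong)
    fix y assume "y \<in> space (leb d)"
    then have "(\<lambda>z. f (app d (Suc e) y z)) \<in> borel_measurable (leb (Suc e))"
      using measurable_compose[OF measurable_app_right Suc.prems] by simp
    then show "(\<integral>\<^sup>+z. \<integral>\<^sup>+s. f ((app d e y z)(d + e := s)) \<partial>lborel \<partial>leb e) =
      (\<integral>\<^sup>+z. f (app d (Suc e) y z) \<partial>leb (Suc e))"
      by (subst nn_integral_leb_Suc) (simp_all add: app_upd)
  qed
  finally show ?case .
qed

lemma emeasure_leb_box:
  assumes "\<And>i. i < n \<Longrightarrow> a i \<le> b i"
  shows "emeasure (leb n) (Pi\<^sub>E {..<n} (\<lambda>i. {a i..b i})) = ennreal (\<Prod>i<n. b i - a i)"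
  unfolding leb_def using assms by (subst lb.emeasure_PiM) (auto intro!: prod_ennreal)

section \<open>Linear changes of variables\<close>

definition lin :: "nat \<Rightarrow> (nat \<Rightarrow> nat \<Rightarrow> real) \<Rightarrow> (nat \<Rightarrow> real) \<Rightarrow> (nat \<Rightarrow> real)"
  where "lin n T x = (\<lambda>i\<in>{..<n}. \<Sum>j<n. T i j * x j)"

text \<open>Inverses are carried as explicit matrices: they give bijectivity and, through their
  entries, bounds on preimages of cubes.\<close>

definition mat_inv :: "nat \<Rightarrow> (nat \<Rightarrow> nat \<Rightarrow> real) \<Rightarrow> (nat \<Rightarrow> nat \<Rightarrow> real) \<Rightarrow> bool"
  where "mat_inv n T R \<longleftrightarrow> (\<forall>i<n. \<forall>k<n.
    (\<Sum>j<n. T i j * R j k) = (if i = k then 1 else 0) \<and>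
    (\<Sum>j<n. R i j * T j k) = (if i = k then 1 else 0))"

definition mmul :: "nat \<Rightarrow> (nat \<Rightarrow> nat \<Rightarrow> real) \<Rightarrow> (nat \<Rightarrow> nat \<Rightarrow> real) \<Rightarrow> (nat \<Rightarrow> nat \<Rightarrow> real)"
  where "mmul n T R i k = (\<Sum>j<n. T i j * R j k)"

lemma GL_iff: "GL n T \<longleftrightarrow> (\<exists>R. mat_inv n T R)"
  by (simp add: GL_def mat_inv_def)

lemma mat_inv_sym: "mat_inv n T R \<Longrightarrow> mat_inv n R T"
  by (simp add: mat_inv_def)

lemma lin_in_Rn [simp]: "lin n T x \<in> Rn n"
  by (simp add: lin_def)

lemma measurable_lin [measurable]: "lin n T \<in> leb n \<rightarrow>\<^sub>M leb n"
  by (rule measurable_lebI) (auto simp: lin_def)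

lemma sum_delta_mult: "i < (n::nat) \<Longrightarrow> (\<Sum>k<n. (if i = k then 1 else 0) * (x k :: real)) = x i"
  by (simp add: if_distrib[of "\<lambda>a. a * _"] sum.delta cong: if_cong)

lemma lin_mmul: "lin n T (lin n R x) = lin n (mmul n T R) x"
proof (rule Rn_eqI[of _ n])
  fix i assume i: "i < n"
  have "(\<Sum>j<n. T i j * (\<Sum>k<n. R j k * x k)) = (\<Sum>k<n. (\<Sum>j<n. T i j * R j k) * x k)"
    by (simp only: sum_distrib_left sum_distrib_right mult.assoc) (rule sum.swap)
  then show "lin n T (lin n R x) i = lin n (mmul n T R) x i"
    using i by (simp add: lin_def mmul_def)
qed auto

lemma lin_cong: "(\<And>i j. i < n \<Longrightarrow> j < n \<Longrightarrow> T i j = R i j) \<Longrightarrow> lin n T x = lin n R x"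
  by (auto simp: lin_def intro!: restrict_ext sum.cong)

lemma lin_id: "x \<in> Rn n \<Longrightarrow> lin n (\<lambda>i k. if i = k then 1 else 0) x = x"
  by (rule Rn_eqI[of _ n]) (simp_all add: lin_def sum_delta_mult)

lemma lin_mat_inv:
  assumes "mat_inv n T R" "x \<in> Rn n"
  shows "lin n T (lin n R x) = x" "lin n R (lin n T x) = x"
proof -
  have "lin n (mmul n T R) x = lin n (\<lambda>i k. if i = k then 1 else 0) x"
    "lin n (mmul n R T) x = lin n (\<lambda>i k. if i = k then 1 else 0) x"
    by (rule lin_cong, use assms(1) in \<open>simp add: mat_inv_def mmul_def\<close>)+
  then show "lin n T (lin n R x) = x" "lin n R (lin n T x) = x"
    using assms(2) by (simp_all add: lin_mmul lin_id)
qed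

lemma lin_add: "lin n T (\<lambda>i\<in>{..<n}. x i + y i) = (\<lambda>i\<in>{..<n}. lin n T x i + lin n T y i)"
  by (auto simp: lin_def distrib_left sum.distrib intro!: restrict_ext)

text \<open>The uniqueness argument for Haar measure. Since \<open>g\<close> has integral 1, the
  left side is the double integral of g(y) f(Tx + y), the shift by \<open>y\<close> being a shift of
  \<open>x\<close> by \<open>R y\<close>. Exchanging the order, substituting y - Tx for
  \<open>y\<close>, and exchanging and shifting back separates the two factors, so the constant does
  not depend on \<open>f\<close>.\<close>

lemma nn_integral_leb_lin_const:
  assumes inv: "mat_inv n T R"
  defines "g \<equiv> indicator (Pi\<^sub>E {..<n} (\<lambda>_. {0..1::real})) :: (nat \<Rightarrow> real) \<Rightarrow> ennreal"
  assumes f [measurable]: "f \<in> borel_measurable (leb n)"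
  shows "(\<integral>\<^sup>+x. f (lin n T x) \<partial>leb n) = (\<integral>\<^sup>+x. g (\<lambda>i\<in>{..<n}. - lin n T x i) \<partial>leb n) * (\<integral>\<^sup>+x. f x \<partial>leb n)"
proof -
  have box: "Pi\<^sub>E {..<n} (\<lambda>_. {0..1::real}) \<in> sets (leb n)"
    unfolding sets_leb by (rule sets_PiM_I_finite) auto
  then have [measurable]: "g \<in> borel_measurable (leb n)"
    unfolding g_def by auto
  have g1: "(\<integral>\<^sup>+x. g x \<partial>leb n) = 1"
    using box emeasure_leb_box[of n "\<lambda>_. 0" "\<lambda>_. 1"] by (simp add: g_def)
  have linR: "lin n T (\<lambda>i\<in>{..<n}. x i + lin n R y i) = (\<lambda>i\<in>{..<n}. lin n T x i + y i)" if "y \<in> Rn n" for x y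
    using lin_mat_inv(1)[OF inv that] by (simp add: lin_add)
  have m1 [measurable]: "(\<lambda>(x, y). \<lambda>i\<in>{..<n}. lin n T x i + y i) \<in> leb n \<Otimes>\<^sub>M leb n \<rightarrow>\<^sub>M leb n"
    by (rule measurable_lebI) (auto simp: lin_def)
  have m2 [measurable]: "(\<lambda>(x, y). \<lambda>i\<in>{..<n}. y i - lin n T x i) \<in> leb n \<Otimes>\<^sub>M leb n \<rightarrow>\<^sub>M leb n"
    by (rule measurable_lebI) (auto simp: lin_def)
  have fm1 [measurable]: "(\<lambda>(x, y). f (\<lambda>i\<in>{..<n}. lin n T x i + y i)) \<in> borel_measurable (leb n \<Otimes>\<^sub>M leb n)"
    using measurable_compose[OF m1 f] by (simp add: split_beta')
  have gm2 [measurable]: "(\<lambda>(x, y). g (\<lambda>i\<in>{..<n}. y i - lin n T x i)) \<in> borel_measurable (leb n \<Otimes>\<^sub>M leb n)"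
    using measurable_compose[OF m2, of g borel] by (simp add: split_beta')
  have t1: "(\<integral>\<^sup>+x. f (lin n T x) \<partial>leb n) = (\<integral>\<^sup>+x. f (\<lambda>i\<in>{..<n}. lin n T x i + y i) \<partial>leb n)" if "y \<in> Rn n" for y
    using nn_integral_leb_translate[of "\<lambda>x. f (lin n T x)" n "lin n R y"] that by (simp add: linR)
  have "(\<integral>\<^sup>+x. f (lin n T x) \<partial>leb n) = (\<integral>\<^sup>+y. g y * (\<integral>\<^sup>+x. f (lin n T x) \<partial>leb n) \<partial>leb n)"
    by (simp add: nn_integral_multc g1)
  also have "\<dots> = (\<integral>\<^sup>+y. \<integral>\<^sup>+x. g y * f (\<lambda>i\<in>{..<n}. lin n T x i + y i) \<partial>leb n \<partial>leb n)"
  proof (rule nn_integral_cong)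
    fix y assume "y \<in> space (leb n)"
    then have y: "y \<in> Rn n" by simp
    have "(\<lambda>x. \<lambda>i\<in>{..<n}. lin n T x i + y i) \<in> leb n \<rightarrow>\<^sub>M leb n"
      by (rule measurable_lebI) (auto simp: lin_def)
    then show "g y * (\<integral>\<^sup>+x. f (lin n T x) \<partial>leb n) = (\<integral>\<^sup>+x. g y * f (\<lambda>i\<in>{..<n}. lin n T x i + y i) \<partial>leb n)"
      by (subst nn_integral_cmult) (simp_all add: t1[OF y])
  qed
  also have "\<dots> = (\<integral>\<^sup>+x. \<integral>\<^sup>+y. g y * f (\<lambda>i\<in>{..<n}. lin n T x i + y i) \<partial>leb n \<partial>leb n)"
    by (rule leb2.Fubini') (use fm1 in \<open>simp add: split_beta'\<close>)
  also have "\<dots> = (\<integral>\<^sup>+x. \<integral>\<^sup>+y. g (\<lambda>i\<in>{..<n}. y i - lin n T x i) * f y \<partial>leb n \<partial>leb n)"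
  proof (rule nn_integral_cong)
    fix x assume x: "x \<in> space (leb n)"
    have "(\<lambda>y. \<lambda>i\<in>{..<n}. y i - lin n T x i) \<in> leb n \<rightarrow>\<^sub>M leb n"
      by (rule measurable_lebI) (auto simp: lin_def)
    then have m: "(\<lambda>y. g (\<lambda>i\<in>{..<n}. y i - lin n T x i) * f y) \<in> borel_measurable (leb n)"
      by measurable
    have eq: "(\<lambda>i\<in>{..<n}. (\<lambda>i\<in>{..<n}. y i + lin n T x i) i - lin n T x i) = y" if "y \<in> Rn n" for y
      by (rule Rn_eqI[of _ n]) (use that in auto)
    show "(\<integral>\<^sup>+y. g y * f (\<lambda>i\<in>{..<n}. lin n T x i + y i) \<partial>leb n) =
        (\<integral>\<^sup>+y. g (\<lambda>i\<in>{..<n}. y i - lin n T x i) * f y \<partial>leb n)"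
      unfolding nn_integral_leb_translate[OF m, of "lin n T x", symmetric]
    proof (rule nn_integral_cong)
      fix y assume "y \<in> space (leb n)"
      then have "y \<in> Rn n" by simp
      then show "g y * f (\<lambda>i\<in>{..<n}. lin n T x i + y i) =
          g (\<lambda>i\<in>{..<n}. (\<lambda>i\<in>{..<n}. y i + lin n T x i) i - lin n T x i) *
          f (\<lambda>i\<in>{..<n}. y i + lin n T x i)"
        by (simp only: eq add.commute[of "lin n T x _"])
    qed
  qed
  also have "\<dots> = (\<integral>\<^sup>+y. \<integral>\<^sup>+x. g (\<lambda>i\<in>{..<n}. y i - lin n T x i) * f y \<partial>leb n \<partial>leb n)"
    by (rule leb2.Fubini'[symmetric]) (use gm2 in \<open>simp add: split_beta'\<close>)
  also have "\<dots> = (\<integral>\<^sup>+y. (\<integral>\<^sup>+x. g (\<lambda>i\<in>{..<n}. - lin n T x i) \<partial>leb n) * f y \<partial>leb n)"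
  proof (rule nn_integral_cong)
    fix y assume "y \<in> space (leb n)"
    then have y: "y \<in> Rn n" by simp
    have "(\<lambda>x. \<lambda>i\<in>{..<n}. y i - lin n T x i) \<in> leb n \<rightarrow>\<^sub>M leb n"
      by (rule measurable_lebI) (auto simp: lin_def)
    then have m: "(\<lambda>x. g (\<lambda>i\<in>{..<n}. y i - lin n T x i)) \<in> borel_measurable (leb n)"
      by measurable
    have eq: "(\<lambda>i\<in>{..<n}. y i - (lin n T x i + y i)) = (\<lambda>i\<in>{..<n}. - lin n T x i)" for x
      by auto
    have "(\<integral>\<^sup>+x. g (\<lambda>i\<in>{..<n}. y i - lin n T x i) \<partial>leb n) = (\<integral>\<^sup>+x. g (\<lambda>i\<in>{..<n}. - lin n T x i) \<partial>leb n)"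
      unfolding nn_integral_leb_translate[OF m, of "lin n R y", symmetric]
      by (intro nn_integral_cong arg_cong[of _ _ g]) (auto simp: linR[OF y] intro!: restrict_ext)
    then show "(\<integral>\<^sup>+x. g (\<lambda>i\<in>{..<n}. y i - lin n T x i) * f y \<partial>leb n) =
       (\<integral>\<^sup>+x. g (\<lambda>i\<in>{..<n}. - lin n T x i) \<partial>leb n) * f y"
      using m by (simp add: nn_integral_multc)
  qed
  also have "\<dots> = (\<integral>\<^sup>+x. g (\<lambda>i\<in>{..<n}. - lin n T x i) \<partial>leb n) * (\<integral>\<^sup>+x. f x \<partial>leb n)"
    by (simp add: nn_integral_cmult)
  finally show ?thesis .
qed

lemma mem_box: "x \<in> Pi\<^sub>E {..<n} (\<lambda>i. {a i..b i}) \<longleftrightarrow> x \<in> Rn n \<and> (\<forall>i<n. a i \<le> x i \<and> x i \<le> (b i :: real))"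
  by (auto simp: Rn_def PiE_def Pi_def)

lemma emeasure_leb_UNIV_pos: "emeasure (leb n) (Rn n) > 0"
proof -
  have "Pi\<^sub>E {..<n} (\<lambda>_. {0..1::real}) \<subseteq> Rn n" by (auto simp: Rn_def)
  then have "emeasure (leb n) (Pi\<^sub>E {..<n} (\<lambda>_. {0..1})) \<le> emeasure (leb n) (Rn n)"
    by (rule emeasure_mono) (use sets.top[of "leb n"] in simp)
  also have "emeasure (leb n) (Pi\<^sub>E {..<n} (\<lambda>_. {0..1})) = 1"
    by (subst emeasure_leb_box) auto
  finally show ?thesis
    by (rule less_le_trans[OF zero_less_one])
qed

lemma nn_integral_leb_lin:
  assumes inv: "mat_inv n T R"
  obtains c :: real where "c > 0"
    "\<And>f. f \<in> borel_measurable (leb n) \<Longrightarrow> (\<integral>\<^sup>+x. f (lin n T x) \<partial>leb n) = ennreal c * (\<integral>\<^sup>+x. f x \<partial>leb n)"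
proof -
  define g where "g = (indicator (Pi\<^sub>E {..<n} (\<lambda>_. {0..1::real})) :: (nat \<Rightarrow> real) \<Rightarrow> ennreal)"
  define c where "c = (\<integral>\<^sup>+x. g (\<lambda>i\<in>{..<n}. - lin n T x i) \<partial>leb n)"
  have *: "(\<integral>\<^sup>+x. f (lin n T x) \<partial>leb n) = c * (\<integral>\<^sup>+x. f x \<partial>leb n)" if "f \<in> borel_measurable (leb n)" for f
    unfolding c_def g_def by (rule nn_integral_leb_lin_const[OF inv that])
  \<comment> \<open>A zero factor would make the whole space null.\<close>
  have "c \<noteq> 0"
    using *[of "\<lambda>_. 1"] emeasure_leb_UNIV_pos[of n] by auto
  \<comment> \<open>\<open>M\<close> bounds the coordinates of the \<open>R\<close>-image of the
    cube [-1, 1]^n, hence the preimage of the unit cube; this makes the factor finite.\<close>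
  define M where "M = (\<Sum>i<n. \<Sum>j<n. \<bar>R i j\<bar>)"
  have M: "M \<ge> 0" by (simp add: M_def sum_nonneg)
  have "c \<le> (\<integral>\<^sup>+x. indicator (Pi\<^sub>E {..<n} (\<lambda>_. {-M..M})) x \<partial>leb n)"
    unfolding c_def
  proof (rule nn_integral_mono)
    fix x assume "x \<in> space (leb n)"
    then have x: "x \<in> Rn n" by simp
    show "g (\<lambda>i\<in>{..<n}. - lin n T x i) \<le> indicator (Pi\<^sub>E {..<n} (\<lambda>_. {-M..M})) x"
    proof (cases "(\<lambda>i\<in>{..<n}. - lin n T x i) \<in> Pi\<^sub>E {..<n} (\<lambda>_. {0..1::real})")
      case True
      then have b: "\<bar>lin n T x j\<bar> \<le> 1" if "j < n" for j
        using that unfolding mem_box by fastforce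
      have "\<bar>x i\<bar> \<le> M" if i: "i < n" for i
      proof -
        have "x i = (\<Sum>j<n. R i j * lin n T x j)"
          using fun_cong[OF lin_mat_inv(2)[OF inv x], of i] i by (subst (asm) lin_def) simp
        also have "\<bar>\<dots>\<bar> \<le> (\<Sum>j<n. \<bar>R i j * lin n T x j\<bar>)" by (rule sum_abs)
        also have "\<dots> \<le> (\<Sum>j<n. \<bar>R i j\<bar>)"
          using b by (intro sum_mono) (auto simp: abs_mult intro: mult_left_le)
        also have "\<dots> \<le> M"
          unfolding M_def using i by (intro member_le_sum) (auto simp: sum_nonneg)
        finally show ?thesis .
      qed
      then have "x \<in> Pi\<^sub>E {..<n} (\<lambda>_. {-M..M})"
        using x unfolding mem_box abs_le_iff by (simp add: minus_le_iff)
      then show ?thesis by (simp add: g_def indicator_def)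
    qed (simp add: g_def)
  qed
  also have "\<dots> = emeasure (leb n) (Pi\<^sub>E {..<n} (\<lambda>_. {-M..M}))"
    by (rule nn_integral_indicator) simp
  also have "\<dots> < \<infinity>"
    using M by (subst emeasure_leb_box) auto
  finally have "c < \<infinity>" .
  then obtain r where "c = ennreal r" "r \<ge> 0" by (cases c) auto
  with \<open>c \<noteq> 0\<close> * show ?thesis
    by (intro that[of r]) (auto simp: less_le)
qed

section \<open>Orthogonal matrices\<close>

definition orth_mat :: "nat \<Rightarrow> (nat \<Rightarrow> nat \<Rightarrow> real) \<Rightarrow> bool"
  where "orth_mat n Q \<longleftrightarrow> mat_inv n Q (\<lambda>i j. Q j i)"

lemma dot_lin: "dot n (lin n T x) y = dot n x (lin n (\<lambda>i j. T j i) y)"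
  by (simp add: dot_def lin_def sum_distrib_left sum_distrib_right mult_ac) (subst sum.swap, rule refl)

lemma dot_commute: "dot n x y = dot n y x"
  by (simp add: dot_def mult.commute)

lemma dot_orth:
  assumes "orth_mat n Q" "x \<in> Rn n"
  shows "dot n (lin n Q x) (lin n Q y) = dot n x y"
proof -
  have "dot n (lin n Q x) (lin n Q y) = dot n (lin n (\<lambda>i j. Q j i) (lin n Q x)) y"
    by (metis dot_commute dot_lin)
  then show ?thesis
    using lin_mat_inv(2)[of n Q "\<lambda>i j. Q j i" x] assms by (simp add: orth_mat_def)
qed

lemma measurable_dot [measurable]:
  assumes "f \<in> M \<rightarrow>\<^sub>M leb n" "g \<in> M \<rightarrow>\<^sub>M leb n"
  shows "(\<lambda>x. dot n (f x) (g x)) \<in> borel_measurable M"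
  unfolding dot_def using assms by (intro borel_measurable_sum borel_measurable_times) (auto dest: measurable_leb_dest)

text \<open>The unknown factor is tested on the unit ball, which is invariant and has finite
  positive measure, and so must be 1.\<close>

lemma nn_integral_leb_orth:
  assumes Q: "orth_mat n Q" and f: "f \<in> borel_measurable (leb n)"
  shows "(\<integral>\<^sup>+x. f (lin n Q x) \<partial>leb n) = (\<integral>\<^sup>+x. f x \<partial>leb n)"
proof -
  obtain c where c: "c > 0"
    "\<And>f. f \<in> borel_measurable (leb n) \<Longrightarrow> (\<integral>\<^sup>+x. f (lin n Q x) \<partial>leb n) = ennreal c * (\<integral>\<^sup>+x. f x \<partial>leb n)"
    using nn_integral_leb_lin Q unfolding orth_mat_def by metis
  define B where "B = {x \<in> Rn n. dot n x x \<le> 1}"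
  have [measurable]: "B \<in> sets (leb n)"
  proof -
    have "{x \<in> space (leb n). dot n x x \<le> 1} \<in> sets (leb n)" by measurable
    then show ?thesis by (simp add: B_def)
  qed
  have eq: "indicator B (lin n Q x) = (indicator B x :: ennreal)" if "x \<in> Rn n" for x
    using that by (simp add: B_def indicator_def dot_orth[OF Q that])
  have sq: "x i * x i \<le> 1" if "x \<in> B" "i < n" for x i
  proof -
    have "x i * x i \<le> dot n x x"
      unfolding dot_def using that(2) by (intro member_le_sum) auto
    with that(1) show ?thesis by (simp add: B_def)
  qed
  have "B \<subseteq> Pi\<^sub>E {..<n} (\<lambda>_. {-1..1})"
  proof
    fix x assume x: "x \<in> B"
    have "\<bar>x i\<bar> \<le> 1" if "i < n" for i
      using sq[OF x that] by (metis abs_le_square_iff abs_one power2_eq_square mult_1)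
    then show "x \<in> Pi\<^sub>E {..<n} (\<lambda>_. {-1..1})"
      using x unfolding mem_box abs_le_iff by (simp add: B_def minus_le_iff)
  qed
  then have "emeasure (leb n) B \<le> emeasure (leb n) (Pi\<^sub>E {..<n} (\<lambda>_. {-1..1}))"
    by (rule emeasure_mono) simp
  also have "\<dots> < \<infinity>" by (subst emeasure_leb_box) (auto simp: power_less_top_ennreal)
  finally have fin: "emeasure (leb n) B < \<infinity>" .
  \<comment> \<open>A cube that fits into the ball: each of the \<open>n\<close> squares is at most
    1 / (n + 1).\<close>
  have "Pi\<^sub>E {..<n} (\<lambda>_. {0..1 / (real n + 1)}) \<subseteq> B"
  proof
    fix x assume x: "x \<in> Pi\<^sub>E {..<n} (\<lambda>_. {0..1 / (real n + 1)})"
    have "dot n x x \<le> (\<Sum>i<n. 1 / (real n + 1) * 1)"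
      unfolding dot_def
    proof (intro sum_mono mult_mono)
      fix i assume "i \<in> {..<n}"
      then have "0 \<le> x i" "x i \<le> 1 / (real n + 1)" using x unfolding mem_box by auto
      moreover have "1 / (real n + 1) \<le> 1" by simp
      ultimately show "x i \<le> 1 / (real n + 1)" "x i \<le> 1" "0 \<le> x i" by linarith+
    qed auto
    also have "\<dots> \<le> 1" by simp
    finally show "x \<in> B" using x unfolding mem_box by (simp add: B_def)
  qed
  then have "emeasure (leb n) (Pi\<^sub>E {..<n} (\<lambda>_. {0..1 / (real n + 1)})) \<le> emeasure (leb n) B"
    by (rule emeasure_mono) simp
  also have "emeasure (leb n) (Pi\<^sub>E {..<n} (\<lambda>_. {0..1 / (real n + 1)})) = ennreal ((1 / (real n + 1)) ^ n)"
    by (subst emeasure_leb_box) auto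
  finally have "ennreal ((1 / (real n + 1)) ^ n) \<le> emeasure (leb n) B" .
  then have pos: "emeasure (leb n) B > 0"
    by (rule less_le_trans[rotated]) simp
  have "emeasure (leb n) B = (\<integral>\<^sup>+x. indicator B (lin n Q x) \<partial>leb n)"
    by (subst nn_integral_cong[where v="indicator B"]) (auto simp: eq)
  also have "\<dots> = ennreal c * emeasure (leb n) B"
    by (subst c) auto
  finally have "ennreal c = 1"
    using fin pos by (cases "emeasure (leb n) B") (auto simp: ennreal_mult'[symmetric] c(1) less_imp_le ennreal_eq_1)
  then show ?thesis using c(2)[OF f] by simp
qed

section \<open>Convex bodies in coordinates\<close>

text \<open>On the topspace the coordinates from \<open>n\<close> on are constantly
  \<open>undefined\<close>, hence continuous. So the topology of the statement is the one inherited
  from the function type, and compactness can be treated there.\<close>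

lemma continuous_map_Rn_euclidean: "continuous_map (powertop_real {..<n::nat}) euclidean (\<lambda>x. x)"
proof -
  have "continuous_map (powertop_real {..<n}) (powertop_real UNIV) (\<lambda>x. x)"
    unfolding continuous_map_componentwise_UNIV
  proof
    fix k :: nat
    show "continuous_map (powertop_real {..<n}) euclideanreal (\<lambda>x. x k)"
    proof (cases "k < n")
      case False
      have "continuous_map (powertop_real {..<n}) euclideanreal (\<lambda>x. undefined)" by simp
      then show ?thesis
        by (rule continuous_map_eq) (use False in \<open>auto simp: PiE_def extensional_def\<close>)
    qed (rule continuous_map_product_projection, simp)
  qed
  then show ?thesis by (simp add: euclidean_product_topology)
qed

lemma continuous_map_restrict_Rn: "continuous_map euclidean (powertop_real {..<n::nat}) (\<lambda>x. restrict x {..<n})"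
  unfolding continuous_map_componentwise
  by (auto intro: continuous_on_subset[OF continuous_on_product_coordinates])

lemma compactin_Rn_iff: "compactin (powertop_real {..<n}) K \<longleftrightarrow> K \<subseteq> Rn n \<and> compact K"
proof
  assume K: "compactin (powertop_real {..<n}) K"
  then have "K \<subseteq> Rn n" using compactin_subset_topspace by (fastforce simp: Rn_def)
  moreover have "compact K"
    using image_compactin[OF K continuous_map_Rn_euclidean] by simp
  ultimately show "K \<subseteq> Rn n \<and> compact K" by simp
next
  assume K: "K \<subseteq> Rn n \<and> compact K"
  then have "(\<lambda>x. restrict x {..<n}) ` K = K"
    by (force simp: image_def Rn_def PiE_def extensional_restrict)
  then show "compactin (powertop_real {..<n}) K"
    using image_compactin[OF _ continuous_map_restrict_Rn, of K n] K by simp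
qed

text \<open>Closed cubes serve as neighbourhoods, because both membership and measure are
  explicit.\<close>

definition ccube :: "nat \<Rightarrow> (nat \<Rightarrow> real) \<Rightarrow> real \<Rightarrow> (nat \<Rightarrow> real) set"
  where "ccube n x r = {y \<in> Rn n. \<forall>i<n. \<bar>y i - x i\<bar> \<le> r}"

lemma interior_Rn_iff: "powertop_real {..<n} interior_of K \<noteq> {} \<longleftrightarrow> (\<exists>x\<in>Rn n. \<exists>r>0. ccube n x r \<subseteq> K)"
proof
  assume "powertop_real {..<n} interior_of K \<noteq> {}"
  then obtain x U where U: "openin (powertop_real {..<n}) U" "x \<in> U" "U \<subseteq> K"
    by (auto simp: interior_of_def)
  then have "\<exists>X. finite {i \<in> {..<n}. X i \<noteq> UNIV} \<and> (\<forall>i\<in>{..<n}. open (X i)) \<and> x \<in> Pi\<^sub>E {..<n} X \<and> Pi\<^sub>E {..<n} X \<subseteq> U"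
    unfolding openin_product_topology_alt by simp
  then obtain X where X: "x \<in> Pi\<^sub>E {..<n} X" "\<forall>i<n. open (X i)" "Pi\<^sub>E {..<n} X \<subseteq> U"
    by blast
  have "\<exists>e>0. \<forall>y. \<bar>y - x i\<bar> \<le> e \<longrightarrow> y \<in> X i" if "i < n" for i
  proof -
    have "x i \<in> X i" using X(1) that by auto
    moreover have "open (X i)" using X(2) that by simp
    ultimately obtain e where e: "e > 0" "cball (x i) e \<subseteq> X i"
      by (metis open_contains_cball)
    have "y \<in> X i" if "\<bar>y - x i\<bar> \<le> e" for y
      using e(2) that by (auto simp: dist_real_def abs_minus_commute intro!: subsetD[OF e(2)])
    with e(1) show ?thesis by blast
  qed
  then have "\<forall>i. \<exists>e. i < n \<longrightarrow> e > 0 \<and> (\<forall>y. \<bar>y - x i\<bar> \<le> e \<longrightarrow> y \<in> X i)" by blast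
  from choice[OF this] obtain e where
    "\<forall>i. i < n \<longrightarrow> e i > 0 \<and> (\<forall>y. \<bar>y - x i\<bar> \<le> e i \<longrightarrow> y \<in> X i)" ..
  then have e: "\<And>i. i < n \<Longrightarrow> e i > 0" "\<And>i y. i < n \<Longrightarrow> \<bar>y - x i\<bar> \<le> e i \<Longrightarrow> y \<in> X i"
    by blast+
  \<comment> \<open>The inserted 1 keeps the minimum defined when there are no coordinates.\<close>
  define r where "r = Min (insert 1 (e ` {..<n}))"
  have r: "r > 0" "\<And>i. i < n \<Longrightarrow> r \<le> e i"
    using e(1) by (auto simp: r_def)
  have "ccube n x r \<subseteq> Pi\<^sub>E {..<n} X"
  proof
    fix y assume y: "y \<in> ccube n x r"
    have "y i \<in> X i" if "i < n" for i
      using y that r(2)[OF that] by (intro e(2)[OF that]) (auto simp: ccube_def intro: order_trans)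
    moreover have "y \<in> Rn n" using y by (simp add: ccube_def)
    ultimately show "y \<in> Pi\<^sub>E {..<n} X" by (simp add: Rn_def PiE_iff)
  qed
  then show "\<exists>x\<in>Rn n. \<exists>r>0. ccube n x r \<subseteq> K"
  proof (intro bexI[of _ x] exI[of _ r] conjI)
    show "x \<in> Rn n" using X(1) by (simp add: Rn_def PiE_iff)
  qed (use X U r(1) in blast)+
next
  assume "\<exists>x\<in>Rn n. \<exists>r>0. ccube n x r \<subseteq> K"
  then obtain x r where x: "x \<in> Rn n" "r > 0" "ccube n x r \<subseteq> K" by blast
  let ?U = "Pi\<^sub>E {..<n} (\<lambda>i. ball (x i) r)"
  have "openin (powertop_real {..<n}) ?U"
    by (subst openin_PiE) auto
  moreover have "?U \<subseteq> ccube n x r"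
  proof
    fix y assume y: "y \<in> ?U"
    have "\<bar>y i - x i\<bar> \<le> r" if "i < n" for i
      using PiE_mem[OF y, of i] that by (simp add: dist_real_def abs_minus_commute)
    moreover have "y \<in> Rn n" using y by (simp add: Rn_def PiE_iff)
    ultimately show "y \<in> ccube n x r" by (simp add: ccube_def)
  qed
  moreover have "x \<in> ?U" using x by (auto simp: Rn_def PiE_iff)
  ultimately have "x \<in> powertop_real {..<n} interior_of K"
    using x(3) unfolding interior_of_def by blast
  then show "powertop_real {..<n} interior_of K \<noteq> {}" by blast
qed

definition comb :: "nat \<Rightarrow> real \<Rightarrow> (nat \<Rightarrow> real) \<Rightarrow> (nat \<Rightarrow> real) \<Rightarrow> (nat \<Rightarrow> real)"
  where "comb n t x y = (\<lambda>i\<in>{..<n}. (1 - t) * x i + t * y i)"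

lemma comb_in_Rn [simp]: "comb n t x y \<in> Rn n"
  by (simp add: comb_def)

definition cvx :: "nat \<Rightarrow> (nat \<Rightarrow> real) set \<Rightarrow> bool"
  where "cvx n K \<longleftrightarrow> (\<forall>x\<in>K. \<forall>y\<in>K. \<forall>t\<in>{0..1}. comb n t x y \<in> K)"

lemma convex_body_iff:
  "convex_body n K \<longleftrightarrow> K \<subseteq> Rn n \<and> compact K \<and> cvx n K \<and> (\<exists>x\<in>Rn n. \<exists>r>0. ccube n x r \<subseteq> K)"
  unfolding convex_body_def interior_Rn_iff compactin_Rn_iff cvx_def comb_def by blast

lemma compact_Rn_box: "compact {x \<in> Rn n. \<forall>i<n. \<bar>x i\<bar> \<le> R}"
proof -
  have "{x \<in> Rn n. \<forall>i<n. \<bar>x i\<bar> \<le> R} = Pi\<^sub>E {..<n} (\<lambda>_. {-R..R})"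
    using abs_diff_le_iff[of _ 0 R] by (intro set_eqI) (simp add: mem_box)
  then have "compactin (powertop_real {..<n}) {x \<in> Rn n. \<forall>i<n. \<bar>x i\<bar> \<le> R}"
    by (simp add: compactin_PiE)
  then show ?thesis by (simp add: compactin_Rn_iff)
qed

lemma tendsto_fun_iff: "(X \<longlongrightarrow> (l :: nat \<Rightarrow> real)) F \<longleftrightarrow> (\<forall>i. ((\<lambda>m. X m i) \<longlongrightarrow> l i) F)"
  using limitin_componentwise[of "\<lambda>_. euclideanreal" UNIV X l F] by (simp add: euclidean_product_topology)

lemma continuous_coord: "continuous_on A (\<lambda>x :: nat \<Rightarrow> real. x i)"
  by (rule continuous_on_subset[OF continuous_on_product_coordinates]) simp

lemma compact_bounded_coord:
  assumes "compact (K :: (nat \<Rightarrow> real) set)"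
  obtains R where "R > 0" "\<And>x i. x \<in> K \<Longrightarrow> i < n \<Longrightarrow> \<bar>x i\<bar> \<le> R"
proof -
  have "\<exists>B. \<forall>x\<in>K. \<bar>x i\<bar> \<le> B" for i
    using compact_imp_bounded[OF compact_continuous_image[OF continuous_coord[of K i] assms]]
    by (auto simp: bounded_iff)
  then obtain B where B: "\<And>i x. x \<in> K \<Longrightarrow> \<bar>x i\<bar> \<le> B i" by metis
  show ?thesis
  proof (rule that[of "1 + (\<Sum>i<n. \<bar>B i\<bar>)"])
    show "0 < 1 + (\<Sum>i<n. \<bar>B i\<bar>)" by (simp add: add_pos_nonneg sum_nonneg)
    fix x i assume "x \<in> K" "i < n"
    then have "\<bar>x i\<bar> \<le> \<bar>B i\<bar>" by (intro order_trans[OF B abs_ge_self])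
    also have "\<dots> \<le> (\<Sum>i<n. \<bar>B i\<bar>)" using \<open>i < n\<close> by (intro member_le_sum) auto
    finally show "\<bar>x i\<bar> \<le> 1 + (\<Sum>i<n. \<bar>B i\<bar>)" by simp
  qed
qed

lemma closed_Rn: "closed (Rn n)"
proof -
  have "Rn n = (\<Inter>i\<in>{n..}. {x. x i = undefined})"
    by (auto simp: Rn_def PiE_def extensional_def)
  moreover have "closed {x :: nat \<Rightarrow> real. x i = undefined}" for i
    by (intro closed_Collect_eq continuous_intros continuous_coord)
  ultimately show ?thesis by auto
qed

lemma compact_RnI:
  assumes "K \<subseteq> Rn n" "closed K" "\<And>x i. x \<in> K \<Longrightarrow> i < n \<Longrightarrow> \<bar>x i\<bar> \<le> R"
  shows "compact K"
proof -
  have *: "{x \<in> Rn n. \<forall>i<n. \<bar>x i\<bar> \<le> R} \<inter> K = K" using assms by auto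
  show ?thesis using compact_Int_closed[OF compact_Rn_box assms(2), of n R] by (simp only: *)
qed

lemma leb_measurable_borel: "(\<lambda>x. x) \<in> borel_measurable (leb n)"
proof (rule measurable_coordinatewise_then_product)
  fix i :: nat
  show "(\<lambda>x. x i) \<in> borel_measurable (leb n)"
  proof (cases "i < n")
    case False
    then have "x i = undefined" if "x \<in> space (leb n)" for x :: "nat \<Rightarrow> real"
      using that by (auto simp: Rn_def PiE_def extensional_def)
    then have "(\<lambda>x. x i) \<in> borel_measurable (leb n) \<longleftrightarrow> (\<lambda>x. undefined :: real) \<in> borel_measurable (leb n)"
      by (intro measurable_cong) auto
    then show ?thesis by simp
  qed simp
qed

lemma borel_in_leb: 
  assumes "A \<in> sets borel" "A \<subseteq> Rn n" shows "A \<in> sets (leb n)"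
proof -
  have "(\<lambda>x. x) -` A \<inter> space (leb n) \<in> sets (leb n)"
    by (rule measurable_sets[OF leb_measurable_borel assms(1)])
  moreover have "(\<lambda>x. x) -` A \<inter> space (leb n) = A" using assms(2) by auto
  ultimately show ?thesis by simp
qed

lemma compact_in_leb: "compact A \<Longrightarrow> A \<subseteq> Rn n \<Longrightarrow> A \<in> sets (leb n)"
  by (rule borel_in_leb) (auto intro: borel_closed compact_imp_closed)

lemma emeasure_ccube:
  assumes "x \<in> Rn n" "r \<ge> 0"
  shows "ccube n x r \<in> sets (leb n)" "emeasure (leb n) (ccube n x r) = ennreal ((2 * r) ^ n)"
proof -
  have *: "ccube n x r = Pi\<^sub>E {..<n} (\<lambda>i. {x i - r..x i + r})"
    by (intro set_eqI) (simp add: ccube_def mem_box abs_diff_le_iff)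
  show "ccube n x r \<in> sets (leb n)"
    unfolding * sets_leb by (rule sets_PiM_I_finite) auto
  show "emeasure (leb n) (ccube n x r) = ennreal ((2 * r) ^ n)"
    unfolding * by (subst emeasure_leb_box) (use assms in auto)
qed

lemma convex_bodyD:
  assumes "convex_body n K"
  shows convex_body_subset: "K \<subseteq> Rn n" and convex_body_compact: "compact K"
    and convex_body_cvx: "cvx n K" and convex_body_sets: "K \<in> sets (leb n)"
    and convex_body_fin: "emeasure (leb n) K < \<infinity>" and convex_body_vol_pos: "vol n K > 0"
proof -
  show 1: "K \<subseteq> Rn n" "compact K" "cvx n K" using assms by (auto simp: convex_body_iff)
  then show 2: "K \<in> sets (leb n)" using compact_in_leb by blast
  obtain R where R: "R > 0" "\<And>x i. x \<in> K \<Longrightarrow> i < n \<Longrightarrow> \<bar>x i\<bar> \<le> R"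
    using compact_bounded_coord[OF 1(2)] by metis
  have 0: "(\<lambda>i\<in>{..<n}. 0) \<in> Rn n" by simp
  have "K \<subseteq> ccube n (\<lambda>i\<in>{..<n}. 0) R" using R 1 by (auto simp: ccube_def)
  then have "emeasure (leb n) K \<le> ennreal ((2 * R) ^ n)"
    using emeasure_mono[of K "ccube n (\<lambda>i\<in>{..<n}. 0) R" "leb n"] emeasure_ccube[OF 0, of R] R(1) by simp
  then show fin: "emeasure (leb n) K < \<infinity>"
    using le_less_trans by fastforce
  obtain x r where x: "x \<in> Rn n" "r > 0" "ccube n x r \<subseteq> K" using assms by (auto simp: convex_body_iff)
  have "ennreal ((2 * r) ^ n) \<le> emeasure (leb n) K"
    using emeasure_mono[OF x(3) 2] emeasure_ccube(2)[OF x(1), of r] x(2) by simp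
  moreover have "ennreal ((2 * r) ^ n) > 0" using x(2) by simp
  ultimately have "emeasure (leb n) K > 0" by (rule less_le_trans[rotated])
  then show "vol n K > 0"
    using fin by (simp add: vol_def measure_def enn2real_positive_iff)
qed

section \<open>Orthonormal families and quadratic forms\<close>

definition orthonormal :: "nat \<Rightarrow> nat \<Rightarrow> (nat \<Rightarrow> nat \<Rightarrow> real) \<Rightarrow> bool"
  where "orthonormal n k w \<longleftrightarrow> (\<forall>j<k. w j \<in> Rn n) \<and>
    (\<forall>i<k. \<forall>j<k. dot n (w i) (w j) = (if i = j then 1 else 0))"

lemma dot_lincomb: 
  "dot n x (lincomb n S w c) = (\<Sum>k\<in>S. c k * dot n x (w k))"
proof -
  have "dot n x (lincomb n S w c) = (\<Sum>i<n. \<Sum>k\<in>S. x i * (c k * w k i))"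
    by (simp add: dot_def lincomb_def sum_distrib_left)
  also have "\<dots> = (\<Sum>k\<in>S. \<Sum>i<n. x i * (c k * w k i))" by (rule sum.swap)
  also have "\<dots> = (\<Sum>k\<in>S. c k * dot n x (w k))"
    by (simp add: dot_def sum_distrib_left mult_ac)
  finally show ?thesis .
qed

lemma dot_unit: "i < n \<Longrightarrow> dot n (\<lambda>k. if k = i then 1 else 0) x = x i"
  by (simp add: dot_def if_distrib[of "\<lambda>a. a * _"] sum.delta cong: if_cong)

lemma dot_diff_self:
  "dot n (\<lambda>i\<in>{..<n}. x i - y i) (\<lambda>i\<in>{..<n}. x i - y i) = dot n x x - 2 * dot n x y + dot n y y"
  by (simp add: dot_def algebra_simps sum.distrib sum_subtractf sum_distrib_left)

lemma dot_diff_left: "dot n (\<lambda>i\<in>{..<n}. x i - y i) z = dot n x z - dot n y z"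
  by (simp add: dot_def algebra_simps sum_subtractf)

lemma dot_scale_left: "dot n (\<lambda>i\<in>{..<n}. c * x i) z = c * dot n x z"
  by (simp add: dot_def algebra_simps sum_distrib_left)

lemma dot_self_nonneg: "dot n x x \<ge> 0"
  by (simp add: dot_def sum_nonneg)

lemma dot_self_zero: "dot n x x = 0 \<Longrightarrow> i < n \<Longrightarrow> x i = 0"
  by (simp add: dot_def sum_nonneg_eq_0_iff)

text \<open>The Gram-Schmidt residual: what is left of \<open>x\<close> after orthogonal projection
  onto the span of the first \<open>k\<close> vectors.\<close>

definition resid :: "nat \<Rightarrow> nat \<Rightarrow> (nat \<Rightarrow> nat \<Rightarrow> real) \<Rightarrow> (nat \<Rightarrow> real) \<Rightarrow> (nat \<Rightarrow> real)"
  where "resid n k w x = (\<lambda>i\<in>{..<n}. x i - lincomb n {..<k} w (\<lambda>j. dot n x (w j)) i)"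

lemma resid_in_Rn [simp]: "resid n k w x \<in> Rn n"
  by (simp add: resid_def)

lemma resid_orth:
  assumes "orthonormal n k w" "j < k"
  shows "dot n (resid n k w x) (w j) = 0"
proof -
  have "(\<Sum>i<k. dot n x (w i) * dot n (w j) (w i)) = (\<Sum>i<k. (if j = i then 1 else 0) * dot n x (w i))"
    using assms by (intro sum.cong) (auto simp: orthonormal_def)
  then show ?thesis
    using assms(2) by (simp add: resid_def dot_diff_left dot_commute[of n "lincomb _ _ _ _"] dot_lincomb sum_delta_mult)
qed

lemma resid_norm:
  assumes "orthonormal n k w"
  shows "dot n (resid n k w x) (resid n k w x) = dot n x x - (\<Sum>j<k. (dot n x (w j))\<^sup>2)"
proof -
  let ?p = "lincomb n {..<k} w (\<lambda>j. dot n x (w j))"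
  have 1: "dot n x ?p = (\<Sum>j<k. (dot n x (w j))\<^sup>2)"
    by (simp add: dot_lincomb power2_eq_square)
  have "dot n (resid n k w x) ?p = 0"
    using resid_orth[OF assms] by (simp add: dot_lincomb)
  then have 2: "dot n ?p ?p = dot n x ?p"
    by (simp add: resid_def dot_diff_left)
  show ?thesis unfolding resid_def dot_diff_self 1 2 by simp
qed

text \<open>The trace of the projection onto the span. Together with Bessel's inequality in each
  coordinate it takes the place of dimension counting.\<close>

lemma sum_sq_orthonormal:
  assumes "orthonormal n k w"
  shows "(\<Sum>i<n. \<Sum>j<k. (w j i)\<^sup>2) = real k"
proof -
  have "(\<Sum>i<n. \<Sum>j<k. (w j i)\<^sup>2) = (\<Sum>j<k. dot n (w j) (w j))"
    by (subst sum.swap) (simp add: dot_def power2_eq_square)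
  also have "\<dots> = (\<Sum>j<k. 1)" using assms by (intro sum.cong) (auto simp: orthonormal_def)
  finally show ?thesis by simp
qed

lemma resid_unit_norm:
  assumes "orthonormal n k w" "i < n"
  shows "dot n (resid n k w (\<lambda>j. if j = i then 1 else 0)) (resid n k w (\<lambda>j. if j = i then 1 else 0))
    = 1 - (\<Sum>j<k. (w j i)\<^sup>2)"
  using assms by (simp add: resid_norm dot_unit)

lemma bessel_coord:
  assumes "orthonormal n k w" "i < n"
  shows "(\<Sum>j<k. (w j i)\<^sup>2) \<le> 1"
  using dot_self_nonneg[of n "resid n k w (\<lambda>j. if j = i then 1 else 0)"] resid_unit_norm[OF assms] by simp

text \<open>Bessel bounds each of the \<open>n\<close> column sums by 1 while their total is
  \<open>n\<close>, so all are equalities and every coordinate vector has residual zero.\<close>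

lemma orthonormal_complete:
  assumes w: "orthonormal n n w" and ij: "i < n" "j < n"
  shows "(\<Sum>k<n. w k i * w k j) = (if i = j then 1 else 0)"
proof -
  let ?e = "\<lambda>k. if k = i then 1 else 0 :: real"
  have "(\<Sum>i<n. 1 - (\<Sum>k<n. (w k i)\<^sup>2)) = 0"
    using sum_sq_orthonormal[OF w] by (simp add: sum_subtractf)
  then have "1 - (\<Sum>k<n. (w k i)\<^sup>2) = 0"
    using bessel_coord[OF w] ij(1) by (subst (asm) sum_nonneg_eq_0_iff) auto
  then have "dot n (resid n n w ?e) (resid n n w ?e) = 0"
    using resid_unit_norm[OF w ij(1)] by simp
  then have "resid n n w ?e j = 0"
    using dot_self_zero ij(2) by blast
  then show ?thesis
    using ij by (auto simp: resid_def lincomb_def dot_unit)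
qed

lemma orthonormal_orth_mat:
  assumes "orthonormal n n w"
  shows "orth_mat n w"
  using assms orthonormal_complete[OF assms]
  by (auto simp: orth_mat_def mat_inv_def orthonormal_def dot_def)

lemma orth_mat_transpose: "orth_mat n w \<Longrightarrow> orth_mat n (\<lambda>i j. w j i)"
  by (auto simp: orth_mat_def mat_inv_def)

lemma lincomb_lin: "lincomb n {..<n} w c = lin n (\<lambda>i k. w k i) c"
  by (simp add: lincomb_def lin_def mult.commute)

text \<open>The trace is \<open>k\<close>, less than \<open>n\<close>, so some coordinate vector is
  not fully captured by the span; its normalised residual is the new direction.\<close>

lemma orthonormal_extend:
  assumes w: "orthonormal n k w" and k: "k < n"
  obtains \<theta> where "\<theta> \<in> Rn n" "dot n \<theta> \<theta> = 1" "\<And>j. j < k \<Longrightarrow> dot n \<theta> (w j) = 0"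
proof -
  have "\<exists>i<n. (\<Sum>j<k. (w j i)\<^sup>2) < 1"
  proof (rule ccontr)
    assume neg: "\<not> ?thesis"
    have "1 \<le> (\<Sum>j<k. (w j i)\<^sup>2)" if "i < n" for i
      using neg that by (meson not_less)
    then have "(\<Sum>i<n. 1) \<le> (\<Sum>i<n. \<Sum>j<k. (w j i)\<^sup>2)"
      by (intro sum_mono) simp
    then show False using sum_sq_orthonormal[OF w] k by simp
  qed
  then obtain i where i: "i < n" "(\<Sum>j<k. (w j i)\<^sup>2) < 1" by blast
  define r where "r = resid n k w (\<lambda>j. if j = i then 1 else 0)"
  have pos: "dot n r r > 0"
    using resid_unit_norm[OF w i(1)] i(2) by (simp add: r_def)
  define s where "s = 1 / sqrt (dot n r r)"
  define \<theta> where "\<theta> = (\<lambda>i\<in>{..<n}. s * r i)"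
  have \<theta>: "dot n \<theta> y = s * dot n r y" for y
    unfolding \<theta>_def by (rule dot_scale_left)
  show ?thesis
  proof (rule that[of \<theta>])
    have "dot n \<theta> \<theta> = s * (s * dot n r r)"
      unfolding \<theta>[of \<theta>] dot_commute[of n r \<theta>] \<theta>[of r] by (rule refl)
    also have "\<dots> = 1"
      using pos by (simp add: s_def field_simps)
    finally show "dot n \<theta> \<theta> = 1" .
    show "dot n \<theta> (w j) = 0" if "j < k" for j
      using resid_orth[OF w that] by (simp add: \<theta> r_def)
  qed (simp add: \<theta>_def)
qed

lemma orthonormal_Suc:
  assumes "orthonormal n k w" "\<theta> \<in> Rn n" "dot n \<theta> \<theta> = 1" "\<And>j. j < k \<Longrightarrow> dot n \<theta> (w j) = 0"
  shows "orthonormal n (Suc k) (w(k := \<theta>))"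
proof -
  have "dot n (w j) \<theta> = 0" if "j < k" for j
    using assms(4)[OF that] by (simp add: dot_commute)
  then show ?thesis
    using assms unfolding orthonormal_def less_Suc_eq by auto
qed

section \<open>The spectral theorem for symmetric forms\<close>

definition bil :: "nat \<Rightarrow> (nat \<Rightarrow> nat \<Rightarrow> real) \<Rightarrow> (nat \<Rightarrow> real) \<Rightarrow> (nat \<Rightarrow> real) \<Rightarrow> real"
  where "bil n B x y = (\<Sum>i<n. \<Sum>j<n. B i j * x i * y j)"

lemma bil_add:
  assumes sym: "\<And>i j. i < n \<Longrightarrow> j < n \<Longrightarrow> B i j = B j i"
  shows "bil n B (\<lambda>i\<in>{..<n}. x i + t * y i) (\<lambda>i\<in>{..<n}. x i + t * y i) =
    bil n B x x + 2 * t * bil n B x y + t\<^sup>2 * bil n B y y"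
proof -
  have "bil n B y x = (\<Sum>j<n. \<Sum>i<n. B i j * y i * x j)" 
    unfolding bil_def by (rule sum.swap)
  also have "\<dots> = bil n B x y"
    unfolding bil_def by (intro sum.cong refl) (use sym in \<open>simp add: mult_ac\<close>)
  finally have s: "bil n B y x = bil n B x y" .
  have "bil n B (\<lambda>i\<in>{..<n}. x i + t * y i) (\<lambda>i\<in>{..<n}. x i + t * y i) =
      (\<Sum>i<n. \<Sum>j<n. B i j * x i * x j + t * (B i j * x i * y j) + t * (B i j * y i * x j) + t\<^sup>2 * (B i j * y i * y j))"
    unfolding bil_def by (intro sum.cong refl) (simp add: algebra_simps power2_eq_square)
  also have "\<dots> = bil n B x x + t * bil n B x y + t * bil n B y x + t\<^sup>2 * bil n B y y"
    by (simp add: bil_def sum.distrib sum_distrib_left)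
  finally show ?thesis using s by simp
qed

lemma bil_scale: "bil n B (\<lambda>i\<in>{..<n}. c * x i) (\<lambda>i\<in>{..<n}. c * x i) = c\<^sup>2 * bil n B x x"
  by (simp add: bil_def sum_distrib_left power2_eq_square mult_ac)

lemma dot_add: "dot n (\<lambda>i\<in>{..<n}. x i + t * y i) z = dot n x z + t * dot n y z"
  by (simp add: dot_def algebra_simps sum.distrib sum_distrib_left)

text \<open>First-order optimality: near 0 a linear term cannot stay below a quadratic one. The test
  point is t = b / N with N a positive bound of M.\<close>

lemma quadratic_zero:
  fixes b M :: real
  assumes "\<And>t. 2 * t * b \<le> t\<^sup>2 * M"
  shows "b = 0"
proof (rule ccontr)
  assume b: "b \<noteq> 0"
  define N where "N = \<bar>M\<bar> + 1"
  have N: "N > 0" "M \<le> N" by (auto simp: N_def)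
  have "2 * (b / N) * b \<le> (b / N)\<^sup>2 * M" by (rule assms)
  also have "\<dots> \<le> (b / N)\<^sup>2 * N" using N by (intro mult_left_mono) auto
  also have "\<dots> = b * b / N" using N by (simp add: power2_eq_square)
  finally have "b * b / N \<le> 0" by simp
  moreover have "b * b / N > 0" using b N by (intro divide_pos_pos) (auto simp: zero_less_mult_iff linorder_neq_iff)
  ultimately show False by simp
qed

lemma continuous_dot_left: "continuous_on A (\<lambda>x. dot n x y)"
  unfolding dot_def by (intro continuous_intros continuous_coord)

lemma continuous_dot_self: "continuous_on A (\<lambda>x. dot n x x)"
  unfolding dot_def by (intro continuous_intros continuous_coord)

lemma continuous_bil_self: "continuous_on A (\<lambda>x. bil n B x x)"
  unfolding bil_def by (intro continuous_intros continuous_coord)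

lemma abs_coord_le_dot: "i < n \<Longrightarrow> (x i)\<^sup>2 \<le> dot n x x"
  using member_le_sum[of i "{..<n}" "\<lambda>i. x i * x i"] by (simp add: dot_def power2_eq_square)

text \<open>The Rayleigh quotient attains its maximum, as the unit sphere of the orthogonal
  complement is compact and, because \<open>k < n\<close>, not empty. Homogeneity extends the
  estimate from unit vectors to all \<open>x\<close>.\<close>

lemma max_direction:
  assumes w: "orthonormal n k w" and k: "k < n"
  obtains \<theta> where "\<theta> \<in> Rn n" "dot n \<theta> \<theta> = 1" "\<And>j. j < k \<Longrightarrow> dot n \<theta> (w j) = 0"
    "\<And>x. (\<And>j. j < k \<Longrightarrow> dot n x (w j) = 0) \<Longrightarrow> bil n B x x \<le> bil n B \<theta> \<theta> * dot n x x"
proof -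
  define S where "S = {\<theta> \<in> Rn n. dot n \<theta> \<theta> = 1} \<inter> (\<Inter>j\<in>{..<k}. {\<theta>. dot n \<theta> (w j) = 0})"
  obtain \<theta>\<^sub>0 where "\<theta>\<^sub>0 \<in> Rn n" "dot n \<theta>\<^sub>0 \<theta>\<^sub>0 = 1" "\<And>j. j < k \<Longrightarrow> dot n \<theta>\<^sub>0 (w j) = 0"
    using orthonormal_extend[OF w k] by metis
  then have "\<theta>\<^sub>0 \<in> S" by (simp add: S_def)
  then have ne: "S \<noteq> {}" by blast
  have "compact S"
  proof (rule compact_RnI)
    show "S \<subseteq> Rn n" by (auto simp: S_def)
    have "S = Rn n \<inter> {\<theta>. dot n \<theta> \<theta> = 1} \<inter> (\<Inter>j\<in>{..<k}. {\<theta>. dot n \<theta> (w j) = 0})"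
      by (auto simp: S_def)
    also have "closed \<dots>"
      by (intro closed_Int closed_Rn closed_INT ballI closed_Collect_eq continuous_dot_left continuous_dot_self continuous_on_const)
    finally show "closed S" .
    show "\<bar>x i\<bar> \<le> 1" if "x \<in> S" "i < n" for x i
    proof -
      have "dot n x x = 1" using that(1) by (simp add: S_def)
      then have "(x i)\<^sup>2 \<le> 1" using abs_coord_le_dot[OF that(2), of x] by linarith
      then show ?thesis by (simp add: abs_square_le_1)
    qed
  qed
  from continuous_attains_sup[OF this ne continuous_bil_self[of _ n B]]
  obtain \<theta> where \<theta>: "\<theta> \<in> S" "\<And>x. x \<in> S \<Longrightarrow> bil n B x x \<le> bil n B \<theta> \<theta>" by blast
  show ?thesis
  proof (rule that[of \<theta>])
    fix x assume x: "\<And>j. j < k \<Longrightarrow> dot n x (w j) = 0"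
    show "bil n B x x \<le> bil n B \<theta> \<theta> * dot n x x"
    proof (cases "dot n x x = 0")
      case True
      then have "x i = 0" if "i < n" for i using dot_self_zero that by blast
      then have "bil n B x x = 0" by (simp add: bil_def)
      then show ?thesis using True by simp
    next
      case False
      then have pos: "dot n x x > 0" using dot_self_nonneg[of n x] by linarith
      define s where "s = 1 / sqrt (dot n x x)"
      define y where "y = (\<lambda>i\<in>{..<n}. s * x i)"
      have y: "dot n y z = s * dot n x z" for z
        unfolding y_def by (rule dot_scale_left)
      have s2: "s\<^sup>2 * dot n x x = 1" using pos by (simp add: s_def power_divide)
      have "dot n y y = s * (s * dot n x x)"
        unfolding y[of y] dot_commute[of n x y] y[of x] by (rule refl)
      then have "dot n y y = 1" using s2 by (simp add: power2_eq_square)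
      then have "y \<in> S" using x y by (auto simp: S_def y_def)
      from \<theta>(2)[OF this] have "s\<^sup>2 * bil n B x x \<le> bil n B \<theta> \<theta>"
        by (simp only: y_def bil_scale)
      then have "s\<^sup>2 * bil n B x x * dot n x x \<le> bil n B \<theta> \<theta> * dot n x x"
        by (rule mult_right_mono) (use pos in simp)
      moreover have "s\<^sup>2 * bil n B x x * dot n x x = bil n B x x"
        using s2 by (simp add: mult_ac)
      ultimately show ?thesis by simp
    qed
  qed (use \<theta>(1) in \<open>auto simp: S_def\<close>)
qed

lemma spectral_orthonormal:
  assumes sym: "\<And>i j. i < n \<Longrightarrow> j < n \<Longrightarrow> B i j = B j i"
  obtains w where "orthonormal n n w" "\<And>k l. k < n \<Longrightarrow> l < n \<Longrightarrow> k \<noteq> l \<Longrightarrow> bil n B (w k) (w l) = 0"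
proof -
  \<comment> \<open>The induction claims \<open>B\<close>-orthogonality to every \<open>v\<close>
    orthogonal to the vectors chosen up to \<open>j\<close>, since the later basis vectors are not
    known yet.\<close>
  have "\<exists>w. orthonormal n k w \<and> (\<forall>j<k. \<forall>v. (\<forall>i\<le>j. dot n v (w i) = 0) \<longrightarrow> bil n B (w j) v = 0)" if "k \<le> n" for k
    using that
  proof (induction k)
    case 0
    then show ?case by (auto simp: orthonormal_def)
  next
    case (Suc k)
    then obtain w where w: "orthonormal n k w" 
      "\<And>j v. j < k \<Longrightarrow> (\<And>i. i \<le> j \<Longrightarrow> dot n v (w i) = 0) \<Longrightarrow> bil n B (w j) v = 0" by force
    obtain \<theta> where \<theta>: "\<theta> \<in> Rn n" "dot n \<theta> \<theta> = 1" "\<And>j. j < k \<Longrightarrow> dot n \<theta> (w j) = 0"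
      "\<And>x. (\<And>j. j < k \<Longrightarrow> dot n x (w j) = 0) \<Longrightarrow> bil n B x x \<le> bil n B \<theta> \<theta> * dot n x x"
      using max_direction[OF w(1), of B] Suc.prems by (metis Suc_le_eq)
    \<comment> \<open>First variation at the maximiser \<open>\<theta>\<close> in the admissible
      direction \<open>v\<close>: the mixed term is linear in \<open>t\<close> and must
      vanish.\<close>
    have b0: "bil n B \<theta> v = 0" if v: "\<And>j. j < k \<Longrightarrow> dot n v (w j) = 0" "dot n v \<theta> = 0" for v
    proof (rule quadratic_zero)
      fix t
      let ?x = "\<lambda>i\<in>{..<n}. \<theta> i + t * v i"
      have d: "dot n ?x z = dot n \<theta> z + t * dot n v z" for z by (rule dot_add)
      have "dot n ?x ?x = dot n \<theta> ?x + t * dot n v ?x" by (rule d)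
      also have "\<dots> = dot n ?x \<theta> + t * dot n ?x v" by (simp only: dot_commute[of n ?x])
      also have "\<dots> = 1 + t\<^sup>2 * dot n v v"
        unfolding d using \<theta>(2) v(2) dot_commute[of n \<theta> v] by (simp add: power2_eq_square)
      finally have dx: "dot n ?x ?x = 1 + t\<^sup>2 * dot n v v" .
      have "bil n B ?x ?x \<le> bil n B \<theta> \<theta> * dot n ?x ?x"
        by (rule \<theta>(4)) (simp add: d \<theta>(3) v(1))
      moreover have "bil n B ?x ?x = bil n B \<theta> \<theta> + 2 * t * bil n B \<theta> v + t\<^sup>2 * bil n B v v"
        by (rule bil_add) (rule sym)
      ultimately have "bil n B \<theta> \<theta> + 2 * t * bil n B \<theta> v + t\<^sup>2 * bil n B v v \<le> bil n B \<theta> \<theta> * (1 + t\<^sup>2 * dot n v v)"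
        by (simp only: dx)
      then show "2 * t * bil n B \<theta> v \<le> t\<^sup>2 * (bil n B \<theta> \<theta> * dot n v v - bil n B v v)"
        by (simp add: algebra_simps)
    qed
    show ?case
    proof (intro exI[of _ "w(k := \<theta>)"] conjI allI impI)
      show "orthonormal n (Suc k) (w(k := \<theta>))"
        by (rule orthonormal_Suc[OF w(1) \<theta>(1-3)])
      fix j v assume j: "j < Suc k" and v: "\<forall>i\<le>j. dot n v ((w(k := \<theta>)) i) = 0"
      show "bil n B ((w(k := \<theta>)) j) v = 0"
      proof (cases "j = k")
        case True
        have "dot n v (w i) = 0" if "i < k" for i
          using v[rule_format, of i] that True by simp
        moreover have "dot n v \<theta> = 0" using v True by force
        ultimately show ?thesis using b0 True by simp
      next
        case False
        then have "j < k" using j by simp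
        moreover have "dot n v (w i) = 0" if "i \<le> j" for i
          using v[rule_format, OF that] that \<open>j < k\<close> by simp
        ultimately show ?thesis using w(2) by simp
      qed
    qed
  qed
  then obtain w where w: "orthonormal n n w"
      "\<And>j v. j < n \<Longrightarrow> (\<And>i. i \<le> j \<Longrightarrow> dot n v (w i) = 0) \<Longrightarrow> bil n B (w j) v = 0" by blast
  have lt: "bil n B (w k) (w l) = 0" if "k < l" "l < n" for k l
    using w that by (intro w(2)) (auto simp: orthonormal_def)
  have "bil n B (w l) (w k) = bil n B (w k) (w l)" for k l
  proof -
    have "bil n B (w l) (w k) = (\<Sum>j<n. \<Sum>i<n. B i j * w l i * w k j)" 
      unfolding bil_def by (rule sum.swap)
    also have "\<dots> = bil n B (w k) (w l)"
      unfolding bil_def by (intro sum.cong refl) (use sym in \<open>simp add: mult_ac\<close>)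
    finally show ?thesis .
  qed
  with lt have "bil n B (w k) (w l) = 0" if "k < n" "l < n" "k \<noteq> l" for k l
    using that by (metis nat_neq_iff)
  with w(1) show ?thesis by (rule that)
qed

section \<open>The Prekopa--Leindler inequality\<close>

text \<open>A bounded convex set of reals is an interval of which only the two end points are in
  doubt. This settles measurability and length together.\<close>

lemma emeasure_convex_real:
  fixes A :: "real set"
  assumes "convex A" "bounded A" "A \<noteq> {}"
  shows "{Inf A<..<Sup A} \<subseteq> A" "A \<subseteq> {Inf A..Sup A}" "A \<in> sets lborel"
    "emeasure lborel A = ennreal (Sup A - Inf A)" "Inf A \<le> Sup A" "Inf A = Sup A \<Longrightarrow> Inf A \<in> A"
proof -
  have bdd: "bdd_above A" "bdd_below A" using assms(2) by (auto simp: bounded_imp_bdd_above bounded_imp_bdd_below)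
  show 1: "{Inf A<..<Sup A} \<subseteq> A"
  proof
    fix x assume "x \<in> {Inf A<..<Sup A}"
    then obtain a b where "a \<in> A" "a < x" "b \<in> A" "x < b"
      using assms(3) bdd by (auto simp: less_cSup_iff cInf_less_iff)
    then show "x \<in> A" using mem_is_interval_1_I[of A a b x] assms(1) by (simp add: is_interval_convex_1)
  qed
  show 2: "A \<subseteq> {Inf A..Sup A}" using bdd by (auto intro: cInf_lower cSup_upper)
  have "A = {Inf A<..<Sup A} \<union> (A \<inter> {Inf A, Sup A})" using 1 2 by fastforce
  also have "\<dots> \<in> sets lborel" by (intro sets.Un) (auto intro: finite_imp_closed borel_closed)
  finally show "A \<in> sets lborel" .
  then have "emeasure lborel {Inf A<..<Sup A} \<le> emeasure lborel A" "emeasure lborel A \<le> emeasure lborel {Inf A..Sup A}"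
    using 1 2 by (auto intro!: emeasure_mono)
  moreover show 3: "Inf A \<le> Sup A" using assms(3) 2 by force
  ultimately show "emeasure lborel A = ennreal (Sup A - Inf A)" by simp
  show "Inf A \<in> A" if "Inf A = Sup A" using 2 assms(3) that by auto
qed

text \<open>The one-dimensional Brunn-Minkowski inequality for intervals, where it reduces to
  combining end points.\<close>

lemma emeasure_convex_comb_le:
  fixes A B :: "real set"
  assumes A: "convex A" "bounded A" "A \<noteq> {}" and B: "convex B" "bounded B" "B \<noteq> {}"
    and C: "C \<in> sets lborel" and t: "0 < t" "t < 1"
    and sub: "\<And>a b. a \<in> A \<Longrightarrow> b \<in> B \<Longrightarrow> (1 - t) * a + t * b \<in> C"
  shows "ennreal (1 - t) * emeasure lborel A + ennreal t * emeasure lborel B \<le> emeasure lborel C"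
proof -
  note EA = emeasure_convex_real[OF A] and EB = emeasure_convex_real[OF B]
  define l where "l = (1 - t) * Inf A + t * Inf B"
  define u where "u = (1 - t) * Sup A + t * Sup B"
  have "{l<..<u} \<subseteq> C"
  proof
    fix x assume x: "x \<in> {l<..<u}"
    \<comment> \<open>The relative position of \<open>x\<close> between \<open>l\<close> and
      \<open>u\<close>. The points of \<open>A\<close> and \<open>B\<close> at the same relative
      position combine to \<open>x\<close>; an interval shrunk to a point needs its own case, as its
      interior is empty.\<close>
    define \<theta> where "\<theta> = (x - l) / (u - l)"
    have \<theta>: "0 < \<theta>" "\<theta> < 1" using x by (auto simp: \<theta>_def divide_simps)
    have xe: "x = l + \<theta> * (u - l)" using x by (simp add: \<theta>_def)
    have pt: "Inf D + \<theta> * (Sup D - Inf D) \<in> D" if D: "convex D" "bounded D" "D \<noteq> {}" for D :: "real set"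
    proof (cases "Inf D = Sup D")
      case True
      then show ?thesis using emeasure_convex_real(6)[OF D True] by simp
    next
      case False
      then have "Inf D < Sup D" using emeasure_convex_real(5)[OF D] by simp
      then have "\<theta> * (Sup D - Inf D) > 0" "\<theta> * (Sup D - Inf D) < 1 * (Sup D - Inf D)"
        using \<theta> by (auto intro: mult_strict_right_mono)
      then have "Inf D + \<theta> * (Sup D - Inf D) \<in> {Inf D<..<Sup D}" by auto
      then show ?thesis using emeasure_convex_real(1)[OF D] by blast
    qed
    have "x = (1 - t) * (Inf A + \<theta> * (Sup A - Inf A)) + t * (Inf B + \<theta> * (Sup B - Inf B))"
      unfolding xe l_def u_def by (simp add: algebra_simps)
    then show "x \<in> C" using sub[OF pt[OF A] pt[OF B]] by simp
  qed
  then have "emeasure lborel {l<..<u} \<le> emeasure lborel C"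
    by (rule emeasure_mono[OF _ C])
  moreover have "l \<le> u"
    unfolding l_def u_def using EA(5) EB(5) t by (intro add_mono mult_left_mono) auto
  moreover have "ennreal (1 - t) * emeasure lborel A + ennreal t * emeasure lborel B = ennreal (u - l)"
    unfolding EA(4) EB(4) using t EA(5) EB(5)
  proof -
    have "ennreal (1 - t) * ennreal (Sup A - Inf A) + ennreal t * ennreal (Sup B - Inf B) =
        ennreal ((1 - t) * (Sup A - Inf A) + t * (Sup B - Inf B))"
      using t EA(5) EB(5) by (simp add: ennreal_mult')
    also have "(1 - t) * (Sup A - Inf A) + t * (Sup B - Inf B) = u - l"
      by (simp add: l_def u_def algebra_simps)
    finally show "ennreal (1 - t) * ennreal (Sup A - Inf A) + ennreal t * ennreal (Sup B - Inf B) = ennreal (u - l)" .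
  qed
  ultimately show ?thesis by simp
qed

lemma nn_integral_layer_cake:
  assumes [measurable]: "W \<in> borel_measurable borel"
  shows "(\<integral>\<^sup>+x. W x \<partial>lborel) = (\<integral>\<^sup>+s. emeasure lborel {x. 0 < s \<and> ennreal s < W x} \<partial>lborel)"
proof -
  have 1: "(\<integral>\<^sup>+s. indicator {s. 0 < s \<and> ennreal s < w} s \<partial>lborel) = w" for w :: ennreal
  proof (cases w)
    case (real r)
    then have "{s. 0 < s \<and> ennreal s < w} = {0<..<r}"
      by (auto simp: ennreal_less_iff)
    then show ?thesis using real by simp
  next
    case top
    have "emeasure lborel {0 :: real<..} = top"
    proof (rule ccontr)
      assume "emeasure lborel {0 :: real<..} \<noteq> top"
      then obtain r where r: "r \<ge> 0" "emeasure lborel {0 :: real<..} = ennreal r"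
        by (cases "emeasure lborel {0 :: real<..}") auto
      have "emeasure lborel {0<..<r + 1} \<le> emeasure lborel {0 :: real<..}"
        by (rule emeasure_mono) auto
      then show False using r by simp
    qed
    moreover have "{s. 0 < s \<and> ennreal s < w} = {0<..}" using top by auto
    ultimately show ?thesis using top by simp
  qed
  have [measurable]: "Measurable.pred (borel \<Otimes>\<^sub>M borel) (\<lambda>(x, s). 0 < s \<and> ennreal s < W x)"
    by measurable
  have "(\<integral>\<^sup>+x. W x \<partial>lborel) = (\<integral>\<^sup>+x. \<integral>\<^sup>+s. indicator {(x, s). 0 < s \<and> ennreal s < W x} (x, s) \<partial>lborel \<partial>lborel)"
    by (intro nn_integral_cong) (subst 1[symmetric], intro nn_integral_cong, simp add: indicator_def)
  also have "\<dots> = (\<integral>\<^sup>+s. \<integral>\<^sup>+x. indicator {(x, s). 0 < s \<and> ennreal s < W x} (x, s) \<partial>lborel \<partial>lborel)"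
    by (rule lborel_pair.Fubini'[symmetric]) (simp add: split_beta')
  also have "\<dots> = (\<integral>\<^sup>+s. emeasure lborel {x. 0 < s \<and> ennreal s < W x} \<partial>lborel)"
  proof (rule nn_integral_cong)
    fix s :: real
    have "(\<integral>\<^sup>+x. indicator {(x, s). 0 < s \<and> ennreal s < W x} (x, s) \<partial>lborel) =
      (\<integral>\<^sup>+x. indicator {x. 0 < s \<and> ennreal s < W x} x \<partial>lborel)"
      by (intro nn_integral_cong) (simp add: indicator_def)
    also have "\<dots> = emeasure lborel {x. 0 < s \<and> ennreal s < W x}"
      by (rule nn_integral_indicator) simp
    finally show "(\<integral>\<^sup>+x. indicator {(x, s). 0 < s \<and> ennreal s < W x} (x, s) \<partial>lborel) = \<dots>" .
  qed
  finally show ?thesis .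
qed

text \<open>Brunn-Minkowski is applied to the level sets and then integrated over the levels. It
  needs both sets nonempty, and equal suprema guarantee that the level sets of \<open>U\<close> and
  \<open>V\<close> become empty at the same height.\<close>

lemma nn_integral_level_set_comb:
  fixes U V W :: "real \<Rightarrow> ennreal"
  assumes m [measurable]: "U \<in> borel_measurable borel" "V \<in> borel_measurable borel" "W \<in> borel_measurable borel"
    and t: "0 < t" "t < 1"
    and W: "\<And>a b. min (U a) (V b) \<le> W ((1 - t) * a + t * b)"
    and U: "\<And>s. s > 0 \<Longrightarrow> convex {x. ennreal s < U x}" "\<And>s. s > 0 \<Longrightarrow> bounded {x. ennreal s < U x}"
    and V: "\<And>s. s > 0 \<Longrightarrow> convex {x. ennreal s < V x}" "\<And>s. s > 0 \<Longrightarrow> bounded {x. ennreal s < V x}"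
    and sup: "(SUP x. U x) = (SUP x. V x)"
  shows "ennreal (1 - t) * (\<integral>\<^sup>+x. U x \<partial>lborel) + ennreal t * (\<integral>\<^sup>+x. V x \<partial>lborel) \<le> (\<integral>\<^sup>+x. W x \<partial>lborel)"
proof -
  have meas: "(\<lambda>s. emeasure lborel {x. 0 < s \<and> ennreal s < F x}) \<in> borel_measurable lborel"
    if [measurable]: "F \<in> borel_measurable borel" for F :: "real \<Rightarrow> ennreal"
  proof -
    have *: "{p \<in> space (borel \<Otimes>\<^sub>M borel). 0 < fst p \<and> ennreal (fst p) < F (snd p)} \<in> sets (borel \<Otimes>\<^sub>M borel)"
      by measurable
    have "(\<lambda>s. emeasure lborel (Pair s -` {p \<in> space (borel \<Otimes>\<^sub>M borel). 0 < fst p \<and> ennreal (fst p) < F (snd p)})) \<in> borel_measurable lborel"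
      by (rule lborel.measurable_emeasure_Pair) (use * in simp)
    then show ?thesis by (simp add: space_pair_measure vimage_def)
  qed
  note [measurable] = meas[OF m(1)] meas[OF m(2)]
  have "ennreal (1 - t) * (\<integral>\<^sup>+x. U x \<partial>lborel) + ennreal t * (\<integral>\<^sup>+x. V x \<partial>lborel) =
    (\<integral>\<^sup>+s. ennreal (1 - t) * emeasure lborel {x. 0 < s \<and> ennreal s < U x} +
      ennreal t * emeasure lborel {x. 0 < s \<and> ennreal s < V x} \<partial>lborel)"
    unfolding nn_integral_layer_cake[OF m(1)] nn_integral_layer_cake[OF m(2)]
    by (simp add: nn_integral_add nn_integral_cmult)
  also have "\<dots> \<le> (\<integral>\<^sup>+s. emeasure lborel {x. 0 < s \<and> ennreal s < W x} \<partial>lborel)"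
  proof (rule nn_integral_mono)
    fix s :: real
    show "ennreal (1 - t) * emeasure lborel {x. 0 < s \<and> ennreal s < U x} +
      ennreal t * emeasure lborel {x. 0 < s \<and> ennreal s < V x} \<le> emeasure lborel {x. 0 < s \<and> ennreal s < W x}"
    proof (cases "0 < s \<and> ennreal s < (SUP x. U x)")
      case True
      have "{x. ennreal s < U x} \<noteq> {}" "{x. ennreal s < V x} \<noteq> {}"
        using True True[unfolded sup] unfolding less_SUP_iff by auto
      moreover have "{x. ennreal s < W x} \<in> sets lborel" by simp
      moreover have "ennreal s < W ((1 - t) * a + t * b)" if "ennreal s < U a" "ennreal s < V b" for a b
        using that by (intro less_le_trans[OF _ W]) simp
      ultimately have "ennreal (1 - t) * emeasure lborel {x. ennreal s < U x} +
          ennreal t * emeasure lborel {x. ennreal s < V x} \<le> emeasure lborel {x. ennreal s < W x}"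
        using U V True t by (intro emeasure_convex_comb_le) auto
      then show ?thesis using True by simp
    next
      case False
      have e: "{x. 0 < s \<and> ennreal s < U x} = {}" "{x. 0 < s \<and> ennreal s < V x} = {}"
        using False False[unfolded sup] unfolding less_SUP_iff by auto
      show ?thesis unfolding e by simp
    qed
  qed
  also have "\<dots> = (\<integral>\<^sup>+x. W x \<partial>lborel)" by (rule nn_integral_layer_cake[OF m(3), symmetric])
  finally show ?thesis .
qed

lemma ennreal_exp_le_mult:
  "ennreal (exp a) \<le> ennreal (exp c) * X \<longleftrightarrow> ennreal (exp (a - c)) \<le> X"
proof (cases X)
  case (real r)
  then show ?thesis
    by (simp add: ennreal_mult'[symmetric] exp_diff divide_le_eq mult.commute)
qed (simp add: ennreal_mult_top)

lemma ennreal_less_exp_mult: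
  assumes "s > 0"
  shows "ennreal s < ennreal (exp c) * X \<longleftrightarrow> ennreal (s * exp (- c)) < X"
proof (cases X)
  case (real r)
  then show ?thesis using assms
    by (simp add: ennreal_mult'[symmetric] ennreal_less_iff exp_minus field_simps)
qed (simp add: ennreal_mult_top)

lemma exp_convex_comb:
  fixes a b t :: real
  assumes "0 \<le> t" "t \<le> 1"
  shows "exp ((1 - t) * a + t * b) \<le> (1 - t) * exp a + t * exp b"
proof -
  define m where "m = (1 - t) * a + t * b"
  \<comment> \<open>The tangent of \<open>exp\<close> at \<open>m\<close>; its average over
    \<open>a\<close> and \<open>b\<close> has no linear term left.\<close>
  have e: "exp m * (1 + (x - m)) \<le> exp x" for x
  proof -
    have "exp m * (1 + (x - m)) \<le> exp m * exp (x - m)"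
      by (intro mult_left_mono exp_ge_add_one_self) simp
    then show ?thesis by (simp add: exp_add[symmetric])
  qed
  have "exp m = (1 - t) * (exp m * (1 + (a - m))) + t * (exp m * (1 + (b - m)))"
  proof -
    have "(1 - t) * (1 + (a - m)) + t * (1 + (b - m)) = 1"
      by (simp add: m_def algebra_simps)
    then have "exp m * ((1 - t) * (1 + (a - m)) + t * (1 + (b - m))) = exp m" by simp
    then show ?thesis by (simp only: distrib_left mult.left_commute mult.assoc)
  qed
  also have "\<dots> \<le> (1 - t) * exp a + t * exp b"
    using assms by (intro add_mono mult_left_mono e) auto
  finally show ?thesis by (simp add: m_def)
qed

lemma ennreal_exp_obtain:
  assumes "(X :: ennreal) \<noteq> 0" "X < \<infinity>"
  obtains u where "X = ennreal (exp u)"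
proof (cases X)
  case (real r)
  then have "r > 0" using assms(1) by (auto simp: less_le)
  then show ?thesis using that[of "ln r"] real by simp
qed (use assms in auto)

text \<open>Dividing \<open>U\<close> and \<open>V\<close> by their suprema makes the level-set
  inequality applicable, which bounds an arithmetic mean of the integrals. Convexity of
  \<open>exp\<close> turns it into the required geometric mean, and undoing the normalisation costs
  the same factor on both sides.\<close>

lemma prekopa_leindler_1d:
  fixes U V W :: "real \<Rightarrow> ennreal"
  assumes m [measurable]: "U \<in> borel_measurable borel" "V \<in> borel_measurable borel" "W \<in> borel_measurable borel"
    and t: "0 < t" "t < 1"
    and W: "\<And>a b \<alpha> \<beta>. ennreal (exp \<alpha>) \<le> U a \<Longrightarrow> ennreal (exp \<beta>) \<le> V b \<Longrightarrow>
       ennreal (exp ((1 - t) * \<alpha> + t * \<beta>)) \<le> W ((1 - t) * a + t * b)"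
    and U: "\<And>s. s > 0 \<Longrightarrow> convex {x. ennreal s < U x}" "\<And>s. s > 0 \<Longrightarrow> bounded {x. ennreal s < U x}"
      "\<And>x. U x \<le> ennreal B"
    and V: "\<And>s. s > 0 \<Longrightarrow> convex {x. ennreal s < V x}" "\<And>s. s > 0 \<Longrightarrow> bounded {x. ennreal s < V x}"
      "\<And>x. V x \<le> ennreal B"
    and int: "ennreal (exp \<alpha>) \<le> (\<integral>\<^sup>+x. U x \<partial>lborel)" "ennreal (exp \<beta>) \<le> (\<integral>\<^sup>+x. V x \<partial>lborel)"
  shows "ennreal (exp ((1 - t) * \<alpha> + t * \<beta>)) \<le> (\<integral>\<^sup>+x. W x \<partial>lborel)"
proof -
  have sup: "\<exists>u. (SUP x. F x) = ennreal (exp u)"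
    if F: "\<And>x. F x \<le> ennreal B" "ennreal (exp c) \<le> (\<integral>\<^sup>+x. F x \<partial>lborel)" for F :: "real \<Rightarrow> ennreal" and c
  proof -
    have "(SUP x. F x) \<noteq> 0"
    proof
      assume "(SUP x. F x) = 0"
      then have "F x = 0" for x using SUP_upper[of x UNIV F] by simp
      then show False using F(2) by simp
    qed
    moreover have "(SUP x. F x) \<le> ennreal B" using F(1) by (auto intro: SUP_least)
    then have "(SUP x. F x) < \<infinity>" using le_less_trans by fastforce
    ultimately show ?thesis using ennreal_exp_obtain by metis
  qed
  obtain u where u: "(SUP x. U x) = ennreal (exp u)" using sup[OF U(3) int(1)] by blast
  obtain v where v: "(SUP x. V x) = ennreal (exp v)" using sup[OF V(3) int(2)] by blast
  define w where "w = (1 - t) * u + t * v"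
  define U' where "U' x = ennreal (exp (- u)) * U x" for x
  define V' where "V' x = ennreal (exp (- v)) * V x" for x
  define W' where "W' x = ennreal (exp (- w)) * W x" for x
  have sup1: "(SUP x. U' x) = 1" "(SUP x. V' x) = 1"
    unfolding U'_def V'_def SUP_mult_left_ennreal[symmetric] u v
    by (simp_all add: ennreal_mult'[symmetric] exp_minus)
  have lev: "{x. ennreal s < U' x} = {x. ennreal (s * exp u) < U x}"
       "{x. ennreal s < V' x} = {x. ennreal (s * exp v) < V x}" if "s > 0" for s
    using that by (simp_all add: U'_def V'_def ennreal_less_exp_mult)
  have "min (U' a) (V' b) \<le> W' ((1 - t) * a + t * b)" for a b
  \<comment> \<open>The hypothesis \<open>W\<close> speaks of positive finite levels only, so the
    minimum, possibly 0, is approached from below.\<close>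
  proof (rule dense_le)
    fix x assume x: "x < min (U' a) (V' b)"
    have "x < \<infinity>" using less_le_trans[OF x top_greatest] by simp
    show "x \<le> W' ((1 - t) * a + t * b)"
    proof (cases "x = 0")
      case False
      then obtain \<gamma> where \<gamma>: "x = ennreal (exp \<gamma>)" using ennreal_exp_obtain \<open>x < \<infinity>\<close> by metis
      have "ennreal (exp (\<gamma> + u)) \<le> U a" "ennreal (exp (\<gamma> + v)) \<le> V b"
        using x \<gamma> ennreal_exp_le_mult[of \<gamma> "-u" "U a"] ennreal_exp_le_mult[of \<gamma> "-v" "V b"]
        by (simp_all add: U'_def V'_def less_imp_le)
      from W[OF this] have "ennreal (exp (\<gamma> + w)) \<le> W ((1 - t) * a + t * b)"
        by (simp add: w_def algebra_simps)
      then show ?thesis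
        using \<gamma> ennreal_exp_le_mult[of \<gamma> "-w"] by (simp add: W'_def)
    qed simp
  qed
  then have "ennreal (1 - t) * (\<integral>\<^sup>+x. U' x \<partial>lborel) + ennreal t * (\<integral>\<^sup>+x. V' x \<partial>lborel) \<le> (\<integral>\<^sup>+x. W' x \<partial>lborel)"
    using t U(1,2) V(1,2) sup1
    by (intro nn_integral_level_set_comb) (auto simp: lev, simp_all add: U'_def V'_def W'_def)
  moreover have "ennreal (exp (\<alpha> - u)) \<le> (\<integral>\<^sup>+x. U' x \<partial>lborel)"
    using int(1) ennreal_exp_le_mult[of "\<alpha> - u" "-u"] by (simp add: U'_def nn_integral_cmult)
  moreover have "ennreal (exp (\<beta> - v)) \<le> (\<integral>\<^sup>+x. V' x \<partial>lborel)"
    using int(2) ennreal_exp_le_mult[of "\<beta> - v" "-v"] by (simp add: V'_def nn_integral_cmult)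
  ultimately have "ennreal (1 - t) * ennreal (exp (\<alpha> - u)) + ennreal t * ennreal (exp (\<beta> - v)) \<le> (\<integral>\<^sup>+x. W' x \<partial>lborel)"
    by (meson add_mono mult_left_mono order_trans zero_le)
  moreover have "ennreal (exp ((1 - t) * (\<alpha> - u) + t * (\<beta> - v))) \<le> ennreal (1 - t) * ennreal (exp (\<alpha> - u)) + ennreal t * ennreal (exp (\<beta> - v))"
    using t exp_convex_comb[of t "\<alpha> - u" "\<beta> - v"]
    by (simp add: ennreal_mult'[symmetric] ennreal_plus[symmetric] ennreal_leI del: ennreal_plus)
  ultimately have "ennreal (exp ((1 - t) * (\<alpha> - u) + t * (\<beta> - v))) \<le> (\<integral>\<^sup>+x. W' x \<partial>lborel)"
    by (rule order_trans[rotated])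
  then have "ennreal (exp ((1 - t) * (\<alpha> - u) + t * (\<beta> - v) + w)) \<le> (\<integral>\<^sup>+x. W x \<partial>lborel)"
    using ennreal_exp_le_mult[of "(1 - t) * (\<alpha> - u) + t * (\<beta> - v)" "-w"] by (simp add: W'_def nn_integral_cmult)
  then show ?thesis by (simp add: w_def algebra_simps)
qed

text \<open>Log-concavity is stated as convexity of the hypograph of \<open>ln F\<close>, which avoids powers of
  extended non-negative reals.\<close>

definition log_concave :: "nat \<Rightarrow> ((nat \<Rightarrow> real) \<Rightarrow> ennreal) \<Rightarrow> bool"
  where "log_concave n F \<longleftrightarrow> (\<forall>x\<in>Rn n. \<forall>y\<in>Rn n. \<forall>t \<alpha> \<beta>. 0 < t \<longrightarrow> t < 1 \<longrightarrow>
    ennreal (exp \<alpha>) \<le> F x \<longrightarrow> ennreal (exp \<beta>) \<le> F y \<longrightarrow>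
    ennreal (exp ((1 - t) * \<alpha> + t * \<beta>)) \<le> F (comb n t x y))"

lemma log_concaveD:
  assumes "log_concave n F" "x \<in> Rn n" "y \<in> Rn n" "0 < t" "t < 1"
    "ennreal (exp \<alpha>) \<le> F x" "ennreal (exp \<beta>) \<le> F y"
  shows "ennreal (exp ((1 - t) * \<alpha> + t * \<beta>)) \<le> F (comb n t x y)"
  using assms unfolding log_concave_def by blast

lemma comb_upd:
  "comb (Suc n) t (x(n := a)) (y(n := b)) = (comb n t x y)(n := (1 - t) * a + t * b)"
  by (auto simp: comb_def fun_eq_iff)

text \<open>Quasi-concavity is given for closed levels, the conclusion concerns strict ones; a level
  \<open>r\<close> strictly between \<open>s\<close> and the smaller of both values connects
  them.\<close>

lemma convex_level_set_of_min:
  fixes U :: "real \<Rightarrow> ennreal"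
  assumes "\<And>a b t r. 0 < t \<Longrightarrow> t < 1 \<Longrightarrow> r > 0 \<Longrightarrow> ennreal r \<le> U a \<Longrightarrow> ennreal r \<le> U b \<Longrightarrow>
    ennreal r \<le> U ((1 - t) * a + t * b)" and s: "s > 0"
  shows "convex {x. ennreal s < U x}"
  unfolding convex_alt
proof (intro ballI allI impI)
  fix a b t assume ab: "a \<in> {x. ennreal s < U x}" "b \<in> {x. ennreal s < U x}" and t: "0 \<le> t \<and> t \<le> (1::real)"
  consider "t = 0" | "t = 1" | "0 < t" "t < 1" using t by linarith
  then show "(1 - t) *\<^sub>R a + t *\<^sub>R b \<in> {x. ennreal s < U x}"
  proof cases
    case 3
    obtain x where x: "ennreal s < x" "x < min (U a) (U b)"
      using dense[of "ennreal s" "min (U a) (U b)"] ab by auto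
    then have "x < top" by (meson less_le_trans top_greatest min.cobounded1)
    then obtain r where r: "x = ennreal r" "r \<ge> 0" by (cases x) auto
    have "s < r" using x(1) r s by (simp add: ennreal_less_iff)
    then have "ennreal r \<le> U ((1 - t) * a + t * b)"
      using 3 r x(2) s by (intro assms(1)) (auto simp: less_imp_le)
    then show ?thesis using x(1) r by simp
  qed (use ab in auto)
qed

text \<open>Log-concave functions bounded by \<open>B\<close> and supported in the cube of half-side
  \<open>R\<close>: the boundedness demands of the one-dimensional inequality, in a form that
  survives integrating out a coordinate.\<close>

definition nice :: "nat \<Rightarrow> real \<Rightarrow> real \<Rightarrow> ((nat \<Rightarrow> real) \<Rightarrow> ennreal) \<Rightarrow> bool"
  where "nice n B R F \<longleftrightarrow> F \<in> borel_measurable (leb n) \<and> 0 \<le> B \<and> 0 \<le> R \<and> (\<forall>x\<in>Rn n. F x \<le> ennreal B) \<and>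
    (\<forall>x\<in>Rn n. F x \<noteq> 0 \<longrightarrow> (\<forall>i<n. \<bar>x i\<bar> \<le> R)) \<and> log_concave n F"

text \<open>Prekopa's theorem for one variable. The new bound is the old one times the length 2R of
  the interval that contains the support of every line restriction.\<close>

lemma nice_marginal:
  assumes F: "nice (Suc n) B R F"
  shows "nice n (B * (2 * R)) R (\<lambda>y. \<integral>\<^sup>+s. F (y(n := s)) \<partial>lborel)"
proof -
  have m [measurable]: "F \<in> borel_measurable (leb (Suc n))" and BR: "0 \<le> B" "0 \<le> R"
    and bd: "\<And>x. x \<in> Rn (Suc n) \<Longrightarrow> F x \<le> ennreal B"
    and supp: "\<And>x i. x \<in> Rn (Suc n) \<Longrightarrow> F x \<noteq> 0 \<Longrightarrow> i < Suc n \<Longrightarrow> \<bar>x i\<bar> \<le> R"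
    and lc: "log_concave (Suc n) F"
    using F unfolding nice_def by auto
  have sm: "(\<lambda>s. F (y(n := s))) \<in> borel_measurable borel" if "y \<in> Rn n" for y
  proof (rule measurable_compose[OF _ m])
    show "(\<lambda>s. y(n := s)) \<in> borel \<rightarrow>\<^sub>M leb (Suc n)"
    proof (rule measurable_lebI)
      show "(\<lambda>s. (y(n := s)) i) \<in> borel_measurable borel" for i by (cases "i = n") auto
    qed (use that in \<open>simp del: fun_upd_apply\<close>)
  qed
  show ?thesis
    unfolding nice_def
  proof (intro conjI ballI impI allI)
    have "(\<lambda>p. F ((fst p)(n := snd p))) \<in> borel_measurable (leb n \<Otimes>\<^sub>M lborel)"
      using measurable_compose[OF measurable_upd_Suc m] by simp
    then show "(\<lambda>y. \<integral>\<^sup>+s. F (y(n := s)) \<partial>lborel) \<in> borel_measurable (leb n)"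
      by (intro lborel.borel_measurable_nn_integral) (simp add: split_beta')
    show "0 \<le> B * (2 * R)" "0 \<le> R" using BR by auto
  next
    fix y assume y: "y \<in> Rn n"
    have "F (y(n := s)) \<le> ennreal B * indicator {-R..R} s" for s
    proof (cases "F (y(n := s)) = 0")
      case False
      then have "\<bar>(y(n := s)) n\<bar> \<le> R" by (rule supp[OF Rn_upd_Suc[OF y]]) simp
      then have "s \<in> {-R..R}" by auto
      then show ?thesis using bd[OF Rn_upd_Suc[OF y], of s] by simp
    qed simp
    then have "(\<integral>\<^sup>+s. F (y(n := s)) \<partial>lborel) \<le> (\<integral>\<^sup>+s. ennreal B * indicator {-R..R} s \<partial>lborel)"
      by (intro nn_integral_mono)
    also have "\<dots> = ennreal (B * (2 * R))"
      using BR by (simp add: nn_integral_cmult ennreal_mult')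
    finally show "(\<integral>\<^sup>+s. F (y(n := s)) \<partial>lborel) \<le> ennreal (B * (2 * R))" .
  next
    fix y i assume y: "y \<in> Rn n" and i: "i < n" and nz: "(\<integral>\<^sup>+s. F (y(n := s)) \<partial>lborel) \<noteq> 0"
    then obtain s where "F (y(n := s)) \<noteq> 0" by (metis nn_integral_0_iff_AE nn_integral_const mult_zero_left nn_integral_cong)
    then show "\<bar>y i\<bar> \<le> R" using supp[of "y(n := s)" i] y i by simp
  next
    show "log_concave n (\<lambda>y. \<integral>\<^sup>+s. F (y(n := s)) \<partial>lborel)"
      unfolding log_concave_def
    proof (intro ballI allI impI)
      fix x y t \<alpha> \<beta>
      assume x: "x \<in> Rn n" and y: "y \<in> Rn n" and t: "0 < t" "t < (1::real)"
        and int: "ennreal (exp \<alpha>) \<le> (\<integral>\<^sup>+s. F (x(n := s)) \<partial>lborel)" "ennreal (exp \<beta>) \<le> (\<integral>\<^sup>+s. F (y(n := s)) \<partial>lborel)"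
      have lev: "convex {a. ennreal s < F (z(n := a))}" "bounded {a. ennreal s < F (z(n := a))}"
        if z: "z \<in> Rn n" and s: "s > 0" for z s
      proof -
        show "convex {a. ennreal s < F (z(n := a))}"
        proof (rule convex_level_set_of_min[OF _ s])
          fix a b t r :: real
          assume *: "0 < t" "t < 1" "r > 0" "ennreal r \<le> F (z(n := a))" "ennreal r \<le> F (z(n := b))"
          have zz: "comb n t z z = z" by (rule Rn_eqI[of _ n]) (use z in \<open>auto simp: comb_def algebra_simps\<close>)
          have r: "r = exp (ln r)" "(1 - t) * ln r + t * ln r = ln r" using * by (simp_all add: algebra_simps)
          show "ennreal r \<le> F (z(n := (1 - t) * a + t * b))"
            using log_concaveD[OF lc, of "z(n := a)" "z(n := b)" t "ln r" "ln r"] * z r(2)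
            by (simp add: comb_upd zz del: fun_upd_apply)
        qed
        have "{a. ennreal s < F (z(n := a))} \<subseteq> {-R..R}"
        proof
          fix a assume "a \<in> {a. ennreal s < F (z(n := a))}"
          then have "F (z(n := a)) \<noteq> 0" by auto
          then have "\<bar>(z(n := a)) n\<bar> \<le> R" by (rule supp[OF Rn_upd_Suc[OF z]]) simp
          then show "a \<in> {-R..R}" by auto
        qed
        then show "bounded {a. ennreal s < F (z(n := a))}"
          using bounded_subset[OF bounded_closed_interval] by blast
      qed
      show "ennreal (exp ((1 - t) * \<alpha> + t * \<beta>)) \<le> (\<integral>\<^sup>+s. F ((comb n t x y)(n := s)) \<partial>lborel)"
      proof (rule prekopa_leindler_1d[where U="\<lambda>s. F (x(n := s))" and V="\<lambda>s. F (y(n := s))" and B=B, OF sm[OF x] sm[OF y] sm t _ lev(1)[OF x] lev(2)[OF x] _ lev(1)[OF y] lev(2)[OF y] _ int])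
        fix a b \<alpha> \<beta> assume "ennreal (exp \<alpha>) \<le> F (x(n := a))" "ennreal (exp \<beta>) \<le> F (y(n := b))"
        then show "ennreal (exp ((1 - t) * \<alpha> + t * \<beta>)) \<le> F ((comb n t x y)(n := (1 - t) * a + t * b))"
          using log_concaveD[OF lc, of "x(n := a)" "y(n := b)" t \<alpha> \<beta>] x y t
          by (simp add: comb_upd del: fun_upd_apply)
      qed (use x y bd in \<open>auto simp del: fun_upd_apply\<close>)
    qed
  qed
qed

lemma log_concave_fibre_integral:
  assumes "nice (d + e) B R F"
  shows "log_concave d (\<lambda>y. \<integral>\<^sup>+z. F (app d e y z) \<partial>leb e)"
  using assms
proof (induction e arbitrary: F B)
  case 0
  have "app d 0 y (\<lambda>_. undefined) = y" if "y \<in> Rn d" for y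
    by (rule Rn_eqI[of _ d]) (use that in \<open>auto simp: app_def Rn_def\<close>)
  then show ?case using 0 by (simp add: nn_integral_leb_0 nice_def log_concave_def)
next
  case (Suc e)
  have m: "F \<in> borel_measurable (leb (d + Suc e))" using Suc.prems by (simp add: nice_def)
  have app_upd: "app d (Suc e) y (z(e := s)) = (app d e y z)(d + e := s)" for y z s
    by (auto simp: app_def fun_eq_iff)
  have eq: "(\<integral>\<^sup>+z. F (app d (Suc e) y z) \<partial>leb (Suc e)) =
      (\<integral>\<^sup>+z. \<integral>\<^sup>+s. F ((app d e y z)(d + e := s)) \<partial>lborel \<partial>leb e)" if "y \<in> Rn d" for y
    using measurable_compose[OF measurable_app_right[OF that] m]
    by (subst nn_integral_leb_Suc) (simp_all add: app_upd)
  have "log_concave d (\<lambda>y. \<integral>\<^sup>+z. \<integral>\<^sup>+s. F ((app d e y z)(d + e := s)) \<partial>lborel \<partial>leb e)"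
    by (rule Suc.IH) (rule nice_marginal, use Suc.prems in simp)
  then show ?case unfolding log_concave_def using eq by simp
qed

text \<open>The parallel section function of \<open>K\<close>, and equally the density of the image
  of Lebesgue measure on \<open>K\<close> under projection to the first \<open>d\<close>
  coordinates. This is the f of the overview.\<close>

definition fibre :: "nat \<Rightarrow> nat \<Rightarrow> (nat \<Rightarrow> real) set \<Rightarrow> (nat \<Rightarrow> real) \<Rightarrow> ennreal"
  where "fibre d e K y = (\<integral>\<^sup>+z. indicator K (app d e y z) \<partial>leb e)"

lemma nice_indicator:
  assumes K: "K \<subseteq> Rn n" "K \<in> sets (leb n)" "cvx n K" "\<And>x i. x \<in> K \<Longrightarrow> i < n \<Longrightarrow> \<bar>x i\<bar> \<le> R" "0 \<le> R"
  shows "nice n 1 R (indicator K)"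
  unfolding nice_def
proof (intro conjI ballI impI allI)
  show "log_concave n (indicator K)"
    unfolding log_concave_def
  proof (intro ballI allI impI)
    fix x y t \<alpha> \<beta>
    assume t: "0 < t" "t < (1::real)" and *: "ennreal (exp \<alpha>) \<le> indicator K x" "ennreal (exp \<beta>) \<le> indicator K y"
    have ind: "z \<in> K \<and> c \<le> 0" if "ennreal (exp c) \<le> indicator K z" for z c
      using that by (cases "z \<in> K") auto
    have xy: "x \<in> K" "y \<in> K" "\<alpha> \<le> 0" "\<beta> \<le> 0"
      using ind[OF *(1)] ind[OF *(2)] by auto
    then have "comb n t x y \<in> K" using K(3) t by (auto simp: cvx_def)
    moreover have "(1 - t) * \<alpha> + t * \<beta> \<le> 0"
      using xy t by (intro add_nonpos_nonpos mult_nonneg_nonpos) auto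
    ultimately show "ennreal (exp ((1 - t) * \<alpha> + t * \<beta>)) \<le> indicator K (comb n t x y)"
      by simp
  qed
next
  fix x i assume "indicator K x \<noteq> (0 :: ennreal)" "i < n"
  then show "\<bar>x i\<bar> \<le> R" using K(4) by (auto simp: indicator_def split: if_splits)
qed (use K in \<open>auto simp: indicator_def\<close>)

lemma convex_body_nice:
  assumes "convex_body n K"
  obtains R where "R > 0" "\<And>x i. x \<in> K \<Longrightarrow> i < n \<Longrightarrow> \<bar>x i\<bar> \<le> R" "nice n 1 R (indicator K)"
proof -
  obtain R where R: "R > 0" "\<And>x i. x \<in> K \<Longrightarrow> i < n \<Longrightarrow> \<bar>x i\<bar> \<le> R"
    using compact_bounded_coord[OF convex_body_compact[OF assms]] by metis
  have "nice n 1 R (indicator K)"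
    by (rule nice_indicator) (use convex_bodyD[OF assms] R in auto)
  then show ?thesis using that[of R] R by blast
qed

section \<open>Fibre volumes and barycentres\<close>

text \<open>Upper semicontinuity by sequences: superlevel sets are closed. It is what makes the
  hypograph of ln f and the Ball body closed.\<close>

definition usc :: "nat \<Rightarrow> ((nat \<Rightarrow> real) \<Rightarrow> ennreal) \<Rightarrow> bool"
  where "usc n f \<longleftrightarrow> (\<forall>X y c. (\<forall>m. X m \<in> Rn n) \<longrightarrow> y \<in> Rn n \<longrightarrow> X \<longlonglongrightarrow> y \<longrightarrow> (\<forall>m. c \<le> f (X m)) \<longrightarrow> c \<le> f y)"

lemma tendsto_app:
  assumes "X \<longlonglongrightarrow> y"
  shows "(\<lambda>m. app d e (X m) z) \<longlonglongrightarrow> app d e y z"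
  unfolding tendsto_fun_iff
proof
  fix i
  show "(\<lambda>m. app d e (X m) z i) \<longlonglongrightarrow> app d e y z i"
    using assms unfolding tendsto_fun_iff app_def by (cases "i < d + e"; cases "i < d") auto
qed

lemma limsup_indicator_closed:
  assumes "closed K" "x \<longlonglongrightarrow> l"
  shows "limsup (\<lambda>m. indicator K (x m) :: ennreal) \<le> indicator K l"
proof (cases "l \<in> K")
  case True
  have "limsup (\<lambda>m. indicator K (x m) :: ennreal) \<le> 1"
    by (rule Limsup_bounded) (auto simp: indicator_def)
  then show ?thesis using True by simp
next
  case False
  then have "eventually (\<lambda>m. x m \<in> - K) sequentially"
    using assms by (intro topological_tendstoD) (auto simp: open_Compl)
  then have "limsup (\<lambda>m. indicator K (x m) :: ennreal) \<le> 0"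
    by (intro Limsup_bounded) (auto elim!: eventually_mono)
  then show ?thesis by simp
qed

lemma app_in_box:
  assumes "\<forall>x\<in>K. \<forall>i<d + e. \<bar>x i\<bar> \<le> R" "app d e y z \<in> K" "z \<in> Rn e"
  shows "z \<in> Pi\<^sub>E {..<e} (\<lambda>_. {-R..R})"
proof -
  have "\<bar>z i\<bar> \<le> R" if "i < e" for i
    using assms(1)[rule_format, OF assms(2), of "d + i"] that by (simp add: app_def)
  then show ?thesis using assms(3) unfolding mem_box by (auto simp: abs_le_iff minus_le_iff)
qed

text \<open>Reverse Fatou: the indicator of a closed set is upper semicontinuous, and all sections
  lie in one box of finite measure.\<close>

lemma fibre_usc:
  assumes K: "closed K" "K \<in> sets (leb (d + e))" and R: "\<And>x i. x \<in> K \<Longrightarrow> i < d + e \<Longrightarrow> \<bar>x i\<bar> \<le> R" "R > 0"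
  shows "usc d (fibre d e K)"
  unfolding usc_def
proof (intro allI impI)
  fix X :: "nat \<Rightarrow> nat \<Rightarrow> real" and y c
  assume X: "\<forall>m. X m \<in> Rn d" and y: "y \<in> Rn d" and lim: "X \<longlonglongrightarrow> y" and c: "\<forall>m. c \<le> fibre d e K (X m)"
  have box: "\<forall>x\<in>K. \<forall>i<d + e. \<bar>x i\<bar> \<le> R" using R by blast
  have m: "(\<lambda>z. indicator K (app d e y z) :: ennreal) \<in> borel_measurable (leb e)" if "y \<in> Rn d" for y
    by (rule measurable_compose[OF measurable_app_right[OF that]]) (use K in auto)
  have "c \<le> limsup (\<lambda>m. fibre d e K (X m))"
    using c by (intro le_Limsup) auto
  also have "\<dots> \<le> (\<integral>\<^sup>+z. limsup (\<lambda>m. indicator K (app d e (X m) z)) \<partial>leb e)"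
    unfolding fibre_def
  proof (rule nn_integral_limsup[where w="indicator (Pi\<^sub>E {..<e} (\<lambda>_. {-R..R}))"])
    show "AE z in leb e. indicator K (app d e (X i) z) \<le> (indicator (Pi\<^sub>E {..<e} (\<lambda>_. {-R..R})) z :: ennreal)" for i
    proof (rule AE_I2)
      fix z assume "z \<in> space (leb e)"
      then show "indicator K (app d e (X i) z) \<le> (indicator (Pi\<^sub>E {..<e} (\<lambda>_. {-R..R})) z :: ennreal)"
        using app_in_box[OF box, of "X i" z] by (simp add: indicator_def)
    qed
    show "(\<integral>\<^sup>+x. indicator (Pi\<^sub>E {..<e} (\<lambda>_. {-R..R})) x \<partial>leb e) < \<infinity>"
      using R(2) by (simp add: emeasure_leb_box power_less_top_ennreal)
  qed (use X m in auto)
  also have "\<dots> \<le> fibre d e K y"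
    unfolding fibre_def
    by (intro nn_integral_mono limsup_indicator_closed K(1) tendsto_app lim)
  finally show "c \<le> fibre d e K y" .
qed

lemma fibre_nice:
  assumes "convex_body (d + e) K"
  obtains B R where "R > 0" "nice d B R (fibre d e K)" "usc d (fibre d e K)"
    "\<And>x i. x \<in> K \<Longrightarrow> i < d + e \<Longrightarrow> \<bar>x i\<bar> \<le> R"
proof -
  obtain R where R: "R > 0" "\<And>x i. x \<in> K \<Longrightarrow> i < d + e \<Longrightarrow> \<bar>x i\<bar> \<le> R" "nice (d + e) 1 R (indicator K)"
    using convex_body_nice[OF assms] by metis
  note [measurable] = convex_body_sets[OF assms]
  have box: "\<forall>x\<in>K. \<forall>i<d + e. \<bar>x i\<bar> \<le> R" using R by blast
  have "nice d ((2 * R) ^ e) R (fibre d e K)"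
    unfolding nice_def
  proof (intro conjI ballI impI allI)
    have "(\<lambda>p. indicator K (app d e (fst p) (snd p)) :: ennreal) \<in> borel_measurable (leb d \<Otimes>\<^sub>M leb e)"
      using measurable_compose[OF measurable_app, of "indicator K"] by simp
    then show "fibre d e K \<in> borel_measurable (leb d)"
      unfolding fibre_def by (intro leb.borel_measurable_nn_integral) (simp add: split_beta')
    show "log_concave d (fibre d e K)"
      unfolding fibre_def by (rule log_concave_fibre_integral[OF R(3)])
  next
    fix y assume "y \<in> Rn d"
    have "fibre d e K y \<le> (\<integral>\<^sup>+z. indicator (Pi\<^sub>E {..<e} (\<lambda>_. {-R..R})) z \<partial>leb e)"
      unfolding fibre_def
    proof (rule nn_integral_mono)
      fix z assume "z \<in> space (leb e)"
      then show "indicator K (app d e y z) \<le> (indicator (Pi\<^sub>E {..<e} (\<lambda>_. {-R..R})) z :: ennreal)"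
        using app_in_box[OF box, of y z] by (simp add: indicator_def)
    qed
    also have "\<dots> = ennreal ((2 * R) ^ e)"
      using R(1) by (simp add: emeasure_leb_box)
    finally show "fibre d e K y \<le> ennreal ((2 * R) ^ e)" .
  next
    fix y i assume y: "fibre d e K y \<noteq> 0" "i < d"
    have "\<exists>z. app d e y z \<in> K"
    proof (rule ccontr)
      assume "\<not> ?thesis"
      then have "fibre d e K y = (\<integral>\<^sup>+z. 0 \<partial>leb e)" unfolding fibre_def by (intro nn_integral_cong) simp
      then show False using y by simp
    qed
    then obtain z where "app d e y z \<in> K" ..
    from R(2)[OF this, of i] y(2) show "\<bar>y i\<bar> \<le> R" by (simp add: app_def)
  qed (use R(1) in auto)
  moreover have "usc d (fibre d e K)"
    by (rule fibre_usc[OF compact_imp_closed[OF convex_body_compact[OF assms]] convex_body_sets[OF assms] _ R(1)])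
       (use R(2) in auto)
  ultimately show ?thesis using that[of R] R by blast
qed

section \<open>Projection of a body to its first coordinates\<close>

lemma measurable_restrict_leb: "d \<le> n \<Longrightarrow> (\<lambda>x. restrict x {..<d}) \<in> leb n \<rightarrow>\<^sub>M leb d"
  by (rule measurable_lebI) auto

lemma restrict_app: "y \<in> Rn d \<Longrightarrow> restrict (app d e y z) {..<d} = y"
  by (auto simp: app_def fun_eq_iff Rn_def PiE_def extensional_def)

text \<open>Fubini, stated for measures, so that moments of the section function can be read off as
  moments of \<open>K\<close>.\<close>

lemma distr_fibre:
  assumes K: "K \<in> sets (leb (d + e))" and f: "fibre d e K \<in> borel_measurable (leb d)"
  shows "distr (density (leb (d + e)) (indicator K)) (leb d) (\<lambda>x. restrict x {..<d}) = density (leb d) (fibre d e K)"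
proof (rule measure_eqI)
  fix A assume "A \<in> sets (distr (density (leb (d + e)) (indicator K)) (leb d) (\<lambda>x. restrict x {..<d}))"
  then have A [measurable]: "A \<in> sets (leb d)" by simp
  note [measurable] = K f
  have pr [measurable]: "(\<lambda>x. restrict x {..<d}) \<in> leb (d + e) \<rightarrow>\<^sub>M leb d" by (rule measurable_restrict_leb) simp
  have "emeasure (distr (density (leb (d + e)) (indicator K)) (leb d) (\<lambda>x. restrict x {..<d})) A
    = emeasure (density (leb (d + e)) (indicator K)) ((\<lambda>x. restrict x {..<d}) -` A \<inter> Rn (d + e))"
    by (subst emeasure_distr) auto
  also have "\<dots> = (\<integral>\<^sup>+x. indicator K x * indicator ((\<lambda>x. restrict x {..<d}) -` A \<inter> Rn (d + e)) x \<partial>leb (d + e))"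
    by (rule emeasure_density) (use measurable_sets[OF pr A] in auto)
  also have "\<dots> = (\<integral>\<^sup>+x. indicator K x * indicator A (restrict x {..<d}) \<partial>leb (d + e))"
    by (intro nn_integral_cong) (auto simp: indicator_def)
  also have "\<dots> = (\<integral>\<^sup>+y. \<integral>\<^sup>+z. indicator K (app d e y z) * indicator A (restrict (app d e y z) {..<d}) \<partial>leb e \<partial>leb d)"
    by (rule nn_integral_leb_app) measurable
  also have "\<dots> = (\<integral>\<^sup>+y. fibre d e K y * indicator A y \<partial>leb d)"
  proof (rule nn_integral_cong)
    fix y assume "y \<in> space (leb d)"
    then have y: "y \<in> Rn d" by simp
    have "(\<lambda>z. indicator K (app d e y z) :: ennreal) \<in> borel_measurable (leb e)"
      by (rule measurable_compose[OF measurable_app_right[OF y]]) measurable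
    then show "(\<integral>\<^sup>+z. indicator K (app d e y z) * indicator A (restrict (app d e y z) {..<d}) \<partial>leb e) = fibre d e K y * indicator A y"
      unfolding restrict_app[OF y] fibre_def by (rule nn_integral_multc)
  qed
  also have "\<dots> = emeasure (density (leb d) (fibre d e K)) A"
    by (rule emeasure_density[symmetric]) auto
  finally show "emeasure (distr (density (leb (d + e)) (indicator K)) (leb d) (\<lambda>x. restrict x {..<d})) A = \<dots>" .
qed simp

lemma fibre_integral:
  assumes K: "K \<in> sets (leb (d + e))" and f: "fibre d e K \<in> borel_measurable (leb d)"
    and h [measurable]: "h \<in> borel_measurable (leb d)"
  shows "(LINT y|density (leb d) (fibre d e K). h y) = (LINT x:K|leb (d + e). (h (restrict x {..<d}) :: real))"
proof -
  have pr [measurable]: "(\<lambda>x. restrict x {..<d}) \<in> leb (d + e) \<rightarrow>\<^sub>M leb d" by (rule measurable_restrict_leb) simp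
  note [measurable] = K
  have ind: "density (leb (d + e)) (indicator K) = density (leb (d + e)) (\<lambda>x. ennreal (indicator K x))"
    by (intro density_cong) (auto simp: indicator_def)
  have "(LINT y|density (leb d) (fibre d e K). h y) = (LINT x|density (leb (d + e)) (\<lambda>x. ennreal (indicator K x)). h (restrict x {..<d}))"
    unfolding distr_fibre[OF K f, symmetric] ind by (rule integral_distr) auto
  also have "\<dots> = (LINT x:K|leb (d + e). (h (restrict x {..<d}) :: real))"
    by (subst integral_real_density) (auto simp: set_lebesgue_integral_def)
  finally show ?thesis .
qed

text \<open>Were the barycentre \<open>c\<close> outside \<open>D\<close>, the nearest point
  \<open>q\<close> of \<open>D\<close> would separate it: the product of q - c with y - c is at
  least |q - c|^2 on \<open>D\<close>, whereas its integral is 0. The random vector \<open>X\<close>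
  is general because the lemma is used both for bodies and for hypographs.\<close>

lemma barycentre_in_closed_convex:
  fixes X :: "'a \<Rightarrow> nat \<Rightarrow> real"
  assumes D: "D \<subseteq> Rn n" "closed D" "cvx n D"
    and F: "emeasure M (space M) = ennreal F" "F > 0"
    and X: "\<And>i. i < n \<Longrightarrow> integrable M (\<lambda>\<omega>. X \<omega> i)" "AE \<omega> in M. X \<omega> \<in> D"
  shows "(\<lambda>i\<in>{..<n}. (\<integral>\<omega>. X \<omega> i \<partial>M) / F) \<in> D"
proof (rule ccontr)
  define c where "c = (\<lambda>i\<in>{..<n}. (\<integral>\<omega>. X \<omega> i \<partial>M) / F)"
  assume "(\<lambda>i\<in>{..<n}. (\<integral>\<omega>. X \<omega> i \<partial>M) / F) \<notin> D"
  then have cD: "c \<notin> D" by (simp add: c_def)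
  define g where "g y = (\<Sum>i<n. (y i - c i)\<^sup>2)" for y
  have "D \<noteq> {}"
  proof
    assume "D = {}"
    then have "emeasure M (space M) = 0" using X(2) by (intro AE_iff_measurable[THEN iffD1, of "space M" M "\<lambda>\<omega>. X \<omega> \<in> D"]) auto
    then show False using F by simp
  qed
  then obtain p where p: "p \<in> D" by blast
  \<comment> \<open>Cutting \<open>D\<close> with a ball about \<open>c\<close> through one of its
    points gives the compactness that a nearest point needs.\<close>
  define D' where "D' = D \<inter> {y. g y \<le> g p}"
  have gc: "continuous_on A g" for A
    unfolding g_def by (intro continuous_intros continuous_coord)
  have "compact D'"
  proof (rule compact_RnI)
    show "D' \<subseteq> Rn n" using D(1) by (auto simp: D'_def)
    show "closed D'" unfolding D'_def
      by (intro closed_Int D(2) closed_Collect_le gc continuous_on_const)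
    fix y i assume y: "y \<in> D'" "i < n"
    have "(y i - c i)\<^sup>2 \<le> g y"
      unfolding g_def using y(2) member_le_sum[of i "{..<n}" "\<lambda>i. (y i - c i)\<^sup>2"] by simp
    also have "\<dots> \<le> g p" using y(1) by (simp add: D'_def)
    finally have "\<bar>y i - c i\<bar> \<le> sqrt (g p)" by (rule real_le_rsqrt[of "\<bar>y i - c i\<bar>", unfolded power2_abs])
    moreover have "\<bar>c i\<bar> \<le> (\<Sum>i<n. \<bar>c i\<bar>)" using y(2) by (intro member_le_sum) auto
    ultimately show "\<bar>y i\<bar> \<le> sqrt (g p) + (\<Sum>i<n. \<bar>c i\<bar>)" by linarith
  qed
  moreover have "D' \<noteq> {}" using p by (auto simp: D'_def)
  ultimately obtain q where q: "q \<in> D'" "\<And>y. y \<in> D' \<Longrightarrow> g q \<le> g y"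
    using continuous_attains_inf[OF _ _ gc] by metis
  have qD: "q \<in> D" using q(1) by (simp add: D'_def)
  have qm: "g q \<le> g y" if "y \<in> D" for y
  proof (cases "g y \<le> g p")
    case True
    then show ?thesis using q(2) that by (simp add: D'_def)
  next
    case False
    then show ?thesis using q(1) by (simp add: D'_def)
  qed
  have gpos: "g q > 0"
  proof -
    have "q \<noteq> c" using qD cD by auto
    moreover have "q \<in> Rn n" "c \<in> Rn n" using qD D(1) by (auto simp: c_def)
    ultimately obtain i where i: "i < n" "q i \<noteq> c i" using Rn_eqI by blast
    have "0 < (q i - c i)\<^sup>2" using i(2) by simp
    also have "\<dots> \<le> g q" unfolding g_def using i(1) member_le_sum[of i "{..<n}" "\<lambda>i. (q i - c i)\<^sup>2"] by simp
    finally show ?thesis .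
  qed
  have sep: "g q \<le> (\<Sum>i<n. (q i - c i) * (y i - c i))" if y: "y \<in> D" for y
  proof -
    define a where "a = (\<Sum>i<n. (q i - c i) * (y i - q i))"
    define b where "b = (\<Sum>i<n. (y i - q i)\<^sup>2)"
    have b: "b \<ge> 0" by (simp add: b_def sum_nonneg)
    \<comment> \<open>Moving from \<open>q\<close> towards \<open>y\<close> by \<open>t\<close> does
      not decrease the distance to \<open>c\<close>; dividing the change by \<open>t\<close> leaves
      this.\<close>
    have pert: "2 * a + t * b \<ge> 0" if t: "0 < t" "t < 1" for t
    proof -
      have "comb n t q y \<in> D" using D(3) qD y t by (auto simp: cvx_def)
      then have "g q \<le> g (comb n t q y)" by (rule qm)
      also have "\<dots> = (\<Sum>i<n. (q i - c i)\<^sup>2 + 2 * t * ((q i - c i) * (y i - q i)) + t\<^sup>2 * (y i - q i)\<^sup>2)"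
        unfolding g_def by (intro sum.cong) (auto simp: comb_def power2_eq_square algebra_simps)
      also have "\<dots> = g q + 2 * t * a + t\<^sup>2 * b"
        by (simp add: g_def a_def b_def sum.distrib sum_distrib_left)
      finally have "0 \<le> t * (2 * a + t * b)" by (simp add: power2_eq_square algebra_simps)
      then show ?thesis using t by (simp add: zero_le_mult_iff)
    qed
    have "a \<ge> 0"
    proof (rule ccontr)
      assume "\<not> a \<ge> 0"
      then have a: "a < 0" by simp
      \<comment> \<open>Small enough that the quadratic contribution t * b stays below -a, and below
        1.\<close>
      define t where "t = min (1 / 2) (- a / (b + 1))"
      have t: "0 < t" "t < 1" using a b by (auto simp: t_def divide_neg_pos)
      have "t * b \<le> (- a / (b + 1)) * b" using b by (intro mult_right_mono) (auto simp: t_def)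
      also have "\<dots> \<le> - a" using a b by (simp add: field_simps)
      finally show False using pert[OF t] a by linarith
    qed
    have "(\<Sum>i<n. (q i - c i) * (y i - c i)) = a + g q"
      unfolding a_def g_def sum.distrib[symmetric] by (intro sum.cong) (auto simp: power2_eq_square algebra_simps)
    then show ?thesis using \<open>a \<ge> 0\<close> by simp
  qed
  have fin: "finite_measure M" using F by (intro finite_measureI) simp
  interpret finite_measure M by (rule fin)
  have meas: "measure M (space M) = F" using F by (simp add: measure_def)
  have "g q * F = (\<integral>\<omega>. g q \<partial>M)" using meas by simp
  also have "\<dots> \<le> (\<integral>\<omega>. (\<Sum>i<n. (q i - c i) * (X \<omega> i - c i)) \<partial>M)"
  proof (rule integral_mono_AE)
    show "integrable M (\<lambda>\<omega>. \<Sum>i<n. (q i - c i) * (X \<omega> i - c i))"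
      using X(1) by (intro Bochner_Integration.integrable_sum integrable_mult_right Bochner_Integration.integrable_diff) auto
    show "AE \<omega> in M. g q \<le> (\<Sum>i<n. (q i - c i) * (X \<omega> i - c i))"
      using X(2) by eventually_elim (rule sep)
  qed simp
  also have "\<dots> = (\<Sum>i<n. (q i - c i) * ((\<integral>\<omega>. X \<omega> i \<partial>M) - c i * F))"
  proof -
    have "(\<integral>\<omega>. (\<Sum>i<n. (q i - c i) * (X \<omega> i - c i)) \<partial>M) = (\<Sum>i<n. \<integral>\<omega>. (q i - c i) * (X \<omega> i - c i) \<partial>M)"
      using X(1) by (intro Bochner_Integration.integral_sum integrable_mult_right Bochner_Integration.integrable_diff) auto
    also have "\<dots> = (\<Sum>i<n. (q i - c i) * ((\<integral>\<omega>. X \<omega> i \<partial>M) - c i * F))"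
      using X(1) by (intro sum.cong refl) (simp add: meas)
    finally show ?thesis .
  qed
  also have "\<dots> = 0"
    using F(2) by (intro sum.neutral) (simp add: c_def)
  finally show False using gpos F(2) by (simp add: mult_le_0_iff)
qed

section \<open>Central sections from below\<close>

lemma restrict_comb: "restrict (comb (Suc d) t x y) {..<d} = comb d t (restrict x {..<d}) (restrict y {..<d})"
  by (auto simp: comb_def fun_eq_iff)

text \<open>The hypograph of ln f with coordinate \<open>d\<close> as the height; there is nothing
  over points where \<open>f\<close> vanishes. Jensen's inequality will say that a barycentre lies
  in this set.\<close>

lemma closed_hypograph:
  assumes usc: "usc d f"
  shows "closed {v \<in> Rn (Suc d). ennreal (exp (v d)) \<le> f (restrict v {..<d})}"
  unfolding closed_sequential_limits
proof (intro allI impI, elim conjE)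
  fix X v assume X: "\<forall>m. X m \<in> {v \<in> Rn (Suc d). ennreal (exp (v d)) \<le> f (restrict v {..<d})}" and lim: "X \<longlonglongrightarrow> v"
  have v: "v \<in> Rn (Suc d)"
    using closed_sequentially[OF closed_Rn _ lim] X by blast
  have "ennreal (exp (v d)) \<le> f (restrict v {..<d})"
  proof (rule ccontr)
    assume "\<not> ?thesis"
    then obtain c where c: "f (restrict v {..<d}) < c" "c < ennreal (exp (v d))"
      using dense by (metis not_le)
    have "(\<lambda>m. ennreal (exp (X m d))) \<longlonglongrightarrow> ennreal (exp (v d))"
      using lim unfolding tendsto_fun_iff by (intro tendsto_ennrealI tendsto_exp) auto
    then have "eventually (\<lambda>m. c < ennreal (exp (X m d))) sequentially"
      using c(2) by (rule order_tendstoD)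
    then obtain N where N: "\<And>m. m \<ge> N \<Longrightarrow> c < ennreal (exp (X m d))"
      by (auto simp: eventually_sequentially)
    \<comment> \<open>\<open>usc\<close> asks for the bound along the whole sequence, so the
      beginning of \<open>X\<close> is cut off.\<close>
    define Y where "Y m = restrict (X (m + N)) {..<d}" for m
    have "Y \<longlonglongrightarrow> restrict v {..<d}"
      unfolding tendsto_fun_iff Y_def
    proof
      fix i
      have "(\<lambda>m. X m i) \<longlonglongrightarrow> v i" using lim unfolding tendsto_fun_iff by auto
      then have "(\<lambda>m. X (m + N) i) \<longlonglongrightarrow> v i" by (rule LIMSEQ_ignore_initial_segment)
      then show "(\<lambda>m. restrict (X (m + N)) {..<d} i) \<longlonglongrightarrow> restrict v {..<d} i"
        by (cases "i < d") auto
    qed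
    moreover have "Y m \<in> Rn d" for m by (simp add: Y_def)
    moreover have "c \<le> f (Y m)" for m
      using N[of "m + N"] X[rule_format, of "m + N"] unfolding Y_def by (auto intro: order_trans less_imp_le)
    ultimately have "c \<le> f (restrict v {..<d})"
      using usc unfolding usc_def by (metis restrict_in_Rn)
    then show False using c(1) by simp
  qed
  then show "v \<in> {v \<in> Rn (Suc d). ennreal (exp (v d)) \<le> f (restrict v {..<d})}" using v by simp
qed

lemma cvx_hypograph:
  assumes lc: "log_concave d f"
  shows "cvx (Suc d) {v \<in> Rn (Suc d). ennreal (exp (v d)) \<le> f (restrict v {..<d})}"
  unfolding cvx_def
proof (intro ballI)
  let ?D = "{v \<in> Rn (Suc d). ennreal (exp (v d)) \<le> f (restrict v {..<d})}"
  fix x y and t :: real assume x: "x \<in> ?D" and y: "y \<in> ?D" and t: "t \<in> {0..1}"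
  consider "t = 0" | "t = 1" | "0 < t" "t < 1" using t by fastforce
  then show "comb (Suc d) t x y \<in> ?D"
  proof cases
    case 1
    have "comb (Suc d) t x y = x" by (rule Rn_eqI[of _ "Suc d"]) (use x 1 in \<open>auto simp: comb_def\<close>)
    then show ?thesis using x by simp
  next
    case 2
    have "comb (Suc d) t x y = y" by (rule Rn_eqI[of _ "Suc d"]) (use y 2 in \<open>auto simp: comb_def\<close>)
    then show ?thesis using y by simp
  next
    case 3
    have "ennreal (exp ((1 - t) * x d + t * y d)) \<le> f (comb d t (restrict x {..<d}) (restrict y {..<d}))"
      by (rule log_concaveD[OF lc]) (use x y 3 in auto)
    then show ?thesis unfolding mem_Collect_eq restrict_comb by (simp add: comb_def)
  qed
qed

text \<open>Almost every (y, ln f(y)) lies in the hypograph of ln f, hence so does the barycentre of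
  these points. Integrability of ln f against the density \<open>f\<close> rests on the boundedness
  of r ln r on [0, B].\<close>

lemma jensen_log_concave:
  fixes C :: real
  assumes f: "nice d B R f" "usc d f"
    and F: "emeasure (density (leb d) f) (Rn d) = ennreal F" "F > 0"
  defines "\<nu> \<equiv> density (leb d) f"
  shows "integrable \<nu> (\<lambda>y. ln (enn2real (f y)))"
    and "\<And>h. h \<in> borel_measurable (leb d) \<Longrightarrow> (\<And>y. y \<in> Rn d \<Longrightarrow> (\<And>i. i < d \<Longrightarrow> \<bar>y i\<bar> \<le> R) \<Longrightarrow> \<bar>h y\<bar> \<le> C) \<Longrightarrow> integrable \<nu> (h :: _ \<Rightarrow> real)"
    and "ennreal (exp ((\<integral>y. ln (enn2real (f y)) \<partial>\<nu>) / F)) \<le> f (\<lambda>i\<in>{..<d}. (\<integral>y. y i \<partial>\<nu>) / F)"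
proof -
  have m [measurable]: "f \<in> borel_measurable (leb d)" and BR: "0 \<le> B" "0 \<le> R"
    and bd: "\<And>x. x \<in> Rn d \<Longrightarrow> f x \<le> ennreal B"
    and supp: "\<And>x i. x \<in> Rn d \<Longrightarrow> f x \<noteq> 0 \<Longrightarrow> i < d \<Longrightarrow> \<bar>x i\<bar> \<le> R"
    and lc: "log_concave d f"
    using f unfolding nice_def by auto
  have finf: "f x < \<infinity>" if "x \<in> Rn d" for x using bd[OF that] le_less_trans by fastforce
  have sets\<nu>: "sets \<nu> = sets (leb d)" "space \<nu> = Rn d" by (auto simp: \<nu>_def)
  have fin: "emeasure \<nu> (space \<nu>) = ennreal F" using F by (simp add: \<nu>_def)
  then interpret finite_measure \<nu> by (intro finite_measureI) simp
  have AE0: "AE y in \<nu>. f y \<noteq> 0" unfolding \<nu>_def by (subst AE_density) auto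
  have meas\<nu>: "h \<in> borel_measurable \<nu>" if "h \<in> borel_measurable (leb d)" for h :: "_ \<Rightarrow> real"
    using that sets\<nu>(1) measurable_cong_sets by blast
  show bdd: "integrable \<nu> h" if "h \<in> borel_measurable (leb d)" "\<And>y. y \<in> Rn d \<Longrightarrow> (\<And>i. i < d \<Longrightarrow> \<bar>y i\<bar> \<le> R) \<Longrightarrow> \<bar>h y\<bar> \<le> C" for h and C :: real
  proof (rule integrable_const_bound[of _ C])
    show "h \<in> borel_measurable \<nu>" by (rule meas\<nu>[OF that(1)])
    have "AE y in \<nu>. y \<in> space \<nu>" by (rule AE_space)
    then show "AE y in \<nu>. norm (h y) \<le> C" using AE0
      by eventually_elim (use that(2) supp sets\<nu>(2) in auto)
  qed
  have dens: "\<nu> = density (leb d) (\<lambda>y. ennreal (enn2real (f y)))"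
    unfolding \<nu>_def by (rule density_cong) (use finf in auto)
  \<comment> \<open>From ln r \<le> r and - ln r \<le> 1 / r.\<close>
  have xlnx: "\<bar>r * ln r\<bar> \<le> 1 + B * B" if r: "0 \<le> r" "r \<le> B" for r
  proof (cases "r = 0")
    case False
    then have r0: "r > 0" using r by simp
    have "r * ln r \<le> r * r" using r0 ln_bound[of r] by (intro mult_left_mono) auto
    also have "\<dots> \<le> B * B" using r by (intro mult_mono) auto
    finally have "r * ln r \<le> B * B" .
    moreover have "- ln r \<le> 1 / r" using ln_bound[of "1 / r"] r0 by (simp add: ln_div)
    then have "r * (- ln r) \<le> r * (1 / r)" using r0 by (intro mult_left_mono) auto
    then have "- (r * ln r) \<le> 1" using r0 by simp
    moreover have "0 \<le> B * B" by simp
    ultimately show ?thesis by linarith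
  qed simp
  show lnint: "integrable \<nu> (\<lambda>y. ln (enn2real (f y)))"
    unfolding dens
  proof (subst integrable_real_density)
    show "integrable (leb d) (\<lambda>y. enn2real (f y) * ln (enn2real (f y)))"
    proof (rule Bochner_Integration.integrable_bound[of _ "\<lambda>y. (1 + B * B) * indicator (Pi\<^sub>E {..<d} (\<lambda>_. {-R..R})) y"])
      show "integrable (leb d) (\<lambda>y. (1 + B * B) * indicator (Pi\<^sub>E {..<d} (\<lambda>_. {-R..R})) y :: real)"
        by (intro integrable_mult_right integrable_real_indicator) (auto simp: emeasure_leb_box BR power_less_top_ennreal)
      show "AE y in leb d. norm (enn2real (f y) * ln (enn2real (f y))) \<le> norm ((1 + B * B) * indicator (Pi\<^sub>E {..<d} (\<lambda>_. {-R..R})) y :: real)"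
      proof (rule AE_I2)
        fix y assume "y \<in> space (leb d)"
        then have y: "y \<in> Rn d" by simp
        show "norm (enn2real (f y) * ln (enn2real (f y))) \<le> norm ((1 + B * B) * indicator (Pi\<^sub>E {..<d} (\<lambda>_. {-R..R})) y :: real)"
        proof (cases "f y = 0")
          case False
          then have "y \<in> Pi\<^sub>E {..<d} (\<lambda>_. {-R..R})"
            using supp[OF y] y unfolding mem_box by (auto simp: abs_le_iff minus_le_iff)
          moreover have "enn2real (f y) \<le> B" using bd[OF y] BR by (simp add: enn2real_leI)
          ultimately show ?thesis using xlnx[of "enn2real (f y)"] by (simp add: abs_mult)
        qed simp
      qed
    qed measurable
  qed (auto)
  show "ennreal (exp ((\<integral>y. ln (enn2real (f y)) \<partial>\<nu>) / F)) \<le> f (\<lambda>i\<in>{..<d}. (\<integral>y. y i \<partial>\<nu>) / F)"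
  proof -
    \<comment> \<open>The point (y, ln f(y)) of the graph, as an element of
      \<open>Rn (Suc d)\<close>.\<close>
    define X where "X y = (y :: nat \<Rightarrow> real)(d := ln (enn2real (f y)))" for y
    let ?D = "{v \<in> Rn (Suc d). ennreal (exp (v d)) \<le> f (restrict v {..<d})}"
    have "(\<lambda>i\<in>{..<Suc d}. (\<integral>y. X y i \<partial>\<nu>) / F) \<in> ?D"
    proof (rule barycentre_in_closed_convex[OF _ closed_hypograph[OF f(2)] cvx_hypograph[OF lc] fin F(2)])
      fix i assume "i < Suc d"
      then consider "i = d" | "i < d" by linarith
      then show "integrable \<nu> (\<lambda>y. X y i)"
      proof cases
        case 1
        then show ?thesis using lnint by (simp add: X_def)
      next
        case 2
        then show ?thesis using bdd[of "\<lambda>y. y i" R] by (simp add: X_def)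
      qed
    next
      have "AE y in \<nu>. y \<in> space \<nu>" by (rule AE_space)
      then show "AE y in \<nu>. X y \<in> ?D" using AE0
      proof eventually_elim
        fix y assume "y \<in> space \<nu>" and nz: "f y \<noteq> 0"
        then have y: "y \<in> Rn d" using sets\<nu>(2) by simp
        have r: "restrict (X y) {..<d} = y" by (rule Rn_eqI[of _ d]) (use y in \<open>auto simp: X_def\<close>)
        have "enn2real (f y) > 0" using nz finf[OF y] by (simp add: enn2real_positive_iff zero_less_iff_neq_zero)
        then have "ennreal (exp (X y d)) = f y" using finf[OF y] by (simp add: X_def)
        then show "X y \<in> ?D" using r y by (simp add: X_def)
      qed
    qed auto
    then have "ennreal (exp ((\<integral>y. X y d \<partial>\<nu>) / F)) \<le> f (restrict (\<lambda>i\<in>{..<Suc d}. (\<integral>y. X y i \<partial>\<nu>) / F) {..<d})"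
      by simp
    moreover have "restrict (\<lambda>i\<in>{..<Suc d}. (\<integral>y. X y i \<partial>\<nu>) / F) {..<d} = (\<lambda>i\<in>{..<d}. (\<integral>y. y i \<partial>\<nu>) / F)"
      by (auto simp: X_def fun_eq_iff)
    ultimately show ?thesis by (simp add: X_def)
  qed
qed

section \<open>Gibbs' inequality with double exponentials\<close>

lemma nn_integral_exp_abs:
  assumes "s > 0"
  shows "(\<integral>\<^sup>+x. ennreal (1 / (2 * s) * exp (- \<bar>x\<bar> / s)) \<partial>lborel) = 1"
proof -
  note measurable_leb_component[measurable del]
  have half: "(\<integral>\<^sup>+x. ennreal (exp (- x)) * indicator {0..} x \<partial>lborel) = 1"
    using nn_intergal_power_times_exp_Ici[of 0] by simp
  have 1: "(\<integral>\<^sup>+x. ennreal (exp (- \<bar>x\<bar>)) \<partial>lborel) = 2"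
  proof -
    have "(\<integral>\<^sup>+x. ennreal (exp (- \<bar>x\<bar>)) \<partial>lborel) =
      (\<integral>\<^sup>+x. ennreal (exp (- x)) * indicator {0..} x + ennreal (exp x) * indicator {0..} (- x) \<partial>lborel)"
    proof (rule nn_integral_cong_AE)
      have "AE x in lborel. x \<noteq> (0::real)" by (rule AE_lborel_singleton)
      then show "AE x in lborel. ennreal (exp (- \<bar>x\<bar>)) = ennreal (exp (- x)) * indicator {0..} x + ennreal (exp x) * indicator {0..} (- x)"
        by eventually_elim (auto simp: indicator_def)
    qed
    also have "\<dots> = (\<integral>\<^sup>+x. ennreal (exp (- x)) * indicator {0..} x \<partial>lborel) + (\<integral>\<^sup>+x. ennreal (exp x) * indicator {0..} (- x) \<partial>lborel)"
      by (rule nn_integral_add) measurable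
    also have "(\<integral>\<^sup>+x. ennreal (exp x) * indicator {0..} (- x) \<partial>lborel) = (\<integral>\<^sup>+x. ennreal (exp (- x)) * indicator {0..} x \<partial>lborel)"
      using nn_integral_real_affine[of "\<lambda>x. ennreal (exp (- x)) * indicator {0..} x" "-1" 0] by simp
    finally show ?thesis using half by simp
  qed
  have "(\<integral>\<^sup>+x. ennreal (exp (- \<bar>x\<bar>)) \<partial>lborel) = ennreal (1 / s) * (\<integral>\<^sup>+x. ennreal (exp (- \<bar>x\<bar> / s)) \<partial>lborel)"
    using nn_integral_real_affine[of "\<lambda>x. ennreal (exp (- \<bar>x\<bar>))" "1 / s" 0] assms by (simp add: abs_mult)
  then have 2: "ennreal (1 / s) * (\<integral>\<^sup>+x. ennreal (exp (- \<bar>x\<bar> / s)) \<partial>lborel) = 2" using 1 by simp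
  have "(\<integral>\<^sup>+x. ennreal (1 / (2 * s) * exp (- \<bar>x\<bar> / s)) \<partial>lborel) = ennreal (1 / 2) * (ennreal (1 / s) * (\<integral>\<^sup>+x. ennreal (exp (- \<bar>x\<bar> / s)) \<partial>lborel))"
  proof -
    have "(\<integral>\<^sup>+x. ennreal (1 / (2 * s) * exp (- \<bar>x\<bar> / s)) \<partial>lborel) = (\<integral>\<^sup>+x. ennreal (1 / (2 * s)) * ennreal (exp (- \<bar>x\<bar> / s)) \<partial>lborel)"
      using assms by (intro nn_integral_cong ennreal_mult) auto
    also have "\<dots> = ennreal (1 / (2 * s)) * (\<integral>\<^sup>+x. ennreal (exp (- \<bar>x\<bar> / s)) \<partial>lborel)"
      by (rule nn_integral_cmult) measurable
    also have "ennreal (1 / (2 * s)) = ennreal (1 / 2) * ennreal (1 / s)"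
      using assms by (subst ennreal_mult'[symmetric]) auto
    finally show ?thesis by (simp only: mult.assoc)
  qed
  also have "\<dots> = ennreal (1 / 2) * ennreal 2" unfolding 2 by simp
  also have "\<dots> = 1" by (subst ennreal_mult'[symmetric]) auto
  finally show ?thesis .
qed

lemma centered_iff:
  assumes "vol n K > 0"
  shows "centered n K \<longleftrightarrow> (\<forall>i<n. (LINT x:K|leb n. x i) = 0)"
  using assms unfolding centered_def barycentre_def
  by (auto simp: fun_eq_iff restrict_def)

lemma emeasure_vol: "emeasure (leb n) K < \<infinity> \<Longrightarrow> emeasure (leb n) K = ennreal (vol n K)"
  unfolding vol_def by (rule emeasure_eq_ennreal_measure) simp

lemma emeasure_fibre_density:
  assumes K: "K \<in> sets (leb (d + e))" and f: "fibre d e K \<in> borel_measurable (leb d)"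
  shows "emeasure (density (leb d) (fibre d e K)) (Rn d) = emeasure (leb (d + e)) K"
proof -
  note [measurable] = K
  have pr [measurable]: "(\<lambda>x. restrict x {..<d}) \<in> leb (d + e) \<rightarrow>\<^sub>M leb d" by (rule measurable_restrict_leb) simp
  have "emeasure (density (leb d) (fibre d e K)) (Rn d) =
    emeasure (density (leb (d + e)) (indicator K)) ((\<lambda>x. restrict x {..<d}) -` Rn d \<inter> Rn (d + e))"
    unfolding distr_fibre[OF K f, symmetric] by (subst emeasure_distr) (use sets.top[of "leb d"] in auto)
  also have "(\<lambda>x. restrict x {..<d}) -` Rn d \<inter> Rn (d + e) = Rn (d + e)" by auto
  also have "emeasure (density (leb (d + e)) (indicator K)) (Rn (d + e)) = (\<integral>\<^sup>+x. indicator K x * indicator (Rn (d + e)) x \<partial>leb (d + e))"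
    by (rule emeasure_density) (use sets.top[of "leb (d + e)"] in auto)
  also have "\<dots> = (\<integral>\<^sup>+x. indicator K x \<partial>leb (d + e))"
    by (intro nn_integral_cong) simp
  also have "\<dots> = emeasure (leb (d + e)) K" by simp
  finally show ?thesis .
qed

lemma nn_integral_double_exp:
  assumes s: "\<And>i. i < d \<Longrightarrow> s i > 0" and F: "F \<ge> 0"
  shows "(\<integral>\<^sup>+y. ennreal (F * (\<Prod>i<d. 1 / (2 * s i) * exp (- \<bar>y i\<bar> / s i))) \<partial>leb d) = ennreal F"
proof -
  have m: "(\<lambda>x. ennreal (1 / (2 * s i) * exp (- \<bar>x\<bar> / s i))) \<in> borel_measurable lborel" for i
    by simp
  have "(\<integral>\<^sup>+y. ennreal (F * (\<Prod>i<d. 1 / (2 * s i) * exp (- \<bar>y i\<bar> / s i))) \<partial>leb d) =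
    (\<integral>\<^sup>+y. ennreal F * (\<Prod>i<d. ennreal (1 / (2 * s i) * exp (- \<bar>y i\<bar> / s i))) \<partial>leb d)"
  proof (intro nn_integral_cong)
    fix y
    have "(\<Prod>i<d. ennreal (1 / (2 * s i) * exp (- \<bar>y i\<bar> / s i))) = ennreal (\<Prod>i<d. 1 / (2 * s i) * exp (- \<bar>y i\<bar> / s i))"
      by (rule prod_ennreal) (use s in \<open>auto intro!: divide_nonneg_nonneg less_imp_le\<close>)
    then show "ennreal (F * (\<Prod>i<d. 1 / (2 * s i) * exp (- \<bar>y i\<bar> / s i))) =
      ennreal F * (\<Prod>i<d. ennreal (1 / (2 * s i) * exp (- \<bar>y i\<bar> / s i)))"
      using F by (simp add: ennreal_mult')
  qed
  also have "\<dots> = ennreal F * (\<integral>\<^sup>+y. (\<Prod>i<d. ennreal (1 / (2 * s i) * exp (- \<bar>y i\<bar> / s i))) \<partial>leb d)"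
  proof (rule nn_integral_cmult)
    show "(\<lambda>y. \<Prod>i<d. ennreal (1 / (2 * s i) * exp (- \<bar>y i\<bar> / s i))) \<in> borel_measurable (leb d)"
      by (rule borel_measurable_prod_ennreal) auto
  qed
  also have "(\<integral>\<^sup>+y. (\<Prod>i<d. ennreal (1 / (2 * s i) * exp (- \<bar>y i\<bar> / s i))) \<partial>leb d) =
     (\<Prod>i<d. \<integral>\<^sup>+x. ennreal (1 / (2 * s i) * exp (- \<bar>x\<bar> / s i)) \<partial>lborel)"
    unfolding leb_def using m by (intro lb.product_nn_integral_prod) auto
  also have "\<dots> = (\<Prod>i<d. 1)"
    using s by (intro prod.cong nn_integral_exp_abs) auto
  finally show ?thesis by simp
qed

text \<open>Jensen's inequality for the concave function \<open>ln f\<close> bounds \<open>f\<close> at the barycentre from below by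
  the entropy, and Gibbs' inequality against a product of double exponentials bounds the entropy.\<close>

lemma fibre_at_origin_ge:
  assumes K: "convex_body (d + e) K" and c: "centered (d + e) K"
    and l: "\<And>i. i < d \<Longrightarrow> lam i = (LINT x:K|leb (d + e). (x i)\<^sup>2)" "\<And>i. i < d \<Longrightarrow> lam i > 0"
  shows "ennreal (vol (d + e) K * (\<Prod>i<d. 1 / (2 * exp 1 * sqrt (lam i / vol (d + e) K)))) \<le> fibre d e K (\<lambda>i\<in>{..<d}. 0)"
proof -
  define F where "F = vol (d + e) K"
  have F: "F > 0" using convex_body_vol_pos[OF K] by (simp add: F_def)
  define f where "f = fibre d e K"
  define f' where "f' y = enn2real (f y)" for y
  define \<nu> where "\<nu> = density (leb d) f"
  obtain B R where R: "R > 0" "nice d B R f" "usc d f" "\<And>x i. x \<in> K \<Longrightarrow> i < d + e \<Longrightarrow> \<bar>x i\<bar> \<le> R"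
    using fibre_nice[OF K] unfolding f_def by metis
  have fm [measurable]: "f \<in> borel_measurable (leb d)" using R(2) by (simp add: nice_def)
  note Ks = convex_body_sets[OF K]
  have fm': "fibre d e K \<in> borel_measurable (leb d)" using fm by (simp add: f_def)
  have finf: "f y < \<infinity>" if "y \<in> Rn d" for y
    by (rule le_less_trans[of _ "ennreal B"]) (use R(2) that in \<open>auto simp: nice_def\<close>)
  have tot: "emeasure \<nu> (Rn d) = ennreal F"
    unfolding \<nu>_def f_def emeasure_fibre_density[OF Ks fm'] F_def
    by (rule emeasure_vol[OF convex_body_fin[OF K]])
  note J = jensen_log_concave[OF R(2,3) tot[unfolded \<nu>_def] F, folded \<nu>_def]
  have mean: "(\<integral>y. y i \<partial>\<nu>) = 0" if "i < d" for i
  proof -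
    have "(\<integral>y. y i \<partial>\<nu>) = (LINT x:K|leb (d + e). restrict x {..<d} i)"
      unfolding \<nu>_def f_def by (rule fibre_integral[OF Ks fm']) (use that in auto)
    also have "\<dots> = (LINT x:K|leb (d + e). x i)" using that by simp
    also have "\<dots> = 0" using c that unfolding centered_iff[OF convex_body_vol_pos[OF K]] by simp
    finally show ?thesis .
  qed
  have sq: "(\<integral>y. (y i)\<^sup>2 \<partial>\<nu>) = lam i" if "i < d" for i
  proof -
    have "(\<integral>y. (y i)\<^sup>2 \<partial>\<nu>) = (LINT x:K|leb (d + e). (restrict x {..<d} i)\<^sup>2)"
      unfolding \<nu>_def f_def by (rule fibre_integral[OF Ks fm']) (use that in auto)
    then show ?thesis using that l(1) by simp
  qed
  have sqi: "integrable \<nu> (\<lambda>y. (y i)\<^sup>2)" if "i < d" for i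
  proof (rule J(2)[where C="R\<^sup>2"])
    fix y :: "nat \<Rightarrow> real" assume "\<And>i. i < d \<Longrightarrow> \<bar>y i\<bar> \<le> R"
    then have "\<bar>y i\<bar> \<le> \<bar>R\<bar>" using that R(1) by simp
    then have "(y i)\<^sup>2 \<le> R\<^sup>2" by (rule iffD1[OF abs_le_square_iff])
    then show "\<bar>(y i)\<^sup>2\<bar> \<le> R\<^sup>2" by simp
  qed (use that in auto)
  have "finite_measure \<nu>" using tot by (intro finite_measureI) (simp add: \<nu>_def)
  then interpret finite_measure \<nu> .
  have mF: "measure \<nu> (space \<nu>) = F" using tot F by (simp add: \<nu>_def measure_def)
  \<comment> \<open>The normalised standard deviation: with this scale the squared coordinates
    divided by s^2 have mean 1, so the quadratic terms cost exactly 1 per coordinate.\<close>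
  define s where "s i = sqrt (lam i / F)" for i
  have s: "s i > 0" "lam i / (s i)\<^sup>2 = F" if "i < d" for i
    using l(2)[OF that] F by (auto simp: s_def field_simps)
  define \<gamma> where "\<gamma> y = F * (\<Prod>i<d. 1 / (2 * s i) * exp (- \<bar>y i\<bar> / s i))" for y
  have \<gamma>pos: "\<gamma> y > 0" for y
    unfolding \<gamma>_def using F s by (intro mult_pos_pos prod_pos) auto
  have \<gamma>m [measurable]: "\<gamma> \<in> borel_measurable (leb d)"
    unfolding \<gamma>_def by (intro borel_measurable_times borel_measurable_const borel_measurable_prod) auto
  \<comment> \<open>A minorant of ln \<gamma> that is quadratic in the coordinates, from 2|v| \<le>
    1 + v^2. Its integral is determined by the second moments, whereas that of the |y i| is
    unknown.\<close>
  define q where "q y = ln F - (\<Sum>i<d. ln (2 * s i)) - (\<Sum>i<d. (1 + (y i)\<^sup>2 / (s i)\<^sup>2) / 2)" for y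
  have q\<gamma>: "q y \<le> ln (\<gamma> y)" for y
  proof -
    have "ln (\<gamma> y) = ln F + (\<Sum>i<d. ln (1 / (2 * s i) * exp (- \<bar>y i\<bar> / s i)))"
    proof -
      have pos: "1 / (2 * s i) * exp (- \<bar>y i\<bar> / s i) > 0" if "i \<in> {..<d}" for i
        using s(1)[of i] that by simp
      have nz: "1 / (2 * s i) * exp (- \<bar>y i\<bar> / s i) \<noteq> 0" if "i \<in> {..<d}" for i
        using pos[OF that] by (rule less_imp_neq[symmetric])
      have "ln (\<Prod>i<d. 1 / (2 * s i) * exp (- \<bar>y i\<bar> / s i)) = (\<Sum>i<d. ln (1 / (2 * s i) * exp (- \<bar>y i\<bar> / s i)))"
        by (rule ln_prod) (use pos nz in blast)+
      moreover have "(\<Prod>i<d. 1 / (2 * s i) * exp (- \<bar>y i\<bar> / s i)) > 0"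
        by (rule prod_pos) (rule pos)
      ultimately show ?thesis
        unfolding \<gamma>_def using F by (simp only: ln_mult_pos)
    qed
    also have "(\<Sum>i<d. ln (1 / (2 * s i) * exp (- \<bar>y i\<bar> / s i))) = (\<Sum>i<d. - ln (2 * s i) - \<bar>y i\<bar> / s i)"
    proof (rule sum.cong)
      fix i assume "i \<in> {..<d}"
      then have "s i > 0" using s by simp
      then show "ln (1 / (2 * s i) * exp (- \<bar>y i\<bar> / s i)) = - ln (2 * s i) - \<bar>y i\<bar> / s i"
        by (simp add: ln_mult ln_div)
    qed simp
    finally have eq: "ln (\<gamma> y) = ln F + (\<Sum>i<d. - ln (2 * s i) - \<bar>y i\<bar> / s i)" .
    have "(\<Sum>i<d. - ln (2 * s i) - (1 + (y i)\<^sup>2 / (s i)\<^sup>2) / 2) \<le> (\<Sum>i<d. - ln (2 * s i) - \<bar>y i\<bar> / s i)"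
    proof (rule sum_mono)
      fix i assume "i \<in> {..<d}"
      have "0 \<le> (\<bar>y i\<bar> / s i - 1)\<^sup>2" by simp
      also have "\<dots> = (y i)\<^sup>2 / (s i)\<^sup>2 - 2 * (\<bar>y i\<bar> / s i) + 1"
        by (simp add: power2_diff power_divide)
      finally show "- ln (2 * s i) - (1 + (y i)\<^sup>2 / (s i)\<^sup>2) / 2 \<le> - ln (2 * s i) - \<bar>y i\<bar> / s i" by simp
    qed
    then show ?thesis unfolding eq q_def by (simp add: sum_subtractf sum_negf)
  qed
  \<comment> \<open>An inequality and not an equality, because the quotient is 0 by convention where
    \<open>f'\<close> vanishes although \<gamma> has mass there.\<close>
  have ratio_nn: "(\<integral>\<^sup>+y. ennreal (\<gamma> y / f' y) \<partial>\<nu>) \<le> ennreal F"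
  proof -
    have "(\<integral>\<^sup>+y. ennreal (\<gamma> y / f' y) \<partial>\<nu>) = (\<integral>\<^sup>+y. f y * ennreal (\<gamma> y / f' y) \<partial>leb d)"
      unfolding \<nu>_def by (rule nn_integral_density) (auto simp: f'_def)
    also have "\<dots> \<le> (\<integral>\<^sup>+y. ennreal (\<gamma> y) \<partial>leb d)"
    proof (rule nn_integral_mono)
      fix y assume "y \<in> space (leb d)"
      then have fy: "f y = ennreal (f' y)" using finf[of y] by (simp add: f'_def)
      have "f' y \<ge> 0" by (simp add: f'_def)
      then show "f y * ennreal (\<gamma> y / f' y) \<le> ennreal (\<gamma> y)"
        unfolding fy using less_imp_le[OF \<gamma>pos, of y] by (cases "f' y = 0") (simp_all add: ennreal_mult'[symmetric])
    qed
    also have "\<dots> = ennreal F"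
      unfolding \<gamma>_def using s F by (intro nn_integral_double_exp) auto
    finally show ?thesis .
  qed
  have rm: "(\<lambda>y. \<gamma> y / f' y) \<in> borel_measurable \<nu>"
    unfolding \<nu>_def f'_def by simp
  have rpos: "\<gamma> y / f' y \<ge> 0" for y using less_imp_le[OF \<gamma>pos] by (simp add: f'_def)
  have rint: "integrable \<nu> (\<lambda>y. \<gamma> y / f' y)"
    using ratio_nn rm rpos by (intro integrableI_nonneg) (auto intro: le_less_trans)
  have rle: "(\<integral>y. \<gamma> y / f' y \<partial>\<nu>) \<le> F"
    using ratio_nn F rpos by (subst integral_eq_nn_integral[OF rm]) (auto intro: enn2real_leI)
  have qint: "integrable \<nu> q"
    unfolding q_def using sqi by (intro Bochner_Integration.integrable_diff Bochner_Integration.integrable_sum) auto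
  have "(\<integral>y. q y \<partial>\<nu>) = F * (ln F - (\<Sum>i<d. ln (2 * s i))) - (\<Sum>i<d. (F + lam i / (s i)\<^sup>2) / 2)"
  proof -
    have i1: "integrable \<nu> (\<lambda>y. (1 + (y i)\<^sup>2 / (s i)\<^sup>2) / 2)" if "i \<in> {..<d}" for i
      using sqi that by simp
    have "(\<integral>y. q y \<partial>\<nu>) = (\<integral>y. ln F - (\<Sum>i<d. ln (2 * s i)) \<partial>\<nu>) - (\<integral>y. (\<Sum>i<d. (1 + (y i)\<^sup>2 / (s i)\<^sup>2) / 2) \<partial>\<nu>)"
      unfolding q_def by (rule Bochner_Integration.integral_diff) (use i1 in auto)
    also have "(\<integral>y. (\<Sum>i<d. (1 + (y i)\<^sup>2 / (s i)\<^sup>2) / 2) \<partial>\<nu>) = (\<Sum>i<d. \<integral>y. (1 + (y i)\<^sup>2 / (s i)\<^sup>2) / 2 \<partial>\<nu>)"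
      by (rule Bochner_Integration.integral_sum) (use i1 in auto)
    also have "\<dots> = (\<Sum>i<d. (F + lam i / (s i)\<^sup>2) / 2)"
      using sqi sq by (intro sum.cong refl) (simp add: mF)
    finally show ?thesis by (simp add: mF mult.commute)
  qed
  also have "(\<Sum>i<d. (F + lam i / (s i)\<^sup>2) / 2) = (\<Sum>i<d. F)"
    using s(2) by (intro sum.cong) auto
  finally have qval: "(\<integral>y. q y \<partial>\<nu>) = F * (ln F - (\<Sum>i<d. ln (2 * s i)) - d)"
    by (simp add: algebra_simps)
  \<comment> \<open>Gibbs' inequality: ln(\<gamma> / f) \<le> \<gamma> / f - 1, and the integral of
    the quotient does not exceed the total mass \<open>F\<close>, so the correction 1 - \<gamma> / f
    has nonnegative integral.\<close>
  have "(\<integral>y. q y \<partial>\<nu>) \<le> (\<integral>y. q y + 1 - \<gamma> y / f' y \<partial>\<nu>)"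
    using rle qint rint by (simp add: mF)
  also have "\<dots> \<le> (\<integral>y. ln (f' y) \<partial>\<nu>)"
  proof (rule integral_mono_AE)
    show "integrable \<nu> (\<lambda>y. q y + 1 - \<gamma> y / f' y)" using qint rint by simp
    show "integrable \<nu> (\<lambda>y. ln (f' y))" using J(1) by (simp add: f'_def)
    have "AE y in \<nu>. f y \<noteq> 0" unfolding \<nu>_def by (subst AE_density) auto
    moreover have "AE y in \<nu>. y \<in> space \<nu>" by (rule AE_space)
    ultimately show "AE y in \<nu>. q y + 1 - \<gamma> y / f' y \<le> ln (f' y)"
    proof eventually_elim
      fix y assume "f y \<noteq> 0" "y \<in> space \<nu>"
      then have f'pos: "f' y > 0" using finf[of y]
        by (simp add: f'_def enn2real_positive_iff zero_less_iff_neq_zero \<nu>_def)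
      have "ln (\<gamma> y / f' y) \<le> \<gamma> y / f' y - 1"
        using \<gamma>pos[of y] f'pos by (intro ln_le_minus_one) simp
      then have "ln (\<gamma> y) - ln (f' y) \<le> \<gamma> y / f' y - 1"
        using \<gamma>pos[of y] f'pos by (simp add: ln_div)
      then show "q y + 1 - \<gamma> y / f' y \<le> ln (f' y)" using q\<gamma>[of y] by linarith
    qed
  qed
  finally have "F * (ln F - (\<Sum>i<d. ln (2 * s i)) - d) \<le> (\<integral>y. ln (f' y) \<partial>\<nu>)" unfolding qval .
  then have "ln F - (\<Sum>i<d. ln (2 * s i)) - d \<le> (\<integral>y. ln (f' y) \<partial>\<nu>) / F"
    using F by (simp add: pos_le_divide_eq mult.commute)
  then have "exp (ln F - (\<Sum>i<d. ln (2 * s i)) - d) \<le> exp ((\<integral>y. ln (f' y) \<partial>\<nu>) / F)" by simp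
  moreover have "exp (ln F - (\<Sum>i<d. ln (2 * s i)) - d) = F * (\<Prod>i<d. 1 / (2 * exp 1 * s i))"
  proof -
    have "ln F - (\<Sum>i<d. ln (2 * s i)) - d = ln F + (\<Sum>i<d. - ln (2 * s i) - 1)"
      by (simp add: sum_subtractf sum_negf)
    also have "exp \<dots> = F * (\<Prod>i<d. exp (- ln (2 * s i) - 1))"
      using F by (simp add: exp_add exp_sum)
    also have "(\<Prod>i<d. exp (- ln (2 * s i) - 1)) = (\<Prod>i<d. 1 / (2 * exp 1 * s i))"
      using s(1) by (intro prod.cong refl) (simp add: exp_diff exp_minus field_simps)
    finally show ?thesis .
  qed
  ultimately have "ennreal (F * (\<Prod>i<d. 1 / (2 * exp 1 * s i))) \<le> ennreal (exp ((\<integral>y. ln (f' y) \<partial>\<nu>) / F))"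
    by (simp add: ennreal_leI)
  also have "\<dots> \<le> f (\<lambda>i\<in>{..<d}. (\<integral>y. y i \<partial>\<nu>) / F)"
    using J(3) by (simp add: f'_def)
  also have "(\<lambda>i\<in>{..<d}. (\<integral>y. y i \<partial>\<nu>) / F) = (\<lambda>i\<in>{..<d}. 0)"
    using mean by (auto simp: fun_eq_iff)
  finally show ?thesis unfolding f_def s_def F_def .
qed

section \<open>Ball bodies\<close>

definition sc :: "nat \<Rightarrow> real \<Rightarrow> (nat \<Rightarrow> real) \<Rightarrow> (nat \<Rightarrow> real)"
  where "sc d r x = (\<lambda>i\<in>{..<d}. r * x i)"

lemma sc_in_Rn [simp]: "sc d r x \<in> Rn d"
  by (simp add: sc_def)

lemma sc_sc: "sc d r (sc d s x) = sc d (r * s) x"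
  by (auto simp: sc_def fun_eq_iff)

lemma sc_1: "x \<in> Rn d \<Longrightarrow> sc d 1 x = x"
  by (simp add: sc_def Rn_restrict_id)

lemma measurable_sc [measurable]: "(\<lambda>(r, x). sc d r x) \<in> borel \<Otimes>\<^sub>M leb d \<rightarrow>\<^sub>M leb d"
  by (rule measurable_lebI) (auto simp: sc_def)

lemma measurable_sc_right: "sc d r \<in> leb d \<rightarrow>\<^sub>M leb d"
  by (rule measurable_lebI) (auto simp: sc_def)

lemma measurable_sc_left: "x \<in> Rn d \<Longrightarrow> (\<lambda>r. sc d r x) \<in> borel \<rightarrow>\<^sub>M leb d"
  by (rule measurable_lebI) (auto simp: sc_def)

text \<open>Homogeneous of degree -(q + 1); its power -1/(q + 1) is, up to a factor, the gauge of
  Ball's body with exponent q + 1. Superlevel sets of \<open>radial\<close> describe the body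
  without roots.\<close>

definition radial :: "nat \<Rightarrow> nat \<Rightarrow> ((nat \<Rightarrow> real) \<Rightarrow> ennreal) \<Rightarrow> (nat \<Rightarrow> real) \<Rightarrow> ennreal"
  where "radial d q f x = (\<integral>\<^sup>+r. ennreal (r ^ q) * f (sc d r x) * indicator {0<..} r \<partial>lborel)"

lemma radial_joint_measurable:
  assumes f: "f \<in> borel_measurable (leb d)"
  shows "(\<lambda>(r, x). ennreal (r ^ q) * f (sc d r x) * indicator {0<..} r) \<in> borel_measurable (borel \<Otimes>\<^sub>M leb d)"
proof -
  have "(\<lambda>p. f (sc d (fst p) (snd p))) \<in> borel_measurable (borel \<Otimes>\<^sub>M leb d)"
    using measurable_compose[OF measurable_sc f] by (simp add: split_beta')
  moreover have "(\<lambda>p. ennreal (fst p ^ q) * indicator {0<..} (fst p)) \<in> borel_measurable (borel \<Otimes>\<^sub>M leb d)"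
    by (rule measurable_compose[OF measurable_fst]) simp
  ultimately have "(\<lambda>p. ennreal (fst p ^ q) * indicator {0<..} (fst p) * f (sc d (fst p) (snd p))) \<in> borel_measurable (borel \<Otimes>\<^sub>M leb d)"
    by (rule borel_measurable_times_ennreal[rotated])
  then show ?thesis by (simp add: split_beta' mult_ac)
qed

lemma radial_measurable:
  assumes "f \<in> borel_measurable (leb d)"
  shows "radial d q f \<in> borel_measurable (leb d)"
proof -
  have "(\<lambda>p. (case (snd p, fst p) of (r, x) \<Rightarrow> ennreal (r ^ q) * f (sc d r x) * indicator {0<..} r)) \<in> borel_measurable (leb d \<Otimes>\<^sub>M borel)"
    by (rule measurable_compose[OF _ radial_joint_measurable[OF assms]]) measurable
  then show ?thesis
    unfolding radial_def by (intro lborel.borel_measurable_nn_integral) (simp add: split_beta')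
qed

lemma radial_integrand_measurable:
  assumes "f \<in> borel_measurable (leb d)" "x \<in> Rn d"
  shows "(\<lambda>r. ennreal (r ^ q) * f (sc d r x) * indicator {0<..} r) \<in> borel_measurable borel"
  by (intro borel_measurable_times_ennreal measurable_compose[OF measurable_sc_left[OF assms(2)] assms(1)]) auto

lemma radial_scale:
  assumes f: "f \<in> borel_measurable (leb d)" and x: "x \<in> Rn d" and s: "s > 0"
  shows "radial d q f (sc d s x) = ennreal (1 / s ^ (q + 1)) * radial d q f x"
proof -
  have "radial d q f x = ennreal s * (\<integral>\<^sup>+r. ennreal ((s * r) ^ q) * f (sc d (s * r) x) * indicator {0<..} (s * r) \<partial>lborel)"
    unfolding radial_def
    using nn_integral_real_affine[OF radial_integrand_measurable[OF f x], of s q 0] s by simp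
  also have "(\<integral>\<^sup>+r. ennreal ((s * r) ^ q) * f (sc d (s * r) x) * indicator {0<..} (s * r) \<partial>lborel) =
      (\<integral>\<^sup>+r. ennreal (s ^ q) * (ennreal (r ^ q) * f (sc d r (sc d s x)) * indicator {0<..} r) \<partial>lborel)"
  proof (rule nn_integral_cong)
    fix r :: real
    show "ennreal ((s * r) ^ q) * f (sc d (s * r) x) * indicator {0<..} (s * r) =
        ennreal (s ^ q) * (ennreal (r ^ q) * f (sc d r (sc d s x)) * indicator {0<..} r)"
    proof (cases "r > 0")
      case True
      then show ?thesis using s
        by (simp add: sc_sc mult.commute[of r s] power_mult_distrib ennreal_mult' mult.assoc)
    next
      case False
      then show ?thesis using s by (simp add: zero_less_mult_iff)
    qed
  qed
  also have "\<dots> = ennreal (s ^ q) * radial d q f (sc d s x)"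
    unfolding radial_def by (rule nn_integral_cmult) (simp add: radial_integrand_measurable[OF f])
  finally have "radial d q f x = ennreal (s ^ (q + 1)) * radial d q f (sc d s x)"
    using s by (simp add: mult.assoc[symmetric] ennreal_mult'[symmetric])
  then have "ennreal (1 / s ^ (q + 1)) * radial d q f x = ennreal (1 / s ^ (q + 1)) * ennreal (s ^ (q + 1)) * radial d q f (sc d s x)"
    by (simp add: mult.assoc)
  also have "ennreal (1 / s ^ (q + 1)) * ennreal (s ^ (q + 1)) = 1"
    using s by (subst ennreal_mult'[symmetric]) auto
  finally show ?thesis by simp
qed

lemma nice_support_scaled:
  assumes "nice d B R f" "x \<in> Rn d" "i < d" "x i \<noteq> 0" "f (sc d r x) \<noteq> 0" "r > 0"
  shows "r \<le> R / \<bar>x i\<bar>"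
proof -
  have "\<bar>sc d r x i\<bar> \<le> R" using assms(1,3,5) unfolding nice_def by (metis sc_in_Rn)
  then have "r * \<bar>x i\<bar> \<le> R" using assms(3,6) by (simp add: sc_def abs_mult)
  then show ?thesis using assms(4) by (simp add: field_simps)
qed

text \<open>Along a ray with nonzero coordinate \<open>i\<close> the support ends at the latest at R
  / |x i|. This bounds the Ball body and keeps \<open>radial\<close> finite off the origin.\<close>

lemma radial_le:
  assumes f: "nice d B R f" and x: "x \<in> Rn d" "i < d" "x i \<noteq> 0"
  shows "radial d q f x \<le> ennreal (B * (R / \<bar>x i\<bar>) ^ (q + 1))"
proof -
  have B: "B \<ge> 0" "R \<ge> 0" and bd: "\<And>x. x \<in> Rn d \<Longrightarrow> f x \<le> ennreal B"
    using f by (auto simp: nice_def)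
  define \<rho> where "\<rho> = R / \<bar>x i\<bar>"
  have \<rho>: "\<rho> \<ge> 0" using B by (simp add: \<rho>_def)
  have "radial d q f x \<le> (\<integral>\<^sup>+r. ennreal (\<rho> ^ q * B) * indicator {0..\<rho>} r \<partial>lborel)"
    unfolding radial_def
  proof (rule nn_integral_mono)
    fix r :: real
    show "ennreal (r ^ q) * f (sc d r x) * indicator {0<..} r \<le> ennreal (\<rho> ^ q * B) * indicator {0..\<rho>} r"
    proof (cases "r > 0 \<and> f (sc d r x) \<noteq> 0")
      case True
      then have "r \<le> \<rho>" using nice_support_scaled[OF f x] by (simp add: \<rho>_def)
      moreover have "ennreal (r ^ q) * f (sc d r x) \<le> ennreal (\<rho> ^ q) * ennreal B"
        using True \<open>r \<le> \<rho>\<close> by (intro mult_mono bd ennreal_leI power_mono) auto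
      ultimately show ?thesis using True \<rho> B by (simp add: ennreal_mult')
    qed auto
  qed
  also have "\<dots> = ennreal (\<rho> ^ q * B) * ennreal \<rho>"
    using \<rho> by (simp add: nn_integral_cmult)
  also have "\<dots> = ennreal (B * \<rho> ^ (q + 1))"
    using \<rho> B by (simp add: ennreal_mult'[symmetric] mult_ac)
  finally show ?thesis by (simp add: \<rho>_def)
qed

lemma log_concave_segment:
  assumes lc: "log_concave d f" and x: "x \<in> Rn d" and f0: "f (\<lambda>i\<in>{..<d}. 0) = ennreal f0" "f0 > 0"
    and r: "0 < r" "r \<le> 1" and e: "ennreal (exp \<beta>) \<le> f x"
  shows "ennreal (exp ((1 - r) * ln f0 + r * \<beta>)) \<le> f (sc d r x)"
proof (cases "r = 1")
  case True
  then show ?thesis using e x by (simp add: sc_1)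
next
  case False
  have "ennreal (exp ((1 - r) * ln f0 + r * \<beta>)) \<le> f (comb d r (\<lambda>i\<in>{..<d}. 0) x)"
    by (rule log_concaveD[OF lc]) (use x f0 r e False in auto)
  also have "comb d r (\<lambda>i\<in>{..<d}. 0) x = sc d r x" by (auto simp: comb_def sc_def fun_eq_iff)
  finally show ?thesis .
qed

text \<open>Only radii in [1/2, 1] are kept. There log-concavity between the origin and
  \<open>x\<close> keeps f above the smaller of the two values, r^q is at least 2^(-q), and the
  interval has length 1/2.\<close>

lemma radial_ge:
  assumes f: "nice d B R f" and x: "x \<in> Rn d" "ennreal \<epsilon> \<le> f x" and f0: "f (\<lambda>i\<in>{..<d}. 0) = ennreal f0" "f0 > 0" and \<epsilon>: "\<epsilon> > 0"
  shows "ennreal ((1 / 2) ^ q * min f0 \<epsilon> * (1 / 2)) \<le> radial d q f x"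
proof -
  have lc: "log_concave d f" using f by (auto simp: nice_def)
  define m where "m = min f0 \<epsilon>"
  have m: "m > 0" "ln m \<le> ln f0" "ln m \<le> ln \<epsilon>" using f0(2) \<epsilon> by (auto simp: m_def)
  have "ennreal ((1 / 2) ^ q * m * (1 / 2)) = ennreal ((1 / 2) ^ q * m) * ennreal (1 / 2)"
    using m(1) by (intro ennreal_mult) auto
  also have "\<dots> = (\<integral>\<^sup>+r. ennreal ((1 / 2) ^ q * m) * indicator {1/2..1::real} r \<partial>lborel)"
    by (simp add: nn_integral_cmult)
  also have "\<dots> \<le> radial d q f x"
    unfolding radial_def
  proof (rule nn_integral_mono)
    fix r :: real
    show "ennreal ((1 / 2) ^ q * m) * indicator {1/2..1} r \<le> ennreal (r ^ q) * f (sc d r x) * indicator {0<..} r"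
    proof (cases "r \<in> {1/2..1}")
      case True
      have "ln m = (1 - r) * ln m + r * ln m" by (simp add: algebra_simps)
      also have "\<dots> \<le> (1 - r) * ln f0 + r * ln \<epsilon>"
        using True m by (intro add_mono mult_left_mono) auto
      finally have "exp (ln m) \<le> exp ((1 - r) * ln f0 + r * ln \<epsilon>)" by simp
      then have "ennreal m \<le> ennreal (exp ((1 - r) * ln f0 + r * ln \<epsilon>))" using m(1) by (simp add: ennreal_leI)
      also have "\<dots> \<le> f (sc d r x)"
        by (rule log_concave_segment[OF lc x(1) f0]) (use True x(2) \<epsilon> in auto)
      finally have "ennreal ((1 / 2) ^ q) * ennreal m \<le> ennreal (r ^ q) * f (sc d r x)"
        using True by (intro mult_mono ennreal_leI power_mono) auto
      then show ?thesis using True by (simp add: ennreal_mult')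
    qed simp
  qed
  finally show ?thesis by (simp add: m_def)
qed

lemma radial_pos:
  assumes f: "nice d B R f" and x: "x \<in> Rn d" "f x \<noteq> 0" and f0: "f (\<lambda>i\<in>{..<d}. 0) = ennreal f0" "f0 > 0"
  shows "radial d q f x > 0"
proof -
  have "f x \<le> ennreal B" using f x by (auto simp: nice_def)
  then have "f x < \<infinity>" by (rule le_less_trans) simp
  then obtain \<beta> where \<beta>: "f x = ennreal (exp \<beta>)" using ennreal_exp_obtain x(2) by metis
  have "ennreal ((1 / 2) ^ q * min f0 (exp \<beta>) * (1 / 2)) \<le> radial d q f x"
    by (rule radial_ge[OF f x(1) _ f0]) (auto simp: \<beta>)
  moreover have "ennreal ((1 / 2) ^ q * min f0 (exp \<beta>) * (1 / 2)) > 0" using f0(2) by simp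
  ultimately show ?thesis by (rule less_le_trans[rotated])
qed

text \<open>Scaling by 2 fixes the origin but multiplies \<open>radial\<close> by 2^(-(q + 1)),
  which a positive finite value cannot satisfy.\<close>

lemma radial_zero_vector:
  assumes f: "nice d B R f" and f0: "f (\<lambda>i\<in>{..<d}. 0) = ennreal f0" "f0 > 0"
  shows "radial d q f (\<lambda>i\<in>{..<d}. 0) = \<infinity>"
proof (rule ccontr)
  let ?o = "\<lambda>i\<in>{..<d}. 0 :: real"
  assume "radial d q f ?o \<noteq> \<infinity>"
  then obtain g where g: "radial d q f ?o = ennreal g" "g \<ge> 0" by (cases "radial d q f ?o") auto
  have fo: "f ?o \<noteq> 0" unfolding f0(1) using f0(2) by simp
  have "g > 0" using radial_pos[OF f restrict_in_Rn fo f0, of q] unfolding g(1) by simp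
  have fm: "f \<in> borel_measurable (leb d)" using f by (simp add: nice_def)
  have "sc d 2 ?o = ?o" by (auto simp: sc_def fun_eq_iff)
  then have "ennreal g = ennreal (1 / 2 ^ (q + 1)) * ennreal g"
    using radial_scale[OF fm, of ?o 2 q] g by simp
  then have "g = 1 / 2 ^ (q + 1) * g"
    using g(2) by (simp add: ennreal_mult'[symmetric] del: power_Suc)
  then have "(1 :: real) = 1 / 2 ^ (q + 1)" using \<open>g > 0\<close> by (metis mult_cancel_right1 less_irrefl)
  moreover have "(1 :: real) / 2 ^ (q + 1) < 1" by (simp add: divide_less_eq less_1_mult' one_less_power)
  ultimately show False by linarith
qed

lemma nn_integral_power_tail:
  fixes r0 :: real
  assumes "r0 > 0"
  shows "(\<integral>\<^sup>+r. ennreal (1 / r ^ (q + 2)) * indicator {r0..} r \<partial>lborel) = ennreal (1 / (real (q + 1) * r0 ^ (q + 1)))"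
proof -
  let ?F = "\<lambda>r :: real. (- 1 / real (q + 1)) * inverse r ^ (q + 1)"
  have "(\<integral>\<^sup>+r. ennreal (1 / r ^ (q + 2)) * indicator {r0..} r \<partial>lborel) = ennreal (0 - ?F r0)"
  proof (rule nn_integral_FTC_atLeast)
    fix r :: real assume r: "r0 \<le> r"
    then have "r > 0" using assms by simp
    then have "((\<lambda>r. inverse r ^ Suc q) has_real_derivative (1 + real q) * (- (inverse r ^ Suc (Suc 0)) * inverse r ^ q)) (at r)"
      by (intro DERIV_power_Suc DERIV_inverse) simp
    then have "(?F has_real_derivative (- 1 / real (q + 1)) * ((1 + real q) * (- (inverse r ^ Suc (Suc 0)) * inverse r ^ q))) (at r)"
      unfolding Suc_eq_plus1[symmetric] by (rule DERIV_cmult)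
    moreover have "(- 1 / real (q + 1)) * ((1 + real q) * (- (inverse r ^ Suc (Suc 0)) * inverse r ^ q)) = inverse r ^ (q + 2)"
      by (simp add: add.commute)
    moreover have "inverse r ^ (q + 2) = 1 / r ^ (q + 2)" by (metis power_inverse inverse_eq_divide)
    ultimately show "DERIV ?F r :> 1 / r ^ (q + 2)" by (simp only:)
    show "0 \<le> 1 / r ^ (q + 2)" using \<open>r > 0\<close> by simp
  next
    have "(?F \<longlongrightarrow> (- 1 / real (q + 1)) * 0 ^ (q + 1)) at_top"
      by (intro tendsto_intros) (rule tendsto_inverse_0_at_top[OF filterlim_ident])
    then show "(?F \<longlongrightarrow> 0) at_top" by simp
  qed measurable
  also have "inverse r0 ^ (q + 1) = 1 / r0 ^ (q + 1)" by (metis power_inverse inverse_eq_divide)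
  also have "0 - (- 1 / real (q + 1)) * (1 / r0 ^ (q + 1)) = 1 / (real (q + 1) * r0 ^ (q + 1))" by simp
  finally show ?thesis .
qed

lemma real_root_pow:
  assumes "c > (0 :: real)" "p > 0"
  obtains t where "t > 0" "t ^ p = c"
  using assms by (metis real_root_gt_zero real_root_pow_pos)

text \<open>Used to stay away from the origin, where \<open>radial\<close> is infinite, and to see
  that a body is not flat.\<close>

lemma AE_leb_nonzero:
  assumes "k < d"
  shows "AE x in leb d. x k \<noteq> 0"
proof -
  have N: "{x \<in> Rn d. x k = 0} \<in> sets (leb d)"
  proof -
    have "{x \<in> space (leb d). x k = 0} \<in> sets (leb d)"
      using assms by measurable
    then show ?thesis by simp
  qed
  have "emeasure (leb d) {x \<in> Rn d. x k = 0} = (\<integral>\<^sup>+x. indicator {x \<in> Rn d. x k = 0} x \<partial>leb d)"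
    using N by simp
  also have "\<dots> = (\<integral>\<^sup>+x. \<integral>\<^sup>+y. indicator {x \<in> Rn d. x k = 0} (x(k := y)) \<partial>lborel \<partial>Pi\<^sub>M ({..<d} - {k}) (\<lambda>_. lborel))"
    by (rule nn_integral_leb_split[OF assms]) (use N in simp)
  also have "\<dots> = (\<integral>\<^sup>+x. 0 \<partial>Pi\<^sub>M ({..<d} - {k}) (\<lambda>_::nat. lborel :: real measure))"
  proof (rule nn_integral_cong)
    fix x :: "nat \<Rightarrow> real"
    have "(\<integral>\<^sup>+y. indicator {x \<in> Rn d. x k = 0} (x(k := y)) \<partial>lborel) \<le> (\<integral>\<^sup>+y. indicator {0 :: real} y \<partial>lborel)"
      by (intro nn_integral_mono) (auto simp: indicator_def)
    then show "(\<integral>\<^sup>+y. indicator {x \<in> Rn d. x k = 0} (x(k := y)) \<partial>lborel) = 0" by simp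
  qed
  finally have "emeasure (leb d) {x \<in> Rn d. x k = 0} = 0" by simp
  then show ?thesis using N by (intro AE_I[of _ _ "{x \<in> Rn d. x k = 0}"]) auto
qed

lemma nn_integral_leb_sc:
  assumes "h \<in> borel_measurable (leb d)" "s > 0"
  shows "(\<integral>\<^sup>+x. h (sc d s x) \<partial>leb d) = ennreal (1 / s ^ d) * (\<integral>\<^sup>+x. h x \<partial>leb d)"
  using nn_integral_leb_scale[OF assms(1), of "\<lambda>_. s"] assms(2)
  by (simp add: sc_def power_one_over)

text \<open>Integrating a homogeneous function over \<open>{radial \<ge> \<eta>}\<close>: Fubini and the substitution
  \<open>x \<mapsto> x / r\<close> replace polar coordinates.\<close>

lemma nn_integral_radial_superlevel:
  assumes f: "nice d B R f" and f0: "f (\<lambda>i\<in>{..<d}. 0) = ennreal f0" "f0 > 0" and d: "d > 0"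
    and q: "q + 1 = d + k" and \<eta>: "\<eta> > 0"
    and g [measurable]: "g \<in> borel_measurable (leb d)"
    and hom: "\<And>x s. x \<in> Rn d \<Longrightarrow> s > 0 \<Longrightarrow> g (sc d s x) = ennreal (s ^ k) * g x"
  shows "(\<integral>\<^sup>+x. g x * indicator {x \<in> Rn d. ennreal \<eta> \<le> radial d q f x} x \<partial>leb d) =
    ennreal (1 / (real (q + 1) * \<eta>)) * (\<integral>\<^sup>+x. g x * f x \<partial>leb d)"
proof -
  have fm [measurable]: "f \<in> borel_measurable (leb d)" using f by (simp add: nice_def)
  note [measurable] = radial_measurable[OF fm, of q]
  \<comment> \<open>Off the origin, h times \<open>radial\<close> is the indicator of the superlevel
    set. Writing out the factor \<open>radial\<close> as an integral brings in the variable
    \<open>r\<close>.\<close>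
  define h where "h x = (if ennreal \<eta> \<le> radial d q f x then inverse (radial d q f x) else 0)" for x
  have hm [measurable]: "h \<in> borel_measurable (leb d)" unfolding h_def by measurable
  have fin: "radial d q f x < \<infinity>" if "x \<in> Rn d" "x 0 \<noteq> 0" for x
    using radial_le[OF f that(1) d that(2), of q] by (rule le_less_trans) simp
  have "(\<integral>\<^sup>+x. g x * indicator {x \<in> Rn d. ennreal \<eta> \<le> radial d q f x} x \<partial>leb d) =
    (\<integral>\<^sup>+x. g x * h x * radial d q f x \<partial>leb d)"
  proof (rule nn_integral_cong_AE)
    have "AE x in leb d. x \<in> space (leb d)" by (rule AE_space)
    then show "AE x in leb d. g x * indicator {x \<in> Rn d. ennreal \<eta> \<le> radial d q f x} x = g x * h x * radial d q f x"
      using AE_leb_nonzero[OF d]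
    proof eventually_elim
      fix x assume x: "x \<in> space (leb d)" "x 0 \<noteq> 0"
      show "g x * indicator {x \<in> Rn d. ennreal \<eta> \<le> radial d q f x} x = g x * h x * radial d q f x"
      proof (cases "ennreal \<eta> \<le> radial d q f x")
        case True
        obtain r where r: "radial d q f x = ennreal r" "r \<ge> 0" using fin[of x] x by (cases "radial d q f x") auto
        have "r > 0" using True \<eta> r by (simp add: ennreal_le_iff)
        then have "inverse (radial d q f x) * radial d q f x = 1"
          unfolding r(1) by (simp add: inverse_ennreal ennreal_mult'[symmetric])
        then show ?thesis using True x by (simp add: h_def mult.assoc)
      next
        case False
        then show ?thesis by (simp add: h_def)
      qed
    qed
  qed
  also have "\<dots> = (\<integral>\<^sup>+x. \<integral>\<^sup>+r. g x * h x * (ennreal (r ^ q) * f (sc d r x) * indicator {0<..} r) \<partial>lborel \<partial>leb d)"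
    unfolding radial_def[of d q f]
    by (intro nn_integral_cong nn_integral_cmult[symmetric]) (simp add: radial_integrand_measurable[OF fm])
  also have "\<dots> = (\<integral>\<^sup>+r. \<integral>\<^sup>+x. g x * h x * (ennreal (r ^ q) * f (sc d r x) * indicator {0<..} r) \<partial>leb d \<partial>lborel)"
  proof (rule leb_lborel.Fubini'[symmetric])
    have "(\<lambda>p. (case (snd p, fst p) of (r, x) \<Rightarrow> ennreal (r ^ q) * f (sc d r x) * indicator {0<..} r)) \<in> borel_measurable (leb d \<Otimes>\<^sub>M lborel)"
      by (rule measurable_compose[OF _ radial_joint_measurable[OF fm]]) measurable
    then have "(\<lambda>p. g (fst p) * h (fst p) * (ennreal (snd p ^ q) * f (sc d (snd p) (fst p)) * indicator {0<..} (snd p))) \<in> borel_measurable (leb d \<Otimes>\<^sub>M lborel)"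
      by (intro borel_measurable_times_ennreal measurable_compose[OF measurable_fst]) (simp_all add: mult.assoc)
    then show "(\<lambda>(x, r). g x * h x * (ennreal (r ^ q) * f (sc d r x) * indicator {0<..} r)) \<in> borel_measurable (leb d \<Otimes>\<^sub>M lborel)"
      by (simp add: split_beta')
  qed
  also have "\<dots> = (\<integral>\<^sup>+r. \<integral>\<^sup>+x. g x * f x * (ennreal (1 / r) * h (sc d (1 / r) x) * indicator {0<..} r) \<partial>leb d \<partial>lborel)"
  proof (rule nn_integral_cong)
    fix r :: real
    show "(\<integral>\<^sup>+x. g x * h x * (ennreal (r ^ q) * f (sc d r x) * indicator {0<..} r) \<partial>leb d) =
      (\<integral>\<^sup>+x. g x * f x * (ennreal (1 / r) * h (sc d (1 / r) x) * indicator {0<..} r) \<partial>leb d)"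
    proof (cases "r > 0")
      case True
      define \<phi> where "\<phi> x = g x * h x * (ennreal (r ^ q) * f (sc d r x))" for x
      have "(\<lambda>x. f (sc d r x)) \<in> borel_measurable (leb d)"
        by (rule measurable_compose[OF measurable_sc_right fm])
      then have \<phi>m: "\<phi> \<in> borel_measurable (leb d)" unfolding \<phi>_def by simp
      have "(\<integral>\<^sup>+x. \<phi> (sc d (1 / r) x) \<partial>leb d) = ennreal (r ^ d) * (\<integral>\<^sup>+x. \<phi> x \<partial>leb d)"
        using nn_integral_leb_sc[OF \<phi>m, of "1 / r"] True by (simp add: power_one_over)
      then have "ennreal (1 / r ^ d) * (\<integral>\<^sup>+x. \<phi> (sc d (1 / r) x) \<partial>leb d) = ennreal (1 / r ^ d) * ennreal (r ^ d) * (\<integral>\<^sup>+x. \<phi> x \<partial>leb d)"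
        by (simp add: mult.assoc)
      also have "ennreal (1 / r ^ d) * ennreal (r ^ d) = 1"
        using True by (subst ennreal_mult'[symmetric]) auto
      finally have "(\<integral>\<^sup>+x. \<phi> x \<partial>leb d) = ennreal (1 / r ^ d) * (\<integral>\<^sup>+x. \<phi> (sc d (1 / r) x) \<partial>leb d)" by simp
      also have "\<dots> = (\<integral>\<^sup>+x. ennreal (1 / r ^ d) * \<phi> (sc d (1 / r) x) \<partial>leb d)"
        by (rule nn_integral_cmult[symmetric]) (rule measurable_compose[OF measurable_sc_right \<phi>m])
      also have "\<dots> = (\<integral>\<^sup>+x. g x * f x * (ennreal (1 / r) * h (sc d (1 / r) x)) \<partial>leb d)"
      proof (rule nn_integral_cong)
        fix x assume "x \<in> space (leb d)"
        then have x: "x \<in> Rn d" by simp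
        \<comment> \<open>The Jacobian r^(-d), the homogeneity r^(-k) and the weight r^q leave
          exactly 1 / r, because q + 1 = d + k.\<close>
        have "r ^ q * r = r ^ d * r ^ k" using q by (metis power_Suc2 Suc_eq_plus1 power_add)
        then have e: "1 / r ^ d * ((1 / r) ^ k * r ^ q) = 1 / r"
          using True by (simp add: field_simps)
        have "sc d r (sc d (1 / r) x) = x" using True x by (simp add: sc_sc sc_1)
        then have "ennreal (1 / r ^ d) * \<phi> (sc d (1 / r) x) =
            ennreal (1 / r ^ d) * (ennreal ((1 / r) ^ k) * ennreal (r ^ q)) * (g x * f x * h (sc d (1 / r) x))"
          using hom[OF x, of "1 / r"] True by (simp add: \<phi>_def mult_ac)
        also have "ennreal (1 / r ^ d) * (ennreal ((1 / r) ^ k) * ennreal (r ^ q)) = ennreal (1 / r)"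
          using True e by (simp add: ennreal_mult'[symmetric])
        finally show "ennreal (1 / r ^ d) * \<phi> (sc d (1 / r) x) = g x * f x * (ennreal (1 / r) * h (sc d (1 / r) x))"
          by (simp add: mult_ac)
      qed
      finally show ?thesis using True by (simp add: \<phi>_def)
    qed simp
  qed
  also have "\<dots> = (\<integral>\<^sup>+x. \<integral>\<^sup>+r. g x * f x * (ennreal (1 / r) * h (sc d (1 / r) x) * indicator {0<..} r) \<partial>lborel \<partial>leb d)"
  proof (rule leb_lborel.Fubini')
    have "(\<lambda>p. (1 / snd p :: real, fst p)) \<in> leb d \<Otimes>\<^sub>M borel \<rightarrow>\<^sub>M borel \<Otimes>\<^sub>M leb d"
      by (intro measurable_Pair measurable_fst borel_measurable_divide borel_measurable_const measurable_snd)
    from measurable_compose[OF measurable_compose[OF this measurable_sc] hm]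
    have "(\<lambda>p. h (sc d (1 / snd p) (fst p))) \<in> borel_measurable (leb d \<Otimes>\<^sub>M borel)" by simp
    moreover have "(\<lambda>p. ennreal (1 / snd p)) \<in> borel_measurable (leb d \<Otimes>\<^sub>M borel)"
      by (rule measurable_compose[OF measurable_snd, where g="\<lambda>s. ennreal (1 / s)"]) simp
    moreover have "(\<lambda>p. indicator {0<..} (snd p) :: ennreal) \<in> borel_measurable (leb d \<Otimes>\<^sub>M (borel :: real measure))"
      by (rule measurable_compose[OF measurable_snd, where g="indicator {0<..}"]) simp
    moreover note measurable_compose[OF measurable_fst g] measurable_compose[OF measurable_fst fm]
    ultimately have "(\<lambda>p. g (fst p) * f (fst p) * (ennreal (1 / snd p) * h (sc d (1 / snd p) (fst p)) * indicator {0<..} (snd p))) \<in> borel_measurable (leb d \<Otimes>\<^sub>M borel)"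
      by (intro borel_measurable_times_ennreal)
    then show "(\<lambda>(x, r). g x * f x * (ennreal (1 / r) * h (sc d (1 / r) x) * indicator {0<..} r)) \<in> borel_measurable (leb d \<Otimes>\<^sub>M lborel)"
      by (simp add: split_beta')
  qed
  also have "\<dots> = (\<integral>\<^sup>+x. ennreal (1 / (real (q + 1) * \<eta>)) * (g x * f x) \<partial>leb d)"
  proof (rule nn_integral_cong_AE)
    have "AE x in leb d. x \<in> space (leb d)" by (rule AE_space)
    then show "AE x in leb d. (\<integral>\<^sup>+r. g x * f x * (ennreal (1 / r) * h (sc d (1 / r) x) * indicator {0<..} r) \<partial>lborel) = ennreal (1 / (real (q + 1) * \<eta>)) * (g x * f x)"
      using AE_leb_nonzero[OF d]
    proof eventually_elim
      fix x assume "x \<in> space (leb d)" and nz: "x 0 \<noteq> 0"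
      then have x: "x \<in> Rn d" by simp
      show "(\<integral>\<^sup>+r. g x * f x * (ennreal (1 / r) * h (sc d (1 / r) x) * indicator {0<..} r) \<partial>lborel) = ennreal (1 / (real (q + 1) * \<eta>)) * (g x * f x)"
      proof (cases "f x = 0")
        case False
        obtain \<gamma> where \<gamma>: "radial d q f x = ennreal \<gamma>" "\<gamma> \<ge> 0" using fin[OF x nz] by (cases "radial d q f x") auto
        have \<gamma>0: "\<gamma> > 0" using radial_pos[OF f x False f0, of q] \<gamma> by simp
        \<comment> \<open>\<open>radial\<close> at x / r is r^(q + 1) * \<gamma>, so x / r belongs
          to the superlevel set exactly from the radius \<open>r0\<close> on.\<close>
        obtain r0 where r0: "r0 > 0" "r0 ^ (q + 1) = \<eta> / \<gamma>" using real_root_pow[of "\<eta> / \<gamma>" "q + 1"] \<eta> \<gamma>0 by auto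
        have "ennreal (1 / r) * h (sc d (1 / r) x) * indicator {0<..} r = ennreal (1 / \<gamma>) * (ennreal (1 / r ^ (q + 2)) * indicator {r0..} r)" for r
        proof (cases "r > 0")
          case True
          have G: "radial d q f (sc d (1 / r) x) = ennreal (r ^ (q + 1) * \<gamma>)"
            using radial_scale[OF fm x, of "1 / r" q] True \<gamma> by (simp add: power_one_over ennreal_mult' del: power_Suc)
          have "\<eta> \<le> r ^ (q + 1) * \<gamma> \<longleftrightarrow> r0 ^ (q + 1) \<le> r ^ (q + 1)"
            unfolding r0(2) using \<gamma>0 by (simp add: divide_le_eq)
          also have "\<dots> \<longleftrightarrow> r0 \<le> r"
            using True r0(1) by (intro power_mono_iff) auto
          finally have "ennreal \<eta> \<le> radial d q f (sc d (1 / r) x) \<longleftrightarrow> r0 \<le> r"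
            unfolding G using True \<gamma>0 by (simp add: ennreal_le_iff)
          then have "h (sc d (1 / r) x) = ennreal (1 / (r ^ (q + 1) * \<gamma>)) * indicator {r0..} r"
            unfolding h_def G using True \<gamma>0 by (simp add: inverse_ennreal inverse_eq_divide)
          moreover have "ennreal (1 / r) * ennreal (1 / (r ^ (q + 1) * \<gamma>)) = ennreal (1 / \<gamma>) * ennreal (1 / r ^ (q + 2))"
            using True \<gamma>0 by (simp add: ennreal_mult'[symmetric] mult_ac)
          ultimately show ?thesis using True by (simp add: mult.assoc[symmetric])
        next
          case False
          then show ?thesis using r0(1) by simp
        qed
        then have "(\<integral>\<^sup>+r. g x * f x * (ennreal (1 / r) * h (sc d (1 / r) x) * indicator {0<..} r) \<partial>lborel) =
          (\<integral>\<^sup>+r. g x * f x * ennreal (1 / \<gamma>) * (ennreal (1 / r ^ (q + 2)) * indicator {r0..} r) \<partial>lborel)"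
          by (simp add: mult.assoc)
        also have "\<dots> = g x * f x * ennreal (1 / \<gamma>) * ennreal (1 / (real (q + 1) * r0 ^ (q + 1)))"
          unfolding nn_integral_power_tail[OF r0(1), of q, symmetric] by (rule nn_integral_cmult) simp
        also have "\<dots> = g x * f x * (ennreal (1 / \<gamma>) * ennreal (1 / (real (q + 1) * (\<eta> / \<gamma>))))"
          unfolding r0(2) by (simp add: mult.assoc)
        also have "ennreal (1 / \<gamma>) * ennreal (1 / (real (q + 1) * (\<eta> / \<gamma>))) = ennreal (1 / (real (q + 1) * \<eta>))"
          using \<gamma>0 \<eta> by (subst ennreal_mult'[symmetric]) (auto simp: field_simps)
        finally show ?thesis by (simp add: mult_ac)
      qed simp
    qed
  qed
  also have "\<dots> = ennreal (1 / (real (q + 1) * \<eta>)) * (\<integral>\<^sup>+x. g x * f x \<partial>leb d)"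
    by (rule nn_integral_cmult) simp
  finally show ?thesis .
qed

section \<open>Convexity of Ball bodies\<close>

declare measurable_leb_component [measurable del]

text \<open>After a reflection the substitution is a \<mapsto> -1/a, which is increasing. It is
  carried out on the compact intervals \<open>I k\<close>, which are symmetric under inversion and
  exhaust the half-line, and the limit is taken by monotone convergence.\<close>

lemma nn_integral_inverse_subst:
  fixes \<phi> :: "real \<Rightarrow> ennreal"
  assumes m [measurable]: "\<phi> \<in> borel_measurable borel" and fin: "\<And>r. \<phi> r < \<infinity>"
  shows "(\<integral>\<^sup>+a. \<phi> (1 / a) * ennreal (1 / a\<^sup>2) * indicator {0<..} a \<partial>lborel) = (\<integral>\<^sup>+r. \<phi> r * indicator {0<..} r \<partial>lborel)"
proof -
  define \<psi> where "\<psi> r = enn2real (\<phi> r)" for r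
  have \<psi>: "\<phi> r = ennreal (\<psi> r)" "\<psi> r \<ge> 0" for r using fin[of r] by (auto simp: \<psi>_def)
  have \<psi>m [measurable]: "\<psi> \<in> borel_measurable borel" unfolding \<psi>_def by measurable
  define I where "I k = {1 / real (Suc k)..real (Suc k)}" for k
  have eq: "(\<integral>\<^sup>+r. \<phi> r * indicator (I k) r \<partial>lborel) = (\<integral>\<^sup>+a. \<phi> (1 / a) * ennreal (1 / a\<^sup>2) * indicator (I k) a \<partial>lborel)" for k
  proof -
    let ?c = "real (Suc k)"
    have c: "?c \<ge> 1" "1 / ?c \<le> ?c" 
    proof -
      show c1: "?c \<ge> 1" by simp
      then have "1 / ?c \<le> 1" by simp
      then show "1 / ?c \<le> ?c" using c1 by linarith
    qed
    have "(\<integral>\<^sup>+r. \<phi> r * indicator (I k) r \<partial>lborel) = (\<integral>\<^sup>+u. \<phi> (- u) * indicator (I k) (- u) \<partial>lborel)"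
      using nn_integral_real_affine[of "\<lambda>r. \<phi> r * indicator (I k) r" "-1" 0] by (simp add: I_def)
    also have "\<dots> = (\<integral>\<^sup>+u. ennreal (\<psi> (- u) * indicator {- 1 / (1 / ?c)..- 1 / ?c} u) \<partial>lborel)"
    proof (rule nn_integral_cong)
      fix u :: real
      have "- u \<in> I k \<longleftrightarrow> u \<in> {- 1 / (1 / ?c)..- 1 / ?c}"
      proof -
        have "- 1 / (1 / ?c) = - ?c" "- 1 / ?c = - (1 / ?c)" by simp_all
        moreover have "(v \<le> - u \<and> - u \<le> w) \<longleftrightarrow> (- w \<le> u \<and> u \<le> - v)" for v w :: real by linarith
        ultimately show ?thesis unfolding I_def atLeastAtMost_iff by (simp only:)
      qed
      then show "\<phi> (- u) * indicator (I k) (- u) = ennreal (\<psi> (- u) * indicator {- 1 / (1 / ?c)..- 1 / ?c} u)"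
        using \<psi>(1)[of "- u"] by (cases "- u \<in> I k") simp_all
    qed
    also have "\<dots> = (\<integral>\<^sup>+a. ennreal (\<psi> (- (- 1 / a)) * (1 / a\<^sup>2) * indicator {1 / ?c..?c} a) \<partial>lborel)"
    proof (rule nn_integral_substitution[of "\<lambda>a. - 1 / a" "1 / ?c" "?c" "\<lambda>u. \<psi> (- u)" "\<lambda>a. 1 / a\<^sup>2"])
      show "set_borel_measurable borel {- 1 / (1 / ?c)..- 1 / ?c} (\<lambda>u. \<psi> (- u))"
        unfolding set_borel_measurable_def by measurable
      fix x assume "x \<in> {1 / ?c..?c}"
      then have x: "x > 0" using c by (auto intro: less_le_trans[of 0 "1 / ?c"])
      then show "((\<lambda>a. - 1 / a) has_real_derivative 1 / x\<^sup>2) (at x)"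
        by (auto intro!: derivative_eq_intros simp: power2_eq_square)
    next
      show "continuous_on {1 / ?c..?c} (\<lambda>a. 1 / a\<^sup>2)"
        using c by (intro continuous_intros) (auto simp: divide_le_eq)
    qed (use c in auto)
    also have "\<dots> = (\<integral>\<^sup>+a. \<phi> (1 / a) * ennreal (1 / a\<^sup>2) * indicator (I k) a \<partial>lborel)"
    proof (intro nn_integral_cong)
      fix a :: real
      have "ennreal (\<psi> (1 / a) * (1 / a\<^sup>2)) = ennreal (\<psi> (1 / a)) * ennreal (1 / a\<^sup>2)"
        by (rule ennreal_mult) (auto simp: \<psi>(2))
      then show "ennreal (\<psi> (- (- 1 / a)) * (1 / a\<^sup>2) * indicator {1 / ?c..?c} a) = \<phi> (1 / a) * ennreal (1 / a\<^sup>2) * indicator (I k) a"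
        unfolding I_def[symmetric] minus_divide_left minus_minus \<psi>(1)[of "1 / a"]
        by (cases "a \<in> I k") simp_all
    qed
    finally show ?thesis .
  qed
  have incI: "I i \<subseteq> I j" if "i \<le> j" for i j
  proof -
    have "1 / real (Suc j) \<le> 1 / real (Suc i)" using that by (intro divide_left_mono) auto
    then show ?thesis using that unfolding I_def by auto
  qed
  have UI: "\<exists>k. r \<in> I k" if r: "r > 0" for r
  proof -
    obtain k where k: "max r (1 / r) < real k" using reals_Archimedean2 by blast
    then have "r < real (Suc k)" "1 / r < real (Suc k)" by auto
    then have "r \<in> I k" using r by (auto simp: I_def field_simps)
    then show ?thesis ..
  qed
  have lim: "(\<lambda>k. \<integral>\<^sup>+r. h r * indicator (I k) r \<partial>lborel) \<longlonglongrightarrow> (\<integral>\<^sup>+r. h r * indicator {0<..} r \<partial>lborel)"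
    if [measurable]: "h \<in> borel_measurable borel" for h :: "real \<Rightarrow> ennreal"
  proof (rule nn_integral_LIMSEQ)
    show "incseq (\<lambda>k r. h r * indicator (I k) r)"
      using incI by (auto simp: incseq_def le_fun_def indicator_def)
    show "(\<lambda>r. h r * indicator (I k) r) \<in> borel_measurable lborel" for k
      unfolding I_def by measurable
    show "(\<lambda>k. h r * indicator (I k) r) \<longlonglongrightarrow> h r * indicator {0<..} r" for r
    proof (cases "r > 0")
      case True
      then obtain k where "r \<in> I k" using UI by blast
      then have "eventually (\<lambda>j. r \<in> I j) sequentially"
        using incI by (auto simp: eventually_sequentially)
      then have "eventually (\<lambda>j. h r * indicator (I j) r = h r * indicator {0<..} r) sequentially"
        by eventually_elim (use True in simp)
      then show ?thesis by (rule tendsto_eventually)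
    next
      case False
      have "r \<notin> I k" for k
      proof
        assume "r \<in> I k"
        then have "1 / real (Suc k) \<le> r" by (simp only: I_def atLeastAtMost_iff)
        moreover have "0 < 1 / real (Suc k)" by simp
        ultimately show False using False by linarith
      qed
      then show ?thesis using False by simp
    qed
  qed
  have "(\<lambda>k. \<integral>\<^sup>+a. \<phi> (1 / a) * ennreal (1 / a\<^sup>2) * indicator (I k) a \<partial>lborel) \<longlonglongrightarrow> (\<integral>\<^sup>+a. \<phi> (1 / a) * ennreal (1 / a\<^sup>2) * indicator {0<..} a \<partial>lborel)"
    by (rule lim) simp
  moreover have "(\<lambda>k. \<integral>\<^sup>+r. \<phi> r * indicator (I k) r \<partial>lborel) \<longlonglongrightarrow> (\<integral>\<^sup>+r. \<phi> r * indicator {0<..} r \<partial>lborel)"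
    by (rule lim) simp
  ultimately show ?thesis unfolding eq by (rule LIMSEQ_unique)
qed

text \<open>The radial integral in the variable \<open>a = 1 / r\<close>: in this variable convex combinations of points
  correspond to convex combinations of parameters.\<close>

definition recip :: "nat \<Rightarrow> nat \<Rightarrow> ((nat \<Rightarrow> real) \<Rightarrow> ennreal) \<Rightarrow> (nat \<Rightarrow> real) \<Rightarrow> real \<Rightarrow> ennreal"
  where "recip d q f x a = ennreal (1 / a ^ (q + 2)) * f (sc d (1 / a) x) * indicator {0<..} a"

lemma recip_measurable:
  assumes "f \<in> borel_measurable (leb d)" "x \<in> Rn d"
  shows "recip d q f x \<in> borel_measurable borel"
proof -
  have "(\<lambda>a. f (sc d (1 / a) x)) \<in> borel_measurable borel"
    by (rule measurable_compose[OF _ measurable_compose[OF measurable_sc_left[OF assms(2)] assms(1)]]) simp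
  then show ?thesis unfolding recip_def[abs_def] by measurable
qed

lemma nn_integral_recip:
  assumes f: "nice d B R f" and x: "x \<in> Rn d"
  shows "(\<integral>\<^sup>+a. recip d q f x a \<partial>lborel) = radial d q f x"
proof -
  have fm: "f \<in> borel_measurable (leb d)" using f by (simp add: nice_def)
  have ffin: "f y < \<infinity>" if "y \<in> Rn d" for y
    by (rule le_less_trans[of _ "ennreal B"]) (use f that in \<open>auto simp: nice_def\<close>)
  define \<phi> where "\<phi> r = ennreal (r ^ q) * f (sc d r x)" for r
  have "\<phi> \<in> borel_measurable borel"
    unfolding \<phi>_def by (intro borel_measurable_times_ennreal measurable_compose[OF measurable_sc_left[OF x] fm]) simp
  moreover have "\<phi> r < \<infinity>" for r
    unfolding \<phi>_def using ffin[of "sc d r x"] by (simp add: ennreal_mult_less_top)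
  ultimately have "(\<integral>\<^sup>+a. \<phi> (1 / a) * ennreal (1 / a\<^sup>2) * indicator {0<..} a \<partial>lborel) = (\<integral>\<^sup>+r. \<phi> r * indicator {0<..} r \<partial>lborel)"
    by (rule nn_integral_inverse_subst)
  moreover have "(\<integral>\<^sup>+r. \<phi> r * indicator {0<..} r \<partial>lborel) = radial d q f x"
    by (simp add: \<phi>_def radial_def)
  moreover have "\<phi> (1 / a) * ennreal (1 / a\<^sup>2) * indicator {0<..} a = recip d q f x a" for a
  proof (cases "a > 0")
    case True
    have "ennreal ((1 / a) ^ q) * ennreal (1 / a\<^sup>2) = ennreal (1 / a ^ (q + 2))"
      using True by (subst ennreal_mult'[symmetric]) (auto simp: power_one_over power_add power2_eq_square)
    then have "\<phi> (1 / a) * ennreal (1 / a\<^sup>2) = ennreal (1 / a ^ (q + 2)) * f (sc d (1 / a) x)"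
      unfolding \<phi>_def by (metis mult.commute mult.left_commute)
    then show ?thesis by (simp add: recip_def)
  qed (simp add: recip_def)
  ultimately show ?thesis by simp
qed

lemma exp_ln_power: "v > 0 \<Longrightarrow> s > 0 \<Longrightarrow> exp (ln s + real n * ln v) = v ^ n * s"
  by (simp add: exp_add exp_of_nat_mult)

text \<open>With c = (1 - t) a + t b, the combined point over \<open>c\<close> is the combination of
  x / a and y / b with weight \<theta> = t b / c, so log-concavity applies. For these weights
  \<open>c\<close> is the harmonic mean of \<open>a\<close> and \<open>b\<close>, hence at most
  their geometric mean, which is exactly what the factors a^(q + 2) and b^(q + 2) require.\<close>

lemma recip_comb:
  assumes lc: "log_concave d f" and x: "x \<in> Rn d" "y \<in> Rn d" and t: "0 < t" "t < 1" and s: "s > 0"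
    and U: "ennreal s \<le> recip d q f x a" "ennreal s \<le> recip d q f y b"
  shows "ennreal s \<le> recip d q f (comb d t x y) ((1 - t) * a + t * b)"
proof -
  have pos: "v > 0 \<and> ennreal (exp (ln s + real (q + 2) * ln v)) \<le> f (sc d (1 / v) w)"
    if *: "ennreal s \<le> recip d q f w v" for w v
  proof -
    have v: "v > 0"
    proof (rule ccontr)
      assume "\<not> v > 0"
      then have "recip d q f w v = 0" by (simp add: recip_def)
      then show False using * s by simp
    qed
    have "ennreal (v ^ (q + 2)) * ennreal s \<le> ennreal (v ^ (q + 2)) * (ennreal (1 / v ^ (q + 2)) * f (sc d (1 / v) w))"
      using * v by (intro mult_left_mono) (auto simp: recip_def)
    also have "\<dots> = f (sc d (1 / v) w)"
      using v by (simp add: mult.assoc[symmetric] ennreal_mult'[symmetric] del: power_Suc)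
    finally have "ennreal (v ^ (q + 2) * s) \<le> f (sc d (1 / v) w)"
      using v by (simp add: ennreal_mult')
    moreover have "exp (ln s + real (q + 2) * ln v) = v ^ (q + 2) * s"
      using v s by (rule exp_ln_power)
    ultimately show ?thesis using v by simp
  qed
  have a: "a > 0" "ennreal (exp (ln s + real (q + 2) * ln a)) \<le> f (sc d (1 / a) x)" using pos[OF U(1)] by auto
  have b: "b > 0" "ennreal (exp (ln s + real (q + 2) * ln b)) \<le> f (sc d (1 / b) y)" using pos[OF U(2)] by auto
  define c where "c = (1 - t) * a + t * b"
  have c: "c > 0" using a(1) b(1) t by (simp add: c_def add_pos_pos)
  define \<theta> where "\<theta> = t * b / c"
  have \<theta>1: "1 - \<theta> = (1 - t) * a / c" using c by (simp add: \<theta>_def c_def field_simps)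
  have "t * b / c > 0" "(1 - t) * a / c > 0" using c a(1) b(1) t by simp_all
  then have \<theta>: "0 < \<theta>" "\<theta> < 1" unfolding \<theta>_def[symmetric] \<theta>1[symmetric] by auto
  have "comb d \<theta> (sc d (1 / a) x) (sc d (1 / b) y) = sc d (1 / c) (comb d t x y)"
  proof (rule Rn_eqI[of _ d])
    fix i assume "i < d"
    then show "comb d \<theta> (sc d (1 / a) x) (sc d (1 / b) y) i = sc d (1 / c) (comb d t x y) i"
      unfolding comb_def sc_def \<theta>1 using a(1) b(1) c by (simp add: \<theta>_def add_divide_distrib)
  qed auto
  moreover have "ennreal (exp ((1 - \<theta>) * (ln s + real (q + 2) * ln a) + \<theta> * (ln s + real (q + 2) * ln b)))
     \<le> f (comb d \<theta> (sc d (1 / a) x) (sc d (1 / b) y))"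
    by (rule log_concaveD[OF lc _ _ \<theta> a(2) b(2)]) auto
  moreover have "ln s + real (q + 2) * ln c \<le> (1 - \<theta>) * (ln s + real (q + 2) * ln a) + \<theta> * (ln s + real (q + 2) * ln b)"
  proof -
    have "(1 - \<theta>) * ln (c / a) \<le> (1 - \<theta>) * (c / a - 1)" "\<theta> * ln (c / b) \<le> \<theta> * (c / b - 1)"
      using \<theta> a(1) b(1) c by (auto intro!: mult_left_mono ln_le_minus_one)
    moreover have "(1 - \<theta>) * (c / a - 1) + \<theta> * (c / b - 1) = 0"
    proof -
      have "(1 - \<theta>) * (c / a) = 1 - t" "\<theta> * (c / b) = t"
        unfolding \<theta>1 using a(1) b(1) c by (simp_all add: \<theta>_def)
      then show ?thesis by (simp add: right_diff_distrib)
    qed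
    moreover have "(1 - \<theta>) * ln (c / a) + \<theta> * ln (c / b) = ln c - ((1 - \<theta>) * ln a + \<theta> * ln b)"
      using a(1) b(1) c by (simp add: ln_divide_pos algebra_simps)
    ultimately have "ln c \<le> (1 - \<theta>) * ln a + \<theta> * ln b" by linarith
    then have "real (q + 2) * ln c \<le> real (q + 2) * ((1 - \<theta>) * ln a + \<theta> * ln b)"
      by (intro mult_left_mono) auto
    then show ?thesis by (simp add: algebra_simps)
  qed
  ultimately have "ennreal (exp (ln s + real (q + 2) * ln c)) \<le> f (sc d (1 / c) (comb d t x y))"
    by (smt (verit, best) ennreal_leI exp_le_cancel_iff order_trans)
  moreover have "exp (ln s + real (q + 2) * ln c) = c ^ (q + 2) * s"
    using c s by (rule exp_ln_power)
  ultimately have "ennreal (1 / c ^ (q + 2)) * ennreal (c ^ (q + 2) * s) \<le> ennreal (1 / c ^ (q + 2)) * f (sc d (1 / c) (comb d t x y))"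
    by (intro mult_left_mono) auto
  moreover have "ennreal (1 / c ^ (q + 2)) * ennreal (c ^ (q + 2) * s) = ennreal s"
    using c by (subst ennreal_mult'[symmetric]) auto
  ultimately show ?thesis using c by (simp add: recip_def c_def)
qed

lemma recip_scale:
  assumes "\<kappa> > 0"
  shows "recip d q f (sc d \<kappa> x) a = ennreal (1 / \<kappa> ^ (q + 2)) * recip d q f x (a / \<kappa>)"
proof (cases "a > 0")
  case True
  have "ennreal (1 / a ^ (q + 2)) = ennreal (1 / \<kappa> ^ (q + 2)) * ennreal (1 / (a / \<kappa>) ^ (q + 2))"
    using assms True by (subst ennreal_mult'[symmetric]) (auto simp: power_divide)
  then show ?thesis using assms True by (simp add: recip_def sc_sc mult.assoc)
next
  case False
  then show ?thesis using assms by (simp add: recip_def zero_less_divide_iff)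
qed

text \<open>The tangent to v^(-p) at \<open>w\<close>. With u = v / w it is Bernoulli's inequality
  for (1 / u)^p combined with 2 \<le> u + 1 / u.\<close>

lemma inverse_power_convex:
  fixes v w :: real
  assumes "v > 0" "w > 0"
  shows "1 / w ^ p - p / w ^ (p + 1) * (v - w) \<le> 1 / v ^ p"
proof -
  define u where "u = v / w"
  have u: "u > 0" "v = u * w" using assms by (auto simp: u_def)
  have "0 \<le> (u - 1)\<^sup>2" by simp
  then have "2 * u \<le> u * u + 1" by (simp add: power2_eq_square algebra_simps)
  then have "2 \<le> u + 1 / u" using u(1) by (simp add: field_simps)
  then have "1 + real p * (1 - u) \<le> 1 + real p * (1 / u - 1)"
    by (intro add_left_mono mult_left_mono) auto
  also have "\<dots> \<le> (1 + (1 / u - 1)) ^ p"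
    using u(1) by (intro Bernoulli_inequality) simp
  finally have "1 + real p * (1 - u) \<le> 1 / u ^ p" by (simp add: power_one_over)
  then have "(1 + real p * (1 - u)) / w ^ p \<le> (1 / u ^ p) / w ^ p"
    using assms(2) by (intro divide_right_mono) auto
  moreover have "(1 + real p * (1 - u)) / w ^ p = 1 / w ^ p - p / w ^ (p + 1) * (v - w)"
    unfolding u(2) using assms(2) by (simp add: field_simps)
  moreover have "(1 / u ^ p) / w ^ p = 1 / v ^ p"
    unfolding u(2) by (simp add: power_mult_distrib)
  ultimately show ?thesis by (simp only:)
qed

lemma inverse_power_jensen:
  fixes v w t :: real
  assumes "v > 0" "w > 0" "0 < t" "t < 1"
  shows "1 / ((1 - t) * v + t * w) ^ p \<le> (1 - t) * (1 / v ^ p) + t * (1 / w ^ p)"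
proof -
  define m where "m = (1 - t) * v + t * w"
  have m: "m > 0" using assms by (simp add: m_def add_pos_pos)
  define k where "k = p / m ^ (p + 1)"
  have "(1 - t) * (1 / m ^ p - k * (v - m)) + t * (1 / m ^ p - k * (w - m)) \<le> (1 - t) * (1 / v ^ p) + t * (1 / w ^ p)"
    unfolding k_def using assms m by (intro add_mono mult_left_mono inverse_power_convex) auto
  moreover have "(1 - t) * (X - k * (v - m)) + t * (X - k * (w - m)) = X - k * ((1 - t) * v + t * w - m)" for X
    by (simp add: algebra_simps)
  ultimately show ?thesis by (simp add: m_def)
qed

lemma le_ennreal_approx:
  fixes X Y :: ennreal
  assumes "\<And>s. s > 0 \<Longrightarrow> ennreal s \<le> X \<Longrightarrow> ennreal s \<le> Y"
  shows "X \<le> Y"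
proof (rule dense_le)
  fix x assume x: "x < X"
  then have "x < top" using less_le_trans[OF x top_greatest] by simp
  then obtain s where s: "x = ennreal s" "s \<ge> 0" by (cases x) auto
  show "x \<le> Y"
  proof (cases "s = 0")
    case False
    then show ?thesis using assms[of s] s x by (simp add: less_imp_le)
  qed (use s in simp)
qed

lemma SUP_scale_arg: 
  fixes U :: "real \<Rightarrow> ennreal"
  assumes "\<kappa> > 0" shows "(SUP a. U (a / \<kappa>)) = (SUP a. U a)"
proof (rule antisym)
  show "(SUP a. U (a / \<kappa>)) \<le> (SUP a. U a)" by (rule SUP_least) (rule SUP_upper, simp)
  show "(SUP a. U a) \<le> (SUP a. U (a / \<kappa>))"
  proof (rule SUP_least)
    fix a show "U a \<le> (SUP a. U (a / \<kappa>))"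
      using SUP_upper[of "a * \<kappa>" UNIV "\<lambda>a. U (a / \<kappa>)"] assms by simp
  qed
qed

lemma recip_level_sets:
  assumes f: "nice d B R f" and x: "x \<in> Rn d" and s: "s > 0"
  shows "convex {a. ennreal s < recip d q f x a}" "bounded {a. ennreal s < recip d q f x a}"
proof -
  have lc: "log_concave d f" and B: "B \<ge> 0" and bd: "\<And>x. x \<in> Rn d \<Longrightarrow> f x \<le> ennreal B" using f by (auto simp: nice_def)
  show "convex {a. ennreal s < recip d q f x a}"
  proof (rule convex_level_set_of_min[OF _ s])
    fix a b t r :: real
    assume "0 < t" "t < 1" "r > 0" "ennreal r \<le> recip d q f x a" "ennreal r \<le> recip d q f x b"
    from recip_comb[OF lc x x this(1-3) this(4,5)]
    have "ennreal r \<le> recip d q f (comb d t x x) ((1 - t) * a + t * b)" .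
    moreover have "comb d t x x = x" by (rule Rn_eqI[of _ d]) (use x in \<open>auto simp: comb_def algebra_simps\<close>)
    ultimately show "ennreal r \<le> recip d q f x ((1 - t) * a + t * b)" by simp
  qed
  have "{a. ennreal s < recip d q f x a} \<subseteq> {0..max 1 (B / s)}"
  proof
    fix a assume "a \<in> {a. ennreal s < recip d q f x a}"
    then have *: "ennreal s < recip d q f x a" by simp
    have a: "a > 0"
    proof (rule ccontr)
      assume "\<not> a > 0"
      then show False using * by (simp add: recip_def)
    qed
    have "ennreal s < ennreal (1 / a ^ (q + 2)) * f (sc d (1 / a) x)" using * a by (simp add: recip_def)
    also have "\<dots> \<le> ennreal (1 / a ^ (q + 2)) * ennreal B" by (intro mult_left_mono bd) auto
    also have "\<dots> = ennreal (B / a ^ (q + 2))" using a by (simp add: ennreal_mult'[symmetric])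
    finally have "s < B / a ^ (q + 2)" using s by (simp add: ennreal_less_iff)
    then have sB: "a ^ (q + 2) < B / s" using a s by (simp add: field_simps)
    have "a \<le> max 1 (B / s)"
    proof (cases "a \<le> 1")
      case False
      then have "a ^ 1 \<le> a ^ (q + 2)" by (intro power_increasing) auto
      then show ?thesis using sB by simp
    qed simp
    then show "a \<in> {0..max 1 (B / s)}" using a by simp
  qed
  then show "bounded {a. ennreal s < recip d q f x a}"
    using bounded_subset[OF bounded_closed_interval] by blast
qed

text \<open>Finite because the ray leaves the support, which forces 1 / a \<le> R / |x i|; positive
  because the integral is. The value is what the normalisation before the level-set inequality
  divides by.\<close>

lemma SUP_recip:
  assumes f: "nice d B R f" and x: "x \<in> Rn d" "i < d" "x i \<noteq> 0" and pos: "radial d q f x \<noteq> 0"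
  obtains m where "m > 0" "(SUP a. recip d q f x a) = ennreal m"
proof -
  have B: "B \<ge> 0" "R \<ge> 0" and bd: "\<And>x. x \<in> Rn d \<Longrightarrow> f x \<le> ennreal B" using f by (auto simp: nice_def)
  have nz: "(SUP a. recip d q f x a) \<noteq> 0"
  proof
    assume "(SUP a. recip d q f x a) = 0"
    then have "recip d q f x a = 0" for a using SUP_upper[of a UNIV "recip d q f x"] by simp
    then have "radial d q f x = 0" using nn_integral_recip[OF f x(1), of q] by simp
    then show False using pos by simp
  qed
  have bound: "recip d q f x a \<le> ennreal ((R / \<bar>x i\<bar>) ^ (q + 2) * B)" for a
  proof (cases "a > 0 \<and> f (sc d (1 / a) x) \<noteq> 0")
    case True
    then have "1 / a \<le> R / \<bar>x i\<bar>" using nice_support_scaled[OF f x, of "1 / a"] by simp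
    then have "(1 / a) ^ (q + 2) \<le> (R / \<bar>x i\<bar>) ^ (q + 2)" using True by (intro power_mono) auto
    then have "ennreal (1 / a ^ (q + 2)) * f (sc d (1 / a) x) \<le> ennreal ((R / \<bar>x i\<bar>) ^ (q + 2)) * ennreal B"
      by (intro mult_mono bd) (auto simp: power_one_over simp del: power_Suc intro: ennreal_leI)
    moreover have "ennreal ((R / \<bar>x i\<bar>) ^ (q + 2) * B) = ennreal ((R / \<bar>x i\<bar>) ^ (q + 2)) * ennreal B"
      using B by (intro ennreal_mult) auto
    moreover have "recip d q f x a = ennreal (1 / a ^ (q + 2)) * f (sc d (1 / a) x)"
      using True by (simp add: recip_def)
    ultimately show ?thesis by (simp only:)
  qed (auto simp: recip_def)
  have "(SUP a. recip d q f x a) \<le> ennreal ((R / \<bar>x i\<bar>) ^ (q + 2) * B)" by (rule SUP_least) (rule bound)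
  then have "(SUP a. recip d q f x a) < \<infinity>" by (rule le_less_trans) simp
  then obtain u where "(SUP a. recip d q f x a) = ennreal (exp u)" using ennreal_exp_obtain nz by metis
  then show ?thesis using that[of "exp u"] by simp
qed

text \<open>The level-set inequality wants equal suprema, so \<open>x\<close> and \<open>y\<close>
  are first dilated until both are 1. The weight \<open>l\<close> is chosen so that the combination
  \<open>Z\<close> of the dilated points is a multiple of the wanted one. Homogeneity moves
  everything back, and the factors recombine by convexity of v^(-p).\<close>

lemma radial_superlevel_convex_aux:
  assumes f: "nice d B R f" and \<eta>: "\<eta> > 0"
    and x: "x \<in> Rn d" "i < d" "x i \<noteq> 0" "ennreal \<eta> \<le> radial d q f x"
    and y: "y \<in> Rn d" "j < d" "y j \<noteq> 0" "ennreal \<eta> \<le> radial d q f y"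
    and t: "0 < t" "t < 1"
  shows "ennreal \<eta> \<le> radial d q f (comb d t x y)"
proof -
  have fm: "f \<in> borel_measurable (leb d)" and lc: "log_concave d f" using f by (auto simp: nice_def)
  have nz: "radial d q f x \<noteq> 0" "radial d q f y \<noteq> 0" using x(4) y(4) \<eta> by auto
  obtain mx where mx: "mx > 0" "(SUP a. recip d q f x a) = ennreal mx" by (rule SUP_recip[OF f x(1-3) nz(1)])
  obtain my where my: "my > 0" "(SUP a. recip d q f y a) = ennreal my" by (rule SUP_recip[OF f y(1-3) nz(2)])
  \<comment> \<open>Dilating by \<kappa> divides the supremum of \<open>recip\<close> by \<kappa>^(q
    + 2).\<close>
  obtain \<kappa> where \<kappa>: "\<kappa> > 0" "\<kappa> ^ (q + 2) = mx" using real_root_pow[of mx "q + 2"] mx by auto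
  obtain \<mu> where \<mu>: "\<mu> > 0" "\<mu> ^ (q + 2) = my" using real_root_pow[of my "q + 2"] my by auto
  \<comment> \<open>The dilation returning \<open>Z\<close> to the combination of \<open>x\<close>
    and \<open>y\<close>: \<sigma> (1 - l) \<kappa> = 1 - t and \<sigma> l \<mu> = t.\<close>
  define \<sigma> where "\<sigma> = (1 - t) / \<kappa> + t / \<mu>"
  have \<sigma>: "\<sigma> > 0" using \<kappa> \<mu> t by (simp add: \<sigma>_def add_pos_pos)
  define l where "l = t / \<mu> / \<sigma>"
  have l1: "1 - l = (1 - t) / \<kappa> / \<sigma>" 
  proof -
    have "1 - l = (\<sigma> - t / \<mu>) / \<sigma>" using \<sigma> by (simp add: l_def diff_divide_distrib)
    also have "\<sigma> - t / \<mu> = (1 - t) / \<kappa>" by (simp add: \<sigma>_def)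
    finally show ?thesis .
  qed
  have "t / \<mu> / \<sigma> > 0" "(1 - t) / \<kappa> / \<sigma> > 0" using \<kappa> \<mu> \<sigma> t by simp_all
  then have l: "0 < l" "l < 1" unfolding l_def[symmetric] l1[symmetric] by auto
  define X where "X = sc d \<kappa> x"
  define Y where "Y = sc d \<mu> y"
  define Z where "Z = comb d l X Y"
  have XY: "X \<in> Rn d" "Y \<in> Rn d" "Z \<in> Rn d" by (auto simp: X_def Y_def Z_def)
  have supX: "(SUP a. recip d q f X a) = 1"
  proof -
    have "(SUP a. recip d q f X a) = ennreal (1 / \<kappa> ^ (q + 2)) * (SUP a. recip d q f x (a / \<kappa>))"
      unfolding X_def recip_scale[OF \<kappa>(1)] by (rule SUP_mult_left_ennreal[symmetric])
    also have "\<dots> = ennreal (1 / mx) * ennreal mx"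
      unfolding SUP_scale_arg[OF \<kappa>(1)] mx(2) \<kappa>(2) by (rule refl)
    also have "\<dots> = 1" using mx(1) by (subst ennreal_mult'[symmetric]) auto
    finally show ?thesis .
  qed
  have supY: "(SUP a. recip d q f Y a) = 1"
  proof -
    have "(SUP a. recip d q f Y a) = ennreal (1 / \<mu> ^ (q + 2)) * (SUP a. recip d q f y (a / \<mu>))"
      unfolding Y_def recip_scale[OF \<mu>(1)] by (rule SUP_mult_left_ennreal[symmetric])
    also have "\<dots> = ennreal (1 / my) * ennreal my"
      unfolding SUP_scale_arg[OF \<mu>(1)] my(2) \<mu>(2) by (rule refl)
    also have "\<dots> = 1" using my(1) by (subst ennreal_mult'[symmetric]) auto
    finally show ?thesis .
  qed
  have "ennreal (1 - l) * (\<integral>\<^sup>+a. recip d q f X a \<partial>lborel) + ennreal l * (\<integral>\<^sup>+a. recip d q f Y a \<partial>lborel) \<le> (\<integral>\<^sup>+a. recip d q f Z a \<partial>lborel)"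
  proof (rule nn_integral_level_set_comb[OF recip_measurable[OF fm XY(1)] recip_measurable[OF fm XY(2)] recip_measurable[OF fm XY(3)] l])
    fix a b
    show "min (recip d q f X a) (recip d q f Y b) \<le> recip d q f Z ((1 - l) * a + l * b)"
    proof (rule le_ennreal_approx)
      fix s :: real assume s: "s > 0" "ennreal s \<le> min (recip d q f X a) (recip d q f Y b)"
      then show "ennreal s \<le> recip d q f Z ((1 - l) * a + l * b)"
        unfolding Z_def by (intro recip_comb[OF lc XY(1,2) l s(1)]) auto
    qed
  qed (use recip_level_sets[OF f XY(1)] recip_level_sets[OF f XY(2)] supX supY in auto)
  then have G: "ennreal (1 - l) * radial d q f X + ennreal l * radial d q f Y \<le> radial d q f Z"
    unfolding nn_integral_recip[OF f XY(1)] nn_integral_recip[OF f XY(2)] nn_integral_recip[OF f XY(3)] .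
  define p where "p = q + 1"
  have GX: "ennreal (1 / \<kappa> ^ p * \<eta>) \<le> radial d q f X"
    unfolding X_def radial_scale[OF fm x(1) \<kappa>(1)] p_def using \<kappa>(1) x(4) \<eta>
    by (subst ennreal_mult) (auto intro: mult_left_mono)
  have GY: "ennreal (1 / \<mu> ^ p * \<eta>) \<le> radial d q f Y"
    unfolding Y_def radial_scale[OF fm y(1) \<mu>(1)] p_def using \<mu>(1) y(4) \<eta>
    by (subst ennreal_mult) (auto intro: mult_left_mono)
  have "(1 - l) * \<kappa> + l * \<mu> = 1 / \<sigma>"
    unfolding l1 using \<kappa>(1) \<mu>(1) \<sigma> by (simp add: l_def add_divide_distrib[symmetric])
  \<comment> \<open>The mean of \<kappa> and \<mu> is 1 / \<sigma>, so Jensen's inequality for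
    v^(-p) bounds \<sigma>^p.\<close>
  then have J: "\<sigma> ^ p \<le> (1 - l) * (1 / \<kappa> ^ p) + l * (1 / \<mu> ^ p)"
    using inverse_power_jensen[OF \<kappa>(1) \<mu>(1) l, of p] \<sigma> by (simp add: power_one_over)
  have "ennreal (\<sigma> ^ p * \<eta>) \<le> ennreal ((1 - l) * (1 / \<kappa> ^ p * \<eta>) + l * (1 / \<mu> ^ p * \<eta>))"
    using mult_right_mono[OF J, of \<eta>] \<eta> by (intro ennreal_leI) (simp add: algebra_simps)
  also have "\<dots> = ennreal (1 - l) * ennreal (1 / \<kappa> ^ p * \<eta>) + ennreal l * ennreal (1 / \<mu> ^ p * \<eta>)"
  proof -
    have e: "ennreal (u * v + w * z) = ennreal u * ennreal v + ennreal w * ennreal z"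
      if "0 \<le> u" "0 \<le> v" "0 \<le> w" "0 \<le> z" for u v w z :: real
      using that by (simp add: ennreal_mult)
    show ?thesis by (rule e) (use l \<kappa>(1) \<mu>(1) \<eta> in auto)
  qed
  also have "\<dots> \<le> ennreal (1 - l) * radial d q f X + ennreal l * radial d q f Y"
    by (intro add_mono mult_left_mono GX GY) auto
  also note G
  finally have GZ: "ennreal (\<sigma> ^ p * \<eta>) \<le> radial d q f Z" .
  have "comb d t x y = sc d \<sigma> Z"
  proof (rule Rn_eqI[of _ d])
    fix i assume "i < d"
    then have "sc d \<sigma> Z i = \<sigma> * ((1 - l) * (\<kappa> * x i) + l * (\<mu> * y i))"
      by (simp add: sc_def Z_def comb_def X_def Y_def)
    also have "\<dots> = (\<sigma> * (1 - l) * \<kappa>) * x i + (\<sigma> * l * \<mu>) * y i" by (simp add: algebra_simps)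
    also have "\<sigma> * (1 - l) * \<kappa> = 1 - t" unfolding l1 using \<sigma> \<kappa>(1) by simp
    also have "\<sigma> * l * \<mu> = t" unfolding l_def using \<sigma> \<mu>(1) by simp
    finally show "comb d t x y i = sc d \<sigma> Z i" using \<open>i < d\<close> by (simp add: comb_def)
  qed auto
  then have "radial d q f (comb d t x y) = ennreal (1 / \<sigma> ^ p) * radial d q f Z"
    unfolding p_def using radial_scale[OF fm XY(3) \<sigma>, of q] by simp
  also have "\<dots> \<ge> ennreal (1 / \<sigma> ^ p) * ennreal (\<sigma> ^ p * \<eta>)"
    by (intro mult_left_mono GZ) simp
  also have "ennreal (1 / \<sigma> ^ p) * ennreal (\<sigma> ^ p * \<eta>) = ennreal \<eta>"
    using \<sigma> \<eta> by (subst ennreal_mult'[symmetric]) auto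
  finally show ?thesis .
qed

lemma Rn_zero_cases:
  assumes "x \<in> Rn d"
  obtains "x = (\<lambda>i\<in>{..<d}. 0)" | i where "i < d" "x i \<noteq> (0 :: real)"
  using Rn_eqI[OF assms restrict_in_Rn, of "\<lambda>_. 0"] by auto

lemma radial_superlevel_convex:
  assumes f: "nice d B R f" and f0: "f (\<lambda>i\<in>{..<d}. 0) = ennreal f0" "f0 > 0" and \<eta>: "\<eta> > 0"
  shows "cvx d {x \<in> Rn d. ennreal \<eta> \<le> radial d q f x}"
  unfolding cvx_def
proof (intro ballI)
  let ?T = "{x \<in> Rn d. ennreal \<eta> \<le> radial d q f x}"
  have fm: "f \<in> borel_measurable (leb d)" using f by (simp add: nice_def)
  fix x y and t :: real assume x: "x \<in> ?T" and y: "y \<in> ?T" and t: "t \<in> {0..1}"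
  have o: "(\<lambda>i\<in>{..<d}. 0) \<in> ?T" using radial_zero_vector[OF f f0, of q] by simp
  \<comment> \<open>Homogeneity makes the set star-shaped about the origin. This covers segments
    that end at the origin, where the supremum of \<open>recip\<close> is infinite and the
    normalisation fails.\<close>
  have star: "sc d s z \<in> ?T" if z: "z \<in> ?T" and s: "0 \<le> s" "s \<le> 1" for s z
  proof (cases "s = 0")
    case True
    then have "sc d s z = (\<lambda>i\<in>{..<d}. 0)" by (auto simp: sc_def)
    then show ?thesis using o by simp
  next
    case False
    then have s0: "s > 0" using s by simp
    have zR: "z \<in> Rn d" using z by simp
    have "ennreal \<eta> \<le> 1 * radial d q f z" using z by simp
    also have "\<dots> \<le> ennreal (1 / s ^ (q + 1)) * radial d q f z"
    proof (rule mult_right_mono)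
      have "s ^ (q + 1) \<le> 1" using s by (intro power_le_one) auto
      then have "1 \<le> 1 / s ^ (q + 1)" using s0 by (simp add: le_divide_eq del: power_Suc)
      then show "1 \<le> ennreal (1 / s ^ (q + 1))" using ennreal_leI[of 1 "1 / s ^ (q + 1)"] by simp
    qed simp
    also have "\<dots> = radial d q f (sc d s z)" by (rule radial_scale[OF fm zR s0, symmetric])
    finally show ?thesis by simp
  qed
  have xR: "x \<in> Rn d" and yR: "y \<in> Rn d" using x y by auto
  show "comb d t x y \<in> ?T"
  proof (cases rule: Rn_zero_cases[OF xR])
    case 1
    then have "comb d t x y = sc d t y" by (auto simp: comb_def sc_def)
    then show ?thesis using star[OF y, of t] t by simp
  next
    case (2 i)
    show ?thesis
    proof (cases rule: Rn_zero_cases[OF yR])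
      case 1
      then have "comb d t x y = sc d (1 - t) x" by (auto simp: comb_def sc_def)
      then show ?thesis using star[OF x, of "1 - t"] t by simp
    next
      case (2 j)
      consider "t = 0" | "t = 1" | "0 < t" "t < 1" using t by fastforce
      then show ?thesis
      proof cases
        case 1
        then have "comb d t x y = x" using xR by (simp add: comb_def Rn_restrict_id)
        then show ?thesis using x by simp
      next
        case 2
        then have "comb d t x y = y" using yR by (simp add: comb_def Rn_restrict_id)
        then show ?thesis using y by simp
      next
        case 3
        then show ?thesis
          using radial_superlevel_convex_aux[OF f \<eta> xR \<open>i < d\<close> \<open>x i \<noteq> 0\<close> _ yR 2, of q t] x y by simp
      qed
    qed
  qed
qed

section \<open>Closedness of Ball bodies\<close>

lemma usc_limsup:
  assumes "usc d f" "\<And>m. X m \<in> Rn d" "y \<in> Rn d" "X \<longlonglongrightarrow> y"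
  shows "limsup (\<lambda>m. f (X m)) \<le> f y"
proof (rule ccontr)
  assume "\<not> ?thesis"
  then obtain c where c: "f y < c" "c < limsup (\<lambda>m. f (X m))" using dense by (metis not_le)
  have "\<not> eventually (\<lambda>m. f (X m) \<le> c) sequentially"
  proof
    assume "eventually (\<lambda>m. f (X m) \<le> c) sequentially"
    then have "limsup (\<lambda>m. f (X m)) \<le> c" by (rule Limsup_bounded)
    then show False using c(2) by simp
  qed
  then obtain s :: "nat \<Rightarrow> nat" where s: "strict_mono s" "\<And>m. \<not> f (X (s m)) \<le> c"
    using not_eventually_sequentiallyD by blast
  have "(\<lambda>m. X (s m)) \<longlonglongrightarrow> y" using LIMSEQ_subseq_LIMSEQ[OF assms(4) s(1)] by (simp add: comp_def)
  moreover have "c \<le> f (X (s m))" for m using s(2)[of m] by simp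
  moreover have "X (s m) \<in> Rn d" for m by (rule assms(2))
  ultimately have "c \<le> f y"
    using assms(1)[unfolded usc_def, rule_format, of "\<lambda>m. X (s m)" y c] assms(3) by simp
  then show False using c(1) by simp
qed

lemma limsup_cmult_le:
  assumes c: "c > 0"
  shows "limsup (\<lambda>m. ennreal c * u m) \<le> ennreal c * limsup (u :: nat \<Rightarrow> ennreal)"
proof (rule ccontr)
  assume "\<not> ?thesis"
  then obtain K where K: "ennreal c * limsup u < K" "K < limsup (\<lambda>m. ennreal c * u m)" using dense by (metis not_le)
  have "K < top" using less_le_trans[OF K(2) top_greatest] by simp
  then obtain k where k: "K = ennreal k" "k \<ge> 0" by (cases K) auto
  have "limsup u < ennreal (k / c)"
  proof (cases "limsup u")
    case (real l)
    then have "c * l < k" using K(1) k c by (simp add: ennreal_mult'[symmetric] ennreal_less_iff)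
    then show ?thesis using real c by (simp add: ennreal_less_iff field_simps)
  next
    case top
    then show ?thesis using K(1) k c by (simp add: ennreal_mult_top)
  qed
  then have "eventually (\<lambda>m. u m < ennreal (k / c)) sequentially" by (rule Limsup_lessD)
  then have "eventually (\<lambda>m. ennreal c * u m \<le> K) sequentially"
  proof eventually_elim
    fix m assume "u m < ennreal (k / c)"
    then have "ennreal c * u m \<le> ennreal c * ennreal (k / c)" by (intro mult_left_mono) auto
    also have "\<dots> = K" using c k by (simp add: ennreal_mult'[symmetric])
    finally show "ennreal c * u m \<le> K" .
  qed
  then have "limsup (\<lambda>m. ennreal c * u m) \<le> K" by (rule Limsup_bounded)
  then show False using K(2) by simp
qed

text \<open>Reverse Fatou needs a common integrable bound. If the limit is not the origin, one
  coordinate stays above \<delta> along a tail of the sequence, so all these rays leave the support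
  before R / \<delta>.\<close>

lemma closed_radial_superlevel:
  assumes f: "nice d B R f" "usc d f" and f0: "f (\<lambda>i\<in>{..<d}. 0) = ennreal f0" "f0 > 0"
  shows "closed {x \<in> Rn d. ennreal \<eta> \<le> radial d q f x}"
  unfolding closed_sequential_limits
proof (intro allI impI, elim conjE)
  have fm: "f \<in> borel_measurable (leb d)" and B: "B \<ge> 0" "R \<ge> 0" and bd: "\<And>x. x \<in> Rn d \<Longrightarrow> f x \<le> ennreal B"
    using f by (auto simp: nice_def)
  fix X x assume X: "\<forall>m. X m \<in> {x \<in> Rn d. ennreal \<eta> \<le> radial d q f x}" and lim: "X \<longlonglongrightarrow> x"
  have XR: "X m \<in> Rn d" "ennreal \<eta> \<le> radial d q f (X m)" for m using X by auto
  have x: "x \<in> Rn d" by (rule closed_sequentially[OF closed_Rn XR(1) lim])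
  show "x \<in> {x \<in> Rn d. ennreal \<eta> \<le> radial d q f x}"
  proof (cases rule: Rn_zero_cases[OF x])
    case 1
    then show ?thesis using radial_zero_vector[OF f(1) f0, of q] by simp
  next
    case (2 i)
    define \<delta> where "\<delta> = \<bar>x i\<bar> / 2"
    have \<delta>: "\<delta> > 0" "\<delta> < \<bar>x i\<bar>" using 2 by (auto simp: \<delta>_def)
    have "(\<lambda>m. \<bar>X m i\<bar>) \<longlonglongrightarrow> \<bar>x i\<bar>" using lim unfolding tendsto_fun_iff by (intro tendsto_intros) auto
    then have "eventually (\<lambda>m. \<delta> < \<bar>X m i\<bar>) sequentially" using \<delta>(2) by (rule order_tendstoD)
    then obtain N where N: "\<And>m. m \<ge> N \<Longrightarrow> \<delta> < \<bar>X m i\<bar>" by (auto simp: eventually_sequentially)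
    define Y where "Y m = X (m + N)" for m
    have Y: "Y m \<in> Rn d" "\<delta> < \<bar>Y m i\<bar>" "ennreal \<eta> \<le> radial d q f (Y m)" for m using XR N by (auto simp: Y_def)
    have Ylim: "Y \<longlonglongrightarrow> x" unfolding Y_def using lim by (rule LIMSEQ_ignore_initial_segment)
    have sclim: "(\<lambda>m. sc d r (Y m)) \<longlonglongrightarrow> sc d r x" for r
      unfolding tendsto_fun_iff
    proof
      fix k
      have "(\<lambda>m. Y m k) \<longlonglongrightarrow> x k" using Ylim unfolding tendsto_fun_iff by auto
      then show "(\<lambda>m. sc d r (Y m) k) \<longlonglongrightarrow> sc d r x k"
        by (cases "k < d") (auto simp: sc_def intro: tendsto_intros)
    qed
    define \<rho> where "\<rho> = R / \<delta>"
    have \<rho>: "\<rho> \<ge> 0" using B \<delta> by (simp add: \<rho>_def)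
    have "ennreal \<eta> \<le> limsup (\<lambda>m. radial d q f (Y m))"
      using Y(3) by (intro le_Limsup) auto
    also have "\<dots> \<le> (\<integral>\<^sup>+r. limsup (\<lambda>m. ennreal (r ^ q) * f (sc d r (Y m)) * indicator {0<..} r) \<partial>lborel)"
      unfolding radial_def
    proof (rule nn_integral_limsup[where w="\<lambda>r. ennreal (\<rho> ^ q * B) * indicator {0..\<rho>} r"])
      show "AE r in lborel. ennreal (r ^ q) * f (sc d r (Y m)) * indicator {0<..} r \<le> ennreal (\<rho> ^ q * B) * indicator {0..\<rho>} r" for m
      proof (rule AE_I2)
        fix r :: real
        show "ennreal (r ^ q) * f (sc d r (Y m)) * indicator {0<..} r \<le> ennreal (\<rho> ^ q * B) * indicator {0..\<rho>} r"
        proof (cases "r > 0 \<and> f (sc d r (Y m)) \<noteq> 0")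
          case True
          have "r \<le> R / \<bar>Y m i\<bar>" 
            by (rule nice_support_scaled[OF f(1) Y(1) \<open>i < d\<close>]) (use True Y(2)[of m] \<delta> in auto)
          also have "\<dots> \<le> \<rho>" unfolding \<rho>_def using Y(2)[of m] \<delta> B by (intro divide_left_mono) auto
          finally have r: "r \<le> \<rho>" .
          have "ennreal (r ^ q) * f (sc d r (Y m)) \<le> ennreal (\<rho> ^ q) * ennreal B"
            using True r by (intro mult_mono bd ennreal_leI power_mono) auto
          then show ?thesis using True r \<rho> B by (simp add: ennreal_mult')
        qed auto
      qed
      show "(\<integral>\<^sup>+r. ennreal (\<rho> ^ q * B) * indicator {0..\<rho>} r \<partial>lborel) < \<infinity>"
        using \<rho> by (simp add: nn_integral_cmult ennreal_mult_less_top)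
    qed (use radial_integrand_measurable[OF fm Y(1)] in auto)
    also have "\<dots> \<le> radial d q f x"
      unfolding radial_def
    proof (rule nn_integral_mono)
      fix r :: real
      show "limsup (\<lambda>m. ennreal (r ^ q) * f (sc d r (Y m)) * indicator {0<..} r) \<le> ennreal (r ^ q) * f (sc d r x) * indicator {0<..} r"
      proof (cases "r > 0")
        case True
        have "limsup (\<lambda>m. ennreal (r ^ q) * f (sc d r (Y m))) \<le> ennreal (r ^ q) * limsup (\<lambda>m. f (sc d r (Y m)))"
          by (rule limsup_cmult_le) (use True in simp)
        also have "\<dots> \<le> ennreal (r ^ q) * f (sc d r x)"
          by (intro mult_left_mono usc_limsup[OF f(2)] sclim) auto
        finally show ?thesis using True by simp
      qed (simp add: Limsup_const)
    qed
    finally show ?thesis using x by simp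
  qed
qed

section \<open>Comparison of radial moments and the volume of Ball bodies\<close>

lemma nn_integral_power_exp:
  assumes "\<tau> > 0"
  shows "(\<integral>\<^sup>+r. ennreal (r ^ k * exp (- r / \<tau>)) * indicator {0<..} r \<partial>lborel) = ennreal (\<tau> ^ (k + 1) * fact k)"
proof -
  have "(\<integral>\<^sup>+r. ennreal (r ^ k * exp (- r)) * indicator {0..} r \<partial>lborel) = ennreal (fact k)"
    by (simp add: nn_intergal_power_times_exp_Ici)
  then have "ennreal (fact k) = ennreal (1 / \<tau>) * (\<integral>\<^sup>+r. ennreal ((r / \<tau>) ^ k * exp (- (r / \<tau>))) * indicator {0..} (r / \<tau>) \<partial>lborel)"
    using nn_integral_real_affine[of "\<lambda>r. ennreal (r ^ k * exp (- r)) * indicator {0..} r" "1 / \<tau>" 0] assms by simp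
  also have "(\<integral>\<^sup>+r. ennreal ((r / \<tau>) ^ k * exp (- (r / \<tau>))) * indicator {0..} (r / \<tau>) \<partial>lborel) =
    (\<integral>\<^sup>+r. ennreal (1 / \<tau> ^ k) * (ennreal (r ^ k * exp (- r / \<tau>)) * indicator {0<..} r) \<partial>lborel)"
  proof (rule nn_integral_cong_AE)
    have "AE r in lborel. r \<noteq> (0::real)" by (rule AE_lborel_singleton)
    then show "AE r in lborel. ennreal ((r / \<tau>) ^ k * exp (- (r / \<tau>))) * indicator {0..} (r / \<tau>) =
      ennreal (1 / \<tau> ^ k) * (ennreal (r ^ k * exp (- r / \<tau>)) * indicator {0<..} r)"
    proof eventually_elim
      fix r :: real assume "r \<noteq> 0"
      show "ennreal ((r / \<tau>) ^ k * exp (- (r / \<tau>))) * indicator {0..} (r / \<tau>) =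
        ennreal (1 / \<tau> ^ k) * (ennreal (r ^ k * exp (- r / \<tau>)) * indicator {0<..} r)"
      proof (cases "r > 0")
        case True
        then show ?thesis using assms by (simp add: ennreal_mult'[symmetric] power_divide)
      next
        case False
        then have "r / \<tau> < 0" using \<open>r \<noteq> 0\<close> assms by (simp add: divide_neg_pos)
        then show ?thesis using False by simp
      qed
    qed
  qed
  also have "\<dots> = ennreal (1 / \<tau> ^ k) * (\<integral>\<^sup>+r. ennreal (r ^ k * exp (- r / \<tau>)) * indicator {0<..} r \<partial>lborel)"
    by (rule nn_integral_cmult) measurable
  finally have *: "ennreal (fact k) = ennreal (1 / \<tau>) * (ennreal (1 / \<tau> ^ k) * (\<integral>\<^sup>+r. ennreal (r ^ k * exp (- r / \<tau>)) * indicator {0<..} r \<partial>lborel))" .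
  have "ennreal (\<tau> ^ (k + 1) * fact k) = ennreal (\<tau> ^ (k + 1)) * ennreal (fact k)"
    using assms by (intro ennreal_mult) auto
  also have "\<dots> = (ennreal (\<tau> ^ (k + 1)) * ennreal (1 / \<tau>) * ennreal (1 / \<tau> ^ k)) * (\<integral>\<^sup>+r. ennreal (r ^ k * exp (- r / \<tau>)) * indicator {0<..} r \<partial>lborel)"
    unfolding * by (simp only: mult.assoc)
  also have "ennreal (\<tau> ^ (k + 1)) * ennreal (1 / \<tau>) * ennreal (1 / \<tau> ^ k) = 1"
    using assms by (simp add: ennreal_mult'[symmetric])
  finally show ?thesis by simp
qed

text \<open>The log-concave function \<open>r \<mapsto> f (r x)\<close> and the exponential with the same value at \<open>0\<close> and the same
  \<open>q\<close>-th moment cross exactly once, so the exponential has the larger higher moments.\<close>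

lemma radial_compare:
  assumes f: "nice d B R f" and f0: "f (\<lambda>i\<in>{..<d}. 0) = ennreal f0" "f0 > 0"
    and x: "x \<in> Rn d" "i < d" "x i \<noteq> 0" and \<tau>: "\<tau> > 0"
    and b: "radial d q f x = ennreal (f0 * (\<tau> ^ (q + 1) * fact q))"
  shows "radial d (q + 2) f x \<le> ennreal (f0 * (\<tau> ^ (q + 3) * fact (q + 2)))"
proof -
  have fm: "f \<in> borel_measurable (leb d)" and lc: "log_concave d f" using f by (auto simp: nice_def)
  have ffin: "f y < \<infinity>" if "y \<in> Rn d" for y
    by (rule le_less_trans[of _ "ennreal B"]) (use f that in \<open>auto simp: nice_def\<close>)
  define h where "h r = enn2real (f (sc d r x))" for r
  have h: "f (sc d r x) = ennreal (h r)" "h r \<ge> 0" for r using ffin[of "sc d r x"] by (auto simp: h_def)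
  have hm [measurable]: "h \<in> borel_measurable borel"
    unfolding h_def by (intro borel_measurable_enn2real measurable_compose[OF measurable_sc_left[OF x(1)] fm])
  define E where "E r = f0 * exp (- r / \<tau>)" for r
  have Em [measurable]: "E \<in> borel_measurable borel" unfolding E_def by measurable
  have E: "E r > 0" for r using f0(2) by (simp add: E_def)
  define S where "S = {r. 0 < r \<and> E r \<le> h r}"
  have Sb: "r \<le> R / \<bar>x i\<bar>" if "r \<in> S" for r
  proof (rule nice_support_scaled[OF f x])
    show "f (sc d r x) \<noteq> 0" using that E[of r] by (auto simp: S_def h(1))
  qed (use that in \<open>auto simp: S_def\<close>)
  \<comment> \<open>\<open>h\<close> and the exponential \<open>E\<close> agree at radius 0 and ln E
    is linear, so by log-concavity a radius where \<open>h\<close> dominates makes it dominate at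
    every smaller one. Hence \<open>S\<close> is an initial interval.\<close>
  have down: "r \<in> S" if r': "r' \<in> S" and r: "0 < r" "r < r'" for r r'
  proof -
    have "E r' = exp (ln f0 - r' / \<tau>)" using f0(2) by (simp add: E_def exp_diff exp_minus field_simps)
    then have "ennreal (exp (ln f0 - r' / \<tau>)) \<le> f (sc d r' x)" using r' h by (simp add: S_def ennreal_leI)
    from log_concave_segment[OF lc sc_in_Rn f0 _ _ this, of "r / r'"]
    have "ennreal (exp ((1 - r / r') * ln f0 + r / r' * (ln f0 - r' / \<tau>))) \<le> f (sc d (r / r') (sc d r' x))"
      using r by simp
    moreover have "(1 - r / r') * ln f0 + r / r' * (ln f0 - r' / \<tau>) = ln f0 - r / \<tau>"
      using r by (simp add: algebra_simps)
    moreover have "sc d (r / r') (sc d r' x) = sc d r x" using r by (simp add: sc_sc)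
    moreover have "exp (ln f0 - r / \<tau>) = E r" using f0(2) by (simp add: E_def exp_diff exp_minus field_simps)
    ultimately have "ennreal (E r) \<le> ennreal (h r)" using h by simp
    then have "E r \<le> h r" using h(2) by (simp add: ennreal_le_iff)
    then show ?thesis using r by (simp add: S_def)
  qed
  define r1 where "r1 = (if S = {} then 0 else Sup S)"
  have bdd: "bdd_above S" by (rule bdd_aboveI) (rule Sb)
  have r1: "r1 \<ge> 0"
  proof (cases "S = {}")
    case False
    then obtain r where "r \<in> S" by blast
    then have "0 < r" "r \<le> Sup S" using bdd by (auto simp: S_def intro: cSup_upper)
    then show ?thesis using False by (simp add: r1_def)
  qed (simp add: r1_def)
  have below: "E r \<le> h r" if "0 < r" "r < r1" for r
  proof -
    have ne: "S \<noteq> {}" using that by (auto simp: r1_def)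
    then have "r < Sup S" using that by (simp add: r1_def)
    then obtain r' where "r' \<in> S" "r < r'" unfolding less_cSup_iff[OF ne bdd] by blast
    then have "r \<in> S" using down that by blast
    then show ?thesis by (simp add: S_def)
  qed
  have above: "h r \<le> E r" if "r1 < r" for r
  proof (rule ccontr)
    assume "\<not> h r \<le> E r"
    then have "r \<in> S" using that r1 by (simp add: S_def)
    then have "r \<le> r1" using bdd by (auto simp: r1_def intro: cSup_upper)
    then show False using that by simp
  qed
  \<comment> \<open>The product of r^2 - r1^2 and E - h is nonnegative on both sides of the
    crossing. It is written with sums only, so that it can be integrated in the extended nonnegative
    reals.\<close>
  have pw: "r\<^sup>2 * h r + r1\<^sup>2 * E r \<le> r\<^sup>2 * E r + r1\<^sup>2 * h r" if r: "r > 0" "r \<noteq> r1" for r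
  proof (cases "r < r1")
    case True
    have "(r1\<^sup>2 - r\<^sup>2) * (h r - E r) \<ge> 0"
      using below[OF r(1) True] True r(1) by (intro mult_nonneg_nonneg) (auto intro: power_mono)
    then show ?thesis by (simp add: algebra_simps)
  next
    case False
    have "(r\<^sup>2 - r1\<^sup>2) * (E r - h r) \<ge> 0"
      using above[of r] False r r1 by (intro mult_nonneg_nonneg) (auto intro: power_mono)
    then show ?thesis by (simp add: algebra_simps)
  qed
  have radh: "radial d k f x = (\<integral>\<^sup>+r. ennreal (r ^ k * h r) * indicator {0<..} r \<partial>lborel)" for k
    unfolding radial_def by (intro nn_integral_cong) (auto simp: h ennreal_mult' indicator_def)
  have radE: "(\<integral>\<^sup>+r. ennreal (r ^ k * E r) * indicator {0<..} r \<partial>lborel) = ennreal (f0 * (\<tau> ^ (k + 1) * fact k))" for k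
  proof -
    have "(\<integral>\<^sup>+r. ennreal (r ^ k * E r) * indicator {0<..} r \<partial>lborel) = (\<integral>\<^sup>+r. ennreal f0 * (ennreal (r ^ k * exp (- r / \<tau>)) * indicator {0<..} r) \<partial>lborel)"
    proof (rule nn_integral_cong)
      fix r :: real
      show "ennreal (r ^ k * E r) * indicator {0<..} r = ennreal f0 * (ennreal (r ^ k * exp (- r / \<tau>)) * indicator {0<..} r)"
        using f0(2) by (cases "r > 0") (simp_all add: E_def ennreal_mult'[symmetric] mult_ac)
    qed
    also have "\<dots> = ennreal f0 * ennreal (\<tau> ^ (k + 1) * fact k)"
      unfolding nn_integral_power_exp[OF \<tau>, symmetric] by (rule nn_integral_cmult) measurable
    finally show ?thesis using f0(2) \<tau> by (simp add: ennreal_mult')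
  qed
  have "radial d (q + 2) f x + ennreal (r1\<^sup>2) * ennreal (f0 * (\<tau> ^ (q + 1) * fact q)) =
    (\<integral>\<^sup>+r. ennreal (r ^ (q + 2) * h r) * indicator {0<..} r + ennreal (r1\<^sup>2) * (ennreal (r ^ q * E r) * indicator {0<..} r) \<partial>lborel)"
    unfolding radh radE[symmetric] by (subst nn_integral_add) (auto simp: nn_integral_cmult)
  also have "\<dots> \<le> (\<integral>\<^sup>+r. ennreal (r ^ (q + 2) * E r) * indicator {0<..} r + ennreal (r1\<^sup>2) * (ennreal (r ^ q * h r) * indicator {0<..} r) \<partial>lborel)"
  proof (rule nn_integral_mono_AE)
    have "AE r in lborel. r \<noteq> r1" by (rule AE_lborel_singleton)
    then show "AE r in lborel. ennreal (r ^ (q + 2) * h r) * indicator {0<..} r + ennreal (r1\<^sup>2) * (ennreal (r ^ q * E r) * indicator {0<..} r)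
      \<le> ennreal (r ^ (q + 2) * E r) * indicator {0<..} r + ennreal (r1\<^sup>2) * (ennreal (r ^ q * h r) * indicator {0<..} r)"
    proof eventually_elim
      fix r assume r: "r \<noteq> r1"
      show "ennreal (r ^ (q + 2) * h r) * indicator {0<..} r + ennreal (r1\<^sup>2) * (ennreal (r ^ q * E r) * indicator {0<..} r)
        \<le> ennreal (r ^ (q + 2) * E r) * indicator {0<..} r + ennreal (r1\<^sup>2) * (ennreal (r ^ q * h r) * indicator {0<..} r)"
      proof (cases "r > 0")
        case True
        have e: "ennreal (r ^ (q + 2) * u) + ennreal (r1\<^sup>2) * ennreal (r ^ q * v) = ennreal (r ^ q * (r\<^sup>2 * u + r1\<^sup>2 * v))"
          if "u \<ge> 0" "v \<ge> 0" for u v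
        proof -
          have "ennreal (r ^ (q + 2) * u) + ennreal (r1\<^sup>2) * ennreal (r ^ q * v) = ennreal (r ^ (q + 2) * u + r1\<^sup>2 * (r ^ q * v))"
            using that True by (simp add: ennreal_mult)
          also have "r ^ (q + 2) * u + r1\<^sup>2 * (r ^ q * v) = r ^ q * (r\<^sup>2 * u + r1\<^sup>2 * v)"
            by (simp add: power_add power2_eq_square algebra_simps)
          finally show ?thesis .
        qed
        have "ennreal (r ^ q * (r\<^sup>2 * h r + r1\<^sup>2 * E r)) \<le> ennreal (r ^ q * (r\<^sup>2 * E r + r1\<^sup>2 * h r))"
          using pw[OF True r] True by (intro ennreal_leI mult_left_mono) auto
        then show ?thesis
          using True e[OF h(2) less_imp_le[OF E], of r r] e[OF less_imp_le[OF E] h(2), of r r] by simp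
      qed simp
    qed
  qed
  also have "\<dots> = ennreal (f0 * (\<tau> ^ (q + 3) * fact (q + 2))) + ennreal (r1\<^sup>2) * ennreal (f0 * (\<tau> ^ (q + 1) * fact q))"
  proof -
    have "q + 2 + 1 = q + 3" by simp
    then show ?thesis
      unfolding radE[of "q + 2", symmetric, unfolded \<open>q + 2 + 1 = q + 3\<close>] b[symmetric] radh
      by (subst nn_integral_add) (auto simp: nn_integral_cmult)
  qed
  finally have le: "radial d (q + 2) f x + X \<le> ennreal (f0 * (\<tau> ^ (q + 3) * fact (q + 2))) + X"
    if "X = ennreal (r1\<^sup>2) * ennreal (f0 * (\<tau> ^ (q + 1) * fact q))" for X
    unfolding that .
  \<comment> \<open>By the equality of the moments of order \<open>q\<close> the same term appears
    on both sides; it is finite and cancels.\<close>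
  define X where "X = ennreal (r1\<^sup>2) * ennreal (f0 * (\<tau> ^ (q + 1) * fact q))"
  have "X \<noteq> top" by (simp add: X_def ennreal_mult_eq_top_iff)
  moreover have "X + radial d (q + 2) f x \<le> X + ennreal (f0 * (\<tau> ^ (q + 3) * fact (q + 2)))"
    using le[OF X_def] by (simp only: add.commute)
  ultimately show ?thesis
    by (simp only: ennreal_add_left_cancel_le) (metis infinity_ennreal_def)
qed

lemma power_le_exp_mult_fact: "real d ^ d \<le> exp (real d) * fact d"
proof -
  have "(\<Sum>n\<in>{d}. real d ^ n /\<^sub>R fact n) \<le> (\<Sum>n. real d ^ n /\<^sub>R fact n)"
    by (intro sum_le_suminf summable_exp_generic) auto
  then have "real d ^ d / fact d \<le> exp (real d)"
    by (simp add: exp_def scaleR_conv_of_real divide_inverse mult.commute)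
  then show ?thesis by (simp add: field_simps)
qed

text \<open>The threshold e / (d + 2) balances two arguments. Below it, the quotient of the two
  moments, \<tau>^2 (d + 1)(d + 2), is at most e^2. Above it, \<tau>^d d! is at least its value at
  the threshold, which d^d \<le> e^d d! and (1 + 2/d)^d \<le> e^2 bound below.\<close>

lemma moment_constant:
  fixes \<tau> :: real
  assumes d: "d > 0" and \<tau>: "\<tau> > 0" and 1: "1 \<le> \<tau> ^ (d + 2) * fact (d + 2)"
  shows "exp (- 2) \<le> \<tau> ^ d * fact d"
proof (cases "\<tau> \<le> exp 1 / real (d + 2)")
  case True
  have "\<tau> * real (d + 2) \<le> exp 1" using True by (simp add: field_simps)
  then have "(\<tau> * real (d + 2))\<^sup>2 \<le> (exp 1)\<^sup>2" using \<tau> by (intro power_mono) auto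
  also have "\<dots> = exp 2" by (simp add: exp_double[symmetric])
  finally have b: "\<tau>\<^sup>2 * (real (d + 2))\<^sup>2 \<le> exp 2" by (simp only: power_mult_distrib)
  have "1 \<le> (\<tau> ^ d * fact d) * (\<tau>\<^sup>2 * (real (d + 2) * real (d + 1)))"
    using 1 by (simp add: power_add power2_eq_square algebra_simps)
  also have "\<dots> \<le> (\<tau> ^ d * fact d) * (\<tau>\<^sup>2 * (real (d + 2))\<^sup>2)"
    using \<tau> by (intro mult_left_mono) (auto simp: power2_eq_square)
  also have "\<dots> \<le> (\<tau> ^ d * fact d) * exp 2"
    using \<tau> by (intro mult_left_mono b) auto
  finally have "1 \<le> (\<tau> ^ d * fact d) * exp 2" .
  then show ?thesis by (simp add: exp_minus field_simps)
next
  case False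
  have "(1 + 2 / real d) ^ d \<le> exp (2 / real d) ^ d"
    by (intro power_mono exp_ge_add_one_self) auto
  also have "\<dots> = exp 2" using d by (simp add: exp_of_nat_mult[symmetric])
  finally have a: "(1 + 2 / real d) ^ d \<le> exp 2" .
  have "1 + 2 / real d = real (d + 2) / real d" using d by (simp add: field_simps)
  then have "real (d + 2) ^ d \<le> exp 2 * real d ^ d"
    using a d by (simp add: power_divide divide_le_eq)
  also have "\<dots> \<le> exp 2 * (exp (real d) * fact d)"
    by (intro mult_left_mono power_le_exp_mult_fact) auto
  finally have "1 \<le> exp 2 * ((exp 1 / real (d + 2)) ^ d * fact d)"
    by (simp add: power_divide exp_of_nat_mult[symmetric] field_simps)
  also have "\<dots> \<le> exp 2 * (\<tau> ^ d * fact d)"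
    using False by (intro mult_left_mono mult_right_mono power_mono) auto
  finally show ?thesis by (simp add: exp_minus field_simps)
qed

text \<open>Comparison with an exponential places the body of exponent d + 2 inside a body of
  exponent d, and the volume of the latter is an exact multiple of the integral of
  \<open>f\<close>.\<close>

lemma radial_superlevel_volume:
  assumes f: "nice d B R f" and f0: "f (\<lambda>i\<in>{..<d}. 0) = ennreal f0" "f0 > 0" and d: "d > 0"
    and F: "(\<integral>\<^sup>+x. f x \<partial>leb d) = ennreal F" "F \<ge> 0"
  shows "emeasure (leb d) {x \<in> Rn d. ennreal (f0 / real (d + 2)) \<le> radial d (d + 1) f x} \<le> ennreal (exp 2 * F / f0)"
proof -
  have fm: "f \<in> borel_measurable (leb d)" using f by (simp add: nice_def)
  \<comment> \<open>The value d \<eta> = e^(-2) f0 is the one for which the exact volume F / (d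
    \<eta>) is e^2 F / f0.\<close>
  define \<eta> where "\<eta> = exp (- 2) * f0 / real d"
  have \<eta>: "\<eta> > 0" using f0 d by (simp add: \<eta>_def)
  let ?D = "{x \<in> Rn d. ennreal \<eta> \<le> radial d (d - 1) f x}"
  have D: "?D \<in> sets (leb d)"
  proof -
    have "{x \<in> space (leb d). ennreal \<eta> \<le> radial d (d - 1) f x} \<in> sets (leb d)"
      using radial_measurable[OF fm] by measurable
    then show ?thesis by simp
  qed
  have d1: "d - 1 + 1 = d" "d - 1 + 2 = d + 1" "d - 1 + 3 = d + 2" using d by simp_all
  have "{x \<in> Rn d. ennreal (f0 / real (d + 2)) \<le> radial d (d + 1) f x} \<subseteq> ?D"
  proof
    fix x assume "x \<in> {x \<in> Rn d. ennreal (f0 / real (d + 2)) \<le> radial d (d + 1) f x}"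
    then have x: "x \<in> Rn d" and ge: "ennreal (f0 / real (d + 2)) \<le> radial d (d + 1) f x" by auto
    have "ennreal \<eta> \<le> radial d (d - 1) f x"
    proof (cases rule: Rn_zero_cases[OF x])
      case 1
      then show ?thesis using radial_zero_vector[OF f f0, of "d - 1"] by simp
    next
      case (2 i)
      have "radial d (d - 1) f x < \<infinity>" using radial_le[OF f x 2, of "d - 1"] by (rule le_less_trans) simp
      then obtain b where b: "radial d (d - 1) f x = ennreal b" "b \<ge> 0" by (cases "radial d (d - 1) f x") auto
      \<comment> \<open>If the moment of order d - 1 vanished, \<open>f\<close> would vanish almost
        everywhere on the ray and the moment of order d + 1 could not reach its threshold.\<close>
      have "b \<noteq> 0"
      proof
        assume "b = 0"
        then have "(\<integral>\<^sup>+r. ennreal (r ^ (d - 1)) * f (sc d r x) * indicator {0<..} r \<partial>lborel) = 0"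
          using b(1) unfolding radial_def by simp
        then have "AE r in lborel. ennreal (r ^ (d - 1)) * f (sc d r x) * indicator {0<..} r = 0"
          using radial_integrand_measurable[OF fm x, of "d - 1"] by (subst (asm) nn_integral_0_iff_AE) auto
        then have "AE r in lborel. ennreal (r ^ (d + 1)) * f (sc d r x) * indicator {0<..} r = 0"
          by eventually_elim (auto simp: indicator_def split: if_splits)
        then have "radial d (d + 1) f x = 0"
          using radial_integrand_measurable[OF fm x, of "d + 1"] unfolding radial_def
          by (subst nn_integral_0_iff_AE) auto
        then show False using ge f0(2) by simp
      qed
      then have b0: "b > 0" using b by simp
      \<comment> \<open>The exponential with value \<open>f0\<close> at 0 and rate 1 / \<tau> has
        the same moment of order d - 1 as the restriction of \<open>f\<close> to the ray.\<close>
      obtain \<tau> where \<tau>: "\<tau> > 0" "\<tau> ^ d = b / (f0 * fact (d - 1))"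
        using real_root_pow[of "b / (f0 * fact (d - 1))" d] b0 f0(2) d by auto
      have "f0 * (\<tau> ^ (d - 1 + 1) * fact (d - 1)) = b" unfolding d1 \<tau>(2) using f0(2) by simp
      then have "radial d (d - 1) f x = ennreal (f0 * (\<tau> ^ (d - 1 + 1) * fact (d - 1)))" using b(1) by simp
      from radial_compare[OF f f0 x 2 \<tau>(1) this]
      have "radial d (d + 1) f x \<le> ennreal (f0 * (\<tau> ^ (d + 2) * fact (d + 1)))" unfolding d1 .
      with ge have "ennreal (f0 / real (d + 2)) \<le> ennreal (f0 * (\<tau> ^ (d + 2) * fact (d + 1)))" by (rule order_trans)
      then have "f0 / real (d + 2) \<le> f0 * (\<tau> ^ (d + 2) * fact (d + 1))"
        using f0(2) \<tau>(1) by (subst (asm) ennreal_le_iff) auto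
      then have "1 / real (d + 2) \<le> \<tau> ^ (d + 2) * fact (d + 1)"
        using f0(2) by (metis mult_le_cancel_left_pos mult.right_neutral times_divide_eq_right)
      then have "1 \<le> \<tau> ^ (d + 2) * (fact (d + 1) * real (d + 2))"
        by (simp add: divide_le_eq mult.assoc del: power_Suc fact_Suc)
      also have "fact (d + 1) * real (d + 2) = fact (d + 2)"
        by (simp add: algebra_simps)
      finally have m: "exp (- 2) \<le> \<tau> ^ d * fact d" by (rule moment_constant[OF d \<tau>(1)])
      have "\<tau> ^ d * fact d = b * real d / f0"
        unfolding \<tau>(2) using d f0(2) by (simp add: fact_reduce)
      then have "exp (- 2) \<le> b * real d / f0" using m by (simp only:)
      then have "exp (- 2) * f0 \<le> b * real d" using f0(2) by (simp only: pos_le_divide_eq)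
      then have "\<eta> \<le> b" using d by (simp add: \<eta>_def pos_divide_le_eq)
      then show ?thesis unfolding b(1) by (rule ennreal_leI)
    qed
    then show "x \<in> ?D" using x by simp
  qed
  then have "emeasure (leb d) {x \<in> Rn d. ennreal (f0 / real (d + 2)) \<le> radial d (d + 1) f x} \<le> emeasure (leb d) ?D"
    by (rule emeasure_mono[OF _ D])
  also have "\<dots> = (\<integral>\<^sup>+x. 1 * indicator ?D x \<partial>leb d)" using D by simp
  also have "\<dots> = ennreal (1 / (real (d - 1 + 1) * \<eta>)) * (\<integral>\<^sup>+x. 1 * f x \<partial>leb d)"
    by (rule nn_integral_radial_superlevel[OF f f0 d _ \<eta>, where k=0]) (use d in auto)
  also have "\<dots> = ennreal (1 / (real d * \<eta>)) * ennreal F"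
    unfolding d1 using F(1) by simp
  also have "\<dots> = ennreal (1 / (real d * \<eta>) * F)"
    using \<eta> F(2) by (intro ennreal_mult[symmetric]) auto
  also have "1 / (real d * \<eta>) * F = exp 2 * F / f0"
    using d f0(2) by (simp add: \<eta>_def exp_minus field_simps)
  finally show ?thesis .
qed

text \<open>Ball's body of a log-concave function, with the exponent chosen so that its second moments are
  exactly proportional to those of the function.\<close>

lemma ball_body:
  assumes f: "nice d B R f" "usc d f" and f0: "f (\<lambda>i\<in>{..<d}. 0) = ennreal f0" "f0 > 0" and d: "d > 0"
    and F: "(\<integral>\<^sup>+x. f x \<partial>leb d) = ennreal F" "F \<ge> 0"
    and box: "y \<in> Rn d" "r > 0" "\<epsilon> > 0" "\<And>x. x \<in> ccube d y r \<Longrightarrow> ennreal \<epsilon> \<le> f x"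
  obtains T where "convex_body d T" "(\<lambda>i\<in>{..<d}. 0) \<in> T" "vol d T \<le> exp 2 * F / f0"
    "\<And>g. g \<in> borel_measurable (leb d) \<Longrightarrow>
      (\<And>x s. x \<in> Rn d \<Longrightarrow> s > 0 \<Longrightarrow> g (sc d s x) = ennreal (s\<^sup>2) * g x) \<Longrightarrow>
      (\<integral>\<^sup>+x. g x * indicator T x \<partial>leb d) = ennreal (1 / f0) * (\<integral>\<^sup>+x. g x * f x \<partial>leb d)"
proof -
  have fm: "f \<in> borel_measurable (leb d)" and BR: "B \<ge> 0" "R \<ge> 0" using f by (auto simp: nice_def)
  \<comment> \<open>With this threshold the factor 1 / ((d + 2) \<eta>) for functions of degree 2
    becomes 1 / f0.\<close>
  define \<eta> where "\<eta> = f0 / real (d + 2)"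
  have \<eta>: "\<eta> > 0" using f0 by (simp add: \<eta>_def)
  define T where "T = {x \<in> Rn d. ennreal \<eta> \<le> radial d (d + 1) f x}"
  have T0: "(\<lambda>i\<in>{..<d}. 0) \<in> T" using radial_zero_vector[OF f(1) f0, of "d + 1"] by (simp add: T_def)
  have "T \<subseteq> Rn d" by (auto simp: T_def)
  moreover have "compact T"
  proof (rule compact_RnI)
    show "T \<subseteq> Rn d" by (auto simp: T_def)
    show "closed T" unfolding T_def by (rule closed_radial_superlevel[OF f f0])
    fix x i assume x: "x \<in> T" "i < d"
    \<comment> \<open>If |x i| > R, the powers of R / |x i| in \<open>radial_le\<close> are at most
      the first one, and membership gives |x i| \<le> R B / \<eta>.\<close>
    show "\<bar>x i\<bar> \<le> R * max 1 (B / \<eta>)"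
    proof (cases "x i = 0")
      case True
      then show ?thesis using BR by simp
    next
      case False
      have xR: "x \<in> Rn d" and xT: "ennreal \<eta> \<le> radial d (d + 1) f x" using x(1) by (auto simp: T_def)
      have "ennreal \<eta> \<le> ennreal (B * (R / \<bar>x i\<bar>) ^ (d + 1 + 1))"
        by (rule order_trans[OF xT radial_le[OF f(1) xR x(2) False]])
      then have le: "\<eta> \<le> B * (R / \<bar>x i\<bar>) ^ (d + 1 + 1)"
        using BR by (subst (asm) ennreal_le_iff) auto
      show ?thesis
      proof (cases "\<bar>x i\<bar> \<le> R")
        case True
        have "R * 1 \<le> R * max 1 (B / \<eta>)" using BR by (intro mult_left_mono) auto
        then show ?thesis using True by simp
      next
        case nle: False
        have "(R / \<bar>x i\<bar>) ^ (d + 1 + 1) \<le> (R / \<bar>x i\<bar>) ^ 1"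
          using nle BR by (intro power_decreasing) (auto simp: divide_le_eq)
        then have "B * (R / \<bar>x i\<bar>) ^ (d + 1 + 1) \<le> B * (R / \<bar>x i\<bar>)"
          using BR by (intro mult_left_mono) auto
        then have "\<eta> \<le> B * (R / \<bar>x i\<bar>)" using le by linarith
        then have "\<bar>x i\<bar> \<le> R * (B / \<eta>)" using \<eta> False by (simp add: field_simps)
        also have "\<dots> \<le> R * max 1 (B / \<eta>)" using BR by (intro mult_left_mono) auto
        finally show ?thesis .
      qed
    qed
  qed
  moreover have "cvx d T" unfolding T_def by (rule radial_superlevel_convex[OF f(1) f0 \<eta>])
  moreover have "\<exists>x\<in>Rn d. \<exists>r>0. ccube d x r \<subseteq> T"
  proof -
    define c where "c = (1 / 2) ^ (d + 1) * min f0 \<epsilon> * (1 / 2)"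
    have c: "c > 0" using f0 box(3) by (simp add: c_def)
    \<comment> \<open>\<open>radial\<close> is at least \<open>c\<close> on the given cube. Dilation
      by \<open>t\<close> multiplies it by t^(-(d + 2)), which turns this lower bound into
      \<eta>.\<close>
    obtain t where t: "t > 0" "t ^ (d + 2) = c / \<eta>" using real_root_pow[of "c / \<eta>" "d + 2"] c \<eta> by auto
    have "ccube d (sc d t y) (t * r) \<subseteq> T"
    proof
      fix x assume x: "x \<in> ccube d (sc d t y) (t * r)"
      define v where "v = sc d (1 / t) x"
      have xR: "x \<in> Rn d" using x by (simp add: ccube_def)
      have xv: "x = sc d t v" using t(1) xR by (simp add: v_def sc_sc sc_1)
      have "\<bar>v i - y i\<bar> \<le> r" if i: "i < d" for i
      proof -
        have "\<bar>x i - t * y i\<bar> \<le> t * r" using x i by (simp add: ccube_def sc_def)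
        moreover have "x i = t * v i" using xv i by (metis lessThan_iff restrict_apply' sc_def)
        ultimately have "\<bar>t * (v i - y i)\<bar> \<le> t * r" by (simp add: algebra_simps)
        then show ?thesis using t(1) by (simp add: abs_mult)
      qed
      then have "v \<in> ccube d y r" by (simp add: ccube_def v_def)
      then have "ennreal c \<le> radial d (d + 1) f v"
        unfolding c_def by (intro radial_ge[OF f(1) _ box(4) f0 box(3)]) (auto simp: v_def)
      then have "ennreal (1 / t ^ (d + 1 + 1)) * ennreal c \<le> ennreal (1 / t ^ (d + 1 + 1)) * radial d (d + 1) f v"
        by (rule mult_left_mono) simp
      moreover have "radial d (d + 1) f x = ennreal (1 / t ^ (d + 1 + 1)) * radial d (d + 1) f v"
        unfolding xv by (rule radial_scale[OF fm _ t(1)]) (simp add: v_def)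
      moreover have "ennreal (1 / t ^ (d + 1 + 1)) * ennreal c = ennreal \<eta>"
      proof -
        have e: "d + 1 + 1 = d + 2" by simp
        have "ennreal (1 / t ^ (d + 1 + 1)) * ennreal c = ennreal (1 / t ^ (d + 2) * c)"
          unfolding e using t(1) c by (intro ennreal_mult[symmetric]) auto
        also have "1 / t ^ (d + 2) * c = \<eta>" unfolding t(2) using c \<eta> by simp
        finally show ?thesis .
      qed
      ultimately show "x \<in> T" using xR by (simp add: T_def)
    qed
    then show ?thesis using t(1) box(2) by (intro bexI[of _ "sc d t y"] exI[of _ "t * r"]) auto
  qed
  ultimately have T: "convex_body d T" by (simp add: convex_body_iff)
  show ?thesis
  proof (rule that[OF T T0])
    have "ennreal (vol d T) \<le> ennreal (exp 2 * F / f0)"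
      using radial_superlevel_volume[OF f(1) f0 d F] emeasure_vol[OF convex_body_fin[OF T]]
      by (simp add: T_def \<eta>_def)
    then show "vol d T \<le> exp 2 * F / f0" using F(2) f0(2) by (subst (asm) ennreal_le_iff) auto
  next
    fix g assume g: "g \<in> borel_measurable (leb d)" "\<And>x s. x \<in> Rn d \<Longrightarrow> s > 0 \<Longrightarrow> g (sc d s x) = ennreal (s\<^sup>2) * g x"
    have "(\<integral>\<^sup>+x. g x * indicator T x \<partial>leb d) = ennreal (1 / (real (d + 1 + 1) * \<eta>)) * (\<integral>\<^sup>+x. g x * f x \<partial>leb d)"
      unfolding T_def by (rule nn_integral_radial_superlevel[OF f(1) f0 d _ \<eta> g]) auto
    also have "real (d + 1 + 1) * \<eta> = f0" by (simp add: \<eta>_def)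
    finally show "(\<integral>\<^sup>+x. g x * indicator T x \<partial>leb d) = ennreal (1 / f0) * (\<integral>\<^sup>+x. g x * f x \<partial>leb d)" .
  qed
qed

section \<open>Affine images and second moments\<close>

definition aff :: "nat \<Rightarrow> (nat \<Rightarrow> real) \<Rightarrow> (nat \<Rightarrow> nat \<Rightarrow> real) \<Rightarrow> (nat \<Rightarrow> real) \<Rightarrow> (nat \<Rightarrow> real)"
  where "aff n a T x = (\<lambda>i\<in>{..<n}. a i + (\<Sum>j<n. T i j * x j))"

lemma affine_image_aff: "affine_image n a T K = aff n a T ` K"
  by (simp add: affine_image_def aff_def[abs_def])

lemma aff_in_Rn [simp]: "aff n a T x \<in> Rn n"
  by (simp add: aff_def)

lemma aff_lin: "aff n a T x = (\<lambda>i\<in>{..<n}. lin n T x i + a i)"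
  by (auto simp: aff_def lin_def fun_eq_iff)

lemma measurable_coord_leb: "i < n \<Longrightarrow> (\<lambda>x. x i) \<in> borel_measurable (leb n)"
  by (rule measurable_leb_component)

lemma measurable_aff: "aff n a T \<in> leb n \<rightarrow>\<^sub>M leb n"
  by (rule measurable_lebI) (auto simp: aff_def intro!: borel_measurable_sum borel_measurable_times borel_measurable_add measurable_coord_leb)

lemma aff_inj:
  assumes "mat_inv n T R" "x \<in> Rn n" "y \<in> Rn n" "aff n a T x = aff n a T y"
  shows "x = y"
proof -
  have "lin n T x = lin n T y"
  proof (rule Rn_eqI[of _ n])
    fix i assume "i < n"
    then show "lin n T x i = lin n T y i" using fun_cong[OF assms(4), of i] by (simp add: aff_lin)
  qed auto
  then show ?thesis using lin_mat_inv(2)[OF assms(1)] assms(2,3) by metis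
qed

lemma aff_apply: "i < n \<Longrightarrow> aff n a T x i = a i + lin n T x i"
  by (simp add: aff_def lin_def)

lemma aff_compose:
  "aff n b S (aff n a T x) = aff n (\<lambda>i. b i + lin n S (\<lambda>j\<in>{..<n}. a j) i) (mmul n S T) x"
proof (rule Rn_eqI[of _ n])
  fix i assume i: "i < n"
  have "lin n S (aff n a T x) i = (\<Sum>j<n. S i j * (a j + lin n T x j))"
    using i by (simp add: lin_def[of n S] aff_apply)
  also have "\<dots> = lin n S (\<lambda>j\<in>{..<n}. a j) i + lin n S (lin n T x) i"
    using i by (simp add: lin_def[of n S] distrib_left sum.distrib)
  finally have "lin n S (aff n a T x) i = lin n S (\<lambda>j\<in>{..<n}. a j) i + lin n (mmul n S T) x i"
    by (simp only: lin_mmul)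
  then show "aff n b S (aff n a T x) i = aff n (\<lambda>i. b i + lin n S (\<lambda>j\<in>{..<n}. a j) i) (mmul n S T) x i"
    by (simp only: aff_apply[OF i] add.assoc)
qed auto

lemma mmul_assoc: "i < n \<Longrightarrow> k < n \<Longrightarrow> mmul n (mmul n A B) C i k = mmul n A (mmul n B C) i k"
proof -
  have "mmul n (mmul n A B) C i k = (\<Sum>l<n. \<Sum>j<n. A i j * (B j l * C l k))"
    by (simp add: mmul_def sum_distrib_right mult.assoc)
  also have "\<dots> = (\<Sum>j<n. \<Sum>l<n. A i j * (B j l * C l k))" by (rule sum.swap)
  also have "\<dots> = mmul n A (mmul n B C) i k" by (simp add: mmul_def sum_distrib_left)
  finally show ?thesis .
qed

lemma mat_inv_mmul:
  assumes "mat_inv n S S'" "mat_inv n T T'"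
  shows "mat_inv n (mmul n S T) (mmul n T' S')"
proof -
  have id: "mmul n (\<lambda>i k. if i = k then 1 else 0) A i k = A i k" if "i < n" for A :: "nat \<Rightarrow> nat \<Rightarrow> real" and i k
    using that by (simp add: mmul_def sum_delta_mult)
  have cong: "mmul n A B i k = mmul n A' B' i k" if "\<And>i j. i < n \<Longrightarrow> j < n \<Longrightarrow> A i j = A' i j" "\<And>i j. i < n \<Longrightarrow> j < n \<Longrightarrow> B i j = B' i j" "i < n" "k < n"
    for A B A' B' :: "nat \<Rightarrow> nat \<Rightarrow> real" and i k
    using that by (auto simp: mmul_def intro!: sum.cong)
  have key: "mmul n (mmul n S T) (mmul n T' S') i k = (if i = k then 1 else 0)"
    if S: "mat_inv n S S'" and T: "mat_inv n T T'" and ik: "i < n" "k < n" for S S' T T' i k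
  proof -
    have "mmul n (mmul n S T) (mmul n T' S') i k = mmul n S (mmul n T (mmul n T' S')) i k"
      using ik by (rule mmul_assoc)
    also have "\<dots> = mmul n S S' i k"
    proof (rule cong[OF refl _ ik])
      fix i j assume ij: "i < n" "j < n"
      have "mmul n T (mmul n T' S') i j = mmul n (mmul n T T') S' i j" using ij by (rule mmul_assoc[symmetric])
      also have "\<dots> = mmul n (\<lambda>i k. if i = k then 1 else 0) S' i j"
        by (rule cong[OF _ refl ij]) (use T in \<open>simp add: mat_inv_def mmul_def\<close>)
      finally show "mmul n T (mmul n T' S') i j = S' i j" using id ij by simp
    qed
    also have "\<dots> = (if i = k then 1 else 0)" using S ik by (simp add: mat_inv_def mmul_def)
    finally show ?thesis .
  qed
  show ?thesis
    unfolding mat_inv_def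
    using key[OF assms] key[OF mat_inv_sym[OF assms(2)] mat_inv_sym[OF assms(1)]] by (simp add: mmul_def)
qed

lemma affine_image_compose:
  "affine_image n b S (affine_image n a T K) = affine_image n (\<lambda>i. b i + lin n S (\<lambda>j\<in>{..<n}. a j) i) (mmul n S T) K"
  unfolding affine_image_aff image_image aff_compose ..

lemma affine_image_restrict: "affine_image n a T K = affine_image n (\<lambda>i\<in>{..<n}. a i) T K"
proof -
  have "aff n (\<lambda>i\<in>{..<n}. a i) T = aff n a T" by (auto simp: aff_def fun_eq_iff)
  then show ?thesis by (simp add: affine_image_aff)
qed

lemma continuous_aff: "continuous_on A (aff n a T)"
proof (rule continuous_on_coordinatewise_then_product)
  fix i
  show "continuous_on A (\<lambda>x. aff n a T x i)"
    unfolding aff_def by (cases "i < n") (auto intro!: continuous_intros continuous_coord)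
qed

lemma comb_aff: "comb n t (aff n a T x) (aff n a T y) = aff n a T (comb n t x y)"
proof (rule Rn_eqI[of _ n])
  fix i assume "i < n"
  then show "comb n t (aff n a T x) (aff n a T y) i = aff n a T (comb n t x y) i"
    by (simp add: comb_def aff_def algebra_simps sum.distrib sum_distrib_left sum_subtractf)
qed auto

lemma aff_surj:
  assumes "mat_inv n T R" "y \<in> Rn n"
  shows "aff n a T (lin n R (\<lambda>i\<in>{..<n}. y i - a i)) = y"
proof (rule Rn_eqI[of _ n])
  fix i assume "i < n"
  then show "aff n a T (lin n R (\<lambda>i\<in>{..<n}. y i - a i)) i = y i"
    using lin_mat_inv(1)[OF assms(1), of "\<lambda>i\<in>{..<n}. y i - a i"] by (simp add: aff_lin)
qed (use assms in auto)

lemma convex_body_affine_image: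
  assumes K: "convex_body n K" and inv: "mat_inv n T R"
  shows "convex_body n (affine_image n a T K)"
  unfolding convex_body_iff
proof (intro conjI)
  show "affine_image n a T K \<subseteq> Rn n" by (auto simp: affine_image_aff)
  show "compact (affine_image n a T K)"
    unfolding affine_image_aff by (rule compact_continuous_image[OF continuous_aff convex_body_compact[OF K]])
  show "cvx n (affine_image n a T K)"
    using convex_body_cvx[OF K] unfolding cvx_def affine_image_aff by (auto simp: comb_aff)
  obtain x r where x: "x \<in> Rn n" "r > 0" "ccube n x r \<subseteq> K" using K unfolding convex_body_iff by blast
  \<comment> \<open>A Lipschitz bound of the inverse in the maximum norm; the added 1 keeps it
    positive also for n = 0.\<close>
  define M where "M = 1 + (\<Sum>i<n. \<Sum>j<n. \<bar>R i j\<bar>)"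
  have M: "M > 0" by (simp add: M_def add_pos_nonneg sum_nonneg)
  have "ccube n (aff n a T x) (r / M) \<subseteq> affine_image n a T K"
  proof
    fix y assume y: "y \<in> ccube n (aff n a T x) (r / M)"
    have yR: "y \<in> Rn n" using y by (simp add: ccube_def)
    define z where "z = lin n R (\<lambda>i\<in>{..<n}. y i - a i)"
    have zy: "aff n a T z = y" unfolding z_def by (rule aff_surj[OF inv yR])
    have xz: "x = lin n R (\<lambda>i\<in>{..<n}. aff n a T x i - a i)"
      using aff_inj[OF inv x(1) lin_in_Rn, of a R "\<lambda>i\<in>{..<n}. aff n a T x i - a i"] aff_surj[OF inv aff_in_Rn, of a a T x] by simp
    have "\<bar>z i - x i\<bar> \<le> r" if i: "i < n" for i
    proof -
      have "x i = (\<Sum>j<n. R i j * (aff n a T x j - a j))"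
        using fun_cong[OF xz, of i] i by (simp add: lin_def)
      then have "z i - x i = (\<Sum>j<n. R i j * (y j - aff n a T x j))"
        using i by (simp add: z_def lin_def sum_subtractf[symmetric] algebra_simps)
      also have "\<bar>\<dots>\<bar> \<le> (\<Sum>j<n. \<bar>R i j\<bar> * (r / M))"
      proof (rule order_trans[OF sum_abs sum_mono])
        fix j assume "j \<in> {..<n}"
        then show "\<bar>R i j * (y j - aff n a T x j)\<bar> \<le> \<bar>R i j\<bar> * (r / M)"
          using y unfolding abs_mult by (intro mult_left_mono) (auto simp: ccube_def)
      qed
      also have "\<dots> = (\<Sum>j<n. \<bar>R i j\<bar>) * (r / M)" by (rule sum_distrib_right[symmetric])
      also have "\<dots> \<le> M * (r / M)"
      proof (rule mult_right_mono)
        have "(\<Sum>j<n. \<bar>R i j\<bar>) \<le> (\<Sum>i<n. \<Sum>j<n. \<bar>R i j\<bar>)"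
          using i by (intro member_le_sum[of i "{..<n}" "\<lambda>i. \<Sum>j<n. \<bar>R i j\<bar>"]) (auto intro: sum_nonneg)
        then show "(\<Sum>j<n. \<bar>R i j\<bar>) \<le> M" by (simp add: M_def)
      qed (use x(2) M in simp)
      finally show ?thesis using M by simp
    qed
    then have "z \<in> ccube n x r" by (simp add: ccube_def z_def)
    then show "y \<in> affine_image n a T K" using x(3) zy by (auto simp: affine_image_aff)
  qed
  then show "\<exists>x\<in>Rn n. \<exists>r>0. ccube n x r \<subseteq> affine_image n a T K"
    using M x(2) by (intro bexI[of _ "aff n a T x"] exI[of _ "r / M"]) auto
qed

text \<open>The factor is passed in together with its defining property, so that each use supplies
  its own value: 1 for rigid motions, the volume for the diagonal normalisation, 2^n for
  halving.\<close>

lemma LINT_affine_image: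
  fixes h :: "(nat \<Rightarrow> real) \<Rightarrow> real"
  assumes c: "c > 0" "\<And>f. f \<in> borel_measurable (leb n) \<Longrightarrow> (\<integral>\<^sup>+x. f (lin n T x) \<partial>leb n) = ennreal c * (\<integral>\<^sup>+x. f x \<partial>leb n)"
    and inv: "mat_inv n T R" and K: "convex_body n K" and h: "h \<in> borel_measurable (leb n)"
  shows "(LINT x:K|leb n. h (aff n a T x)) = c * (LINT y:affine_image n a T K|leb n. h y)"
proof -
  let ?K' = "affine_image n a T K"
  note am = measurable_aff[of n a T]
  have K': "?K' \<in> sets (leb n)" by (rule convex_body_sets[OF convex_body_affine_image[OF K inv]])
  have dist: "distr (leb n) (leb n) (aff n a T) = density (leb n) (\<lambda>_. ennreal c)"
  proof (rule measure_eqI)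
    fix A assume "A \<in> sets (distr (leb n) (leb n) (aff n a T))"
    then have A: "A \<in> sets (leb n)" by simp
    have tr: "(\<lambda>x. \<lambda>i\<in>{..<n}. x i + a i) \<in> leb n \<rightarrow>\<^sub>M leb n"
      by (rule measurable_lebI) (auto intro!: borel_measurable_add measurable_coord_leb)
    have iA: "(\<lambda>x. indicator A (\<lambda>i\<in>{..<n}. x i + a i) :: ennreal) \<in> borel_measurable (leb n)"
      by (rule measurable_compose[OF tr borel_measurable_indicator[OF A]])
    have "emeasure (distr (leb n) (leb n) (aff n a T)) A = (\<integral>\<^sup>+x. indicator A x \<partial>distr (leb n) (leb n) (aff n a T))"
      using A by simp
    also have "\<dots> = (\<integral>\<^sup>+x. indicator A (aff n a T x) \<partial>leb n)"
      by (rule nn_integral_distr[OF am]) (use A in simp)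
    also have "\<dots> = (\<integral>\<^sup>+x. indicator A (\<lambda>i\<in>{..<n}. lin n T x i + a i) \<partial>leb n)" by (simp add: aff_lin)
    also have "\<dots> = ennreal c * (\<integral>\<^sup>+x. indicator A (\<lambda>i\<in>{..<n}. x i + a i) \<partial>leb n)"
      by (rule c(2)[OF iA])
    also have "(\<integral>\<^sup>+x. indicator A (\<lambda>i\<in>{..<n}. x i + a i) \<partial>leb n) = (\<integral>\<^sup>+x. indicator A x \<partial>leb n)"
      by (rule nn_integral_leb_translate) (use A in simp)
    also have "ennreal c * \<dots> = (\<integral>\<^sup>+x. ennreal c * indicator A x \<partial>leb n)"
      by (rule nn_integral_cmult[symmetric]) (use A in simp)
    also have "\<dots> = emeasure (density (leb n) (\<lambda>_. ennreal c)) A"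
      by (rule emeasure_density[symmetric]) (use A in auto)
    finally show "emeasure (distr (leb n) (leb n) (aff n a T)) A = \<dots>" .
  qed simp
  have gm: "(\<lambda>y. indicator ?K' y *\<^sub>R h y) \<in> borel_measurable (leb n)"
    by (intro borel_measurable_scaleR borel_measurable_indicator K' h)
  have ind: "indicator ?K' (aff n a T x) = (indicator K x :: real)" if "x \<in> Rn n" for x
  proof -
    have "aff n a T x \<in> ?K' \<longleftrightarrow> x \<in> K"
      using aff_inj[OF inv that] convex_body_subset[OF K] unfolding affine_image_aff by blast
    then show ?thesis by (simp add: indicator_def)
  qed
  have "(LINT x:K|leb n. h (aff n a T x)) = (LINT x|leb n. indicator ?K' (aff n a T x) *\<^sub>R h (aff n a T x))"
    unfolding set_lebesgue_integral_def by (intro Bochner_Integration.integral_cong) (auto simp: ind)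
  also have "\<dots> = (LINT y|distr (leb n) (leb n) (aff n a T). indicator ?K' y *\<^sub>R h y)"
    by (rule integral_distr[symmetric, OF am gm])
  also have "\<dots> = (LINT y|leb n. c *\<^sub>R (indicator ?K' y *\<^sub>R h y))"
    unfolding dist by (rule integral_density) (use gm c in auto)
  also have "\<dots> = c * (LINT y:?K'|leb n. h y)"
    by (simp add: set_lebesgue_integral_def)
  finally show ?thesis .
qed

section \<open>Linear and quadratic forms integrated over a body\<close>

lemma vol_LINT: "convex_body n K \<Longrightarrow> vol n K = (LINT x:K|leb n. 1)"
  using convex_body_sets[of n K] convex_body_subset[of n K]
  by (simp add: vol_def set_lebesgue_integral_def Int_absorb2)

lemma set_integral_sum:
  fixes f :: "'i \<Rightarrow> 'a \<Rightarrow> real"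
  assumes "\<And>i. i \<in> I \<Longrightarrow> set_integrable M A (f i)"
  shows "(LINT x:A|M. \<Sum>i\<in>I. f i x) = (\<Sum>i\<in>I. LINT x:A|M. f i x)"
    and "set_integrable M A (\<lambda>x. \<Sum>i\<in>I. f i x)"
  using assms unfolding set_lebesgue_integral_def set_integrable_def scaleR_sum_right
  by (auto intro: Bochner_Integration.integral_sum Bochner_Integration.integrable_sum)

lemma body_integrable:
  fixes h :: "(nat \<Rightarrow> real) \<Rightarrow> real"
  assumes K: "convex_body n K" and h: "h \<in> borel_measurable (leb n)" and C: "\<And>x. x \<in> K \<Longrightarrow> \<bar>h x\<bar> \<le> C"
  shows "set_integrable (leb n) K h"
  unfolding set_integrable_def
proof (rule Bochner_Integration.integrable_bound[of _ "\<lambda>x. C * indicator K x"])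
  show "integrable (leb n) (\<lambda>x. C * indicator K x :: real)"
    by (intro integrable_mult_right integrable_real_indicator convex_body_sets[OF K])
      (use convex_body_fin[OF K] in simp)
  show "(\<lambda>x. indicator K x *\<^sub>R h x) \<in> borel_measurable (leb n)"
    by (intro borel_measurable_scaleR borel_measurable_indicator convex_body_sets[OF K] h)
  show "AE x in leb n. norm (indicator K x *\<^sub>R h x) \<le> norm (C * indicator K x :: real)"
  proof (rule AE_I2)
    fix x
    show "norm (indicator K x *\<^sub>R h x) \<le> norm (C * indicator K x :: real)"
      using C[of x] by (cases "x \<in> K") auto
  qed
qed

text \<open>Taken about the origin and not divided by the volume, so a covariance matrix only when
  the body is centered and of volume 1.\<close>

definition mom :: "nat \<Rightarrow> (nat \<Rightarrow> real) set \<Rightarrow> nat \<Rightarrow> nat \<Rightarrow> real"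
  where "mom n K i j = (LINT x:K|leb n. x i * x j)"

lemma body_integrable_coord: "convex_body n K \<Longrightarrow> i < n \<Longrightarrow> set_integrable (leb n) K (\<lambda>x. x i)"
  using compact_bounded_coord[of K n] convex_body_compact[of n K] 
  by (metis body_integrable measurable_coord_leb)

lemma body_integrable_prod:
  assumes K: "convex_body n K" and "i < n" "j < n"
  shows "set_integrable (leb n) K (\<lambda>x. x i * x j)"
proof -
  obtain R where R: "R > 0" "\<And>x i. x \<in> K \<Longrightarrow> i < n \<Longrightarrow> \<bar>x i\<bar> \<le> R"
    using compact_bounded_coord[OF convex_body_compact[OF K]] by metis
  show ?thesis
  proof (rule body_integrable[OF K, of _ "R * R"])
    show "(\<lambda>x. x i * x j) \<in> borel_measurable (leb n)"
      using assms by (intro borel_measurable_times measurable_coord_leb)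
    show "\<bar>x i * x j\<bar> \<le> R * R" if "x \<in> K" for x
      unfolding abs_mult using R that assms by (intro mult_mono) auto
  qed
qed

lemma LINT_lin:
  assumes K: "convex_body n K"
  shows "(LINT x:K|leb n. dot n x u) = (\<Sum>i<n. u i * (LINT x:K|leb n. x i))"
    "set_integrable (leb n) K (\<lambda>x. dot n x u)"
proof -
  have i: "set_integrable (leb n) K (\<lambda>x. u i * x i)" if "i \<in> {..<n}" for i
    using body_integrable_coord[OF K] that by (intro set_integrable_mult_right) auto
  have e: "dot n x u = (\<Sum>i<n. u i * x i)" for x by (simp add: dot_def mult.commute)
  show "(LINT x:K|leb n. dot n x u) = (\<Sum>i<n. u i * (LINT x:K|leb n. x i))"
    unfolding e by (subst set_integral_sum(1)) (use i in auto)
  show "set_integrable (leb n) K (\<lambda>x. dot n x u)"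
    unfolding e by (rule set_integral_sum(2)) (use i in auto)
qed

lemma LINT_bilinear:
  assumes K: "convex_body n K"
  shows "(LINT x:K|leb n. dot n x u * dot n x v) = bil n (mom n K) u v"
    "set_integrable (leb n) K (\<lambda>x. dot n x u * dot n x v)"
proof -
  have e: "dot n x u * dot n x v = (\<Sum>i<n. \<Sum>j<n. (u i * v j) * (x i * x j))" for x
    by (simp add: dot_def sum_product mult_ac)
  have i1: "set_integrable (leb n) K (\<lambda>x. (u i * v j) * (x i * x j))" if "i \<in> {..<n}" "j \<in> {..<n}" for i j
    using body_integrable_prod[OF K] that by (intro set_integrable_mult_right) auto
  have i2: "set_integrable (leb n) K (\<lambda>x. \<Sum>j<n. (u i * v j) * (x i * x j))" if "i \<in> {..<n}" for i
    by (rule set_integral_sum(2)) (use i1 that in auto)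
  show "set_integrable (leb n) K (\<lambda>x. dot n x u * dot n x v)"
    unfolding e by (rule set_integral_sum(2)) (use i2 in auto)
  have "(LINT x:K|leb n. dot n x u * dot n x v) = (\<Sum>i<n. LINT x:K|leb n. \<Sum>j<n. (u i * v j) * (x i * x j))"
    unfolding e by (rule set_integral_sum(1)) (use i2 in auto)
  also have "\<dots> = (\<Sum>i<n. \<Sum>j<n. LINT x:K|leb n. (u i * v j) * (x i * x j))"
    by (intro sum.cong refl set_integral_sum(1)) (use i1 in auto)
  also have "\<dots> = bil n (mom n K) u v"
    unfolding bil_def mom_def by (intro sum.cong refl) (simp only: set_integral_mult_right, simp only: mult_ac)
  finally show "(LINT x:K|leb n. dot n x u * dot n x v) = bil n (mom n K) u v" .
qed

section \<open>Isotropic constants\<close>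

lemma affine_image_cong:
  assumes "\<And>i. i < n \<Longrightarrow> a i = b i" "\<And>i j. i < n \<Longrightarrow> j < n \<Longrightarrow> T i j = S i j"
  shows "affine_image n a T K = affine_image n b S K"
proof -
  have "aff n a T x = aff n b S x" for x
    using assms by (auto simp: aff_def intro!: restrict_ext sum.cong)
  then show ?thesis by (simp add: affine_image_aff)
qed

lemma isotropic_withD:
  assumes "isotropic_with n K L"
  shows "convex_body n K" "vol n K = 1" "centered n K" "L > 0"
    "(LINT x:K|leb n. (dot n x \<theta>)\<^sup>2) = L\<^sup>2 * dot n \<theta> \<theta>"
proof -
  show "convex_body n K" "vol n K = 1" "centered n K" "L > 0" using assms by (auto simp: isotropic_with_def)
  show "(LINT x:K|leb n. (dot n x \<theta>)\<^sup>2) = L\<^sup>2 * dot n \<theta> \<theta>"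
  proof (cases "dot n \<theta> \<theta> = 0")
    case True
    then have "dot n x \<theta> = 0" for x
      using dot_self_zero[OF True] by (simp add: dot_def)
    then show ?thesis using True by simp
  next
    case False
    then have pos: "dot n \<theta> \<theta> > 0" using dot_self_nonneg[of n \<theta>] by linarith
    define s where "s = sqrt (dot n \<theta> \<theta>)"
    have s: "s > 0" "s\<^sup>2 = dot n \<theta> \<theta>" using pos by (auto simp: s_def)
    define \<phi> where "\<phi> = (\<lambda>i\<in>{..<n}. (1 / s) * \<theta> i)"
    have d: "dot n \<phi> z = (1 / s) * dot n \<theta> z" for z unfolding \<phi>_def by (rule dot_scale_left)
    have "dot n \<phi> \<phi> = (1 / s) * ((1 / s) * dot n \<theta> \<theta>)"
      unfolding d[of \<phi>] dot_commute[of n \<theta> \<phi>] d[of \<theta>] by (rule refl)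
    also have "\<dots> = 1" using s by (simp add: s(2)[symmetric] power2_eq_square)
    finally have "(LINT x:K|leb n. (dot n x \<phi>)\<^sup>2) = L\<^sup>2"
      using assms unfolding isotropic_with_def by (simp add: \<phi>_def)
    moreover have "(dot n x \<theta>)\<^sup>2 = s\<^sup>2 * (dot n x \<phi>)\<^sup>2" for x
      using d[of x] s(1) by (simp add: dot_commute[of n x] power_mult_distrib[symmetric])
    ultimately show ?thesis using s by simp
  qed
qed

lemma dot_row: "k < n \<Longrightarrow> lin n T x k = dot n x (T k)"
  by (simp add: lin_def dot_def mult.commute)

text \<open>An affine map between isotropic bodies satisfies \<open>G G\<^sup>T = (L2 / L1)\<^sup>2 I\<close> and preserves volume.\<close>

lemma isotropic_unique:
  assumes n: "n \<ge> 1" and K1: "isotropic_with n K L1" and K2: "isotropic_with n (affine_image n g G K) L2"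
    and inv: "mat_inv n G R"
  shows "L1 = L2"
proof -
  note I1 = isotropic_withD[OF K1] and I2 = isotropic_withD[OF K2]
  let ?K2 = "affine_image n g G K"
  obtain c where c: "c > 0" "\<And>f. f \<in> borel_measurable (leb n) \<Longrightarrow> (\<integral>\<^sup>+x. f (lin n G x) \<partial>leb n) = ennreal c * (\<integral>\<^sup>+x. f x \<partial>leb n)"
    using nn_integral_leb_lin[OF inv] by metis
  have tr: "(LINT x:K|leb n. h (aff n g G x)) = c * (LINT y:?K2|leb n. h y)"
    if "h \<in> borel_measurable (leb n)" for h :: "(nat \<Rightarrow> real) \<Rightarrow> real"
    by (rule LINT_affine_image[OF c(1) _ inv I1(1) that]) (rule c(2))
  \<comment> \<open>Tested on the constant 1: both bodies have volume 1.\<close>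
  have c1: "c = 1"
    using tr[of "\<lambda>_. 1"] I1(2) I2(2) by (simp add: vol_LINT[OF I1(1)] vol_LINT[OF I2(1)])
  have m1: "(LINT x:K|leb n. x i) = 0" if "i < n" for i
    using I1(2,3) that by (subst (asm) centered_iff) auto
  have m2: "(LINT x:?K2|leb n. x i) = 0" if "i < n" for i
    using I2(2,3) that by (subst (asm) centered_iff) auto
  have g0: "g i = 0" if i: "i < n" for i
  proof -
    have "0 = (LINT x:K|leb n. aff n g G x i)"
      using tr[OF measurable_coord_leb[OF i]] m2[OF i] by simp
    also have "\<dots> = (LINT x:K|leb n. g i * 1 + dot n x (G i))"
      using i by (simp add: aff_apply dot_row)
    also have "\<dots> = (LINT x:K|leb n. g i * 1) + (LINT x:K|leb n. dot n x (G i))"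
      by (rule set_integral_add) (use LINT_lin(2)[OF I1(1)] body_integrable[OF I1(1), of "\<lambda>_. g i * 1" "\<bar>g i\<bar>"] in auto)
    also have "(LINT x:K|leb n. dot n x (G i)) = 0"
      unfolding LINT_lin(1)[OF I1(1)] using m1 by simp
    also have "(LINT x:K|leb n. g i * 1) = g i"
      unfolding set_integral_mult_right vol_LINT[OF I1(1), symmetric] I1(2) by simp
    finally show ?thesis by simp
  qed
  have affG: "aff n g G x = lin n G x" for x
    using g0 by (auto simp: aff_def lin_def)
  define \<rho> where "\<rho> = L2 / L1"
  have \<rho>: "\<rho> > 0" "\<rho>\<^sup>2 * L1\<^sup>2 = L2\<^sup>2" using I1(4) I2(4) by (auto simp: \<rho>_def power_divide)
  have GT: "dot n (lin n (\<lambda>i j. G j i) \<theta>) (lin n (\<lambda>i j. G j i) \<theta>) = \<rho>\<^sup>2 * dot n \<theta> \<theta>" for \<theta>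
  proof -
    have "(\<lambda>x. (dot n x \<theta>)\<^sup>2) \<in> borel_measurable (leb n)"
      unfolding dot_def by (intro borel_measurable_power borel_measurable_sum borel_measurable_times measurable_coord_leb) auto
    from tr[OF this] have "(LINT x:K|leb n. (dot n (lin n G x) \<theta>)\<^sup>2) = (LINT x:?K2|leb n. (dot n x \<theta>)\<^sup>2)"
      by (simp add: affG c1)
    then have "L1\<^sup>2 * dot n (lin n (\<lambda>i j. G j i) \<theta>) (lin n (\<lambda>i j. G j i) \<theta>) = L2\<^sup>2 * dot n \<theta> \<theta>"
      unfolding I2(5) dot_lin I1(5) .
    also have "\<dots> = L1\<^sup>2 * (\<rho>\<^sup>2 * dot n \<theta> \<theta>)" unfolding \<rho>(2)[symmetric] by simp
    finally show ?thesis using I1(4) by simp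
  qed
  define e where "e j = (\<lambda>i\<in>{..<n}. if i = j then 1 else 0 :: real)" for j :: nat
  have Ge: "lin n (\<lambda>i j. G j i) (e j) i = G j i" if "i < n" "j < n" for i j
    using that by (simp add: lin_def e_def if_distrib[of "\<lambda>a. _ * a"] sum.delta cong: if_cong)
  have rowrow: "dot n (G j) (G k) = \<rho>\<^sup>2 * (if j = k then 1 else 0)" if jk: "j < n" "k < n" for j k
  proof -
    have dotG: "dot n (lin n (\<lambda>i j. G j i) (e j)) (lin n (\<lambda>i j. G j i) (e k)) = dot n (G j) (G k)" if "j < n" "k < n" for j k
      using that by (simp add: dot_def Ge)
    have ee: "dot n (e j) (e k) = (if j = k then 1 else 0)" if "j < n" "k < n" for j k
      using that by (simp add: dot_def e_def if_distrib[of "\<lambda>a. a * _"] sum.delta cong: if_cong)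
    have self: "dot n (G j) (G j) = \<rho>\<^sup>2" if "j < n" for j
      using GT[of "e j"] that by (simp add: dotG ee)
    show ?thesis
    proof (cases "j = k")
      case True
      then show ?thesis using self jk by simp
    next
      case False
      let ?s = "\<lambda>i\<in>{..<n}. e j i + e k i"
      have d: "dot n (\<lambda>i\<in>{..<n}. u i + v i) (\<lambda>i\<in>{..<n}. u i + v i) = dot n u u + 2 * dot n u v + dot n v v" for u v
        by (simp add: dot_def algebra_simps sum.distrib sum_distrib_left)
      have "dot n (lin n (\<lambda>i j. G j i) ?s) (lin n (\<lambda>i j. G j i) ?s) = \<rho>\<^sup>2 + 2 * dot n (G j) (G k) + \<rho>\<^sup>2"
        unfolding lin_add d using jk by (simp add: dotG self)
      moreover have "dot n ?s ?s = 2" unfolding d using jk False by (simp add: ee)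
      ultimately show ?thesis using GT[of ?s] False by simp
    qed
  qed
  \<comment> \<open>The rows of \<open>G\<close> are orthogonal of length \<rho>, so
    \<open>G\<close> is a dilation by \<rho> followed by a rotation.\<close>
  define w where "w k = (\<lambda>i\<in>{..<n}. (1 / \<rho>) * G k i)" for k
  have "orthonormal n n w"
    unfolding orthonormal_def
  proof (intro conjI allI impI)
    fix j k assume jk: "j < n" "k < n"
    have "dot n (w j) (w k) = (1 / \<rho>) * dot n (G j) (w k)" unfolding w_def by (rule dot_scale_left)
    also have "dot n (G j) (w k) = (1 / \<rho>) * dot n (G k) (G j)"
      unfolding dot_commute[of n "G j"] w_def by (rule dot_scale_left)
    finally show "dot n (w j) (w k) = (if j = k then 1 else 0)"
      using rowrow[OF jk(2,1)] \<rho>(1) by (auto simp: power2_eq_square)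
  qed (simp add: w_def)
  then have om: "orth_mat n w" by (rule orthonormal_orth_mat)
  have linG: "lin n G x = lin n w (\<lambda>i\<in>{..<n}. \<rho> * x i)" for x
    using \<rho>(1) by (auto simp: lin_def w_def intro!: restrict_ext sum.cong)
  have KS: "K \<in> sets (leb n)" by (rule convex_body_sets[OF I1(1)])
  have iK: "(indicator K :: _ \<Rightarrow> ennreal) \<in> borel_measurable (leb n)" using KS by simp
  have "emeasure (leb n) K = 1" using emeasure_vol[OF convex_body_fin[OF I1(1)]] I1(2) by simp
  then have e1: "(\<integral>\<^sup>+x. indicator K x \<partial>leb n) = 1" using KS by simp
  \<comment> \<open>The rotation has factor 1 and the dilation \<rho>^(-n), so invariance of volume
    leaves \<rho>^(-n) = 1.\<close>
  have "1 = (\<integral>\<^sup>+x. indicator K (lin n G x) \<partial>leb n)"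
    using c(2)[OF iK] c1 e1 by simp
  also have "\<dots> = (\<integral>\<^sup>+x. indicator K (lin n w (\<lambda>i\<in>{..<n}. \<rho> * x i)) \<partial>leb n)" by (simp add: linG)
  also have "\<dots> = ennreal (\<Prod>i<n. 1 / \<bar>\<rho>\<bar>) * (\<integral>\<^sup>+x. indicator K (lin n w x) \<partial>leb n)"
    by (rule nn_integral_leb_scale[where s="\<lambda>_. \<rho>"])
      (use \<rho>(1) measurable_compose[OF measurable_lin iK] in auto)
  also have "(\<integral>\<^sup>+x. indicator K (lin n w x) \<partial>leb n) = 1"
    using nn_integral_leb_orth[OF om iK] e1 by simp
  finally have "ennreal ((1 / \<rho>) ^ n) = 1" using \<rho>(1) by simp
  then have "(1 / \<rho>) ^ n = 1" by (simp add: ennreal_eq_1)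
  then have "norm (1 / \<rho>) = 1" using power_eq_1_iff[of "1 / \<rho>" n] n by simp
  then have "1 / \<rho> = 1" using \<rho>(1) by simp
  then show ?thesis using I1(4) by (simp add: \<rho>_def)
qed

text \<open>Two isotropic images of \<open>K\<close> differ by the affine map with matrix T' R, to
  which uniqueness applies. This evaluates the definite description.\<close>

lemma isotropic_constant_eq:
  assumes n: "n \<ge> 1" and K: "K \<subseteq> Rn n" and T: "mat_inv n T R" and iso: "isotropic_with n (affine_image n a T K) L"
  shows "isotropic_constant n K = L"
  unfolding isotropic_constant_def
proof (rule the_equality)
  show "\<exists>a\<in>Rn n. \<exists>T. GL n T \<and> isotropic_with n (affine_image n a T K) L"
  proof (intro bexI exI conjI)
    show "isotropic_with n (affine_image n (\<lambda>i\<in>{..<n}. a i) T K) L"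
      using iso affine_image_restrict[of n a T K] by simp
  qed (use T GL_iff in auto)
  fix L' assume "\<exists>a\<in>Rn n. \<exists>T. GL n T \<and> isotropic_with n (affine_image n a T K) L'"
  then obtain a' T' R' where T': "mat_inv n T' R'" and iso': "isotropic_with n (affine_image n a' T' K) L'"
    using GL_iff by blast
  define G where "G = mmul n T' R"
  have G: "mat_inv n G (mmul n T R')" unfolding G_def by (rule mat_inv_mmul[OF T' mat_inv_sym[OF T]])
  define g where "g i = a' i - lin n G (\<lambda>j\<in>{..<n}. a j) i" for i
  have GT: "mmul n G T i k = T' i k" if ik: "i < n" "k < n" for i k
  proof -
    have "mmul n G T i k = mmul n T' (mmul n R T) i k" unfolding G_def by (rule mmul_assoc[OF ik])
    also have "\<dots> = (\<Sum>j<n. T' i j * (if j = k then 1 else 0))"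
      unfolding mmul_def[of n T'] using T ik by (intro sum.cong refl) (simp add: mmul_def mat_inv_def)
    also have "\<dots> = T' i k" using ik by (simp add: if_distrib[of "\<lambda>a. _ * a"] sum.delta' cong: if_cong)
    finally show ?thesis .
  qed
  have "affine_image n g G (affine_image n a T K) = affine_image n a' T' K"
    unfolding affine_image_compose by (rule affine_image_cong) (auto simp: g_def GT)
  then have "isotropic_with n (affine_image n g G (affine_image n a T K)) L'" using iso' by simp
  from isotropic_unique[OF n iso this G] show "L' = L" by simp
qed

text \<open>A zero moment would confine \<open>K\<close>, up to a null set, to a coordinate
  hyperplane.\<close>

lemma second_moment_pos:
  assumes K: "convex_body n K" and k: "k < n"
  shows "mom n K k k > 0"
proof -
  have int: "integrable (leb n) (\<lambda>x. indicator K x *\<^sub>R (x k * x k))"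
    using body_integrable_prod[OF K k k] by (simp add: set_integrable_def)
  have nn: "mom n K k k \<ge> 0"
    unfolding mom_def set_lebesgue_integral_def by (rule Bochner_Integration.integral_nonneg) simp
  have "mom n K k k \<noteq> 0"
  proof
    assume "mom n K k k = 0"
    then have "AE x in leb n. indicator K x *\<^sub>R (x k * x k) = 0"
      unfolding mom_def set_lebesgue_integral_def
      by (subst (asm) integral_nonneg_eq_0_iff_AE[OF int]) auto
    then have "AE x in leb n. x \<notin> K" using AE_leb_nonzero[OF k]
      by eventually_elim (auto simp: indicator_def)
    then have "emeasure (leb n) K = 0"
      using convex_body_sets[OF K] convex_body_subset[OF K]
      by (subst AE_iff_measurable[of K "leb n" "\<lambda>x. x \<notin> K", symmetric]) auto
    then show False using convex_body_vol_pos[OF K] by (simp add: vol_def measure_def)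
  qed
  then show ?thesis using nn by simp
qed

lemma LINT_quadratic_diag:
  assumes K: "convex_body n K" and diag: "\<And>j k. j < n \<Longrightarrow> k < n \<Longrightarrow> j \<noteq> k \<Longrightarrow> mom n K j k = 0"
  shows "(LINT x:K|leb n. (dot n x u)\<^sup>2) = (\<Sum>i<n. (u i)\<^sup>2 * mom n K i i)"
proof -
  have "(LINT x:K|leb n. (dot n x u)\<^sup>2) = bil n (mom n K) u u"
    using LINT_bilinear(1)[OF K, of u u] by (simp add: power2_eq_square)
  also have "\<dots> = (\<Sum>i<n. \<Sum>j<n. if i = j then (u i)\<^sup>2 * mom n K i i else 0)"
    unfolding bil_def using diag by (intro sum.cong refl) (auto simp: power2_eq_square)
  also have "\<dots> = (\<Sum>i<n. (u i)\<^sup>2 * mom n K i i)" by (simp add: sum.delta)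
  finally show ?thesis .
qed

text \<open>When the moment matrix is diagonal, rescaling each coordinate to equal second moments is
  enough; the common value is then dictated by volume 1.\<close>

lemma isotropic_image_diag:
  assumes n: "n \<ge> 1" and K: "convex_body n K" "centered n K"
    and diag: "\<And>j k. j < n \<Longrightarrow> k < n \<Longrightarrow> j \<noteq> k \<Longrightarrow> mom n K j k = 0"
  obtains T R L where "mat_inv n T R" "isotropic_with n (affine_image n (\<lambda>_. 0) T K) L"
    "L > 0" "L ^ (2 * n) * vol n K ^ (n + 2) = (\<Prod>k<n. mom n K k k)"
proof -
  define V where "V = vol n K"
  have V: "V > 0" using convex_body_vol_pos[OF K(1)] by (simp add: V_def)
  define l where "l k = mom n K k k" for k
  have l: "l k > 0" if "k < n" for k using second_moment_pos[OF K(1) that] by (simp add: l_def)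
  define P where "P = (\<Prod>k<n. l k)"
  have P: "P > 0" unfolding P_def using l by (intro prod_pos) auto
  \<comment> \<open>The value for which the scales \<open>s k\<close> multiply to 1 / V. Each (s
    k)^2 l k equals L^2 V, and the change of variables divides this by V.\<close>
  obtain L where L: "L > 0" "L ^ (2 * n) = P / V ^ (n + 2)"
    using real_root_pow[of "P / V ^ (n + 2)" "2 * n"] P V n by auto
  define s where "s k = L * sqrt (V / l k)" for k
  have s: "s k > 0" "(s k)\<^sup>2 * l k = L\<^sup>2 * V" if "k < n" for k
    using L(1) V l[OF that] by (auto simp: s_def power_mult_distrib)
  have "(\<Prod>k<n. s k)\<^sup>2 * P = (\<Prod>k<n. (s k)\<^sup>2 * l k)"
    by (simp add: P_def prod.distrib prod_power_distrib)
  also have "\<dots> = (\<Prod>k<n. L\<^sup>2 * V)" using s(2) by (intro prod.cong) auto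
  also have "\<dots> = L ^ (2 * n) * V ^ n" by (simp add: power_mult_distrib power_mult)
  also have "\<dots> = P / V\<^sup>2" unfolding L(2) using V by (simp add: power_add power2_eq_square)
  finally have "((\<Prod>k<n. s k) * V)\<^sup>2 = 1" using P V by (simp add: power_mult_distrib field_simps)
  moreover have "(\<Prod>k<n. s k) > 0" using s(1) by (intro prod_pos) auto
  ultimately have "(\<Prod>k<n. s k) * V = 1" using V by (simp add: power2_eq_1_iff) (smt (verit) mult_pos_pos)
  then have ps: "(\<Prod>k<n. 1 / \<bar>s k\<bar>) = V"
  proof -
    have "(\<Prod>k<n. 1 / \<bar>s k\<bar>) = (\<Prod>k<n. 1 / s k)" using s(1) by (intro prod.cong) (auto simp: abs_of_pos)
    also have "\<dots> = 1 / (\<Prod>k<n. s k)" by (simp add: prod_dividef)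
    also have "\<dots> = V" using \<open>(\<Prod>k<n. s k) * V = 1\<close> \<open>(\<Prod>k<n. s k) > 0\<close>
      by (metis less_irrefl mult.commute nonzero_eq_divide_eq)
    finally show ?thesis .
  qed
  define T where "T i j = (if i = j then s i else 0)" for i j :: nat
  define R where "R i j = (if i = j then 1 / s i else 0)" for i j :: nat
  have linT: "lin n T x = (\<lambda>i\<in>{..<n}. s i * x i)" for x
    by (auto simp: lin_def T_def if_distrib[of "\<lambda>a. a * _"] sum.delta cong: if_cong)
  have inv: "mat_inv n T R"
    unfolding mat_inv_def
  proof (intro allI impI)
    fix i k assume ik: "i < n" "k < n"
    have "s i \<noteq> 0" using s(1)[OF ik(1)] by simp
    then show "(\<Sum>j<n. T i j * R j k) = (if i = k then 1 else 0) \<and> (\<Sum>j<n. R i j * T j k) = (if i = k then 1 else 0)"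
      using ik by (auto simp: T_def R_def if_distrib[of "\<lambda>a. a * _"] sum.delta cong: if_cong)
  qed
  let ?K' = "affine_image n (\<lambda>_. 0) T K"
  have K': "convex_body n ?K'" by (rule convex_body_affine_image[OF K(1) inv])
  have cT: "(\<integral>\<^sup>+x. f (lin n T x) \<partial>leb n) = ennreal V * (\<integral>\<^sup>+x. f x \<partial>leb n)" if "f \<in> borel_measurable (leb n)" for f
    unfolding linT ps[symmetric] using s(1) by (intro nn_integral_leb_scale that) (metis less_irrefl)
  have tr: "(LINT x:K|leb n. h (aff n (\<lambda>_. 0) T x)) = V * (LINT y:?K'|leb n. h y)"
    if "h \<in> borel_measurable (leb n)" for h :: "(nat \<Rightarrow> real) \<Rightarrow> real"
    by (rule LINT_affine_image[OF V _ inv K(1) that]) (rule cT)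
  have affT: "aff n (\<lambda>_. 0) T x = lin n T x" for x by (simp add: aff_def lin_def)
  have vol': "vol n ?K' = 1"
    using tr[of "\<lambda>_. 1"] V by (simp add: vol_LINT[OF K'] vol_LINT[OF K(1), symmetric] V_def[symmetric])
  have m1: "(LINT x:K|leb n. x i) = 0" if "i < n" for i
    using K(2) that by (subst (asm) centered_iff[OF convex_body_vol_pos[OF K(1)]]) auto
  have "centered n ?K'"
  proof (subst centered_iff[OF convex_body_vol_pos[OF K']], intro allI impI)
    fix i assume i: "i < n"
    have "V * (LINT x:?K'|leb n. x i) = (LINT x:K|leb n. s i * x i)"
      using tr[OF measurable_coord_leb[OF i]] i by (simp add: affT linT)
    also have "\<dots> = 0" using m1[OF i] by simp
    finally show "(LINT x:?K'|leb n. x i) = 0" using V by simp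
  qed
  moreover have "(LINT x:?K'|leb n. (dot n x \<theta>)\<^sup>2) = L\<^sup>2" if \<theta>: "dot n \<theta> \<theta> = 1" for \<theta>
  proof -
    have "(\<lambda>x. (dot n x \<theta>)\<^sup>2) \<in> borel_measurable (leb n)"
      unfolding dot_def by (intro borel_measurable_power borel_measurable_sum borel_measurable_times measurable_coord_leb) auto
    from tr[OF this] have "V * (LINT x:?K'|leb n. (dot n x \<theta>)\<^sup>2) = (LINT x:K|leb n. (dot n (lin n T x) \<theta>)\<^sup>2)"
      by (simp add: affT)
    also have "\<dots> = (LINT x:K|leb n. (dot n x (\<lambda>i. s i * \<theta> i))\<^sup>2)"
      by (simp add: linT dot_def mult_ac)
    also have "\<dots> = (\<Sum>i<n. (s i * \<theta> i)\<^sup>2 * l i)"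
      unfolding l_def by (rule LINT_quadratic_diag[OF K(1) diag])
    also have "\<dots> = (\<Sum>i<n. L\<^sup>2 * V * (\<theta> i * \<theta> i))"
    proof (intro sum.cong refl)
      fix i assume "i \<in> {..<n}"
      have "(s i * \<theta> i)\<^sup>2 * l i = ((s i)\<^sup>2 * l i) * (\<theta> i * \<theta> i)" by (simp add: power2_eq_square mult_ac)
      also have "(s i)\<^sup>2 * l i = L\<^sup>2 * V" using s(2) \<open>i \<in> {..<n}\<close> by simp
      finally show "(s i * \<theta> i)\<^sup>2 * l i = L\<^sup>2 * V * (\<theta> i * \<theta> i)" .
    qed
    also have "\<dots> = L\<^sup>2 * V" using \<theta> by (simp add: sum_distrib_left[symmetric] dot_def)
    finally show ?thesis using V by simp
  qed
  ultimately have "isotropic_with n ?K' L"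
    using K' vol' L(1) by (simp add: isotropic_with_def)
  moreover have "L ^ (2 * n) * vol n K ^ (n + 2) = (\<Prod>k<n. mom n K k k)"
    unfolding L(2) V_def[symmetric] using V by (simp add: P_def l_def)
  ultimately show ?thesis using that inv L(1) by blast
qed

lemma isotropic_constant_diag:
  assumes n: "n \<ge> 1" and K: "convex_body n K" "centered n K"
    and diag: "\<And>j k. j < n \<Longrightarrow> k < n \<Longrightarrow> j \<noteq> k \<Longrightarrow> mom n K j k = 0"
  shows "isotropic_constant n K > 0"
    "isotropic_constant n K ^ (2 * n) * vol n K ^ (n + 2) = (\<Prod>k<n. mom n K k k)"
proof -
  obtain T R L where *: "mat_inv n T R" "isotropic_with n (affine_image n (\<lambda>_. 0) T K) L"
    "L > 0" "L ^ (2 * n) * vol n K ^ (n + 2) = (\<Prod>k<n. mom n K k k)"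
    by (rule isotropic_image_diag[OF n K diag])
  have "isotropic_constant n K = L"
    by (rule isotropic_constant_eq[OF n convex_body_subset[OF K(1)] *(1,2)])
  then show "isotropic_constant n K > 0"
    "isotropic_constant n K ^ (2 * n) * vol n K ^ (n + 2) = (\<Prod>k<n. mom n K k k)"
    using * by auto
qed

lemma orthonormal_mat_inv: "orthonormal n n w \<Longrightarrow> mat_inv n w (\<lambda>i j. w j i)"
  using orthonormal_orth_mat orth_mat_def by blast

lemma convex_body_rigid: "orthonormal n n w \<Longrightarrow> convex_body n K \<Longrightarrow> convex_body n (affine_image n a w K)"
  by (rule convex_body_affine_image[OF _ orthonormal_mat_inv])

lemma LINT_rigid:
  fixes h :: "(nat \<Rightarrow> real) \<Rightarrow> real"
  assumes w: "orthonormal n n w" and K: "convex_body n K" and h: "h \<in> borel_measurable (leb n)"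
  shows "(LINT y:affine_image n a w K|leb n. h y) = (LINT x:K|leb n. h (aff n a w x))"
proof -
  have "(\<integral>\<^sup>+x. f (lin n w x) \<partial>leb n) = ennreal 1 * (\<integral>\<^sup>+x. f x \<partial>leb n)" if "f \<in> borel_measurable (leb n)" for f
    using nn_integral_leb_orth[OF orthonormal_orth_mat[OF w] that] by simp
  then show ?thesis
    using LINT_affine_image[OF zero_less_one _ orthonormal_mat_inv[OF w] K h, of a] by simp
qed

lemma vol_rigid:
  assumes w: "orthonormal n n w" and K: "convex_body n K"
  shows "vol n (affine_image n a w K) = vol n K"
  using LINT_rigid[OF assms, of "\<lambda>_. 1"] by (simp add: vol_LINT[OF K] vol_LINT[OF convex_body_rigid[OF assms]])

lemma aff_0: "aff n (\<lambda>_. 0) T x = lin n T x"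
  by (simp add: aff_def lin_def)

lemma mom_rotation:
  assumes w: "orthonormal n n w" and K: "convex_body n K" and "j < n" "k < n"
  shows "mom n (affine_image n (\<lambda>_. 0) w K) j k = (LINT x:K|leb n. dot n x (w j) * dot n x (w k))"
proof -
  have "(\<lambda>x. x j * x k) \<in> borel_measurable (leb n)"
    using assms by (intro borel_measurable_times measurable_coord_leb)
  from LINT_rigid[OF w K this] show ?thesis using assms by (simp add: mom_def aff_0 dot_row)
qed

lemma centered_rotation:
  assumes w: "orthonormal n n w" and K: "convex_body n K" and c: "centered n K"
  shows "centered n (affine_image n (\<lambda>_. 0) w K)"
proof (subst centered_iff[OF convex_body_vol_pos[OF convex_body_rigid[OF w K]]], intro allI impI)
  fix i assume i: "i < n"
  have "(LINT y:affine_image n (\<lambda>_. 0) w K|leb n. y i) = (LINT x:K|leb n. dot n x (w i))"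
    using LINT_rigid[OF w K measurable_coord_leb[OF i], of "\<lambda>_. 0"] i by (simp add: aff_0 dot_row)
  also have "\<dots> = 0"
    unfolding LINT_lin(1)[OF K] using c centered_iff[OF convex_body_vol_pos[OF K]] by simp
  finally show "(LINT y:affine_image n (\<lambda>_. 0) w K|leb n. y i) = 0" .
qed

text \<open>The identity matrix with rows in \<open>Rn n\<close>; it makes translations a case of
  rigid motions.\<close>

definition unit_frame :: "nat \<Rightarrow> nat \<Rightarrow> nat \<Rightarrow> real"
  where "unit_frame n k = (\<lambda>i\<in>{..<n}. if k = i then 1 else 0)"

lemma orthonormal_unit: "orthonormal n n (unit_frame n)"
  by (auto simp: orthonormal_def dot_def unit_frame_def sum_delta_mult)

lemma centered_translate:
  assumes K: "convex_body n K"
  shows "centered n (affine_image n (\<lambda>i. - barycentre n K i) (unit_frame n) K)" (is "centered n ?K'")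
proof (subst centered_iff[OF convex_body_vol_pos[OF convex_body_rigid[OF orthonormal_unit K]]], intro allI impI)
  fix i assume i: "i < n"
  let ?b = "barycentre n K"
  have "(LINT y:?K'|leb n. y i) = (LINT x:K|leb n. - ?b i * 1 + x i)"
    using LINT_rigid[OF orthonormal_unit K measurable_coord_leb[OF i], of "\<lambda>i. - ?b i"] i
    by (simp add: aff_def unit_frame_def sum_delta_mult)
  also have "\<dots> = (LINT x:K|leb n. - ?b i * 1) + (LINT x:K|leb n. x i)"
    by (rule set_integral_add) (use body_integrable_coord[OF K i] body_integrable[OF K, of "\<lambda>_. - ?b i * 1" "\<bar>?b i\<bar>"] in auto)
  also have "(LINT x:K|leb n. - ?b i * 1) = - ?b i * vol n K"
    unfolding set_integral_mult_right vol_LINT[OF K, symmetric] ..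
  also have "\<dots> = - (LINT x:K|leb n. x i)"
    using i convex_body_vol_pos[OF K] by (simp add: barycentre_def)
  finally show "(LINT y:?K'|leb n. y i) = 0" by simp
qed

lemma principal_axes:
  assumes K: "convex_body n K"
  obtains w where "orthonormal n n w"
    "\<And>j k. j < n \<Longrightarrow> k < n \<Longrightarrow> j \<noteq> k \<Longrightarrow> mom n (affine_image n (\<lambda>_. 0) w K) j k = 0"
proof -
  obtain w where w: "orthonormal n n w" "\<And>k l. k < n \<Longrightarrow> l < n \<Longrightarrow> k \<noteq> l \<Longrightarrow> bil n (mom n K) (w k) (w l) = 0"
    by (rule spectral_orthonormal[of n "mom n K"]) (simp_all add: mom_def mult.commute)
  show ?thesis
    by (rule that[OF w(1)]) (simp add: mom_rotation[OF w(1) K] LINT_bilinear(1)[OF K] w(2))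
qed

text \<open>Translation to the barycentre, rotation to the principal axes and diagonal rescaling,
  composed into one affine map.\<close>

lemma isotropic_image_exists:
  assumes n: "n \<ge> 1" and K: "convex_body n K"
  obtains a T R where "mat_inv n T R" "isotropic_with n (affine_image n a T K) (isotropic_constant n K)"
proof -
  let ?E = "unit_frame n" and ?b = "\<lambda>i. - barycentre n K i"
  let ?K1 = "affine_image n ?b ?E K"
  have K1: "convex_body n ?K1" "centered n ?K1"
    by (rule convex_body_rigid[OF orthonormal_unit K], rule centered_translate[OF K])
  obtain w where w: "orthonormal n n w"
    "\<And>j k. j < n \<Longrightarrow> k < n \<Longrightarrow> j \<noteq> k \<Longrightarrow> mom n (affine_image n (\<lambda>_. 0) w ?K1) j k = 0"
    using principal_axes[OF K1(1)] by metis
  let ?K2 = "affine_image n (\<lambda>_. 0) w ?K1"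
  obtain T R L where T: "mat_inv n T R" "isotropic_with n (affine_image n (\<lambda>_. 0) T ?K2) L"
    by (rule isotropic_image_diag[OF n convex_body_rigid[OF w(1) K1(1)] centered_rotation[OF w(1) K1] w(2)])
  note e = mat_inv_mmul[OF T(1) mat_inv_mmul[OF orthonormal_mat_inv[OF w(1)] orthonormal_mat_inv[OF orthonormal_unit]]]
  have iso: "isotropic_with n (affine_image n (\<lambda>i. 0 + lin n T (\<lambda>j\<in>{..<n}. 0 + lin n w (\<lambda>j\<in>{..<n}. ?b j) j) i) (mmul n T (mmul n w ?E)) K) L"
    using T(2) unfolding affine_image_compose .
  from isotropic_constant_eq[OF n convex_body_subset[OF K] e iso] show ?thesis
    using that[OF e] iso by simp
qed

lemma isotropic_constant_pos: "n \<ge> 1 \<Longrightarrow> convex_body n K \<Longrightarrow> isotropic_constant n K > 0"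
  using isotropic_image_exists isotropic_withD(4) by metis

lemma isotropic_constant_affine:
  assumes n: "n \<ge> 1" and K: "convex_body n K" and G: "mat_inv n G G'"
  shows "isotropic_constant n (affine_image n g G K) = isotropic_constant n K"
proof -
  let ?K' = "affine_image n g G K"
  obtain a T R where T: "mat_inv n T R" "isotropic_with n (affine_image n a T ?K') (isotropic_constant n ?K')"
    by (rule isotropic_image_exists[OF n convex_body_affine_image[OF K G]])
  from T(2) show ?thesis
    unfolding affine_image_compose
    using isotropic_constant_eq[OF n convex_body_subset[OF K] mat_inv_mmul[OF T(1) G]] by metis
qed

text \<open>The determinant formula for the isotropic constant. In the exponent n + 2 the part
  \<open>n\<close> normalises the moments and 2 comes from rescaling to volume 1.\<close>

lemma isotropic_constant_principal:
  assumes n: "n \<ge> 1" and K: "convex_body n K" "centered n K" and w: "orthonormal n n w"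
    and diag: "\<And>j k. j < n \<Longrightarrow> k < n \<Longrightarrow> j \<noteq> k \<Longrightarrow> mom n (affine_image n (\<lambda>_. 0) w K) j k = 0"
  shows "isotropic_constant n K ^ (2 * n) * vol n K ^ (n + 2) = (\<Prod>k<n. LINT x:K|leb n. (dot n x (w k))\<^sup>2)"
proof -
  let ?K' = "affine_image n (\<lambda>_. 0) w K"
  have "isotropic_constant n ?K' ^ (2 * n) * vol n ?K' ^ (n + 2) = (\<Prod>k<n. mom n ?K' k k)"
    by (rule isotropic_constant_diag(2)[OF n convex_body_rigid[OF w K(1)] centered_rotation[OF w K] diag])
  then show ?thesis
    by (simp add: isotropic_constant_affine[OF n K(1) orthonormal_mat_inv[OF w]] vol_rigid[OF w K(1)]
      mom_rotation[OF w K(1)] power2_eq_square)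
qed

section \<open>Finiteness of the maximal isotropic constant\<close>

lemma barycentre_in_body:
  assumes K: "convex_body n K"
  shows "barycentre n K \<in> K"
proof -
  let ?M = "density (leb n) (indicator K)"
  note KS = convex_body_sets[OF K]
  have e: "emeasure ?M (space ?M) = ennreal (vol n K)"
    using KS emeasure_vol[OF convex_body_fin[OF K]] convex_body_subset[OF K]
    by (simp add: emeasure_density sets.top[of "leb n", simplified] indicator_inter_arith[symmetric] Int_absorb2)
  have d: "?M = density (leb n) (\<lambda>x. ennreal (indicator K x))" by (simp add: ennreal_indicator)
  have i: "integrable ?M (\<lambda>x. x i)" "(LINT x|?M. x i) = (LINT x:K|leb n. x i)" if i: "i < n" for i
  proof -
    show "integrable ?M (\<lambda>x. x i)"
      unfolding d using body_integrable_coord[OF K i] KS measurable_coord_leb[OF i]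
      by (subst integrable_density) (auto simp: set_integrable_def)
    show "(LINT x|?M. x i) = (LINT x:K|leb n. x i)"
      unfolding d using KS measurable_coord_leb[OF i]
      by (subst integral_density) (auto simp: set_lebesgue_integral_def)
  qed
  have ae: "AE x in ?M. x \<in> K"
    using KS by (subst AE_density) (auto simp: indicator_def)
  have "(\<lambda>i\<in>{..<n}. (LINT x|?M. x i) / vol n K) \<in> K"
    by (rule barycentre_in_closed_convex[OF convex_body_subset[OF K] compact_imp_closed[OF convex_body_compact[OF K]]
      convex_body_cvx[OF K] e convex_body_vol_pos[OF K] i(1) ae])
  also have "(\<lambda>i\<in>{..<n}. (LINT x|?M. x i) / vol n K) = barycentre n K"
    using i(2) by (auto simp: barycentre_def)
  finally show ?thesis .
qed

text \<open>Otherwise the second moment in direction \<theta> would be at most L^2 / 4.\<close>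

lemma second_moment_large_point:
  assumes K: "convex_body n K" "vol n K = 1" and m: "(LINT x:K|leb n. (dot n x \<theta>)\<^sup>2) = L\<^sup>2" and L: "L > 0"
  obtains x where "x \<in> K" "\<bar>dot n x \<theta>\<bar> \<ge> L / 2"
proof (rule ccontr)
  assume no: "\<not> thesis"
  note found = that
  have less: "\<bar>dot n x \<theta>\<bar> \<le> L / 2" if "x \<in> K" for x
    using found[of x] no that by linarith
  have "L\<^sup>2 = (LINT x:K|leb n. (dot n x \<theta>)\<^sup>2)" using m by simp
  also have "\<dots> \<le> (LINT x:K|leb n. (L / 2)\<^sup>2 * 1)"
  proof (rule set_integral_mono)
    show "set_integrable (leb n) K (\<lambda>x. (dot n x \<theta>)\<^sup>2)"
      using LINT_bilinear(2)[OF K(1), of \<theta> \<theta>] by (simp add: power2_eq_square)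
    show "set_integrable (leb n) K (\<lambda>_. (L / 2)\<^sup>2 * 1)"
      by (rule body_integrable[OF K(1), of _ "(L / 2)\<^sup>2"]) auto
    show "(dot n x \<theta>)\<^sup>2 \<le> (L / 2)\<^sup>2 * 1" if "x \<in> K" for x
      using less[OF that] by (metis mult.right_neutral abs_ge_zero power2_abs power_mono)
  qed
  also have "\<dots> = (L / 2)\<^sup>2" unfolding set_integral_mult_right vol_LINT[OF K(1), symmetric] K(2) by simp
  finally show False using L by (simp add: power2_eq_square)
qed

lemma dot_cauchy_schwarz: "(dot n x y)\<^sup>2 \<le> dot n x x * dot n y y"
  unfolding dot_def power2_eq_square[of "x _", symmetric]
  using Cauchy_Schwarz_ineq_sum[of x y "{..<n}"] by (simp add: power2_eq_square)

text \<open>Gram-Schmidt along the body: take a direction \<theta> orthogonal to the frame so far, a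
  point of \<open>K\<close> far out along it, and the normalised residual of that point as next
  frame vector. By Cauchy-Schwarz the residual is at least as long as the component along \<theta>.
  The points are triangular with respect to the frame.\<close>

lemma adapted_frame:
  assumes K: "isotropic_with n K L"
  obtains q x where "orthonormal n n q" "\<And>k. k < n \<Longrightarrow> x k \<in> K" "\<And>k. k < n \<Longrightarrow> dot n (x k) (q k) \<ge> L / 2"
    "\<And>k i. k < i \<Longrightarrow> i < n \<Longrightarrow> dot n (x k) (q i) = 0"
proof -
  note I = isotropic_withD[OF K]
  \<comment> \<open>The last clause says that \<open>x j\<close> lies in the span of the frame so
    far; it gives orthogonality to the vectors added later.\<close>
  have "\<exists>q x. orthonormal n k q \<and> (\<forall>j<k. x j \<in> K \<and> dot n (x j) (q j) \<ge> L / 2 \<and> (\<forall>i<k. j < i \<longrightarrow> dot n (x j) (q i) = 0) \<and>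
      (\<forall>v. (\<forall>i<k. dot n v (q i) = 0) \<longrightarrow> dot n v (x j) = 0))" if "k \<le> n" for k
    using that
  proof (induction k)
    case 0
    then show ?case by (auto simp: orthonormal_def)
  next
    case (Suc k)
    then obtain q x where q: "orthonormal n k q" and x: "\<forall>j<k. x j \<in> K \<and> dot n (x j) (q j) \<ge> L / 2 \<and>
      (\<forall>i<k. j < i \<longrightarrow> dot n (x j) (q i) = 0) \<and> (\<forall>v. (\<forall>i<k. dot n v (q i) = 0) \<longrightarrow> dot n v (x j) = 0)" by auto
    obtain \<theta> where \<theta>: "\<theta> \<in> Rn n" "dot n \<theta> \<theta> = 1" "\<And>j. j < k \<Longrightarrow> dot n \<theta> (q j) = 0"
      using orthonormal_extend[OF q] Suc.prems by (metis Suc_le_lessD)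
    obtain z where z: "z \<in> K" "\<bar>dot n z \<theta>\<bar> \<ge> L / 2"
      using second_moment_large_point[OF I(1,2) _ I(4), of \<theta>] I(5)[of \<theta>] \<theta>(2) by (metis mult.right_neutral)
    let ?r = "resid n k q z"
    have split: "dot n v z = dot n v ?r + (\<Sum>j<k. dot n z (q j) * dot n v (q j))" for v
      unfolding dot_lincomb[symmetric] resid_def by (simp add: dot_commute[of n v "restrict _ _"] dot_diff_left dot_commute[of n v])
    define N where "N = sqrt (dot n ?r ?r)"
    have "dot n \<theta> z = dot n \<theta> ?r" using split[of \<theta>] \<theta>(3) by simp
    then have "\<bar>dot n z \<theta>\<bar> ^ 2 \<le> dot n ?r ?r"
      using dot_cauchy_schwarz[of n \<theta> ?r] \<theta>(2) by (simp add: dot_commute[of n z])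
    moreover have "(L / 2)\<^sup>2 \<le> \<bar>dot n z \<theta>\<bar> ^ 2" using z(2) I(4) by (intro power_mono) auto
    ultimately have NL: "N \<ge> L / 2" unfolding N_def by (intro real_le_rsqrt) linarith
    then have N: "N > 0" "N * N = dot n ?r ?r" using I(4) dot_self_nonneg[of n ?r] by (linarith, simp add: N_def)
    define u where "u = (\<lambda>i\<in>{..<n}. (1 / N) * ?r i)"
    have du: "dot n u v = (1 / N) * dot n ?r v" for v unfolding u_def by (rule dot_scale_left)
    have uq: "dot n u (q j) = 0" if "j < k" for j using du resid_orth[OF q that] by simp
    have "dot n u ?r = N" using N unfolding du by (simp add: N(2)[symmetric])
    then have uu: "dot n u u = 1" unfolding du[of u] dot_commute[of n ?r] using N(1) by simp
    have zu: "dot n z u = N" using split[of u] uq \<open>dot n u ?r = N\<close> by (simp add: dot_commute[of n z])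
    have rv: "dot n v ?r = N * dot n v u" for v
      using du[of v] N(1) by (simp add: dot_commute[of n v])
    have os: "orthonormal n (Suc k) (q(k := u))"
      by (rule orthonormal_Suc[OF q _ uu uq]) (auto simp: u_def)
    have "\<forall>j<Suc k. (x(k := z)) j \<in> K \<and> dot n ((x(k := z)) j) ((q(k := u)) j) \<ge> L / 2 \<and>
      (\<forall>i<Suc k. j < i \<longrightarrow> dot n ((x(k := z)) j) ((q(k := u)) i) = 0) \<and>
      (\<forall>v. (\<forall>i<Suc k. dot n v ((q(k := u)) i) = 0) \<longrightarrow> dot n v ((x(k := z)) j) = 0)"
    proof (intro allI impI)
      fix j assume j: "j < Suc k"
      have xu: "dot n (x j) u = 0" if "j < k" using x uq that by (simp add: dot_commute[of n "x j"])
      have vz: "dot n v z = 0" if v: "\<forall>i<Suc k. dot n v ((q(k := u)) i) = 0" for v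
      proof -
        have "dot n v (q i) = 0" if "i < k" for i using v[rule_format, of i] that by simp
        moreover have "dot n v u = 0" using v[rule_format, of k] by simp
        ultimately show ?thesis using split[of v] rv[of v] by simp
      qed
      show "(x(k := z)) j \<in> K \<and> dot n ((x(k := z)) j) ((q(k := u)) j) \<ge> L / 2 \<and>
        (\<forall>i<Suc k. j < i \<longrightarrow> dot n ((x(k := z)) j) ((q(k := u)) i) = 0) \<and>
        (\<forall>v. (\<forall>i<Suc k. dot n v ((q(k := u)) i) = 0) \<longrightarrow> dot n v ((x(k := z)) j) = 0)"
      proof (cases "j = k")
        case True
        then show ?thesis using z(1) zu NL vz by auto
      next
        case False
        then have "j < k" using j by simp
        moreover have "dot n v (x j) = 0" if v: "\<forall>i<Suc k. dot n v ((q(k := u)) i) = 0" for v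
        proof -
          have "dot n v (q i) = 0" if "i < k" for i using v[rule_format, of i] that by simp
          then show ?thesis using x \<open>j < k\<close> by blast
        qed
        moreover have "dot n (x j) ((q(k := u)) i) = 0" if "i < Suc k" "j < i" for i
          using x xu \<open>j < k\<close> that by (cases "i = k") auto
        ultimately show ?thesis using x by auto
      qed
    qed
    then show ?case using os by blast
  qed
  from this[of n] obtain q x where "orthonormal n n q" "\<forall>j<n. x j \<in> K \<and> dot n (x j) (q j) \<ge> L / 2 \<and> (\<forall>i<n. j < i \<longrightarrow> dot n (x j) (q i) = 0)"
    by auto
  then show ?thesis by (intro that[of q x]) auto
qed

lemma origin_in_body:
  assumes "convex_body n K" "centered n K"
  shows "(\<lambda>i\<in>{..<n}. 0) \<in> K"
  using barycentre_in_body[OF assms(1)] assms(2) by (simp add: centered_def)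

text \<open>The permitted weights 1/2, 1/4, ... sum to less than 1, and the origin takes up the
  rest. In the induction the last point with doubled weight and the combination of the others with
  doubled weights are averaged.\<close>

lemma dyadic_comb_in_cvx:
  assumes K: "cvx n K" "(\<lambda>i\<in>{..<n}. 0) \<in> K" and y: "\<And>k. k < m \<Longrightarrow> y k \<in> K"
    and t: "\<And>k. k < m \<Longrightarrow> 0 \<le> t k \<and> t k \<le> (1/2) ^ (m - k)"
  shows "(\<lambda>i\<in>{..<n}. \<Sum>k<m. t k * y k i) \<in> K"
  using y t
proof (induction m arbitrary: t)
  case 0
  then show ?case using K(2) by (simp del: restrict_apply)
next
  case (Suc m)
  have t2: "0 \<le> 2 * t k \<and> 2 * t k \<le> (1/2) ^ (m - k)" if "k < m" for k
    using Suc.prems(2)[of k] that by (simp add: Suc_diff_le power_Suc)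
  have 1: "(\<lambda>i\<in>{..<n}. \<Sum>k<m. 2 * t k * y k i) \<in> K"
    by (rule Suc.IH[OF Suc.prems(1) t2]) auto
  have "comb n (2 * t m) (\<lambda>i\<in>{..<n}. 0) (y m) \<in> K"
    using K Suc.prems(1)[of m] Suc.prems(2)[of m] unfolding cvx_def by (auto simp: power_Suc)
  with 1 K(1) have "comb n (1/2) (\<lambda>i\<in>{..<n}. \<Sum>k<m. 2 * t k * y k i) (comb n (2 * t m) (\<lambda>i\<in>{..<n}. 0) (y m)) \<in> K"
    unfolding cvx_def by auto
  also have "comb n (1/2) (\<lambda>i\<in>{..<n}. \<Sum>k<m. 2 * t k * y k i) (comb n (2 * t m) (\<lambda>i\<in>{..<n}. 0) (y m)) =
    (\<lambda>i\<in>{..<n}. \<Sum>k<Suc m. t k * y k i)"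
    by (auto simp: comb_def sum_distrib_left sum_distrib_right fun_eq_iff mult_ac)
  finally show ?case .
qed

text \<open>\<open>K\<close> contains the image of a small cube under a triangular map with diagonal entries at least \<open>L / 2\<close>.
  Only the finiteness of the bound for each \<open>n\<close> matters.\<close>

lemma isotropic_bound:
  assumes n: "n \<ge> 1" and K: "isotropic_with n K L"
  shows "L \<le> 2 * 2 ^ n"
proof -
  note I = isotropic_withD[OF K]
  obtain q x where q: "orthonormal n n q" and x: "\<And>k. k < n \<Longrightarrow> x k \<in> K" "\<And>k. k < n \<Longrightarrow> dot n (x k) (q k) \<ge> L / 2"
    "\<And>k i. k < i \<Longrightarrow> i < n \<Longrightarrow> dot n (x k) (q i) = 0"
    using adapted_frame[OF K] by metis
  let ?K' = "affine_image n (\<lambda>_. 0) q K"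
  have K': "convex_body n ?K'" by (rule convex_body_rigid[OF q I(1)])
  have S: "?K' \<in> sets (leb n)" by (rule convex_body_sets[OF K'])
  define y where "y k = lin n q (x k)" for k
  have y: "y k i = dot n (x k) (q i)" if "i < n" for k i using that by (simp add: y_def dot_row)
  have yK: "y k \<in> ?K'" if "k < n" for k using x(1)[OF that] by (auto simp: affine_image_aff aff_0[abs_def] y_def)
  have yd: "y k k \<ge> L / 2" "y k k > 0" if "k < n" for k using x(2)[OF that] y[OF that] I(4) by auto
  have yz: "y k i = 0" if "k < i" "i < n" for k i using x(3) y that by simp
  \<comment> \<open>A side for which every coordinate of the cube is a permitted dyadic
    weight.\<close>
  let ?\<epsilon> = "(1/2::real) ^ n"
  let ?cube = "Pi\<^sub>E {..<n} (\<lambda>_. {0..?\<epsilon>})"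
  define \<beta> where "\<beta> i t = (\<Sum>k\<in>{i<..<n}. t k * y k i)" for i and t :: "nat \<Rightarrow> real"
  have sum: "y i i * t i + \<beta> i t = (\<Sum>k<n. t k * y k i)" if i: "i < n" for i t
  proof -
    have "(\<Sum>k<n. t k * y k i) = (\<Sum>k\<in>{i..<n}. t k * y k i)"
      using yz i by (intro sum.mono_neutral_right) auto
    also have "{i..<n} = insert i {i<..<n}" using i by auto
    finally show ?thesis by (simp add: \<beta>_def mult.commute)
  qed
  have "ennreal (?\<epsilon> ^ n) = emeasure (leb n) ?cube"
    using emeasure_leb_box[of n "\<lambda>_. 0" "\<lambda>_. ?\<epsilon>"] by simp
  also have "\<dots> = (\<integral>\<^sup>+t. indicator ?cube t \<partial>leb n)"
    by (rule nn_integral_indicator[symmetric]) (auto simp: leb_def intro!: sets_PiM_I_finite)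
  \<comment> \<open>The combinations with weights in the cube form the image of the cube under a
    triangular map. It lies in the body of volume 1, which bounds the diagonal entries and hence
    L.\<close>
  also have "\<dots> \<le> (\<integral>\<^sup>+t. indicator ?K' (\<lambda>i\<in>{..<n}. y i i * t i + \<beta> i t) \<partial>leb n)"
  proof (rule nn_integral_mono)
    fix t
    show "indicator ?cube t \<le> (indicator ?K' (\<lambda>i\<in>{..<n}. y i i * t i + \<beta> i t) :: ennreal)"
    proof (cases "t \<in> ?cube")
      case True
      have "(\<lambda>i\<in>{..<n}. \<Sum>k<n. t k * y k i) \<in> ?K'"
      proof (rule dyadic_comb_in_cvx[OF convex_body_cvx[OF K'] origin_in_body[OF K' centered_rotation[OF q I(1,3)]] yK])
        fix k assume k: "k < n"
        have "?\<epsilon> \<le> (1/2) ^ (n - k)" by (intro power_decreasing) auto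
        moreover have "t k \<in> {0..?\<epsilon>}" using PiE_mem[OF True, of k] k by blast
        ultimately show "0 \<le> t k \<and> t k \<le> (1/2) ^ (n - k)" by (meson atLeastAtMost_iff order_trans)
      qed
      also have "(\<lambda>i\<in>{..<n}. \<Sum>k<n. t k * y k i) = (\<lambda>i\<in>{..<n}. y i i * t i + \<beta> i t)"
        using sum by (auto intro!: restrict_ext)
      finally show ?thesis using True by (simp del: restrict_apply)
    qed simp
  qed
  also have "\<dots> = ennreal (\<Prod>i<n. 1 / \<bar>y i i\<bar>) * (\<integral>\<^sup>+t. indicator ?K' t \<partial>leb n)"
  proof (rule nn_integral_leb_triangular)
    show "indicator ?K' \<in> borel_measurable (leb n)" using S by simp
    show "y i i \<noteq> 0" if "i < n" for i using yd(2)[OF that] by simp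
    show "\<beta> i \<in> borel_measurable (leb n)" for i
      unfolding \<beta>_def by (intro borel_measurable_sum borel_measurable_times measurable_coord_leb) auto
    show "\<beta> i x = \<beta> i y" if "\<And>j. i < j \<Longrightarrow> j < n \<Longrightarrow> x j = y j" for i x y
      unfolding \<beta>_def using that by (intro sum.cong) auto
  qed
  also have "(\<integral>\<^sup>+t. indicator ?K' t \<partial>leb n) = 1"
    using S emeasure_vol[OF convex_body_fin[OF K']] vol_rigid[OF q I(1)] I(2) by simp
  also have "(\<Prod>i<n. 1 / \<bar>y i i\<bar>) \<le> (\<Prod>i<n. 2 / L)"
  proof (rule prod_mono, intro conjI)
    fix i assume "i \<in> {..<n}"
    then show "1 / \<bar>y i i\<bar> \<le> 2 / L" using yd[of i] I(4) by (simp add: field_simps)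
  qed simp
  finally have "ennreal (?\<epsilon> ^ n) \<le> ennreal ((2 / L) ^ n)"
    by (simp add: ennreal_leI)
  then have "?\<epsilon> ^ n \<le> (2 / L) ^ n" using I(4) by (simp add: ennreal_le_iff)
  then have "?\<epsilon> \<le> 2 / L" using power_le_imp_le_base[of ?\<epsilon> "n - 1" "2 / L"] I(4) n by simp
  then show ?thesis using I(4) by (simp add: field_simps)
qed

text \<open>A real supremum bounds its members only when they are bounded above; this is where the
  exponential bound is used.\<close>

lemma isotropic_constant_le_max:
  assumes n: "n \<ge> 1" and K: "convex_body n K"
  shows "isotropic_constant n K \<le> max_isotropic_constant n"
  unfolding max_isotropic_constant_def
proof (rule cSUP_upper)
  show "bdd_above (isotropic_constant n ` {K. convex_body n K})"
    by (rule bdd_aboveI2[of _ _ "2 * 2 ^ n"]) (metis isotropic_bound isotropic_image_exists mem_Collect_eq n)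
qed (use K in simp)

lemma convex_body_ccube: "convex_body n (ccube n (\<lambda>i\<in>{..<n}. 0) 1)"
  unfolding convex_body_iff
proof (intro conjI)
  let ?B = "ccube n (\<lambda>i\<in>{..<n}. 0) 1"
  show "?B \<subseteq> Rn n" by (auto simp: ccube_def)
  have "?B = {x \<in> Rn n. \<forall>i<n. \<bar>x i\<bar> \<le> 1}" by (auto simp: ccube_def)
  then show "compact ?B" by (simp only: compact_Rn_box)
  show "cvx n ?B"
    unfolding cvx_def
  proof (intro ballI)
    fix x y and t :: real assume x: "x \<in> ?B" and y: "y \<in> ?B" and t: "t \<in> {0..1}"
    have "\<bar>(1 - t) * x i + t * y i\<bar> \<le> 1" if "i < n" for i
    proof -
      have xy: "\<bar>x i\<bar> \<le> 1" "\<bar>y i\<bar> \<le> 1" using x y that by (auto simp: ccube_def)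
      have "\<bar>(1 - t) * x i + t * y i\<bar> \<le> (1 - t) * \<bar>x i\<bar> + t * \<bar>y i\<bar>"
        using t abs_triangle_ineq[of "(1 - t) * x i" "t * y i"] by (simp add: abs_mult)
      also have "\<dots> \<le> 1" using t xy by (intro convex_bound_le) auto
      finally show ?thesis .
    qed
    then show "comb n t x y \<in> ?B" by (simp add: ccube_def comb_def)
  qed
  show "\<exists>x\<in>Rn n. \<exists>r>0. ccube n x r \<subseteq> ?B" by (intro bexI[of _ "\<lambda>i\<in>{..<n}. 0"] exI[of _ 1]) auto
qed

lemma max_isotropic_constant_pos: "n \<ge> 1 \<Longrightarrow> max_isotropic_constant n > 0"
  using isotropic_constant_le_max[OF _ convex_body_ccube] isotropic_constant_pos[OF _ convex_body_ccube] by (meson less_le_trans)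

text \<open>A body within a factor 2 of the supremum; the factor goes into the constant of the final
  lower bound.\<close>

lemma max_isotropic_constant_attained_half:
  assumes n: "n \<ge> 1"
  obtains K L where "isotropic_with n K L" "L \<ge> max_isotropic_constant n / 2"
    "isotropic_constant n K = L"
proof -
  have "max_isotropic_constant n / 2 < max_isotropic_constant n" using max_isotropic_constant_pos[OF n] by simp
  then have "\<exists>K. convex_body n K \<and> max_isotropic_constant n / 2 \<le> isotropic_constant n K"
    using cSUP_least[of "{K. convex_body n K}" "isotropic_constant n" "max_isotropic_constant n / 2"] convex_body_ccube
    unfolding max_isotropic_constant_def[symmetric] by (metis empty_Collect_eq linorder_linear mem_Collect_eq not_less)
  then obtain K where K: "convex_body n K" "max_isotropic_constant n / 2 \<le> isotropic_constant n K" by blast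
  obtain a T R where T: "mat_inv n T R" "isotropic_with n (affine_image n a T K) (isotropic_constant n K)"
    by (rule isotropic_image_exists[OF n K(1)])
  show ?thesis
    using that[OF T(2) K(2) isotropic_constant_affine[OF n K(1) T(1)]] .
qed

section \<open>Volume in subspaces\<close>

lemma orthonormal_basis_of_iff:
  "orthonormal_basis_of n E k u \<longleftrightarrow> orthonormal n k u \<and> lin_span n {..<k} u = E"
  by (auto simp: orthonormal_basis_of_def orthonormal_def)

lemma span_expansion:
  assumes u: "orthonormal n k u" and v: "v \<in> lin_span n {..<k} u"
  shows "v = lincomb n {..<k} u (\<lambda>i. dot n v (u i))"
proof -
  obtain c where c: "v = lincomb n {..<k} u c" using v by (auto simp: lin_span_def)
  have "dot n v (u i) = c i" if i: "i < k" for i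
  proof -
    have "dot n v (u i) = (\<Sum>j<k. c j * dot n (u i) (u j))"
      unfolding c dot_commute[of n "lincomb _ _ _ _"] dot_lincomb ..
    also have "\<dots> = (\<Sum>j<k. c j * (if j = i then 1 else 0))"
      using u i by (intro sum.cong) (auto simp: orthonormal_def)
    also have "\<dots> = c i" using i by (simp add: if_distrib[of "\<lambda>a. _ * a"] sum.delta cong: if_cong)
    finally show ?thesis .
  qed
  then show ?thesis unfolding lincomb_def c by (intro restrict_ext sum.cong) (auto simp: lincomb_def)
qed

lemma span_parseval:
  assumes u: "orthonormal n k u" and v: "v \<in> lin_span n {..<k} u"
  shows "dot n x v = (\<Sum>i<k. dot n x (u i) * dot n v (u i))"
proof -
  have "dot n x v = dot n x (lincomb n {..<k} u (\<lambda>i. dot n v (u i)))"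
    using span_expansion[OF u v] by simp
  then show ?thesis by (simp add: dot_lincomb mult.commute)
qed

lemma orthonormal_in_span: "orthonormal n k u \<Longrightarrow> j < k \<Longrightarrow> u j \<in> lin_span n {..<k} u"
proof -
  assume u: "orthonormal n k u" "j < k"
  then have "lincomb n {..<k} u (\<lambda>i. if i = j then 1 else 0) = u j"
    by (intro Rn_eqI[of _ n]) (auto simp: orthonormal_def lincomb_def if_distrib[of "\<lambda>a. a * _"] sum.delta cong: if_cong)
  then show ?thesis unfolding lin_span_def by (metis rangeI)
qed

text \<open>By Parseval the sum of all squared inner products between the two bases equals the size
  of either of them.\<close>

lemma orthonormal_basis_card:
  assumes "orthonormal_basis_of n E k u" "orthonormal_basis_of n E l v"
  shows "k = l"
proof -
  have u: "orthonormal n k u" "lin_span n {..<k} u = E" and v: "orthonormal n l v" "lin_span n {..<l} v = E"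
    using assms by (auto simp: orthonormal_basis_of_iff)
  have *: "real k = (\<Sum>j<k. \<Sum>i<l. (dot n (u j) (v i))\<^sup>2)"
    if u: "orthonormal n k u" "lin_span n {..<k} u = E" and v: "orthonormal n l v" "lin_span n {..<l} v = E" for k l u v
  proof -
    have "(\<Sum>i<l. (dot n (u j) (v i))\<^sup>2) = 1" if j: "j < k" for j
    proof -
      have "u j \<in> lin_span n {..<l} v" using orthonormal_in_span[OF u(1) j] u(2) v(2) by simp
      from span_parseval[OF v(1) this, of "u j"] have "dot n (u j) (u j) = (\<Sum>i<l. (dot n (u j) (v i))\<^sup>2)"
        by (simp add: power2_eq_square)
      then show ?thesis using u(1) j by (simp add: orthonormal_def)
    qed
    then show ?thesis by simp
  qed
  have "real k = (\<Sum>j<k. \<Sum>i<l. (dot n (u j) (v i))\<^sup>2)" by (rule *[OF u v])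
  also have "\<dots> = (\<Sum>i<l. \<Sum>j<k. (dot n (v i) (u j))\<^sup>2)"
    by (subst sum.swap) (simp only: dot_commute)
  also have "\<dots> = real l" by (rule *[OF v u, symmetric])
  finally show ?thesis by simp
qed

lemma measurable_lincomb: "lincomb n {..<k} u \<in> leb k \<rightarrow>\<^sub>M leb n"
proof (rule measurable_lebI)
  fix i assume "i < n"
  then have "(\<lambda>y. lincomb n {..<k} u y i) = (\<lambda>y. \<Sum>j<k. y j * u j i)" by (simp add: lincomb_def)
  also have "\<dots> \<in> borel_measurable (leb k)"
    by (intro borel_measurable_sum borel_measurable_times measurable_coord_leb) auto
  finally show "(\<lambda>y. lincomb n {..<k} u y i) \<in> borel_measurable (leb k)" .
qed (simp add: lincomb_def)

lemma lincomb_preimage_sets: "K \<in> sets (leb n) \<Longrightarrow> {y \<in> Rn k. lincomb n {..<k} u y \<in> K} \<in> sets (leb k)"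
  using measurable_sets[OF measurable_lincomb[of n k u], of K] by (simp add: vimage_def Int_def conj_commute)

text \<open>The matrix of inner products of the two bases has orthonormal rows by Parseval.\<close>

lemma lincomb_change_basis:
  assumes u: "orthonormal n k u" "lin_span n {..<k} u = E" and v: "orthonormal n k v" "lin_span n {..<k} v = E"
  obtains Q where "orth_mat k Q" "\<And>y. lincomb n {..<k} u y = lincomb n {..<k} v (lin k Q y)"
proof
  define Q where "Q i = (\<lambda>j\<in>{..<k}. dot n (u j) (v i))" for i
  have uv: "u j \<in> lin_span n {..<k} v" "v j \<in> lin_span n {..<k} u" if "j < k" for j
    using orthonormal_in_span[OF u(1) that] orthonormal_in_span[OF v(1) that] u(2) v(2) by simp_all
  have "orthonormal k k Q"
    unfolding orthonormal_def
  proof (intro conjI allI impI)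
    fix i j assume ij: "i < k" "j < k"
    have "dot k (Q i) (Q j) = (\<Sum>l<k. dot n (v i) (u l) * dot n (v j) (u l))"
      by (simp add: dot_def[of k] Q_def dot_commute)
    also have "\<dots> = dot n (v i) (v j)" by (rule span_parseval[OF u(1) uv(2)[OF ij(2)], symmetric])
    finally show "dot k (Q i) (Q j) = (if i = j then 1 else 0)" using v(1) ij by (simp add: orthonormal_def)
  qed (simp add: Q_def)
  then show "orth_mat k Q" by (rule orthonormal_orth_mat)
  fix y
  show "lincomb n {..<k} u y = lincomb n {..<k} v (lin k Q y)"
  proof (rule Rn_eqI[of _ n])
    fix m assume m: "m < n"
    have um: "u j m = (\<Sum>i<k. dot n (u j) (v i) * v i m)" if "j < k" for j
      using fun_cong[OF span_expansion[OF v(1) uv(1)[OF that]], of m] m by (simp add: lincomb_def)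
    have "lincomb n {..<k} u y m = (\<Sum>j<k. \<Sum>i<k. y j * (dot n (u j) (v i) * v i m))"
      using m by (simp add: lincomb_def um sum_distrib_left)
    also have "\<dots> = (\<Sum>i<k. \<Sum>j<k. y j * (dot n (u j) (v i) * v i m))" by (rule sum.swap)
    also have "\<dots> = lincomb n {..<k} v (lin k Q y) m"
      using m by (simp add: lincomb_def lin_def Q_def sum_distrib_right sum_distrib_left mult_ac)
    finally show "lincomb n {..<k} u y m = lincomb n {..<k} v (lin k Q y) m" .
  qed (simp_all add: lincomb_def)
qed

text \<open>Two orthonormal bases of \<open>E\<close> have the same size and differ by an orthogonal
  matrix, which preserves \<open>leb k\<close>. So the definite description denotes the volume
  computed in any of them.\<close>

lemma subspace_vol_eq:
  assumes u: "orthonormal_basis_of n E k u" and K: "K \<in> sets (leb n)"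
  shows "subspace_vol n E (K \<inter> E) = vol k {y \<in> Rn k. lincomb n {..<k} u y \<in> K}"
proof -
  have E: "{y \<in> Rn l. lincomb n {..<l} v y \<in> K \<inter> E} = {y \<in> Rn l. lincomb n {..<l} v y \<in> K}"
    if "orthonormal_basis_of n E l v" for l v
    using that by (auto simp: orthonormal_basis_of_def lin_span_def)
  have "vol l {y \<in> Rn l. lincomb n {..<l} v y \<in> K} = vol k {y \<in> Rn k. lincomb n {..<k} u y \<in> K}"
    if v: "orthonormal_basis_of n E l v" for l v
  proof -
    have l: "l = k" by (rule orthonormal_basis_card[OF v u])
    have u': "orthonormal n k u" "lin_span n {..<k} u = E" and v': "orthonormal n k v" "lin_span n {..<k} v = E"
      using u v l by (auto simp: orthonormal_basis_of_iff)
    obtain Q where Q: "orth_mat k Q" "\<And>y. lincomb n {..<k} v y = lincomb n {..<k} u (lin k Q y)"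
      using lincomb_change_basis[OF v' u'] by metis
    let ?A = "{y \<in> Rn k. lincomb n {..<k} u y \<in> K}" and ?B = "{y \<in> Rn k. lincomb n {..<k} v y \<in> K}"
    have S: "?A \<in> sets (leb k)" "?B \<in> sets (leb k)" by (rule lincomb_preimage_sets[OF K])+
    have "emeasure (leb k) ?B = (\<integral>\<^sup>+y. indicator ?B y \<partial>leb k)" using S by simp
    also have "\<dots> = (\<integral>\<^sup>+y. indicator ?A (lin k Q y) \<partial>leb k)"
      by (intro nn_integral_cong) (simp add: indicator_def Q(2))
    also have "\<dots> = (\<integral>\<^sup>+y. indicator ?A y \<partial>leb k)" by (rule nn_integral_leb_orth[OF Q(1)]) (use S in simp)
    also have "\<dots> = emeasure (leb k) ?A" using S by simp
    finally show ?thesis unfolding l vol_def measure_def by simp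
  qed
  note same = this
  show ?thesis
    unfolding subspace_vol_def
  proof (rule the_equality)
    show "\<exists>l v. orthonormal_basis_of n E l v \<and>
      vol k {y \<in> Rn k. lincomb n {..<k} u y \<in> K} = vol l {y \<in> Rn l. lincomb n {..<l} v y \<in> K \<inter> E}"
      using u E[OF u] by (intro exI[of _ k] exI[of _ u]) simp
    fix a assume "\<exists>l v. orthonormal_basis_of n E l v \<and> a = vol l {y \<in> Rn l. lincomb n {..<l} v y \<in> K \<inter> E}"
    then obtain l v where v: "orthonormal_basis_of n E l v" and a: "a = vol l {y \<in> Rn l. lincomb n {..<l} v y \<in> K \<inter> E}"
      by blast
    show "a = vol k {y \<in> Rn k. lincomb n {..<k} u y \<in> K}" unfolding a E[OF v] by (rule same[OF v])
  qed
qed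

section \<open>Central sections as fibres over the origin\<close>

lemma orth_compl_span:
  assumes S: "finite S"
  shows "orth_compl n (lin_span n S w) = {x \<in> Rn n. \<forall>k\<in>S. dot n x (w k) = 0}"
proof (intro subset_antisym subsetI)
  fix x assume x: "x \<in> orth_compl n (lin_span n S w)"
  have "dot n x (w k) = 0" if k: "k \<in> S" for k
  proof -
    have "0 = dot n x (lincomb n S w (\<lambda>j. if j = k then 1 else 0))"
      using x by (auto simp: orth_compl_def lin_span_def)
    also have "\<dots> = dot n x (w k)"
      using k S by (simp add: dot_lincomb if_distrib[of "\<lambda>a. a * _"] sum.delta cong: if_cong)
    finally show ?thesis by simp
  qed
  then show "x \<in> {x \<in> Rn n. \<forall>k\<in>S. dot n x (w k) = 0}" using x by (simp add: orth_compl_def)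
qed (auto simp: orth_compl_def lin_span_def dot_lincomb)

lemma lincomb_coordinates:
  assumes u: "orthonormal n n u" and x: "x \<in> Rn n"
  shows "lincomb n {..<n} u (lin n u x) = x"
  unfolding lincomb_lin using lin_mat_inv(2)[OF orthonormal_mat_inv[OF u] x] by simp

lemma lincomb_shift:
  "lincomb n {..<d + e} u (app d e (\<lambda>i\<in>{..<d}. 0) z) = lincomb n {..<e} (\<lambda>i. u (d + i)) z"
proof -
  have "(\<Sum>k<d + e. app d e (\<lambda>i\<in>{..<d}. 0) z k * u k i) = (\<Sum>k<e. z k * u (d + k) i)" for i
  proof -
    have "(\<Sum>k<d + e. F k) = (\<Sum>k<d. F k) + (\<Sum>k<e. F (d + k))" for F :: "nat \<Rightarrow> real"
      by (induction e) simp_all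
    then show ?thesis by (simp add: app_def)
  qed
  then show ?thesis by (auto simp: lincomb_def)
qed

lemma orthonormal_basis_of_tail:
  assumes u: "orthonormal n n u" and n: "n = d + e"
  shows "orthonormal_basis_of n {x \<in> Rn n. \<forall>k<d. dot n x (u k) = 0} e (\<lambda>i. u (d + i))"
  unfolding orthonormal_basis_of_iff
proof
  show "orthonormal n e (\<lambda>i. u (d + i))" using u n by (auto simp: orthonormal_def)
  show "lin_span n {..<e} (\<lambda>i. u (d + i)) = {x \<in> Rn n. \<forall>k<d. dot n x (u k) = 0}"
  proof (intro subset_antisym subsetI)
    fix x assume "x \<in> lin_span n {..<e} (\<lambda>i. u (d + i))"
    then obtain c where c: "x = lincomb n {..<e} (\<lambda>i. u (d + i)) c" by (auto simp: lin_span_def)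
    have "dot n x (u k) = 0" if "k < d" for k
      unfolding c dot_commute[of n "lincomb _ _ _ _"] dot_lincomb
      by (rule sum.neutral) (use u n that in \<open>auto simp: orthonormal_def\<close>)
    then show "x \<in> {x \<in> Rn n. \<forall>k<d. dot n x (u k) = 0}" by (simp add: c lincomb_def)
  next
    fix x assume x: "x \<in> {x \<in> Rn n. \<forall>k<d. dot n x (u k) = 0}"
    let ?z = "\<lambda>i. dot n x (u (d + i))"
    have "lin n u x = app d e (\<lambda>i\<in>{..<d}. 0) ?z"
      using x n by (intro Rn_eqI[of _ n]) (auto simp: dot_row app_def)
    then have "x = lincomb n {..<e} (\<lambda>i. u (d + i)) ?z"
      using lincomb_coordinates[OF u, of x] x lincomb_shift[of n d e u ?z] n by simp
    then show "x \<in> lin_span n {..<e} (\<lambda>i. u (d + i))" unfolding lin_span_def by blast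
  qed
qed

text \<open>In the coordinates of \<open>u\<close> the subspace \<open>E\<close> consists of the
  points whose first \<open>d\<close> coordinates vanish.\<close>

lemma subspace_vol_fibre:
  assumes u: "orthonormal n n u" and n: "n = d + e" and K: "convex_body n K"
  defines "E \<equiv> {x \<in> Rn n. \<forall>k<d. dot n x (u k) = 0}"
  shows "subspace_vol n E (K \<inter> E) = enn2real (fibre d e (affine_image n (\<lambda>_. 0) u K) (\<lambda>i\<in>{..<d}. 0))"
proof -
  let ?K' = "affine_image n (\<lambda>_. 0) u K"
  let ?A = "{z \<in> Rn e. lincomb n {..<e} (\<lambda>i. u (d + i)) z \<in> K}"
  have A: "?A \<in> sets (leb e)" by (rule lincomb_preimage_sets[OF convex_body_sets[OF K]])
  have mem: "lincomb n {..<n} u y \<in> K \<longleftrightarrow> y \<in> ?K'" if y: "y \<in> Rn n" for y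
  proof
    assume "lincomb n {..<n} u y \<in> K"
    moreover have "lin n u (lincomb n {..<n} u y) = y"
      unfolding lincomb_lin using lin_mat_inv(1)[OF orthonormal_mat_inv[OF u] y] by simp
    ultimately show "y \<in> ?K'" unfolding affine_image_aff aff_0[abs_def] by (metis imageI)
  next
    assume "y \<in> ?K'"
    then obtain x where "x \<in> K" "y = lin n u x" by (auto simp: affine_image_aff aff_0)
    then show "lincomb n {..<n} u y \<in> K" using lincomb_coordinates[OF u] convex_body_subset[OF K] by auto
  qed
  have "fibre d e ?K' (\<lambda>i\<in>{..<d}. 0) = (\<integral>\<^sup>+z. indicator ?A z \<partial>leb e)"
    unfolding fibre_def
  proof (rule nn_integral_cong)
    fix z assume "z \<in> space (leb e)"
    have "app d e (\<lambda>i\<in>{..<d}. 0) z \<in> ?K' \<longleftrightarrow> lincomb n {..<e} (\<lambda>i. u (d + i)) z \<in> K"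
      using mem[of "app d e (\<lambda>i\<in>{..<d}. 0) z"] lincomb_shift[of n d e u z] n by simp
    then show "indicator ?K' (app d e (\<lambda>i\<in>{..<d}. 0) z) = (indicator ?A z :: ennreal)"
      using \<open>z \<in> space (leb e)\<close> by (simp add: indicator_def)
  qed
  also have "\<dots> = emeasure (leb e) ?A" using A by simp
  finally show ?thesis
    unfolding E_def subspace_vol_eq[OF orthonormal_basis_of_tail[OF u n] convex_body_sets[OF K]]
    by (simp add: vol_def measure_def)
qed

lemma orthogonal_basis_nonzero:
  assumes "orthogonal_basis n w" "k < n"
  shows "dot n (w k) (w k) > 0"
proof (rule ccontr)
  assume "\<not> ?thesis"
  then have "dot n (w k) (w k) = 0" using dot_self_nonneg[of n "w k"] by simp
  then have "w k i = 0" if "i < n" for i using dot_self_zero that by blast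
  then have "lincomb n {..<n} w (\<lambda>j. if j = k then 1 else 0) = (\<lambda>i\<in>{..<n}. 0)"
    using assms(2) unfolding lincomb_def
    by (intro restrict_ext) (simp add: if_distrib[of "\<lambda>a. a * _"] sum.delta cong: if_cong)
  moreover have "\<forall>c. lincomb n {..<n} w c = (\<lambda>i\<in>{..<n}. 0) \<longrightarrow> (\<forall>k<n. c k = 0)"
    using assms(1) unfolding orthogonal_basis_def basis_def by blast
  ultimately have "\<forall>j<n. (if j = k then 1 else 0 :: real) = 0" by blast
  then show False using assms(2) by auto
qed

lemma orthonormal_orthogonal_basis:
  assumes w: "orthonormal n n w"
  shows "orthogonal_basis n w"
  unfolding orthogonal_basis_def basis_def
proof (intro conjI allI impI)
  show "lin_span n {..<n} w = Rn n"
  proof (intro subset_antisym subsetI)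
    fix x assume "x \<in> Rn n"
    then show "x \<in> lin_span n {..<n} w" unfolding lin_span_def by (metis lincomb_coordinates[OF w] rangeI)
  qed (auto simp: lin_span_def lincomb_def)
  fix c k assume c: "lincomb n {..<n} w c = (\<lambda>i\<in>{..<n}. 0)" and k: "k < n"
  have "0 = dot n (w k) (lincomb n {..<n} w c)" unfolding c by (simp add: dot_def)
  also have "\<dots> = (\<Sum>j<n. c j * (if j = k then 1 else 0))"
    unfolding dot_lincomb using w k by (intro sum.cong) (auto simp: orthonormal_def)
  also have "\<dots> = c k" using k by (simp add: if_distrib[of "\<lambda>a. _ * a"] sum.delta cong: if_cong)
  finally show "c k = 0" by simp
qed (use w in \<open>auto simp: orthonormal_def\<close>)

text \<open>Normalising the basis vectors and listing those of \<open>S\<close> first does not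
  change \<open>E\<close>, and brings the section into the form of a fibre over the origin.\<close>

lemma section_fibre:
  assumes w: "orthogonal_basis n w" and S: "S \<subseteq> {..<n}" and K: "convex_body n K"
  defines "E \<equiv> orth_compl n (lin_span n S w)"
  obtains u \<pi> e where "orthonormal n n u" "n = card S + e" "bij_betw \<pi> {..<card S} S"
    "\<And>i. i < card S \<Longrightarrow> u i = (\<lambda>j\<in>{..<n}. (1 / sqrt (dot n (w (\<pi> i)) (w (\<pi> i)))) * w (\<pi> i) j)"
    "subspace_vol n E (K \<inter> E) = enn2real (fibre (card S) e (affine_image n (\<lambda>_. 0) u K) (\<lambda>i\<in>{..<card S}. 0))"
proof -
  have fS: "finite S" using S finite_subset by blast
  define d where "d = card S"
  define e where "e = n - d"
  have n: "n = d + e" using card_mono[OF _ S] by (simp add: d_def e_def)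
  obtain f where f: "bij_betw f {..<d} S" using ex_bij_betw_nat_finite[OF fS] by (auto simp: d_def atLeast0LessThan)
  have cc: "card ({..<n} - S) = e" using S fS by (simp add: card_Diff_subset e_def d_def)
  obtain g where g: "bij_betw g {..<e} ({..<n} - S)"
    using ex_bij_betw_nat_finite[of "{..<n} - S"] by (auto simp: cc atLeast0LessThan)
  \<comment> \<open>Enumerates \<open>S\<close> first and then its complement.\<close>
  define \<pi> where "\<pi> i = (if i < d then f i else g (i - d))" for i
  have \<pi>n: "\<pi> i < n" if "i < n" for i
    using that S bij_betwE[OF f] bij_betwE[OF g] n by (auto simp: \<pi>_def)
  have \<pi>inj: "\<pi> i \<noteq> \<pi> j" if "i < n" "j < n" "i \<noteq> j" for i j
  proof -
    have 1: "f a \<in> S" if "a < d" for a using bij_betwE[OF f] that by blast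
    have 2: "g a \<notin> S" if "a < e" for a using bij_betwE[OF g] that by blast
    have 3: "f a \<noteq> f b" if "a < d" "b < d" "a \<noteq> b" for a b using f that by (meson bij_betw_def inj_onD lessThan_iff)
    have 4: "g a \<noteq> g b" if "a < e" "b < e" "a \<noteq> b" for a b using g that by (meson bij_betw_def inj_onD lessThan_iff)
    show ?thesis
    proof (cases "i < d"; cases "j < d")
      assume "i < d" "j < d"
      then show ?thesis using 3 that by (simp add: \<pi>_def)
    next
      assume "i < d" "\<not> j < d"
      moreover have "j - d < e" using calculation that n by linarith
      ultimately show ?thesis using 1[of i] 2[of "j - d"] by (auto simp: \<pi>_def)
    next
      assume "\<not> i < d" "j < d"
      moreover have "i - d < e" using calculation that n by linarith
      ultimately show ?thesis using 1[of j] 2[of "i - d"] by (auto simp: \<pi>_def)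
    next
      assume "\<not> i < d" "\<not> j < d"
      moreover have "i - d < e" "j - d < e" "i - d \<noteq> j - d" using calculation that n by linarith+
      ultimately show ?thesis using 4[of "i - d" "j - d"] by (auto simp: \<pi>_def)
    qed
  qed
  define N where "N k = 1 / sqrt (dot n (w k) (w k))" for k
  define u where "u i = (\<lambda>j\<in>{..<n}. N (\<pi> i) * w (\<pi> i) j)" for i
  have N: "N k > 0" "N k * (N k * dot n (w k) (w k)) = 1" if "k < n" for k
    using orthogonal_basis_nonzero[OF w that] by (auto simp: N_def)
  have du: "dot n (u i) y = N (\<pi> i) * dot n (w (\<pi> i)) y" for i y
    unfolding u_def by (rule dot_scale_left)
  have ou: "orthonormal n n u"
    unfolding orthonormal_def
  proof (intro conjI allI impI)
    fix i j assume ij: "i < n" "j < n"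
    have "dot n (u i) (u j) = N (\<pi> i) * (N (\<pi> j) * dot n (w (\<pi> j)) (w (\<pi> i)))"
      unfolding du[of i] dot_commute[of n "w (\<pi> i)"] du[of j] ..
    also have "\<dots> = (if i = j then 1 else 0)"
      using N(2)[OF \<pi>n[OF ij(1)]] w \<pi>inj[OF ij] \<pi>n ij by (auto simp: orthogonal_basis_def)
    finally show "dot n (u i) (u j) = (if i = j then 1 else 0)" .
  qed (simp add: u_def)
  have zero: "dot n x (u i) = 0 \<longleftrightarrow> dot n x (w (f i)) = 0" if "i < d" for i x
  proof -
    have "N (\<pi> i) > 0" using N(1) \<pi>n that n by simp
    then show ?thesis unfolding dot_commute[of n x] du using that by (simp add: \<pi>_def)
  qed
  have "E = {x \<in> Rn n. \<forall>k<d. dot n x (u k) = 0}"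
    unfolding E_def orth_compl_span[OF fS]
    using zero bij_betw_imp_surj_on[OF f] by (auto simp: image_def)
  then have "subspace_vol n E (K \<inter> E) = enn2real (fibre d e (affine_image n (\<lambda>_. 0) u K) (\<lambda>i\<in>{..<d}. 0))"
    using subspace_vol_fibre[OF ou n K] by simp
  note vol_eq = this
  show ?thesis
  proof (rule that[of u e f])
    show "n = card S + e" "bij_betw f {..<card S} S" using n f by (simp_all add: d_def)
    show "u i = (\<lambda>j\<in>{..<n}. (1 / sqrt (dot n (w (f i)) (w (f i)))) * w (f i) j)" if "i < card S" for i
      using that by (simp add: u_def \<pi>_def N_def d_def)
    show "subspace_vol n E (K \<inter> E) = enn2real (fibre (card S) e (affine_image n (\<lambda>_. 0) u K) (\<lambda>i\<in>{..<card S}. 0))"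
      using vol_eq by (simp only: d_def)
  qed (rule ou)
qed

section \<open>Central sections of isotropic bodies\<close>

lemma LINT_affine_product:
  assumes K: "convex_body n K"
  shows "set_integrable (leb n) K (\<lambda>y. (s * dot n y u - \<beta>) * (t * dot n y v - \<gamma>))" (is ?A)
    and "(LINT y:K|leb n. (s * dot n y u - \<beta>) * (t * dot n y v - \<gamma>)) =
      s * t * (LINT y:K|leb n. dot n y u * dot n y v) - s * \<gamma> * (LINT y:K|leb n. dot n y u)
      - t * \<beta> * (LINT y:K|leb n. dot n y v) + \<beta> * \<gamma> * vol n K" (is ?B)
proof -
  have e: "(s * dot n y u - \<beta>) * (t * dot n y v - \<gamma>) =
    s * t * (dot n y u * dot n y v) - s * \<gamma> * dot n y u - t * \<beta> * dot n y v + \<beta> * \<gamma> * 1" for y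
    by (simp add: algebra_simps)
  have i1: "set_integrable (leb n) K (\<lambda>y. s * t * (dot n y u * dot n y v))"
    by (intro set_integrable_mult_right LINT_bilinear(2)[OF K])
  have i2: "set_integrable (leb n) K (\<lambda>y. s * \<gamma> * dot n y u)" "set_integrable (leb n) K (\<lambda>y. t * \<beta> * dot n y v)"
    by (intro set_integrable_mult_right LINT_lin(2)[OF K])+
  have i3: "set_integrable (leb n) K (\<lambda>y. \<beta> * \<gamma> * 1)"
    by (rule body_integrable[OF K, of _ "\<bar>\<beta> * \<gamma>\<bar>"]) auto
  show ?A unfolding e by (intro set_integral_add(1) set_integral_diff(1) i1 i2 i3)
  have "(LINT y:K|leb n. (s * dot n y u - \<beta>) * (t * dot n y v - \<gamma>)) =
     (LINT y:K|leb n. s * t * (dot n y u * dot n y v)) - (LINT y:K|leb n. s * \<gamma> * dot n y u)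
     - (LINT y:K|leb n. t * \<beta> * dot n y v) + (LINT y:K|leb n. \<beta> * \<gamma> * 1)"
    unfolding e by (simp only: set_integral_add(2) set_integral_diff(1,2) i1 i2 i3)
  then show ?B by (simp only: set_integral_mult_right vol_LINT[OF K])
qed

lemma set_integral_mono_body:
  fixes h :: "(nat \<Rightarrow> real) \<Rightarrow> real"
  assumes "set_integrable (leb n) A h" "set_integrable (leb n) B h" "A \<subseteq> B" "\<And>x. h x \<ge> 0"
  shows "(LINT x:A|leb n. h x) \<le> (LINT x:B|leb n. h x)"
  using assms unfolding set_lebesgue_integral_def set_integrable_def
  by (intro Bochner_Integration.integral_mono) (auto simp: indicator_def)

text \<open>Compare the variance over \<open>T\<close> with its part over \<open>T/2 \<subseteq> T\<close>: the halved mean exactly cancels the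
  mixed term.\<close>

lemma variance_ge_second_moment:
  assumes T: "convex_body n T" "(\<lambda>i\<in>{..<n}. 0) \<in> T" and \<beta>: "(LINT y:T|leb n. dot n y u) = vol n T * \<beta>"
  shows "(LINT y:T|leb n. (dot n y u)\<^sup>2) / (4 * 2 ^ n) \<le> (LINT y:T|leb n. (dot n y u - \<beta>)\<^sup>2)"
proof -
  define H where "H i j = (if i = j then 1/2 else 0 :: real)" for i j :: nat
  define H' where "H' i j = (if i = j then 2 else 0 :: real)" for i j :: nat
  have inv: "mat_inv n H H'"
    by (auto simp: mat_inv_def H_def H'_def if_distrib[of "\<lambda>a. a * _"] sum.delta cong: if_cong)
  have linH: "lin n H x = (\<lambda>i\<in>{..<n}. 1/2 * x i)" for x
    by (auto simp: lin_def H_def if_distrib[of "\<lambda>a. a * _"] sum.delta cong: if_cong)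
  have cH: "(\<integral>\<^sup>+x. f (lin n H x) \<partial>leb n) = ennreal (2 ^ n) * (\<integral>\<^sup>+x. f x \<partial>leb n)"
    if "f \<in> borel_measurable (leb n)" for f
    unfolding linH using nn_integral_leb_scale[OF that, of "\<lambda>_. 1/2"] by simp
  let ?h = "\<lambda>y. (dot n y u - \<beta>)\<^sup>2"
  have hm: "?h \<in> borel_measurable (leb n)"
    unfolding dot_def by (intro borel_measurable_power borel_measurable_diff borel_measurable_sum borel_measurable_times measurable_coord_leb borel_measurable_const) auto
  let ?T' = "affine_image n (\<lambda>_. 0) H T"
  have T': "convex_body n ?T'" by (rule convex_body_affine_image[OF T(1) inv])
  have sub: "?T' \<subseteq> T"
  proof
    fix y assume "y \<in> ?T'"
    then obtain x where x: "x \<in> T" "y = lin n H x" by (auto simp: affine_image_aff aff_0)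
    have "comb n (1/2) (\<lambda>i\<in>{..<n}. 0) x \<in> T" using convex_body_cvx[OF T(1)] T(2) x(1) by (auto simp: cvx_def)
    also have "comb n (1/2) (\<lambda>i\<in>{..<n}. 0) x = y" by (auto simp: comb_def x(2) linH)
    finally show "y \<in> T" .
  qed
  have int: "set_integrable (leb n) A ?h" if "convex_body n A" for A
    using LINT_affine_product(1)[OF that, of 1 u \<beta> 1 u \<beta>] by (simp add: power2_eq_square)
  have "(LINT x:T|leb n. ?h (aff n (\<lambda>_. 0) H x)) = 2 ^ n * (LINT y:?T'|leb n. ?h y)"
    by (rule LINT_affine_image[OF _ _ inv T(1) hm]) (simp, rule cH)
  also have "\<dots> \<le> 2 ^ n * (LINT y:T|leb n. ?h y)"
    by (intro mult_left_mono set_integral_mono_body int T T' sub) auto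
  also have "(LINT x:T|leb n. ?h (aff n (\<lambda>_. 0) H x)) = (LINT x:T|leb n. (1/2 * dot n x u - \<beta>) * (1/2 * dot n x u - \<beta>))"
    by (simp only: aff_0 linH dot_scale_left power2_eq_square)
  also have "\<dots> = (LINT y:T|leb n. (dot n y u)\<^sup>2) / 4"
    unfolding LINT_affine_product(2)[OF T(1)] \<beta> by (simp add: power2_eq_square)
  finally show ?thesis by (simp add: field_simps)
qed

text \<open>By isotropy of the second moments, the products of distinct coordinates of the barycentre along the
  principal axes vanish, so at most one variance differs from \<open>a\<close>.\<close>

lemma isotropic_constant_ge_of_moments:
  assumes d: "d \<ge> 1" and T: "convex_body d T" "(\<lambda>i\<in>{..<d}. 0) \<in> T" and a: "a > 0"
    and m: "\<And>\<theta>. (LINT y:T|leb d. (dot d y \<theta>)\<^sup>2) = a * dot d \<theta> \<theta>"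
  shows "a ^ d / (4 * 2 ^ d) \<le> isotropic_constant d T ^ (2 * d) * vol d T ^ (d + 2)"
proof -
  let ?b = "barycentre d T" and ?V = "vol d T"
  have V: "?V > 0" by (rule convex_body_vol_pos[OF T(1)])
  let ?T0 = "affine_image d (\<lambda>i. - ?b i) (unit_frame d) T"
  have T0: "convex_body d ?T0" "centered d ?T0"
    by (rule convex_body_rigid[OF orthonormal_unit T(1)], rule centered_translate[OF T(1)])
  have affb: "aff d (\<lambda>i. - ?b i) (unit_frame d) y = (\<lambda>i\<in>{..<d}. y i - ?b i)" for y
    by (auto simp: aff_def unit_frame_def sum_delta_mult)
  obtain w where w: "orthonormal d d w"
    "\<And>j k. j < d \<Longrightarrow> k < d \<Longrightarrow> j \<noteq> k \<Longrightarrow> mom d (affine_image d (\<lambda>_. 0) w ?T0) j k = 0"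
    using principal_axes[OF T0(1)] by metis
  define \<beta> where "\<beta> k = dot d ?b (w k)" for k
  have mean: "(LINT y:T|leb d. dot d y (w k)) = ?V * \<beta> k" for k
    unfolding LINT_lin(1)[OF T(1)] \<beta>_def dot_def[of d ?b] using V
    by (simp add: barycentre_def sum_distrib_left mult.commute)
  have tr: "(LINT x:?T0|leb d. dot d x (w j) * dot d x (w k)) = (LINT y:T|leb d. (dot d y (w j) - \<beta> j) * (dot d y (w k) - \<beta> k))" for j k
  proof -
    have "(\<lambda>x. dot d x (w j) * dot d x (w k)) \<in> borel_measurable (leb d)"
      unfolding dot_def by (intro borel_measurable_sum borel_measurable_times measurable_coord_leb borel_measurable_const) auto
    from LINT_rigid[OF orthonormal_unit T(1) this] show ?thesis by (simp only: affb dot_diff_left \<beta>_def)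
  qed
  have orth0: "(LINT y:T|leb d. dot d y (w j) * dot d y (w k)) = 0" if jk: "j < d" "k < d" "j \<noteq> k" for j k
  proof -
    let ?s = "\<lambda>i\<in>{..<d}. w j i + w k i"
    have ds: "dot d y ?s = dot d y (w j) + dot d y (w k)" for y
      by (simp add: dot_def distrib_left sum.distrib)
    have "(dot d y (w j) + dot d y (w k))\<^sup>2 =
      (dot d y (w j))\<^sup>2 + 2 * (dot d y (w j) * dot d y (w k)) + (dot d y (w k))\<^sup>2" for y
      by (simp add: power2_eq_square algebra_simps)
    moreover have "set_integrable (leb d) T (\<lambda>y. (dot d y v)\<^sup>2)" for v
      using LINT_bilinear(2)[OF T(1), of v v] by (simp add: power2_eq_square)
    moreover have "set_integrable (leb d) T (\<lambda>y. 2 * (dot d y (w j) * dot d y (w k)))"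
      by (intro set_integrable_mult_right LINT_bilinear(2)[OF T(1)])
    ultimately have "(LINT y:T|leb d. (dot d y ?s)\<^sup>2) = (LINT y:T|leb d. (dot d y (w j))\<^sup>2)
        + 2 * (LINT y:T|leb d. dot d y (w j) * dot d y (w k)) + (LINT y:T|leb d. (dot d y (w k))\<^sup>2)"
      by (simp only: ds set_integral_add set_integral_mult_right)
    moreover have "dot d ?s ?s = 2"
      using w(1) jk unfolding ds dot_commute[of d ?s] by (simp add: orthonormal_def)
    ultimately show ?thesis using m w(1) jk by (simp add: orthonormal_def)
  qed
  have \<beta>0: "\<beta> j * \<beta> k = 0" if jk: "j < d" "k < d" "j \<noteq> k" for j k
  proof -
    have "0 = (LINT y:T|leb d. (1 * dot d y (w j) - \<beta> j) * (1 * dot d y (w k) - \<beta> k))"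
      using w(2)[OF jk] mom_rotation[OF w(1) T0(1) jk(1,2)] tr by simp
    also have "\<dots> = - (?V * (\<beta> j * \<beta> k))"
      unfolding LINT_affine_product(2)[OF T(1)] orth0[OF jk] mean by simp
    finally show ?thesis using V by simp
  qed
  define v where "v k = (LINT x:?T0|leb d. (dot d x (w k))\<^sup>2)" for k
  have v_def': "v k = (LINT y:T|leb d. (dot d y (w k) - \<beta> k)\<^sup>2)" for k
    using tr[of k k] by (simp add: v_def power2_eq_square)
  have mk: "(LINT y:T|leb d. (dot d y (w k))\<^sup>2) = a" if "k < d" for k
    using m[of "w k"] w(1) that by (simp add: orthonormal_def)
  have vge: "v k \<ge> a / (4 * 2 ^ d)" if "k < d" for k
    using variance_ge_second_moment[OF T mean, of k] mk[OF that] by (simp add: v_def')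
  have veq: "v k = a" if "k < d" "\<beta> k = 0" for k
    using that mk by (simp add: v_def')
  have "isotropic_constant d T ^ (2 * d) * vol d T ^ (d + 2) = (\<Prod>k<d. v k)"
    unfolding v_def using isotropic_constant_principal[OF d T0 w]
    by (simp add: isotropic_constant_affine[OF d T(1) orthonormal_mat_inv[OF orthonormal_unit]] vol_rigid[OF orthonormal_unit T(1)])
  also have "\<dots> \<ge> a ^ d / (4 * 2 ^ d)"
  proof (cases "\<exists>k<d. \<beta> k \<noteq> 0")
    case True
    then obtain k where k: "k < d" "\<beta> k \<noteq> 0" by blast
    have "v j = a" if "j \<in> {..<d} - {k}" for j
      using veq[of j] \<beta>0[of k j] k that by auto
    then have "(\<Prod>j<d. v j) = v k * a ^ (d - 1)"
      using k(1) by (simp add: prod.remove[of "{..<d}" k])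
    also have "\<dots> \<ge> a / (4 * 2 ^ d) * a ^ (d - 1)"
      by (intro mult_right_mono vge k(1)) (use a in simp)
    also have "a / (4 * 2 ^ d) * a ^ (d - 1) = a ^ d / (4 * 2 ^ d)"
      using d by (simp add: power_eq_if)
    finally show ?thesis .
  next
    case False
    then have "(\<Prod>j<d. v j) = a ^ d" using veq by simp
    moreover have "a ^ d / (4 * 2 ^ d) \<le> a ^ d / 1" 
      using a mult_mono[of 1 4 1 "(2::real) ^ d"] by (intro divide_left_mono) auto
    ultimately show ?thesis by simp
  qed
  finally show ?thesis .
qed

section \<open>Upper bounds for isotropic sections\<close>

lemma nn_set_integral_body:
  fixes h :: "(nat \<Rightarrow> real) \<Rightarrow> real"
  assumes "set_integrable (leb n) K h" "\<And>x. h x \<ge> 0"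
  shows "(\<integral>\<^sup>+x. ennreal (h x) * indicator K x \<partial>leb n) = ennreal (LINT x:K|leb n. h x)"
proof -
  have "(\<integral>\<^sup>+x. ennreal (h x) * indicator K x \<partial>leb n) = (\<integral>\<^sup>+x. ennreal (indicator K x *\<^sub>R h x) \<partial>leb n)"
    by (intro nn_integral_cong) (auto simp: indicator_def)
  also have "\<dots> = ennreal (LINT x:K|leb n. h x)"
    unfolding set_lebesgue_integral_def
    by (rule nn_integral_eq_integral) (use assms in \<open>auto simp: set_integrable_def\<close>)
  finally show ?thesis .
qed

text \<open>Supplies the cube on which f is bounded below, from which the Ball body obtains its
  interior.\<close>

lemma fibre_box_ge:
  assumes sub: "ccube (d + e) x r \<subseteq> K" and y: "y \<in> ccube d (restrict x {..<d}) r" and r: "r \<ge> 0"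
  shows "ennreal ((2 * r) ^ e) \<le> fibre d e K y"
proof -
  let ?z = "\<lambda>i\<in>{..<e}. x (d + i)"
  have "ennreal ((2 * r) ^ e) = emeasure (leb e) (ccube e ?z r)"
    using emeasure_ccube(2)[of ?z e r] r by simp
  also have "\<dots> = (\<integral>\<^sup>+z. indicator (ccube e ?z r) z \<partial>leb e)"
    using emeasure_ccube(1)[of ?z e r] r by simp
  also have "\<dots> \<le> fibre d e K y"
    unfolding fibre_def
  proof (rule nn_integral_mono)
    fix z
    show "indicator (ccube e ?z r) z \<le> (indicator K (app d e y z) :: ennreal)"
    proof (cases "z \<in> ccube e ?z r")
      case True
      have "\<bar>app d e y z i - x i\<bar> \<le> r" if i: "i < d + e" for i
      proof (cases "i < d")
        case True
        then show ?thesis using y i by (auto simp: ccube_def app_def)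
      next
        case False
        then obtain j where "i = d + j" "j < e" using i by (metis add_less_cancel_left le_Suc_ex not_less)
        then show ?thesis using True by (simp add: ccube_def app_def)
      qed
      then have "app d e y z \<in> ccube (d + e) x r" by (simp add: ccube_def)
      then show ?thesis using sub by (auto simp: indicator_def)
    qed simp
  qed
  finally show ?thesis .
qed

lemma nn_integral_fibre:
  assumes K: "K \<in> sets (leb (d + e))" and g: "g \<in> borel_measurable (leb d)"
  shows "(\<integral>\<^sup>+y. g y * fibre d e K y \<partial>leb d) = (\<integral>\<^sup>+x. g (restrict x {..<d}) * indicator K x \<partial>leb (d + e))"
proof -
  have m: "(\<lambda>x. g (restrict x {..<d}) * indicator K x) \<in> borel_measurable (leb (d + e))"
    by (intro borel_measurable_times_ennreal measurable_compose[OF measurable_restrict_leb g] borel_measurable_indicator K) simp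
  have "(\<integral>\<^sup>+x. g (restrict x {..<d}) * indicator K x \<partial>leb (d + e)) =
    (\<integral>\<^sup>+y. \<integral>\<^sup>+z. g y * indicator K (app d e y z) \<partial>leb e \<partial>leb d)"
    unfolding nn_integral_leb_app[OF m] by (intro nn_integral_cong) (simp add: restrict_app)
  also have "\<dots> = (\<integral>\<^sup>+y. g y * fibre d e K y \<partial>leb d)"
    unfolding fibre_def
    by (intro nn_integral_cong nn_integral_cmult measurable_compose[OF measurable_app_right borel_measurable_indicator[OF K]]) simp
  finally show ?thesis by simp
qed

lemma isotropic_rotation:
  assumes u: "orthonormal n n u" and K: "isotropic_with n K L"
  shows "isotropic_with n (affine_image n (\<lambda>_. 0) u K) L"
proof -
  note I = isotropic_withD[OF K]
  let ?K' = "affine_image n (\<lambda>_. 0) u K"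
  have "(LINT x:?K'|leb n. (dot n x \<theta>)\<^sup>2) = L\<^sup>2" if \<theta>: "\<theta> \<in> Rn n" "dot n \<theta> \<theta> = 1" for \<theta>
  proof -
    have "(\<lambda>x. (dot n x \<theta>)\<^sup>2) \<in> borel_measurable (leb n)"
      unfolding dot_def by (intro borel_measurable_power borel_measurable_sum borel_measurable_times measurable_coord_leb borel_measurable_const) auto
    from LINT_rigid[OF u I(1) this] have "(LINT x:?K'|leb n. (dot n x \<theta>)\<^sup>2) = (LINT x:K|leb n. (dot n x (lin n (\<lambda>i j. u j i) \<theta>))\<^sup>2)"
      by (simp only: aff_0 dot_lin)
    also have "\<dots> = L\<^sup>2"
      unfolding I(5) using dot_orth[OF orth_mat_transpose[OF orthonormal_orth_mat[OF u]] \<theta>(1)] \<theta>(2) by simp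
    finally show ?thesis .
  qed
  then show ?thesis
    unfolding isotropic_with_def
    using convex_body_rigid[OF u I(1)] vol_rigid[OF u I(1)] centered_rotation[OF u I(1,3)] I(2,4) by simp
qed

lemma fibre_finite:
  assumes "convex_body (d + e) K" "y \<in> Rn d"
  shows "fibre d e K y < \<infinity>"
proof -
  obtain B R where "R > 0" "nice d B R (fibre d e K)" "usc d (fibre d e K)"
    using fibre_nice[OF assms(1)] by metis
  then have "fibre d e K y \<le> ennreal B" using assms(2) by (simp add: nice_def)
  then show ?thesis by (rule le_less_trans) simp
qed

lemma isotropic_coord_second_moment:
  assumes K: "isotropic_with n K L" and i: "i < n"
  shows "(LINT x:K|leb n. (x i)\<^sup>2) = L\<^sup>2"
proof -
  let ?e = "\<lambda>k. if k = i then 1 else 0 :: real"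
  have "dot n x ?e = x i" for x unfolding dot_commute[of n x] by (rule dot_unit[OF i])
  then show ?thesis using isotropic_withD(5)[OF K, of ?e] by simp
qed

text \<open>Ball's body \<open>T\<close> of the section function has second moments L^2 / f0 in all
  directions and volume at most e^2 / f0. Inserted into the moment estimate for its isotropic
  constant, which is at most L_d, this can be solved for f0.\<close>

lemma isotropic_fibre_at_origin_le:
  assumes d: "d \<ge> 1" and K: "isotropic_with (d + e) K L"
  shows "enn2real (fibre d e K (\<lambda>i\<in>{..<d}. 0)) \<le> (4 * exp 3 * max_isotropic_constant d / L) ^ d"
proof -
  note I = isotropic_withD[OF K]
  note KS = convex_body_sets[OF I(1)]
  let ?f = "fibre d e K" and ?o = "\<lambda>i\<in>{..<d}. 0 :: real"
  obtain B R where BR: "R > 0" "nice d B R ?f" "usc d ?f" using fibre_nice[OF I(1)] by metis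
  define f0 where "f0 = enn2real (?f ?o)"
  have ff0: "?f ?o = ennreal f0" using fibre_finite[OF I(1), of ?o] by (simp add: f0_def ennreal_enn2real)
  \<comment> \<open>Ball's body needs a positive value at the origin; the lower estimate for central
    sections provides it.\<close>
  have "ennreal (vol (d + e) K * (\<Prod>i<d. 1 / (2 * exp 1 * sqrt (L\<^sup>2 / vol (d + e) K)))) \<le> ?f ?o"
    by (rule fibre_at_origin_ge[OF I(1,3)]) (use isotropic_coord_second_moment[OF K] I(4) in auto)
  moreover have "vol (d + e) K * (\<Prod>i<d. 1 / (2 * exp 1 * sqrt (L\<^sup>2 / vol (d + e) K))) > 0"
    using I(2,4) by simp
  ultimately have "0 < ennreal f0" unfolding ff0 by (metis ennreal_less_zero_iff less_le_trans)
  then have f0: "f0 > 0" by simp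
  have F: "(\<integral>\<^sup>+y. ?f y \<partial>leb d) = ennreal 1"
    using nn_integral_fibre[OF KS, of "\<lambda>_. 1"] KS emeasure_vol[OF convex_body_fin[OF I(1)]] I(2) by simp
  obtain x r where x: "x \<in> Rn (d + e)" "r > 0" "ccube (d + e) x r \<subseteq> K" using I(1) unfolding convex_body_iff by blast
  have box: "ennreal ((2 * r) ^ e) \<le> ?f y" if "y \<in> ccube d (restrict x {..<d}) r" for y
    by (rule fibre_box_ge[OF x(3) that]) (use x(2) in simp)
  have rd: "restrict x {..<d} \<in> Rn d" "(2 * r) ^ e > 0" "0 < d" using x(2) d by auto
  have "\<exists>T. convex_body d T \<and> ?o \<in> T \<and> vol d T \<le> exp 2 * 1 / f0 \<and> (\<forall>g. g \<in> borel_measurable (leb d) \<longrightarrow>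
      (\<forall>x s. x \<in> Rn d \<longrightarrow> s > 0 \<longrightarrow> g (sc d s x) = ennreal (s\<^sup>2) * g x) \<longrightarrow>
      (\<integral>\<^sup>+x. g x * indicator T x \<partial>leb d) = ennreal (1 / f0) * (\<integral>\<^sup>+x. g x * ?f x \<partial>leb d))"
  proof (rule ball_body[OF BR(2,3) ff0 f0 rd(3) F zero_le_one rd(1) x(2) rd(2)])
    show "ennreal ((2 * r) ^ e) \<le> ?f y" if "y \<in> ccube d (restrict x {..<d}) r" for y by (rule box[OF that])
    fix T assume T: "convex_body d T" "?o \<in> T" "vol d T \<le> exp 2 * 1 / f0"
      and m: "\<And>g. g \<in> borel_measurable (leb d) \<Longrightarrow>
      (\<And>x s. x \<in> Rn d \<Longrightarrow> s > 0 \<Longrightarrow> g (sc d s x) = ennreal (s\<^sup>2) * g x) \<Longrightarrow>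
      (\<integral>\<^sup>+x. g x * indicator T x \<partial>leb d) = ennreal (1 / f0) * (\<integral>\<^sup>+x. g x * ?f x \<partial>leb d)"
    show "\<exists>T. convex_body d T \<and> ?o \<in> T \<and> vol d T \<le> exp 2 * 1 / f0 \<and> (\<forall>g. g \<in> borel_measurable (leb d) \<longrightarrow>
      (\<forall>x s. x \<in> Rn d \<longrightarrow> s > 0 \<longrightarrow> g (sc d s x) = ennreal (s\<^sup>2) * g x) \<longrightarrow>
      (\<integral>\<^sup>+x. g x * indicator T x \<partial>leb d) = ennreal (1 / f0) * (\<integral>\<^sup>+x. g x * ?f x \<partial>leb d))"
      by (intro exI[of _ T] conjI allI impI T m) blast+
  qed
  then obtain T where T: "convex_body d T" "?o \<in> T" "vol d T \<le> exp 2 * 1 / f0"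
    and mT: "\<And>g. g \<in> borel_measurable (leb d) \<Longrightarrow>
      (\<forall>x s. x \<in> Rn d \<longrightarrow> s > 0 \<longrightarrow> g (sc d s x) = ennreal (s\<^sup>2) * g x) \<Longrightarrow>
      (\<integral>\<^sup>+x. g x * indicator T x \<partial>leb d) = ennreal (1 / f0) * (\<integral>\<^sup>+x. g x * ?f x \<partial>leb d)" by blast
  define a where "a = L\<^sup>2 / f0"
  have a: "a > 0" using I(4) f0 by (simp add: a_def)
  have moment: "(LINT y:T|leb d. (dot d y \<theta>)\<^sup>2) = a * dot d \<theta> \<theta>" for \<theta>
  proof -
    let ?g = "\<lambda>y. ennreal ((dot d y \<theta>)\<^sup>2)"
    have gm: "?g \<in> borel_measurable (leb d)"
      unfolding dot_def by (intro measurable_compose[OF _ measurable_ennreal] borel_measurable_power borel_measurable_sum borel_measurable_times measurable_coord_leb borel_measurable_const) auto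
    have gs: "?g (sc d s x) = ennreal (s\<^sup>2) * ?g x" for s x
      unfolding sc_def dot_scale_left by (simp add: power_mult_distrib ennreal_mult)
    \<comment> \<open>Extending \<theta> by zeros turns moments of the projection into moments of
      \<open>K\<close>, where isotropy applies.\<close>
    let ?\<theta>' = "\<lambda>i. if i < d then \<theta> i else 0"
    have split: "(\<Sum>k<d + e. F k) = (\<Sum>k<d. F k) + (\<Sum>k<e. F (d + k))" for F :: "nat \<Rightarrow> real"
      by (induction e) simp_all
    have dx: "dot (d + e) x ?\<theta>' = dot d (restrict x {..<d}) \<theta>" for x
      unfolding dot_def split by simp
    have dt: "dot (d + e) ?\<theta>' ?\<theta>' = dot d \<theta> \<theta>"
      unfolding dot_def split by simp
    have sq: "set_integrable (leb n) A (\<lambda>y. (dot n y v)\<^sup>2)" if "convex_body n A" for n A v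
      using LINT_bilinear(2)[OF that, of v v] by (simp add: power2_eq_square)
    have "ennreal (LINT y:T|leb d. (dot d y \<theta>)\<^sup>2) = (\<integral>\<^sup>+y. ?g y * indicator T y \<partial>leb d)"
      by (rule nn_set_integral_body[symmetric, OF sq[OF T(1)]]) simp
    also have "\<dots> = ennreal (1 / f0) * (\<integral>\<^sup>+y. ?g y * ?f y \<partial>leb d)"
      by (rule mT[OF gm]) (use gs in auto)
    also have "(\<integral>\<^sup>+y. ?g y * ?f y \<partial>leb d) = (\<integral>\<^sup>+x. ennreal ((dot (d + e) x ?\<theta>')\<^sup>2) * indicator K x \<partial>leb (d + e))"
      unfolding nn_integral_fibre[OF KS gm] dx ..
    also have "\<dots> = ennreal (LINT x:K|leb (d + e). (dot (d + e) x ?\<theta>')\<^sup>2)"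
      by (rule nn_set_integral_body[OF sq[OF I(1)]]) simp
    also have "\<dots> = ennreal (L\<^sup>2 * dot d \<theta> \<theta>)" unfolding I(5) dt ..
    also have "ennreal (1 / f0) * \<dots> = ennreal (a * dot d \<theta> \<theta>)"
      using f0 dot_self_nonneg[of d \<theta>] by (simp add: ennreal_mult[symmetric] a_def)
    finally show ?thesis
      using a dot_self_nonneg[of d \<theta>]
      by (subst (asm) ennreal_inj) (auto simp: set_lebesgue_integral_def intro!: Bochner_Integration.integral_nonneg)
  qed
  define M where "M = max_isotropic_constant d"
  have LT: "0 < isotropic_constant d T" "isotropic_constant d T \<le> M"
    unfolding M_def using isotropic_constant_pos[OF d T(1)] isotropic_constant_le_max[OF d T(1)] by auto
  have V: "vol d T > 0" by (rule convex_body_vol_pos[OF T(1)])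
  have "a ^ d / (4 * 2 ^ d) \<le> isotropic_constant d T ^ (2 * d) * vol d T ^ (d + 2)"
    by (rule isotropic_constant_ge_of_moments[OF d T(1,2) a moment])
  also have "\<dots> \<le> M ^ (2 * d) * (exp 2 / f0) ^ (d + 2)"
    using LT V T(3) by (intro mult_mono power_mono) auto
  finally have main: "a ^ d / (4 * 2 ^ d) \<le> M ^ (2 * d) * (exp 2 / f0) ^ (d + 2)" .
  \<comment> \<open>Multiplication by f0^(d + 2) clears the volume term. Since a^d contains f0^(-d),
    a square of f0 is left, and all other powers are even as well.\<close>
  have "f0\<^sup>2 * (L ^ (2 * d) / (4 * 2 ^ d)) = f0 ^ (d + 2) * (a ^ d / (4 * 2 ^ d))"
    using f0 by (simp add: a_def power_divide power_mult power_add power2_eq_square[of f0])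
  also have "\<dots> \<le> f0 ^ (d + 2) * (M ^ (2 * d) * (exp 2 / f0) ^ (d + 2))"
    using f0 main by (intro mult_left_mono) auto
  also have "\<dots> = M ^ (2 * d) * exp 2 ^ (d + 2)" using f0 by (simp add: power_divide)
  finally have "f0\<^sup>2 * L ^ (2 * d) \<le> (4 * 2 ^ d * exp 2 ^ (d + 2)) * M ^ (2 * d)"
    by (simp add: field_simps)
  also have "\<dots> \<le> (4 * exp 3) ^ (2 * d) * M ^ (2 * d)"
  \<comment> \<open>As d \<ge> 1, the loose factors 4 and e^4 are absorbed by 8^d and e^(4d); 16^d
    and e^(6d) together are (4 e^3)^(2d).\<close>
  proof (rule mult_right_mono)
    have "(4::real) \<le> 8 ^ d * 1" using power_increasing[OF d, of "8::real"] by simp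
    have "4 * 2 ^ d * exp 2 ^ (d + 2) = (4 * 2 ^ d) * exp (2 * real d + 4)"
      by (simp add: exp_of_nat_mult[symmetric] mult.commute power_add exp_add) (simp add: exp_of_nat_mult power2_eq_square exp_add[symmetric])
    also have "\<dots> \<le> (8 ^ d * 2 ^ d) * exp (6 * real d)"
      using \<open>4 \<le> 8 ^ d * 1\<close> d by (intro mult_mono) auto
    also have "\<dots> = (4 * exp 3) ^ (2 * d)"
      by (simp add: power_mult_distrib power_mult exp_of_nat_mult[symmetric] flip: exp_double power_mult_distrib)
    finally show "4 * 2 ^ d * exp 2 ^ (d + 2) \<le> (4 * exp 3 :: real) ^ (2 * d)" .
  qed (use LT in auto)
  finally have "(f0 * L ^ d)\<^sup>2 \<le> ((4 * exp 3 * M) ^ d)\<^sup>2"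
    by (simp add: power_mult_distrib power_mult[symmetric] mult.commute)
  then have "f0 * L ^ d \<le> (4 * exp 3 * M) ^ d"
    by (rule power2_le_imp_le) (use LT in auto)
  then have "f0 \<le> (4 * exp 3 * M / L) ^ d"
    using I(4) by (simp add: power_divide field_simps)
  then show ?thesis by (simp add: f0_def M_def)
qed

text \<open>The case of an empty cover set: the subspace is the whole space and the section is the
  body itself.\<close>

lemma fibre_zero_dim:
  assumes K: "K \<in> sets (leb n)"
  shows "fibre 0 n K (\<lambda>i\<in>{..<0}. 0) = emeasure (leb n) K"
proof -
  have 0: "(\<lambda>i\<in>{..<0::nat}. 0::real) = (\<lambda>_. undefined)" by auto
  have "emeasure (leb n) K = (\<integral>\<^sup>+x. indicator K x \<partial>leb (0 + n))" using K by simp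
  also have "\<dots> = fibre 0 n K (\<lambda>_. undefined)"
    unfolding fibre_def using K by (subst nn_integral_leb_app) (simp_all add: nn_integral_leb_0)
  finally show ?thesis unfolding 0 by simp
qed

lemma isotropic_section_le:
  assumes K: "isotropic_with n K L" and w: "orthogonal_basis n w" and S: "S \<subseteq> {..<n}"
  defines "E \<equiv> orth_compl n (lin_span n S w)"
  shows "subspace_vol n E (K \<inter> E) \<le> (if S = {} then 1 else (4 * exp 3 * max_isotropic_constant (card S) / L) ^ card S)"
proof -
  note I = isotropic_withD[OF K]
  obtain u \<pi> e where u: "orthonormal n n u" "n = card S + e"
    "subspace_vol n E (K \<inter> E) = enn2real (fibre (card S) e (affine_image n (\<lambda>_. 0) u K) (\<lambda>i\<in>{..<card S}. 0))"
    unfolding E_def using section_fibre[OF w S I(1)] by metis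
  let ?K' = "affine_image n (\<lambda>_. 0) u K"
  have K': "isotropic_with n ?K' L" by (rule isotropic_rotation[OF u(1) K])
  have fS: "finite S" using S finite_subset by blast
  show ?thesis
  proof (cases "S = {}")
    case True
    then have "n = e" using u(2) by simp
    then have "subspace_vol n E (K \<inter> E) = enn2real (fibre 0 n ?K' (\<lambda>i\<in>{..<0}. 0))"
      using u(3) True by simp
    also have "\<dots> = 1"
      using fibre_zero_dim[OF convex_body_sets[OF isotropic_withD(1)[OF K']]] isotropic_withD(2)[OF K']
      by (simp add: vol_def measure_def)
    finally show ?thesis using True by simp
  next
    case False
    then have "card S \<ge> 1" using fS by (simp add: Suc_leI card_gt_0_iff)
    from isotropic_fibre_at_origin_le[OF this, of e ?K' L] show ?thesis
      using K' u(2,3) False by simp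
  qed
qed

lemma mom_normalised:
  assumes K: "convex_body n K" and u: "orthonormal n n u" and i: "i < n"
    and v: "u i = (\<lambda>j\<in>{..<n}. (1 / sqrt (dot n v v)) * v j)" "dot n v v > 0"
  shows "(LINT x:K|leb n. (dot n x v)\<^sup>2) / dot n v v = mom n (affine_image n (\<lambda>_. 0) u K) i i"
proof -
  have "dot n x (u i) = 1 / sqrt (dot n v v) * dot n x v" for x
    unfolding v(1) dot_commute[of n x] by (rule dot_scale_left)
  then have "dot n x (u i) * dot n x (u i) = 1 / dot n v v * (dot n x v)\<^sup>2" for x
    using v(2) by (simp add: power2_eq_square)
  then have "mom n (affine_image n (\<lambda>_. 0) u K) i i = 1 / dot n v v * (LINT x:K|leb n. (dot n x v)\<^sup>2)"
    unfolding mom_rotation[OF u K i i] by (simp only: set_integral_mult_right)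
  then show ?thesis by simp
qed

lemma section_ge:
  assumes K: "convex_body n K" "centered n K" and w: "orthogonal_basis n w" and S: "S \<subseteq> {..<n}"
  defines "E \<equiv> orth_compl n (lin_span n S w)"
  defines "lam \<equiv> \<lambda>k. (LINT x:K|leb n. (dot n x (w k))\<^sup>2) / dot n (w k) (w k)"
  shows "vol n K * (\<Prod>k\<in>S. 1 / (2 * exp 1 * sqrt (lam k / vol n K))) \<le> subspace_vol n E (K \<inter> E)"
    and "\<And>k. k \<in> S \<Longrightarrow> lam k > 0"
proof -
  obtain u \<pi> e where u: "orthonormal n n u" "n = card S + e" "bij_betw \<pi> {..<card S} S"
    "\<forall>i<card S. u i = (\<lambda>j\<in>{..<n}. (1 / sqrt (dot n (w (\<pi> i)) (w (\<pi> i)))) * w (\<pi> i) j)"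
    "subspace_vol n E (K \<inter> E) = enn2real (fibre (card S) e (affine_image n (\<lambda>_. 0) u K) (\<lambda>i\<in>{..<card S}. 0))"
    using section_fibre[OF w S K(1)] unfolding E_def by metis
  let ?K' = "affine_image n (\<lambda>_. 0) u K"
  have K': "convex_body n ?K'" "centered n ?K'" by (rule convex_body_rigid[OF u(1) K(1)], rule centered_rotation[OF u(1) K])
  have lam: "lam (\<pi> i) = mom n ?K' i i" "mom n ?K' i i > 0" if i: "i < card S" for i
  proof -
    have "i < n" "\<pi> i < n" using i u(2) bij_betwE[OF u(3)] S by auto
    then show "lam (\<pi> i) = mom n ?K' i i" "mom n ?K' i i > 0"
      unfolding lam_def using mom_normalised[OF K(1) u(1) _ u(4)[rule_format, OF i]] orthogonal_basis_nonzero[OF w]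
        second_moment_pos[OF K'(1)] by auto
  qed
  show "lam k > 0" if "k \<in> S" for k
    using lam bij_betw_imp_surj_on[OF u(3)] that by (metis imageE lessThan_iff)
  let ?o = "\<lambda>i\<in>{..<card S}. 0 :: real"
  have "ennreal (vol (card S + e) ?K' * (\<Prod>i<card S. 1 / (2 * exp 1 * sqrt (mom n ?K' i i / vol (card S + e) ?K')))) \<le> fibre (card S) e ?K' ?o"
    by (rule fibre_at_origin_ge) (use K' lam(2) u(2) in \<open>auto simp: mom_def power2_eq_square\<close>)
  then have "enn2real (ennreal (vol n K * (\<Prod>i<card S. 1 / (2 * exp 1 * sqrt (mom n ?K' i i / vol n K))))) \<le> subspace_vol n E (K \<inter> E)"
    unfolding u(5) using vol_rigid[OF u(1) K(1)] fibre_finite[of "card S" e ?K' ?o] K'(1) u(2)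
    by (intro enn2real_mono) auto
  moreover have "(\<Prod>i<card S. 1 / (2 * exp 1 * sqrt (mom n ?K' i i / vol n K))) = (\<Prod>i<card S. 1 / (2 * exp 1 * sqrt (lam (\<pi> i) / vol n K)))"
    using lam(1) by (intro prod.cong) auto
  moreover have "\<dots> = (\<Prod>k\<in>S. 1 / (2 * exp 1 * sqrt (lam k / vol n K)))"
    by (rule prod.reindex_bij_betw[OF u(3)])
  moreover have "0 \<le> vol n K * (\<Prod>i<card S. 1 / (2 * exp 1 * sqrt (mom n ?K' i i / vol n K)))"
    using lam(2) convex_body_vol_pos[OF K(1)] by (intro mult_nonneg_nonneg prod_nonneg) (auto intro: less_imp_le)
  ultimately show "vol n K * (\<Prod>k\<in>S. 1 / (2 * exp 1 * sqrt (lam k / vol n K))) \<le> subspace_vol n E (K \<inter> E)"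
    by simp
qed

section \<open>Uniform covers\<close>

text \<open>After exchanging the products each \<open>t k\<close> collects the weights of the sets
  containing \<open>k\<close>, which sum to 1. The covering identity enters the whole proof
  here.\<close>

lemma uniform_cover_prod_powr:
  assumes c: "uniform_cover n m S p" and t: "\<And>k. k < n \<Longrightarrow> t k > (0::real)"
  shows "(\<Prod>j<m. (\<Prod>k\<in>S j. t k) powr p j) = (\<Prod>k<n. t k)"
proof -
  have S: "S j \<subseteq> {..<n}" if "j < m" for j using c that by (auto simp: uniform_cover_def)
  have "(\<Prod>k\<in>S j. t k) powr p j = (\<Prod>k<n. t k powr (p j * indicator (S j) k))" if "j < m" for j
  proof -
    have "(\<Prod>k\<in>S j. t k) powr p j = (\<Prod>k\<in>S j. t k powr p j)"
      by (rule prod_powr_distrib)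
    also have "\<dots> = (\<Prod>k<n. t k powr (p j * indicator (S j) k))"
    proof (rule prod.mono_neutral_cong_left)
      show "\<forall>k\<in>{..<n} - S j. t k powr (p j * indicator (S j) k) = 1"
        using t by (auto simp: indicator_def) (metis less_irrefl)
    qed (use S[OF that] in auto)
    finally show ?thesis .
  qed
  then have "(\<Prod>j<m. (\<Prod>k\<in>S j. t k) powr p j) = (\<Prod>j<m. \<Prod>k<n. t k powr (p j * indicator (S j) k))"
    by (intro prod.cong) auto
  also have "\<dots> = (\<Prod>k<n. \<Prod>j<m. t k powr (p j * indicator (S j) k))" by (rule prod.swap)
  also have "\<dots> = (\<Prod>k<n. t k)"
  proof (rule prod.cong[OF refl])
    fix k assume "k \<in> {..<n}"
    then have k: "t k > 0" "(\<Sum>j<m. p j * indicator (S j) k) = 1" using t c by (auto simp: uniform_cover_def)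
    then show "(\<Prod>j<m. t k powr (p j * indicator (S j) k)) = t k"
      using powr_sum[of "t k" "\<lambda>j. p j * indicator (S j) k" "{..<m}"] by simp
  qed
  finally show ?thesis .
qed

lemma Lambda_body_le:
  assumes w: "orthogonal_basis n w"
  shows "Lambda_body n m S p K \<le> vol n K powr ((\<Sum>j<m. p j) - 1) /
    (\<Prod>j<m. subspace_vol n (orth_compl n (lin_span n (S j) w)) (K \<inter> orth_compl n (lin_span n (S j) w)) powr p j)"
proof -
  have "bdd_below ((\<lambda>w. vol n K powr ((\<Sum>j<m. p j) - 1) /
    (\<Prod>j<m. let E = orth_compl n (lin_span n (S j) w) in subspace_vol n E (K \<inter> E) powr p j)) ` {w. orthogonal_basis n w})"
    by (rule bdd_belowI2[of _ 0]) (auto simp: Let_def intro!: divide_nonneg_nonneg prod_nonneg)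
  from cINF_lower[OF this, of w] show ?thesis using w by (simp add: Lambda_body_def Let_def)
qed

text \<open>The infimum is bounded by its value at the principal axes, the basis for which the
  product of all second moments is determined by the isotropic constant.\<close>

lemma Lambda_body_le_isotropic_constant:
  assumes n: "n \<ge> 1" and K: "convex_body n K" "centered n K" and c: "uniform_cover n m S p"
  shows "Lambda_body n m S p K \<le> (2 * exp 1 * isotropic_constant n K) ^ n"
proof -
  define V where "V = vol n K"
  have V: "V > 0" using convex_body_vol_pos[OF K(1)] by (simp add: V_def)
  define L where "L = isotropic_constant n K"
  have L: "L > 0" using isotropic_constant_pos[OF n K(1)] by (simp add: L_def)
  obtain w where w: "orthonormal n n w"
    "\<And>j k. j < n \<Longrightarrow> k < n \<Longrightarrow> j \<noteq> k \<Longrightarrow> mom n (affine_image n (\<lambda>_. 0) w K) j k = 0"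
    using principal_axes[OF K(1)] by metis
  have ow: "orthogonal_basis n w" by (rule orthonormal_orthogonal_basis[OF w(1)])
  have ww: "dot n (w k) (w k) = 1" if "k < n" for k using w(1) that by (simp add: orthonormal_def)
  define lam where "lam k = (LINT x:K|leb n. (dot n x (w k))\<^sup>2)" for k
  have lam: "lam k > 0" if k: "k < n" for k
    using section_ge(2)[OF K ow, of "{k}" k] ww[OF k] k by (simp add: lam_def)
  have prod_lam: "L ^ (2 * n) * V ^ (n + 2) = (\<Prod>k<n. lam k)"
    using isotropic_constant_principal[OF n K w] by (simp add: L_def V_def lam_def)
  define t where "t k = 1 / (2 * exp 1 * sqrt (lam k / V))" for k
  have t: "t k > 0" if "k < n" for k using lam[OF that] V by (simp add: t_def)
  let ?s = "\<lambda>j. subspace_vol n (orth_compl n (lin_span n (S j) w)) (K \<inter> orth_compl n (lin_span n (S j) w))"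
  have S: "S j \<subseteq> {..<n}" "p j \<ge> 0" if "j < m" for j using c that by (auto simp: uniform_cover_def)
  have tS: "(\<Prod>k\<in>S j. t k) > 0" if "j < m" for j using t S[OF that] by (intro prod_pos) auto
  have sge: "V * (\<Prod>k\<in>S j. t k) \<le> ?s j" if j: "j < m" for j
  proof -
    have "(\<Prod>k\<in>S j. t k) = (\<Prod>k\<in>S j. 1 / (2 * exp 1 * sqrt ((LINT x:K|leb n. (dot n x (w k))\<^sup>2) / dot n (w k) (w k) / vol n K)))"
      using ww S(1)[OF j] by (intro prod.cong refl) (auto simp: t_def lam_def V_def)
    then show ?thesis using section_ge(1)[OF K ow S(1)[OF j]] by (simp add: V_def)
  qed
  define P where "P = (\<Sum>j<m. p j)"
  have tp: "(\<Prod>k<n. t k) > 0" using t by (intro prod_pos) auto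
  have "V powr P * (\<Prod>k<n. t k) = (\<Prod>j<m. V powr p j) * (\<Prod>j<m. (\<Prod>k\<in>S j. t k) powr p j)"
    using uniform_cover_prod_powr[OF c t] powr_sum[of V p "{..<m}"] V by (simp add: P_def)
  also have "\<dots> = (\<Prod>j<m. (V * (\<Prod>k\<in>S j. t k)) powr p j)"
    using V tS by (subst prod.distrib[symmetric], intro prod.cong) (auto simp: powr_mult less_imp_le)
  also have "\<dots> \<le> (\<Prod>j<m. ?s j powr p j)"
    using V tS S(2) by (intro prod_mono conjI powr_mono2 sge) (auto simp: less_imp_le)
  finally have den: "V powr P * (\<Prod>k<n. t k) \<le> (\<Prod>j<m. ?s j powr p j)" .
  have den0: "V powr P * (\<Prod>k<n. t k) > 0" using V tp by simp
  have "Lambda_body n m S p K \<le> V powr (P - 1) / (\<Prod>j<m. ?s j powr p j)"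
    using Lambda_body_le[OF ow, of m S p K] by (simp add: V_def P_def)
  also have "\<dots> \<le> V powr (P - 1) / (V powr P * (\<Prod>k<n. t k))"
    using den den0 by (intro frac_le) auto
  also have "\<dots> = 1 / (V * (\<Prod>k<n. t k))" using V by (simp add: powr_diff)
  \<comment> \<open>The normalised standard deviations multiply to L^n V, so the volume cancels from
    the quotient.\<close>
  also have "(\<Prod>k<n. t k) = 1 / ((2 * exp 1) ^ n * (L ^ n * V))"
  proof -
    have "(\<Prod>k<n. sqrt (lam k / V))\<^sup>2 = (\<Prod>k<n. lam k) / V ^ n"
      using lam V by (simp add: prod_power_distrib less_imp_le prod_dividef)
    also have "\<dots> = (L ^ n * V)\<^sup>2"
      unfolding prod_lam[symmetric] using V
      by (simp add: power_add power_mult_distrib power_mult[symmetric] mult.commute power2_eq_square[of V])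
    finally have "(\<Prod>k<n. sqrt (lam k / V)) = L ^ n * V"
      by (rule power2_eq_imp_eq) (use lam V L in \<open>auto intro!: prod_nonneg simp: less_imp_le\<close>)
    then show ?thesis by (simp add: t_def prod_dividef prod.distrib)
  qed
  also have "1 / (V * (1 / ((2 * exp 1) ^ n * (L ^ n * V)))) = (2 * exp 1 * L) ^ n"
    using V by (simp add: power_mult_distrib)
  finally show ?thesis by (simp add: L_def)
qed

text \<open>In isotropic position the estimate for sections is the same in every direction, so it
  holds for all orthogonal bases at once and survives the infimum.\<close>

lemma Lambda_body_isotropic_ge:
  assumes K: "isotropic_with n K L" and c: "uniform_cover n m S p"
  shows "(L / (4 * exp 3)) ^ n / (\<Prod>j<m. L_factor (card (S j)) (p j)) \<le> Lambda_body n m S p K"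
proof -
  note I = isotropic_withD[OF K]
  have S: "S j \<subseteq> {..<n}" "p j \<ge> 0" if "j < m" for j using c that by (auto simp: uniform_cover_def)
  define D :: real where "D = 4 * exp 3 / L"
  have D: "D > 0" using I(4) by (simp add: D_def)
  define M where "M j = (if S j = {} then 1 else max_isotropic_constant (card (S j)) ^ card (S j))" for j
  have cS: "card (S j) = 0 \<longleftrightarrow> S j = {}" if "j < m" for j
    using finite_subset[OF S(1)[OF that]] by simp
  have mp: "max_isotropic_constant (card (S j)) > 0" if "j < m" "S j \<noteq> {}" for j
    using max_isotropic_constant_pos[of "card (S j)"] cS[OF that(1)] that(2) by (simp add: Suc_le_eq)
  have M: "M j > 0" if "j < m" for j using mp[OF that] by (simp add: M_def)
  have MLf: "M j powr p j = L_factor (card (S j)) (p j)" if "j < m" for j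
    using mp[OF that] cS[OF that] by (auto simp: M_def L_factor_def powr_realpow[symmetric] powr_powr mult.commute)
  show ?thesis
    unfolding Lambda_body_def
  proof (rule cINF_greatest)
    show "{w. orthogonal_basis n w} \<noteq> {}" using orthonormal_orthogonal_basis[OF orthonormal_unit] by blast
    fix w assume "w \<in> {w. orthogonal_basis n w}"
    then have w: "orthogonal_basis n w" by simp
    let ?s = "\<lambda>j. subspace_vol n (orth_compl n (lin_span n (S j) w)) (K \<inter> orth_compl n (lin_span n (S j) w))"
    \<comment> \<open>The power of \<open>D\<close> is written as a product over \<open>S j\<close>,
      so that the covering identity turns the weighted product into D^n.\<close>
    have sle: "?s j \<le> (\<Prod>k\<in>S j. D) * M j" if "j < m" for j
      using isotropic_section_le[OF K w S(1)[OF that]] by (auto simp: M_def D_def power_mult_distrib power_divide split: if_splits)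
    \<comment> \<open>A zero section would make the quotient 0 by convention, so positivity is
      needed before inverting.\<close>
    have s0: "?s j > 0" if j: "j < m" for j
    proof -
      have "vol n K * (\<Prod>k\<in>S j. 1 / (2 * exp 1 * sqrt ((LINT x:K|leb n. (dot n x (w k))\<^sup>2) / dot n (w k) (w k) / vol n K))) > 0"
        using section_ge(2)[OF I(1,3) w S(1)[OF j]] I(2) by (intro mult_pos_pos prod_pos) auto
      then show ?thesis using section_ge(1)[OF I(1,3) w S(1)[OF j]] by linarith
    qed
    have "(\<Prod>j<m. ?s j powr p j) \<le> (\<Prod>j<m. ((\<Prod>k\<in>S j. D) * M j) powr p j)"
      using s0 S(2) by (intro prod_mono conjI powr_mono2 sle) (auto simp: less_imp_le)
    also have "\<dots> = (\<Prod>j<m. (\<Prod>k\<in>S j. D) powr p j) * (\<Prod>j<m. L_factor (card (S j)) (p j))"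
      using M D MLf by (subst prod.distrib[symmetric], intro prod.cong) (auto simp: powr_mult less_imp_le)
    also have "(\<Prod>j<m. (\<Prod>k\<in>S j. D) powr p j) = D ^ n"
      using uniform_cover_prod_powr[OF c, of "\<lambda>_. D"] D by simp
    finally have le: "(\<Prod>j<m. ?s j powr p j) \<le> D ^ n * (\<Prod>j<m. L_factor (card (S j)) (p j))" .
    have "(\<Prod>j<m. ?s j powr p j) > 0" using s0 by (intro prod_pos) (metis less_irrefl lessThan_iff powr_gt_zero)
    then have "1 / (D ^ n * (\<Prod>j<m. L_factor (card (S j)) (p j))) \<le> 1 / (\<Prod>j<m. ?s j powr p j)"
      using le by (intro frac_le) auto
    moreover have "1 / (D ^ n * (\<Prod>j<m. L_factor (card (S j)) (p j))) =
      (L / (4 * exp 3)) ^ n / (\<Prod>j<m. L_factor (card (S j)) (p j))"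
      by (simp add: D_def power_divide)
    ultimately show "(L / (4 * exp 3)) ^ n / (\<Prod>j<m. L_factor (card (S j)) (p j)) \<le>
      vol n K powr ((\<Sum>j<m. p j) - 1) / (\<Prod>j<m. let E = orth_compl n (lin_span n (S j) w) in subspace_vol n E (K \<inter> E) powr p j)"
      using I(2) by (simp add: Let_def)
  qed
qed

lemma L_factor_nonneg: "L_factor d q \<ge> 0"
  by (simp add: L_factor_def)

theorem theorem1p2:
  shows "(\<exists>C::real. C > 0 \<and>
            (\<forall>n K m S p. n \<ge> 1 \<longrightarrow> convex_body n K \<longrightarrow> centered n K \<longrightarrow> uniform_cover n m S p \<longrightarrow>
               Lambda_body n m S p K \<le> (C * isotropic_constant n K) ^ n))
       \<and> (\<exists>c C::real. c > 0 \<and> C > 0 \<and>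
            (\<forall>n m S p. n \<ge> 1 \<longrightarrow> uniform_cover n m S p \<longrightarrow>
               ereal ((c * max_isotropic_constant n) ^ n / (\<Prod>j<m. L_factor (card (S j)) (p j)))
                 \<le> Lambda_dim n m S p
               \<and> Lambda_dim n m S p \<le> ereal ((C * max_isotropic_constant n) ^ n)))"
proof (rule conjI)
  show "\<exists>C::real. C > 0 \<and>
    (\<forall>n K m S p. n \<ge> 1 \<longrightarrow> convex_body n K \<longrightarrow> centered n K \<longrightarrow> uniform_cover n m S p \<longrightarrow>
       Lambda_body n m S p K \<le> (C * isotropic_constant n K) ^ n)"
    by (intro exI[of _ "2 * exp 1"]) (auto intro: Lambda_body_le_isotropic_constant)
next
  \<comment> \<open>Half of the factor 1 / (4 e^3) from isotropic bodies, the half being lost in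
    choosing a nearly maximal body.\<close>
  let ?c = "1 / (8 * exp 3) :: real" and ?C = "2 * exp 1 :: real"
  have "ereal ((?c * max_isotropic_constant n) ^ n / (\<Prod>j<m. L_factor (card (S j)) (p j))) \<le> Lambda_dim n m S p
      \<and> Lambda_dim n m S p \<le> ereal ((?C * max_isotropic_constant n) ^ n)"
    if n: "n \<ge> 1" and c: "uniform_cover n m S p" for n m S p
  proof (rule conjI)
    obtain K L where K: "isotropic_with n K L" "L \<ge> max_isotropic_constant n / 2" "isotropic_constant n K = L"
      by (rule max_isotropic_constant_attained_half[OF n])
    note I = isotropic_withD[OF K(1)]
    have "(1 / (8 * exp 3) * max_isotropic_constant n) ^ n / (\<Prod>j<m. L_factor (card (S j)) (p j)) \<le>
      (L / (4 * exp 3)) ^ n / (\<Prod>j<m. L_factor (card (S j)) (p j))"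
      using K(2) max_isotropic_constant_pos[OF n]
      by (intro divide_right_mono power_mono prod_nonneg) (auto simp: L_factor_nonneg field_simps)
    also have "\<dots> \<le> Lambda_body n m S p K" by (rule Lambda_body_isotropic_ge[OF K(1) c])
    finally have "ereal ((1 / (8 * exp 3) * max_isotropic_constant n) ^ n / (\<Prod>j<m. L_factor (card (S j)) (p j))) \<le>
      ereal (Lambda_body n m S p K)" by simp
    also have "\<dots> \<le> Lambda_dim n m S p"
      unfolding Lambda_dim_def by (rule SUP_upper) (use I in simp)
    finally show "ereal ((1 / (8 * exp 3) * max_isotropic_constant n) ^ n / (\<Prod>j<m. L_factor (card (S j)) (p j)))
      \<le> Lambda_dim n m S p" .
    show "Lambda_dim n m S p \<le> ereal ((2 * exp 1 * max_isotropic_constant n) ^ n)"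
      unfolding Lambda_dim_def
    proof (rule SUP_least)
      fix K assume "K \<in> {K. convex_body n K \<and> centered n K}"
      then have K: "convex_body n K" "centered n K" by auto
      have "Lambda_body n m S p K \<le> (2 * exp 1 * isotropic_constant n K) ^ n"
        by (rule Lambda_body_le_isotropic_constant[OF n K c])
      also have "\<dots> \<le> (2 * exp 1 * max_isotropic_constant n) ^ n"
        using isotropic_constant_pos[OF n K(1)] isotropic_constant_le_max[OF n K(1)] by (intro power_mono mult_left_mono) auto
      finally show "ereal (Lambda_body n m S p K) \<le> ereal ((2 * exp 1 * max_isotropic_constant n) ^ n)" by simp
    qed
  qed
  then show "\<exists>c C::real. c > 0 \<and> C > 0 \<and>
    (\<forall>n m S p. n \<ge> 1 \<longrightarrow> uniform_cover n m S p \<longrightarrow>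
       ereal ((c * max_isotropic_constant n) ^ n / (\<Prod>j<m. L_factor (card (S j)) (p j))) \<le> Lambda_dim n m S p
       \<and> Lambda_dim n m S p \<le> ereal ((C * max_isotropic_constant n) ^ n))"
    by (intro exI[of _ ?c] exI[of _ ?C]) simp
qed

end
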